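(* Let $n\ge2$, $\lambda>n/2-1$, and $f\in L^2(S^n_+;\tilde W)$; put $F=V_+f$. Define $f_\nu=\int_{S^n_+}f(x)\tilde\eta_\nu(x)\tilde W(x)\,d\sigma(x)$ and $F_\nu=\int_{\mathfrak{C}_n}F(\theta,t)\tilde\zeta_\nu(\theta,t)\tilde w(t)\,d\sigma(\theta)\,dt$ for $\nu\in\mathcal{N}$. Then (i) $(V_+f)(\theta,t)=\sum_{\nu\in\mathcal{N}}s_\nu f_\nu\tilde\zeta_\nu(\theta,t)$, with convergence in $L^2_e(\mathfrak{C}_n;\tilde w)$; (ii) $f(x)=\sum_{\nu\in\mathcal{N}}s_\nu^{-1}F_\nu\tilde\eta_\nu(x)$, with convergence in $L^2(S^n_+;\tilde W)$.
   Context: Notation: $x=(x',x_{n+1})\in\mathbb{R}^{n+1}$; $S^n_+=\{x\in S^n:x_{n+1}\ge0\}$ with surface measure $d\sigma$; $B_n$ unit ball of $\mathbb{R}^n$; $S^{n-1}$ its boundary; $\mathfrak{C}_n=S^{n-1}\times(-1,1)$. $(V_+f)(\theta,t)=\int_{S^n_+\cap\{x\in S^n:x'\cdot\theta=t\}}f\,d_\tau\sigma$ (induced surface measure on the slice). Weights: $W(x')=(1-|x'|^2)^{n/2-\lambda}$, $\tilde W(x)=x_{n+1}^{\,n-2\lambda-1}$, $w(t)=(1-t^2)^{1/2-\lambda}$, $\tilde w(t)=(1-t^2)^{-1/2-\lambda}$; $L^2(X;W)$ weighted $L^2$ space; $L^2_e(\mathfrak{C}_n;\tilde w)$ the subspace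 of $L^2(\mathfrak{C}_n;\tilde w)$ of functions with $F(-\theta,-t)=F(\theta,t)$. $\{Y_{m,\mu}\}$ real orthonormal basis of spherical harmonics in $L^2(S^{n-1})$, $d_n(m)=(n+2m-2)\frac{(n+m-3)!}{m!(n-2)!}$, $\mathcal{N}=\{(m,\mu,k):m,k\ge0,1\le\mu\le d_n(m)\}$. With Jacobi $P^{(a,b)}_k$ and Gegenbauer $C^\lambda_j$: $p_{2k}(x')=P_k^{(\lambda-n/2,m+n/2-1)}(2|x'|^2-1)$; $\eta_\nu(x')=c_\nu|x'|^mW^{-1}(x')p_{2k}(x')Y_{m,\mu}(x'/|x'|)$; $\zeta_\nu(\theta,t)=d_\nu w^{-1}(t)C^\lambda_{m+2k}(t)Y_{m,\mu}(\theta)$; $c_\nu=\Big(\frac{2\,k!(2k+\lambda+m)\Gamma(k+m+\lambda)}{\Gamma(k+\lambda-n/2+1)\Gamma(k+m+n/2)}\Big)^{1/2}$; $d_\nu=2^{\lambda-1/2}\Gamma(\lambda)\Big(\frac{(m+2k)!(m+2k+\lambda)}{\pi\Gamma(m+2k+2\lambda)}\Big)^{1/2}$; $\tilde\eta_\nu(x)=x_{n+1}\eta_\nu(x')$; $\tilde\zeta_\nu(\theta,t)=(1-t^2)^{1/2}\zeta_\nu(\theta,t)$; $s_\nu=2^\lambda\pi^{(n-1)/2}\Big[\frac{(m+2k)!\Gamma(k+m+\lambda)\Gamma(k+1+\lambda-n/2)}{k!\Gamma(m+2k+2\lambda)\Gamma(k+m+n/2)}\Big]^{1/2}$. *)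

theory Defs
  imports "HOL-Analysis.Analysis"
begin

text \<open>Surface measure on the unit sphere of a Euclidean space, via the cone construction:
  sigma(A) = DIM * vol{r a : a in A, 0 < r <= 1}.\<close>
definition sphere_measure :: "'a::euclidean_space measure" where
  "sphere_measure =
     scale_measure (of_nat DIM('a))
       (distr (restrict_space lborel (cball 0 1 - {0})) (restrict_space borel (sphere 0 1))
              (\<lambda>x. x /\<^sub>R norm x))"

definition Splus :: "((real^'n) \<times> real) set" where
  "Splus = {x \<in> sphere 0 1. 0 \<le> snd x}"

definition Splus_measure :: "((real^'n) \<times> real) measure" where
  "Splus_measure = restrict_space sphere_measure Splus"

definition perp_space :: "real^'n \<Rightarrow> ((real^'n) \<times> real) set" where
  "perp_space \<theta> = {x. fst x \<bullet> \<theta> = 0}"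

definition iso_onto :: "((real^'n) \<times> real) set \<Rightarrow> (real^'n \<Rightarrow> (real^'n) \<times> real)" where
  "iso_onto E = (SOME L. linear L \<and> (\<forall>v. norm (L v) = norm v) \<and> range L = E)"

text \<open>Induced surface measure on the slice {x in S^n : x' . theta = t}, an (n-1)-sphere of
  radius sqrt(1-t^2) centred at (t theta, 0) in the hyperplane x' . theta = t.\<close>
definition slice_measure :: "real^'n \<Rightarrow> real \<Rightarrow> ((real^'n) \<times> real) measure" where
  "slice_measure \<theta> t =
     (let r = sqrt (1 - t\<^sup>2); L = iso_onto (perp_space \<theta>) in
      distr (scale_measure (ennreal (r ^ (CARD('n) - 1))) (sphere_measure :: (real^'n) measure))
            borel (\<lambda>v. (t *\<^sub>R \<theta>, 0) + r *\<^sub>R L v))"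

definition V_plus :: "((real^'n) \<times> real \<Rightarrow> real) \<Rightarrow> real^'n \<Rightarrow> real \<Rightarrow> real" where
  "V_plus f \<theta> t = (LINT x:Splus|slice_measure \<theta> t. f x)"

definition cyl_measure :: "((real^'n) \<times> real) measure" where
  "cyl_measure = (sphere_measure :: (real^'n) measure) \<Otimes>\<^sub>M restrict_space lborel {-1<..<1}"

definition L2w :: "'a measure \<Rightarrow> ('a \<Rightarrow> real) \<Rightarrow> ('a \<Rightarrow> real) \<Rightarrow> bool" where
  "L2w M w g \<longleftrightarrow> g \<in> borel_measurable M \<and> integrable M (\<lambda>x. (g x)\<^sup>2 * w x)"

definition L2dist :: "'a measure \<Rightarrow> ('a \<Rightarrow> real) \<Rightarrow> ('a \<Rightarrow> real) \<Rightarrow> ('a \<Rightarrow> real) \<Rightarrow> real" where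
  "L2dist M w g h = sqrt (\<integral>x. (g x - h x)\<^sup>2 * w x \<partial>M)"

definition L2_series_conv ::
  "'a measure \<Rightarrow> ('a \<Rightarrow> real) \<Rightarrow> ('i \<Rightarrow> 'a \<Rightarrow> real) \<Rightarrow> 'i set \<Rightarrow> ('a \<Rightarrow> real) \<Rightarrow> bool" where
  "L2_series_conv M w a I g \<longleftrightarrow>
     ((\<lambda>S. L2dist M w (\<lambda>x. \<Sum>i\<in>S. a i x) g) \<longlongrightarrow> 0) (finite_subsets_at_top I)"

definition laplacian :: "(real^'n \<Rightarrow> real) \<Rightarrow> real^'n \<Rightarrow> real" where
  "laplacian P x = (\<Sum>i\<in>UNIV. deriv (\<lambda>s. deriv (\<lambda>u. P (x + u *\<^sub>R axis i 1)) s) 0)"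

definition spherical_harmonic :: "nat \<Rightarrow> (real^'n \<Rightarrow> real) \<Rightarrow> bool" where
  "spherical_harmonic m Y \<longleftrightarrow>
     (\<exists>P. real_polynomial_function P \<and> (\<forall>c x. P (c *\<^sub>R x) = c ^ m * P x)
          \<and> (\<forall>x. laplacian P x = 0) \<and> (\<forall>\<theta>\<in>sphere 0 1. Y \<theta> = P \<theta>))"

text \<open>d_n(m), the dimension of the space of spherical harmonics of degree m on S^(n-1)
  (d_n(0) = 1).\<close>
definition dn :: "nat \<Rightarrow> nat \<Rightarrow> nat" where
  "dn n m = (if m = 0 then 1 else (n + 2*m - 2) * fact (n + m - 3) div (fact m * fact (n - 2)))"

definition index_set :: "nat \<Rightarrow> (nat \<times> nat \<times> nat) set" where
  "index_set n = {(m, \<mu>, k). 1 \<le> \<mu> \<and> \<mu> \<le> dn n m}"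

definition sph_harm_basis :: "nat \<Rightarrow> (nat \<Rightarrow> nat \<Rightarrow> real^'n \<Rightarrow> real) \<Rightarrow> bool" where
  "sph_harm_basis n Y \<longleftrightarrow>
     (\<forall>m \<mu>. 1 \<le> \<mu> \<and> \<mu> \<le> dn n m \<longrightarrow> spherical_harmonic m (Y m \<mu>)) \<and>
     (\<forall>m \<mu> m' \<mu>'. 1 \<le> \<mu> \<and> \<mu> \<le> dn n m \<and> 1 \<le> \<mu>' \<and> \<mu>' \<le> dn n m' \<longrightarrow>
        (\<integral>\<theta>. Y m \<mu> \<theta> * Y m' \<mu>' \<theta> \<partial>sphere_measure) = (if (m, \<mu>) = (m', \<mu>') then 1 else 0)) \<and>
     (\<forall>g. L2w sphere_measure (\<lambda>_. 1) g \<and>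
        (\<forall>m \<mu>. 1 \<le> \<mu> \<and> \<mu> \<le> dn n m \<longrightarrow> (\<integral>\<theta>. g \<theta> * Y m \<mu> \<theta> \<partial>sphere_measure) = 0)
        \<longrightarrow> (AE \<theta> in sphere_measure. g \<theta> = 0))"

definition jacobiP :: "nat \<Rightarrow> real \<Rightarrow> real \<Rightarrow> real \<Rightarrow> real" where
  "jacobiP k a b x = (\<Sum>s\<le>k. ((real k + a) gchoose (k - s)) * ((real k + b) gchoose s)
                              * ((x - 1) / 2) ^ s * ((x + 1) / 2) ^ (k - s))"

definition gegenbauerC :: "real \<Rightarrow> nat \<Rightarrow> real \<Rightarrow> real" where
  "gegenbauerC lam j t = (\<Sum>i\<le>j div 2. (-1) ^ i * pochhammer lam (j - i)
                              / (fact i * fact (j - 2*i)) * (2*t) ^ (j - 2*i))"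

definition W :: "nat \<Rightarrow> real \<Rightarrow> real^'n \<Rightarrow> real" where
  "W n lam x' = (1 - (norm x')\<^sup>2) powr (real n / 2 - lam)"

definition Wt :: "nat \<Rightarrow> real \<Rightarrow> (real^'n) \<times> real \<Rightarrow> real" where
  "Wt n lam x = (snd x) powr (real n - 2*lam - 1)"

definition w :: "real \<Rightarrow> real \<Rightarrow> real" where
  "w lam t = (1 - t\<^sup>2) powr (1/2 - lam)"

definition wt :: "real \<Rightarrow> real \<Rightarrow> real" where
  "wt lam t = (1 - t\<^sup>2) powr (-1/2 - lam)"

definition c_const :: "nat \<Rightarrow> real \<Rightarrow> nat \<times> nat \<times> nat \<Rightarrow> real" where
  "c_const n lam \<nu> = (case \<nu> of (m, \<mu>, k) \<Rightarrow>
     sqrt (2 * fact k * (2*real k + lam + real m) * Gamma (real k + real m + lam)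
           / (Gamma (real k + lam - real n / 2 + 1) * Gamma (real k + real m + real n / 2))))"

definition d_const :: "nat \<Rightarrow> real \<Rightarrow> nat \<times> nat \<times> nat \<Rightarrow> real" where
  "d_const n lam \<nu> = (case \<nu> of (m, \<mu>, k) \<Rightarrow>
     2 powr (lam - 1/2) * Gamma lam *
     sqrt (fact (m + 2*k) * (real (m + 2*k) + lam) / (pi * Gamma (real (m + 2*k) + 2*lam))))"

definition s_const :: "nat \<Rightarrow> real \<Rightarrow> nat \<times> nat \<times> nat \<Rightarrow> real" where
  "s_const n lam \<nu> = (case \<nu> of (m, \<mu>, k) \<Rightarrow>
     2 powr lam * pi powr ((real n - 1) / 2) *
     sqrt (fact (m + 2*k) * Gamma (real k + real m + lam) * Gamma (real k + 1 + lam - real n / 2)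
           / (fact k * Gamma (real (m + 2*k) + 2*lam) * Gamma (real k + real m + real n / 2))))"

definition eta :: "nat \<Rightarrow> real \<Rightarrow> (nat \<Rightarrow> nat \<Rightarrow> real^'n \<Rightarrow> real) \<Rightarrow> nat \<times> nat \<times> nat
                    \<Rightarrow> real^'n \<Rightarrow> real" where
  "eta n lam Y \<nu> x' = (case \<nu> of (m, \<mu>, k) \<Rightarrow>
     c_const n lam \<nu> * norm x' ^ m * inverse (W n lam x')
     * jacobiP k (lam - real n / 2) (real m + real n / 2 - 1) (2 * (norm x')\<^sup>2 - 1)
     * Y m \<mu> (x' /\<^sub>R norm x'))"

definition zeta :: "nat \<Rightarrow> real \<Rightarrow> (nat \<Rightarrow> nat \<Rightarrow> real^'n \<Rightarrow> real) \<Rightarrow> nat \<times> nat \<times> nat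
                    \<Rightarrow> (real^'n) \<times> real \<Rightarrow> real" where
  "zeta n lam Y \<nu> p = (case \<nu> of (m, \<mu>, k) \<Rightarrow> case p of (\<theta>, t) \<Rightarrow>
     d_const n lam \<nu> * inverse (w lam t) * gegenbauerC lam (m + 2*k) t * Y m \<mu> \<theta>)"

definition eta_t :: "nat \<Rightarrow> real \<Rightarrow> (nat \<Rightarrow> nat \<Rightarrow> real^'n \<Rightarrow> real) \<Rightarrow> nat \<times> nat \<times> nat
                    \<Rightarrow> (real^'n) \<times> real \<Rightarrow> real" where
  "eta_t n lam Y \<nu> x = snd x * eta n lam Y \<nu> (fst x)"

definition zeta_t :: "nat \<Rightarrow> real \<Rightarrow> (nat \<Rightarrow> nat \<Rightarrow> real^'n \<Rightarrow> real) \<Rightarrow> nat \<times> nat \<times> nat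
                    \<Rightarrow> (real^'n) \<times> real \<Rightarrow> real" where
  "zeta_t n lam Y \<nu> p = (1 - (snd p)\<^sup>2) powr (1/2) * zeta n lam Y \<nu> p"

end

theory Submission
  imports Defs "HOL-Computational_Algebra.Formal_Power_Series"
begin

text \<open>
  In the coordinates x = (sqrt (1 - t^2) u, t), with u on the unit sphere of R^n and 0 < t < 1, the
  functions eta are products of spherical harmonics in u and weighted Jacobi polynomials in t. They
  form a complete orthonormal system, because a function on (0, 1) whose moments against the powers
  of 1 - t^2 vanish is zero almost everywhere.

  For fixed theta, the t-moments of V eta are integrals of (x' . theta)^l eta over the half sphere.
  In the same coordinates these factor into a Beta type integral and the integral of
  (u . theta)^l Y(u), which is a multiple of Y(theta) by the Funk--Hecke formula. They agree with the
  moments of s zeta, hence V eta = s zeta almost everywhere, with zeta orthonormal.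

  By the Cauchy--Schwarz inequality on each slice V is bounded between the weighted L^2 spaces, so it
  may be applied term by term to the expansion of f; comparing coefficients gives F_nu = s_nu f_nu.
\<close>


text \<open>The \<open>zeta\<close> system is not complete among even functions: for j < m of the
  same parity, C_j times Y_m is orthogonal to all of it. The expansion of F therefore cannot come
  from a basis of the cylinder; it is transported from the expansion of f, and only
  \<open>eta\<close> is shown to be complete.

  Boundedness of V rests on 1 / \<open>Wt\<close> being integrable over a half slice: there it is,
  up to a factor, the power 2 lam + 1 - n of the height, and this exponent exceeds -1 exactly when
  lam > n/2 - 1.

  The slice measure is built from an isometry chosen by \<open>SOME\<close>, while the surface
  measure is given by cones. Rotation invariance bridges the two: it allows the unknown isometry to
  be replaced by an explicit reflection.

  Because only moments are compared, the Funk--Hecke formula is needed for powers alone, where it is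
  a recurrence coming from integration by parts on the sphere. The number s_nu is what makes
  Funk--Hecke coefficient times Jacobi moment agree with the Gegenbauer moment after the
  normalisations c_nu and d_nu; the point is that the same number works for every order l.\<close>

section \<open>Surface measure and polar coordinates\<close>

lemma nn_integral_sphere_measure:
  fixes g :: "'a::euclidean_space \<Rightarrow> ennreal"
  assumes [measurable]: "g \<in> borel_measurable borel"
  shows "(\<integral>\<^sup>+u. g u \<partial>sphere_measure) =
    of_nat DIM('a) * (\<integral>\<^sup>+x. indicator (cball 0 1 - {0}) x * g (x /\<^sub>R norm x) \<partial>lborel)"
proof -
  have "(\<lambda>x::'a. x /\<^sub>R norm x) \<in> restrict_space lborel (cball 0 1 - {0}) \<rightarrow>\<^sub>M restrict_space borel (sphere 0 1)"
    by (intro measurable_restrict_space2 measurable_restrict_space1) (auto simp: space_restrict_space)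
  then have "(\<integral>\<^sup>+u. g u \<partial>sphere_measure) = of_nat DIM('a) *
      (\<integral>\<^sup>+x. g (x /\<^sub>R norm x) \<partial>restrict_space lborel (cball 0 1 - {0}))"
    unfolding sphere_measure_def
    by (subst nn_integral_scale_measure, simp add: measurable_restrict_space1,
        subst nn_integral_distr) (auto simp: measurable_restrict_space1)
  also have "(\<integral>\<^sup>+x. g (x /\<^sub>R norm x) \<partial>restrict_space lborel (cball 0 1 - {0})) =
      (\<integral>\<^sup>+x. indicator (cball 0 1 - {0}) x * g (x /\<^sub>R norm x) \<partial>lborel)"
    by (subst nn_integral_restrict_space) (auto simp: mult.commute)
  finally show ?thesis .
qed

lemma sets_sphere_measure [measurable_cong]:
  "sets (sphere_measure :: 'a::euclidean_space measure) = sets (restrict_space borel (sphere 0 1))"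
  by (simp add: sphere_measure_def)

lemma space_sphere_measure [simp]:
  "space (sphere_measure :: 'a::euclidean_space measure) = sphere 0 1"
  using sets_eq_imp_space_eq[OF sets_sphere_measure] by (simp add: space_restrict_space)

lemma nn_integral_lborel_scale:
  fixes g :: "'a::euclidean_space \<Rightarrow> ennreal"
  assumes [measurable]: "g \<in> borel_measurable borel" and s: "s > 0"
  shows "(\<integral>\<^sup>+y. g y \<partial>lborel) = ennreal (s ^ DIM('a)) * (\<integral>\<^sup>+x. g (s *\<^sub>R x) \<partial>lborel)"
proof -
  have "(\<integral>\<^sup>+y. g y \<partial>lborel) =
    (\<integral>\<^sup>+y. g y \<partial>density (distr lborel borel (\<lambda>x::'a. 0 + s *\<^sub>R x)) (\<lambda>_. \<bar>s\<bar>^DIM('a)))"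
    using lborel_affine[of s "0::'a"] s by simp
  also have "\<dots> = ennreal (s ^ DIM('a)) * (\<integral>\<^sup>+x. g (s *\<^sub>R x) \<partial>lborel)"
    using s by (subst nn_integral_density) (simp_all add: nn_integral_distr nn_integral_cmult)
  finally show ?thesis .
qed

lemma nn_integral_power_tail:
  assumes a: "a > 0" and D: "D > 0"
  shows "(\<integral>\<^sup>+s. ennreal (inverse (s ^ Suc D)) * indicator {a..} s \<partial>lborel) = ennreal (inverse (D * a ^ D))"
proof -
  have "(\<integral>\<^sup>+s. ennreal (inverse (s ^ Suc D)) * indicator {a..} s \<partial>lborel)
      = ennreal (0 - (- inverse (D * a ^ D)))"
  proof (rule nn_integral_FTC_atLeast)
    fix s assume "a \<le> s"
    with a have s: "s > 0" by simp
    show "DERIV (\<lambda>s. - inverse (D * s ^ D)) s :> inverse (s ^ Suc D)"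
      using s D by (auto intro!: derivative_eq_intros simp: field_simps power_Suc[symmetric] simp del: power_Suc)
        (cases D; simp add: field_simps)+
    show "0 \<le> inverse (s ^ Suc D)" using s by simp
  next
    have "((\<lambda>s::real. - inverse (D * s ^ D)) \<longlongrightarrow> - 0) at_top"
      using D by (intro tendsto_minus tendsto_inverse_0_at_top filterlim_tendsto_pos_mult_at_top[OF tendsto_const]
        filterlim_pow_at_top filterlim_ident) auto
    then show "((\<lambda>s::real. - inverse (D * s ^ D)) \<longlongrightarrow> 0) at_top" by simp
  qed simp
  then show ?thesis by simp
qed

text \<open>Both sides are rewritten with Tonelli and the scalings r = s |x| and y = s x.\<close>

lemma nn_integral_polar:
  fixes h :: "'a::euclidean_space \<Rightarrow> ennreal"
  assumes h[measurable]: "h \<in> borel_measurable borel"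
  shows "(\<integral>\<^sup>+x. h x \<partial>lborel) =
    (\<integral>\<^sup>+r. indicator {0<..} r * ennreal (r ^ (DIM('a) - 1)) * (\<integral>\<^sup>+u. h (r *\<^sub>R u) \<partial>sphere_measure) \<partial>lborel)"
    (is "_ = ?R")
proof -
  define D where "D = DIM('a)"
  have D: "D > 0" by (simp add: D_def)
  let ?B = "cball 0 1 - {0} :: 'a set"
  have [measurable]: "?B \<in> sets borel" by simp
  have "?R = (\<integral>\<^sup>+r. indicator {0<..} r * ennreal (r ^ (D - 1)) *
      (of_nat D * (\<integral>\<^sup>+x. indicator ?B x * h (r *\<^sub>R (x /\<^sub>R norm x)) \<partial>lborel)) \<partial>lborel)"
    by (subst nn_integral_sphere_measure) (simp_all add: D_def)
  also have "\<dots> = (\<integral>\<^sup>+r. of_nat D * (\<integral>\<^sup>+x. indicator ?B x * (indicator {0<..} r * ennreal (r ^ (D - 1)) *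
       h (r *\<^sub>R (x /\<^sub>R norm x))) \<partial>lborel) \<partial>lborel)"
  proof (rule nn_integral_cong)
    fix r :: real
    show "indicator {0<..} r * ennreal (r ^ (D - 1)) *
      (of_nat D * (\<integral>\<^sup>+x. indicator ?B x * h (r *\<^sub>R (x /\<^sub>R norm x)) \<partial>lborel)) =
      of_nat D * (\<integral>\<^sup>+x. indicator ?B x * (indicator {0<..} r * ennreal (r ^ (D - 1)) *
       h (r *\<^sub>R (x /\<^sub>R norm x))) \<partial>lborel)"
    proof -
      let ?c = "indicator {0<..} r * ennreal (r ^ (D - 1))"
      have "(\<integral>\<^sup>+x. indicator ?B x * (?c * h (r *\<^sub>R (x /\<^sub>R norm x))) \<partial>lborel) =
        (\<integral>\<^sup>+x. ?c * (indicator ?B x * h (r *\<^sub>R (x /\<^sub>R norm x))) \<partial>lborel)"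
        by (simp only: mult_ac)
      also have "\<dots> = ?c * (\<integral>\<^sup>+x. indicator ?B x * h (r *\<^sub>R (x /\<^sub>R norm x)) \<partial>lborel)"
        by (rule nn_integral_cmult) (intro borel_measurable_times_ennreal, auto)
      finally show ?thesis by (simp only: mult_ac)
    qed
  qed
  also have "\<dots> = of_nat D * (\<integral>\<^sup>+r. (\<integral>\<^sup>+x. indicator ?B x * (indicator {0<..} r * ennreal (r ^ (D - 1)) *
       h (r *\<^sub>R (x /\<^sub>R norm x))) \<partial>lborel) \<partial>lborel)"
    by (rule nn_integral_cmult) measurable
  also have "(\<integral>\<^sup>+r. (\<integral>\<^sup>+x. indicator ?B x * (indicator {0<..} r * ennreal (r ^ (D - 1)) *
       h (r *\<^sub>R (x /\<^sub>R norm x))) \<partial>lborel) \<partial>lborel) =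
     (\<integral>\<^sup>+x. (\<integral>\<^sup>+r. indicator ?B x * (indicator {0<..} r * ennreal (r ^ (D - 1)) *
       h (r *\<^sub>R (x /\<^sub>R norm x))) \<partial>lborel) \<partial>lborel)"
    by (rule lborel_pair.Fubini') simp
  \<comment> \<open>With r = s |x| the norm leaves the argument of h, and r^(D-1) dr becomes |x|^D
    s^(D-1) ds.\<close>
  also have "\<dots> = (\<integral>\<^sup>+x. (\<integral>\<^sup>+s. indicator ?B x * (ennreal (norm x ^ D) * indicator {0<..} s *
      ennreal (s ^ (D - 1)) * h (s *\<^sub>R x)) \<partial>lborel) \<partial>lborel)"
  proof (rule nn_integral_cong)
    fix x :: 'a
    show "(\<integral>\<^sup>+r. indicator ?B x * (indicator {0<..} r * ennreal (r ^ (D - 1)) *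
       h (r *\<^sub>R (x /\<^sub>R norm x))) \<partial>lborel) = (\<integral>\<^sup>+s. indicator ?B x * (ennreal (norm x ^ D) *
       indicator {0<..} s * ennreal (s ^ (D - 1)) * h (s *\<^sub>R x)) \<partial>lborel)"
    proof (cases "x \<in> ?B")
      case True
      then have x: "norm x > 0" by simp
      have e: "norm x ^ D = norm x * norm x ^ (D - 1)" using D by (cases D) auto
      show ?thesis
        using x True by (subst nn_integral_real_affine[where c = "norm x" and t = 0], simp, simp,
            subst nn_integral_cmult[symmetric], simp, intro nn_integral_cong)
          (auto simp: indicator_def zero_less_mult_iff e power_mult_distrib ennreal_mult mult_ac)
    qed simp
  qed
  also have "\<dots> = (\<integral>\<^sup>+s. (\<integral>\<^sup>+x. indicator ?B x * (ennreal (norm x ^ D) * indicator {0<..} s *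
      ennreal (s ^ (D - 1)) * h (s *\<^sub>R x)) \<partial>lborel) \<partial>lborel)"
    by (rule lborel_pair.Fubini') simp
  \<comment> \<open>With y = s x the constraint |x| <= 1 becomes |y| <= s, and the powers of s
    collect to s^(-D-1).\<close>
  also have "\<dots> = (\<integral>\<^sup>+s. (\<integral>\<^sup>+y. indicator {0<..} s * ennreal (inverse (s ^ Suc D)) *
      (indicator (cball 0 s - {0}) y * ennreal (norm y ^ D) * h y) \<partial>lborel) \<partial>lborel)"
  proof (rule nn_integral_cong)
    fix s :: real
    show "(\<integral>\<^sup>+x. indicator ?B x * (ennreal (norm x ^ D) * indicator {0<..} s *
      ennreal (s ^ (D - 1)) * h (s *\<^sub>R x)) \<partial>lborel) = (\<integral>\<^sup>+y. indicator {0<..} s * ennreal (inverse (s ^ Suc D)) *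
      (indicator (cball 0 s - {0}) y * ennreal (norm y ^ D) * h y) \<partial>lborel)"
    proof (cases "s > 0")
      case True
      have 1: "ennreal (s ^ D) * (ennreal (inverse (s ^ Suc D)) * ennreal (s ^ D)) = ennreal (s ^ (D - Suc 0))"
        using True D by (cases D) (auto simp: ennreal_mult[symmetric] field_simps)
      have 2: "indicator (cball 0 s - {0}) (s *\<^sub>R x) = (indicator ?B x :: ennreal)" for x
        using True by (auto simp: indicator_def)
      let ?k = "\<lambda>y. indicator {0<..} s * ennreal (inverse (s ^ Suc D)) *
        (indicator (cball 0 s - {0}) y * ennreal (norm y ^ D) * h y)"
      have [measurable]: "cball 0 s - {0::'a} \<in> sets borel" by simp
      have [measurable]: "?k \<in> borel_measurable borel" by measurable
      have "(\<integral>\<^sup>+y. ?k y \<partial>lborel) = ennreal (s ^ D) * (\<integral>\<^sup>+x. ?k (s *\<^sub>R x) \<partial>lborel)"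
        unfolding D_def by (rule nn_integral_lborel_scale) (use True in simp_all)
      also have "\<dots> = (\<integral>\<^sup>+x. ennreal (s ^ D) * ?k (s *\<^sub>R x) \<partial>lborel)"
        by (rule nn_integral_cmult[symmetric]) measurable
      also have "\<dots> = (\<integral>\<^sup>+x. indicator ?B x * (ennreal (norm x ^ D) * indicator {0<..} s *
          ennreal (s ^ (D - 1)) * h (s *\<^sub>R x)) \<partial>lborel)"
        using True by (intro nn_integral_cong)
          (simp add: 2 1[symmetric] power_mult_distrib ennreal_mult mult_ac del: power_Suc)
      finally show ?thesis by simp
    qed simp
  qed
  also have "\<dots> = (\<integral>\<^sup>+y. (\<integral>\<^sup>+s. indicator {0<..} s * ennreal (inverse (s ^ Suc D)) *
      (indicator (cball 0 s - {0}) y * ennreal (norm y ^ D) * h y) \<partial>lborel) \<partial>lborel)"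
  proof (rule lborel_pair.Fubini')
    have "Measurable.pred (borel \<Otimes>\<^sub>M borel) (\<lambda>p::'a \<times> real. fst p \<in> cball 0 (snd p) - {0})"
      by (simp add: dist_norm)
    then have [measurable]: "(\<lambda>p::'a \<times> real. indicator (cball 0 (snd p) - {0}) (fst p) :: ennreal) \<in> borel_measurable (borel \<Otimes>\<^sub>M borel)"
      unfolding indicator_def by measurable
    show "(\<lambda>(y, s). indicator {0<..} s * ennreal (inverse (s ^ Suc D)) *
      (indicator (cball 0 s - {0}) y * ennreal (norm y ^ D) * h y)) \<in> borel_measurable (lborel \<Otimes>\<^sub>M lborel)"
      unfolding case_prod_beta by measurable
  qed
  \<comment> \<open>For fixed y only s >= |y| contributes, and that tail is 1 / (D |y|^D). The norm
    cancels against |y|^D; the factor D of the cone construction cancels the rest.\<close>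
  also have "\<dots> = (\<integral>\<^sup>+y. ennreal (inverse D) * (indicator (- {0}) y * h y) \<partial>lborel)"
  proof (rule nn_integral_cong)
    fix y :: 'a
    show "(\<integral>\<^sup>+s. indicator {0<..} s * ennreal (inverse (s ^ Suc D)) *
      (indicator (cball 0 s - {0}) y * ennreal (norm y ^ D) * h y) \<partial>lborel) =
      ennreal (inverse D) * (indicator (- {0}) y * h y)"
    proof (cases "y = 0")
      case False
      have "(\<integral>\<^sup>+s. indicator {0<..} s * ennreal (inverse (s ^ Suc D)) *
          (indicator (cball 0 s - {0}) y * ennreal (norm y ^ D) * h y) \<partial>lborel) =
        (\<integral>\<^sup>+s. (ennreal (norm y ^ D) * h y) * (ennreal (inverse (s ^ Suc D)) * indicator {norm y..} s) \<partial>lborel)"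
      proof (rule nn_integral_cong)
        fix s :: real
        have "0 < s" if "norm y \<le> s" using False that less_le_trans[of 0 "norm y" s] by simp
        then show "indicator {0<..} s * ennreal (inverse (s ^ Suc D)) *
            (indicator (cball 0 s - {0}) y * ennreal (norm y ^ D) * h y) =
          (ennreal (norm y ^ D) * h y) * (ennreal (inverse (s ^ Suc D)) * indicator {norm y..} s)"
          using False by (cases "norm y \<le> s") (simp_all add: indicator_def mult_ac)
      qed
      also have "\<dots> = (ennreal (norm y ^ D) * h y) * ennreal (inverse (D * norm y ^ D))"
        using False D by (subst nn_integral_cmult, simp, subst nn_integral_power_tail) auto
      also have "\<dots> = ennreal (norm y ^ D * inverse (D * norm y ^ D)) * h y"
        by (simp add: ennreal_mult mult_ac)
      also have "norm y ^ D * inverse (D * norm y ^ D) = inverse D" using False by simp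
      finally show ?thesis using False by simp
    qed simp
  qed
  also have "of_nat D * \<dots> = (\<integral>\<^sup>+y. indicator (- {0}) y * h y \<partial>lborel)"
    using D by (subst nn_integral_cmult, simp)
      (simp add: mult.assoc[symmetric] ennreal_of_nat_eq_real_of_nat ennreal_mult[symmetric])
  also have "\<dots> = (\<integral>\<^sup>+x. h x \<partial>lborel)"
    by (intro nn_integral_cong_AE eventually_mono[OF AE_lborel_singleton[of "0::'a"]]) (simp add: indicator_def)
  finally show ?thesis by simp
qed

section \<open>Rotation invariance\<close>

text \<open>A translation invariant measure is a multiple of Lebesgue measure; the unit ball fixes the factor.\<close>

lemma distr_lborel_isometry:
  fixes U :: "'a::euclidean_space \<Rightarrow> 'a"
  assumes lin: "linear U" and nrm: "\<And>x. norm (U x) = norm x"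
  shows "distr lborel borel U = lborel"
proof -
  have U[measurable]: "U \<in> borel_measurable borel"
    using linear_continuous_on[of U UNIV] lin by (intro borel_measurable_continuous_onI) (auto simp: linear_conv_bounded_linear)
  define M where "M = distr lborel borel U"
  have sM[measurable_cong, simp]: "sets M = sets borel" by (simp add: M_def)
  have inj: "inj U" using nrm lin by (metis linear_injective_0 norm_eq_zero)
  then have sur: "surj U" using lin by (simp add: linear_injective_imp_surjective)
  let ?B = "ball 0 1 :: 'a set"
  have [measurable]: "?B \<in> sets borel" by simp
  have UB: "U -` ?B = ?B" using nrm by auto
  have MB: "emeasure M ?B = emeasure lborel ?B"
    by (simp add: M_def emeasure_distr UB)
  \<comment> \<open>Balls about 0 are their own preimages under U, so they exhaust the space with
    finite mass. This is what Fubini needs for M.\<close>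
  have sf: "sigma_finite_measure M"
  proof -
    have "emeasure M (ball 0 (real n)) = emeasure lborel (ball 0 (real n) :: 'a set)" for n
    proof -
      have "U -` ball 0 (real n) = ball 0 (real n)" using nrm by auto
      then show ?thesis by (simp add: M_def emeasure_distr)
    qed
    then have "emeasure M (ball 0 (real n)) \<noteq> \<infinity>" for n
      using emeasure_lborel_ball_finite[of "0::'a" "real n"] by simp
    moreover have "(\<Union>n. ball 0 (real n)) = (UNIV::'a set)"
      by (auto simp: reals_Archimedean2)
    ultimately show ?thesis
      by (intro sigma_finite_measure.intro exI[of _ "range (\<lambda>n. ball 0 (real n))"]) (auto simp: M_def)
  qed
  interpret MP: pair_sigma_finite M "lborel :: 'a measure"
    using sf by (simp add: pair_sigma_finite_def sigma_finite_lborel)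
  have trans: "(\<integral>\<^sup>+x. g (x + y) \<partial>M) = (\<integral>\<^sup>+x. g x \<partial>M)" if [measurable]: "g \<in> borel_measurable borel" for g :: "'a \<Rightarrow> ennreal" and y
  proof -
    obtain z where z: "y = U z" using sur by blast
    have "(\<integral>\<^sup>+x. g (x + y) \<partial>M) = (\<integral>\<^sup>+x. g (U (z + x)) \<partial>lborel)"
      by (simp add: M_def nn_integral_distr z linear_add[OF lin] add.commute)
    also have "\<dots> = (\<integral>\<^sup>+x. g (U x) \<partial>distr lborel borel ((+) z))"
      by (simp add: nn_integral_distr)
    also have "\<dots> = (\<integral>\<^sup>+x. g x \<partial>M)" by (simp add: M_def nn_integral_distr lborel_distr_plus)
    finally show ?thesis .
  qed
  have trl: "(\<integral>\<^sup>+x. g (x - y) \<partial>lborel) = (\<integral>\<^sup>+x. g x \<partial>lborel)" if [measurable]: "g \<in> borel_measurable borel" for g :: "'a \<Rightarrow> ennreal" and y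
    using that lborel_distr_plus[of "-y"] nn_integral_distr[of "(+) (-y)" lborel borel g] by simp
  show ?thesis
  proof (rule measure_eqI)
    fix A assume "A \<in> sets (distr lborel borel U)"
    then have [measurable]: "A \<in> sets borel" by simp
    \<comment> \<open>The product is a double integral over M and \<open>lborel\<close>. A shift by
      y in M, then one by x in \<open>lborel\<close>, then again one by y in M exchange the roles of
      the two sets; symmetry of the ball gives
      \<open>emeasure M ?B * emeasure lborel A\<close>.\<close>
    have "emeasure lborel ?B * emeasure M A = (\<integral>\<^sup>+y. indicator ?B y * (\<integral>\<^sup>+x. indicator A x \<partial>M) \<partial>lborel)"
      by (subst nn_integral_multc) auto
    also have "\<dots> = (\<integral>\<^sup>+y. indicator ?B y * (\<integral>\<^sup>+x. indicator A (x + y) \<partial>M) \<partial>lborel)"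
      by (intro nn_integral_cong arg_cong2[where f = "(*)"] trans[symmetric]) auto
    also have "\<dots> = (\<integral>\<^sup>+y. (\<integral>\<^sup>+x. indicator ?B y * indicator A (x + y) \<partial>M) \<partial>lborel)"
      by (intro nn_integral_cong nn_integral_cmult[symmetric]) measurable
    also have "\<dots> = (\<integral>\<^sup>+x. (\<integral>\<^sup>+y. indicator ?B y * indicator A (x + y) \<partial>lborel) \<partial>M)"
      by (rule MP.Fubini') measurable
    also have "\<dots> = (\<integral>\<^sup>+x. (\<integral>\<^sup>+y. indicator ?B (y - x) * indicator A y \<partial>lborel) \<partial>M)"
    proof (rule nn_integral_cong)
      fix x
      show "(\<integral>\<^sup>+y. indicator ?B y * indicator A (x + y) \<partial>lborel) = (\<integral>\<^sup>+y. indicator ?B (y - x) * indicator A y \<partial>lborel)"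
        using trl[of "\<lambda>y. indicator ?B y * indicator A (x + y)" x] by simp
    qed
    also have "\<dots> = (\<integral>\<^sup>+y. (\<integral>\<^sup>+x. indicator ?B (y - x) * indicator A y \<partial>M) \<partial>lborel)"
      by (rule MP.Fubini'[symmetric]) measurable
    also have "\<dots> = (\<integral>\<^sup>+y. emeasure M ?B * indicator A y \<partial>lborel)"
    proof (rule nn_integral_cong)
      fix y
      have "(\<integral>\<^sup>+x. indicator ?B (y - x) * indicator A y \<partial>M) = (\<integral>\<^sup>+x. indicator ?B (y - x) \<partial>M) * indicator A y"
        by (rule nn_integral_multc) measurable
      also have "(\<integral>\<^sup>+x. indicator ?B (y - x) \<partial>M) = (\<integral>\<^sup>+x. indicator ?B (y - (x + y)) \<partial>M)"
        by (subst trans[symmetric, where y = y]) auto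
      also have "\<dots> = (\<integral>\<^sup>+x. indicator ?B x \<partial>M)" by (intro nn_integral_cong) (auto simp: indicator_def)
      also have "\<dots> = emeasure M ?B" by simp
      finally show "(\<integral>\<^sup>+x. indicator ?B (y - x) * indicator A y \<partial>M) = emeasure M ?B * indicator A y" .
    qed
    also have "\<dots> = emeasure lborel ?B * emeasure lborel A" by (simp add: nn_integral_cmult MB)
    finally have "emeasure lborel ?B * emeasure M A = emeasure lborel ?B * emeasure lborel A" .
    moreover have "emeasure lborel ?B \<noteq> 0" "emeasure lborel ?B \<noteq> \<infinity>"
      using emeasure_lborel_ball_finite[of "0::'a" 1] content_ball_pos[of 1 "0::'a"] by (auto simp: measure_def)
    ultimately show "emeasure (distr lborel borel U) A = emeasure lborel A"
      unfolding M_def[symmetric] by (simp add: ennreal_mult_cancel_left)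
  qed simp
qed

text \<open>U maps the punctured ball to itself and commutes with x / |x|, so the cone construction
  inherits the invariance of Lebesgue measure.\<close>

lemma nn_integral_sphere_isometry:
  fixes U :: "'a::euclidean_space \<Rightarrow> 'a" and g :: "'a \<Rightarrow> ennreal"
  assumes lin: "linear U" and nrm: "\<And>x. norm (U x) = norm x" and [measurable]: "g \<in> borel_measurable borel"
  shows "(\<integral>\<^sup>+u. g (U u) \<partial>sphere_measure) = (\<integral>\<^sup>+u. g u \<partial>sphere_measure)"
proof -
  have [measurable]: "U \<in> borel_measurable borel"
    using linear_continuous_on[of U UNIV] lin by (intro borel_measurable_continuous_onI) (auto simp: linear_conv_bounded_linear)
  have [measurable]: "cball 0 1 - {0::'a} \<in> sets borel" by simp
  have ind: "indicator (cball 0 1 - {0}) (U x) = (indicator (cball 0 1 - {0}) x :: ennreal)" for x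
    using nrm[of x] by (metis (no_types) DiffE DiffI indicator_simps mem_cball_0 norm_eq_zero singleton_iff)
  have "(\<integral>\<^sup>+x. indicator (cball 0 1 - {0}) x * g (x /\<^sub>R norm x) \<partial>lborel) =
    (\<integral>\<^sup>+x. indicator (cball 0 1 - {0}) x * g (x /\<^sub>R norm x) \<partial>distr lborel borel U)"
    by (simp add: distr_lborel_isometry[OF lin nrm])
  also have "\<dots> = (\<integral>\<^sup>+x. indicator (cball 0 1 - {0}) x * g (U (x /\<^sub>R norm x)) \<partial>lborel)"
    by (subst nn_integral_distr) (auto simp: ind nrm linear_scale[OF lin])
  finally show ?thesis by (simp add: nn_integral_sphere_measure)
qed

section \<open>Slicing the sphere of a product with the line\<close>

text \<open>The substitution tau = t / sqrt (1 - t^2), whose derivative is the density. It converts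
  the slope tau of a ray into the height t at which the ray meets the unit sphere.\<close>

lemma lborel_eq_distr_open_interval:
  "lborel = distr (density lborel (\<lambda>t. indicator {-1<..<1} t * ennreal (inverse (sqrt (1 - t\<^sup>2) ^ 3)))) borel
      (\<lambda>t. t / sqrt (1 - t\<^sup>2))" (is "_ = distr (density lborel ?d) borel ?g")
proof (rule lborel_eqI)
  fix l u :: real
  assume "\<And>b. b \<in> Basis \<Longrightarrow> l \<bullet> b \<le> u \<bullet> b"
  then have lu: "l \<le> u" by simp
  \<comment> \<open>\<open>q\<close> inverts the substitution on the whole line, so inside (-1, 1)
    the preimage of an interval is the interval between the \<open>q\<close>-values of its
    ends.\<close>
  define q where "q = (\<lambda>\<tau>::real. \<tau> / sqrt (1 + \<tau>\<^sup>2))"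
  have q1: "q \<tau> \<in> {-1<..<1}" for \<tau>
  proof -
    have "(q \<tau>)\<^sup>2 < 1" unfolding q_def by (simp add: power_divide add_pos_nonneg)
    then show ?thesis by (simp add: abs_square_less_1 abs_less_iff)
  qed
  have sq: "1 - (q \<tau>)\<^sup>2 = inverse (1 + \<tau>\<^sup>2)" for \<tau>
  proof -
    have "1 + \<tau>\<^sup>2 > 0" by (simp add: add_pos_nonneg)
    then show ?thesis unfolding q_def by (simp add: power_divide field_simps)
  qed
  have gq: "?g (q \<tau>) = \<tau>" for \<tau>
    unfolding sq unfolding q_def by (simp add: real_sqrt_inverse add_pos_nonneg less_imp_neq[symmetric] add_nonneg_eq_0_iff)
  have pos: "1 - t\<^sup>2 > 0" if "t \<in> {-1<..<1}" for t :: real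
    using that by (simp add: abs_square_less_1 abs_less_iff)
  have der: "(?g has_real_derivative inverse (sqrt (1 - t\<^sup>2) ^ 3)) (at t)" if "t \<in> {-1<..<1}" for t
  proof -
    have p: "1 - t\<^sup>2 > 0" using pos[OF that] .
    define r where "r = sqrt (1 - t\<^sup>2)"
    have r: "r > 0" "r ^ 2 = 1 - t\<^sup>2" using p by (auto simp: r_def)
    have "(?g has_real_derivative (1 * r - t * (- (2 * t) * (inverse r / 2))) / (r * r)) (at t)"
      unfolding r_def using p by (auto intro!: derivative_eq_intros)
    also have "(1 * r - t * (- (2 * t) * (inverse r / 2))) / (r * r) = inverse (r ^ 3)"
      using r by (simp add: field_simps power2_eq_square power3_eq_cube)
    finally show ?thesis unfolding r_def .
  qed
  have mono: "?g s < ?g t" if "s < t" "s \<in> {-1<..<1}" "t \<in> {-1<..<1}" for s t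
  proof (rule DERIV_pos_imp_increasing[OF that(1)])
    fix x assume "s \<le> x" "x \<le> t"
    then have x: "x \<in> {-1<..<1}" using that by auto
    show "\<exists>y. (?g has_real_derivative y) (at x) \<and> 0 < y"
      using der[OF x] pos[OF x] by (intro exI[of _ "inverse (sqrt (1 - x\<^sup>2) ^ 3)"]) auto
  qed
  have iff: "t < q \<tau> \<longleftrightarrow> ?g t < \<tau>" "q \<tau> < t \<longleftrightarrow> \<tau> < ?g t" if "t \<in> {-1<..<1}" for t \<tau>
    using mono[OF _ that q1[of \<tau>]] mono[OF _ q1[of \<tau>] that] gq[of \<tau>] by (metis less_asym linorder_neqE_linordered_idom)+
  have qlu: "q l \<le> q u" using iff(1)[OF q1[of u], of l] lu gq[of u] by (simp add: not_less[symmetric])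
  have [measurable]: "?d \<in> borel_measurable borel" by measurable
  have "emeasure (distr (density lborel ?d) borel ?g) (box l u) = (\<integral>\<^sup>+t. ?d t * indicator (?g -` {l<..<u}) t \<partial>lborel)"
  proof -
    have [measurable]: "?g \<in> borel_measurable borel" by measurable
    have "?g -` {l<..<u} \<in> sets lborel" using measurable_sets_borel[of ?g borel "{l<..<u}"] by simp
    then show ?thesis by (subst emeasure_distr) (simp_all add: emeasure_density)
  qed
  also have "\<dots> = (\<integral>\<^sup>+t. ennreal (indicator {-1<..<1} t * inverse (sqrt (1 - t\<^sup>2) ^ 3)) * indicator {q l..q u} t \<partial>lborel)"
  proof (rule nn_integral_cong_AE)
    show "AE t in lborel. ?d t * indicator (?g -` {l<..<u}) t =
       ennreal (indicator {-1<..<1} t * inverse (sqrt (1 - t\<^sup>2) ^ 3)) * indicator {q l..q u} t"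
      using AE_lborel_singleton[of "q l"] AE_lborel_singleton[of "q u"]
    proof eventually_elim
      case (elim t)
      show ?case
      proof (cases "t \<in> {-1<..<1}")
        case True
        then show ?thesis using iff(1)[OF True, of u] iff(2)[OF True, of l] elim by (auto simp: indicator_def)
      qed simp
    qed
  qed
  also have "\<dots> = ennreal (?g (q u) - ?g (q l))"
  proof (rule nn_integral_FTC_Icc[OF _ _ _ qlu])
    fix t assume t: "t \<in> {q l..q u}"
    have t1: "t \<in> {-1<..<1}" using t q1[of l] q1[of u] by auto
    show "(?g has_real_derivative indicat_real {- 1<..<1} t * inverse (sqrt (1 - t\<^sup>2) ^ 3)) (at t)"
      using der[OF t1] t1 by simp
    show "0 \<le> indicat_real {- 1<..<1} t * inverse (sqrt (1 - t\<^sup>2) ^ 3)" using pos[OF t1] by simp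
  qed simp
  finally show "emeasure (distr (density lborel ?d) borel ?g) (box l u) = (\<Prod>b\<in>Basis. (u - l) \<bullet> b)"
    by (simp add: gq)
qed simp

lemma nn_integral_power_initial:
  assumes "b \<ge> 0"
  shows "(\<integral>\<^sup>+r. ennreal (r ^ n) * indicator {0..b} r \<partial>lborel) = ennreal (b ^ Suc n / Suc n)"
proof -
  have "(\<integral>\<^sup>+r. ennreal (r ^ n) * indicator {0..b} r \<partial>lborel) = ennreal (b ^ Suc n / Suc n - 0 ^ Suc n / Suc n)"
  proof (rule nn_integral_FTC_Icc[where F = "\<lambda>r. r ^ Suc n / Suc n", OF _ _ _ assms])
    fix x :: real assume "x \<in> {0..b}"
    then show "0 \<le> x ^ n" by simp
    have "((\<lambda>r. r ^ Suc n / Suc n) has_real_derivative Suc n * x ^ n / Suc n) (at x)"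
      by (rule DERIV_cdivide, rule DERIV_cong[OF DERIV_pow]) simp
    then show "((\<lambda>r. r ^ Suc n / Suc n) has_real_derivative x ^ n) (at x)"
      by (simp del: power_Suc of_nat_Suc)
  qed simp
  then show ?thesis by simp
qed

lemma scale_measure_eq_density: "scale_measure c M = density M (\<lambda>_. c)"
  by (rule measure_eqI) (simp_all add: emeasure_density_const)

lemma borel_measurable_linear:
  fixes L :: "'a::euclidean_space \<Rightarrow> 'b::euclidean_space"
  assumes "linear L"
  shows "L \<in> borel_measurable borel"
  using assms linear_continuous_on[of L UNIV]
  by (intro borel_measurable_continuous_onI) (simp add: linear_conv_bounded_linear)

lemma measurable_sphere_measure_borel:
  "f \<in> borel \<rightarrow>\<^sub>M N \<Longrightarrow> f \<in> (sphere_measure :: 'a::euclidean_space measure) \<rightarrow>\<^sub>M N"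
  unfolding measurable_cong_sets[OF sets_sphere_measure refl] by (rule measurable_restrict_space1)

lemma finite_measure_sphere_measure: "finite_measure (sphere_measure :: 'a::euclidean_space measure)"
proof -
  have "emeasure lborel (cball 0 1 - {0::'a}) \<le> emeasure lborel (cball (0::'a) 1)"
    by (intro emeasure_mono) auto
  also have "\<dots> < \<infinity>" by (rule emeasure_lborel_cball_finite)
  finally have fin: "emeasure lborel (cball 0 1 - {0::'a}) < \<infinity>" .
  have "emeasure (sphere_measure :: 'a measure) (space sphere_measure) = (\<integral>\<^sup>+u. 1 \<partial>(sphere_measure :: 'a measure))" by simp
  also have "\<dots> \<noteq> \<infinity>"
    using fin by (subst nn_integral_sphere_measure)
      (simp_all add: ennreal_mult_eq_top_iff less_top[symmetric])
  finally show ?thesis by (rule finite_measureI)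
qed

text \<open>In the cone over the sphere put (y, z) = (r u, r tau). The ball restricts r to r <= b =
  (1 + tau^2)^(-1/2), the radial integral is b^(D+1) / (D+1), and passing from the slope tau to the
  height t gives the slicing formula.\<close>

lemma nn_integral_sphere_prod_real:
  fixes g :: "'a::euclidean_space \<times> real \<Rightarrow> ennreal"
  assumes g[measurable]: "g \<in> borel_measurable borel" and D2: "DIM('a) \<ge> 2"
  shows "(\<integral>\<^sup>+x. g x \<partial>sphere_measure) = (\<integral>\<^sup>+t. indicator {-1<..<1} t *
     ennreal (sqrt (1 - t\<^sup>2) ^ (DIM('a) - 2)) * (\<integral>\<^sup>+u. g (sqrt (1 - t\<^sup>2) *\<^sub>R u, t) \<partial>sphere_measure) \<partial>lborel)"
proof -
  define D where "D = DIM('a)"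
  have D: "D \<ge> 2" using D2 by (simp add: D_def)
  let ?S = "sphere_measure :: 'a measure"
  let ?ind = "\<lambda>r z::real. indicator {..1} (r\<^sup>2 + z\<^sup>2) :: ennreal"
  have gm[measurable]: "g \<in> borel_measurable (borel \<Otimes>\<^sub>M borel)" using g unfolding borel_prod .
  interpret finite_measure ?S by (rule finite_measure_sphere_measure)
  \<comment> \<open>The normalised point of (r u, z) depends on r and z only through the slope z /
    r.\<close>
  define G where "G = (\<lambda>\<tau>::real. \<integral>\<^sup>+u. g ((1 / sqrt (1 + \<tau>\<^sup>2)) *\<^sub>R (u, \<tau>)) \<partial>?S)"
  have [measurable]: "G \<in> borel_measurable borel"
  proof -
    have [measurable]: "snd \<in> borel \<Otimes>\<^sub>M ?S \<rightarrow>\<^sub>M borel"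
      by (rule measurable_compose[OF measurable_snd, of "\<lambda>u. u"]) (simp add: measurable_sphere_measure_borel)
    have "(\<lambda>p::real \<times> 'a. ((1 / sqrt (1 + (fst p)\<^sup>2)) *\<^sub>R snd p, (1 / sqrt (1 + (fst p)\<^sup>2)) * fst p))
        \<in> borel \<Otimes>\<^sub>M ?S \<rightarrow>\<^sub>M borel \<Otimes>\<^sub>M borel" by measurable
    from measurable_compose[OF this gm] show ?thesis
      unfolding G_def by (intro borel_measurable_nn_integral) (simp add: case_prod_beta)
  qed
  have "(\<integral>\<^sup>+x. g x \<partial>sphere_measure) = of_nat (Suc D) *
     (\<integral>\<^sup>+p. indicator (cball 0 1 - {0}) p * g (p /\<^sub>R norm p) \<partial>(lborel \<Otimes>\<^sub>M lborel))"
    by (subst nn_integral_sphere_measure) (simp_all add: D_def lborel_prod)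
  also have "(\<integral>\<^sup>+p. indicator (cball 0 1 - {0}) p * g (p /\<^sub>R norm p) \<partial>(lborel \<Otimes>\<^sub>M lborel)) =
      (\<integral>\<^sup>+z. (\<integral>\<^sup>+y. indicator (cball 0 1 - {0}) (y :: 'a, z) * g ((y, z) /\<^sub>R norm (y, z)) \<partial>lborel) \<partial>lborel)"
  proof (rule lborel_pair.nn_integral_snd[symmetric])
    have [measurable]: "cball 0 1 - {0} \<in> sets (borel :: ('a \<times> real) measure)" by simp
    have "(\<lambda>p::'a \<times> real. indicator (cball 0 1 - {0}) p * g (p /\<^sub>R norm p)) \<in> borel_measurable borel"
      by measurable
    then show "(\<lambda>p::'a \<times> real. indicator (cball 0 1 - {0}) p * g (p /\<^sub>R norm p))
      \<in> borel_measurable (lborel \<Otimes>\<^sub>M (lborel :: real measure))"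
      by (simp only: split_def prod.collapse lborel_prod measurable_lborel1 measurable_lborel2)
  qed
  also have "\<dots> = (\<integral>\<^sup>+z. (\<integral>\<^sup>+r. indicator {0<..} r * ennreal (r ^ (D - 1)) * (?ind r z * G (z / r)) \<partial>lborel) \<partial>lborel)"
  proof (rule nn_integral_cong)
    fix z :: real
    have [measurable]: "(\<lambda>y::'a. indicator (cball 0 1 - {0}) (y, z) * g ((y, z) /\<^sub>R norm (y, z))) \<in> borel_measurable borel"
    proof -
      have [measurable]: "cball 0 1 - {0} \<in> sets (borel :: ('a \<times> real) measure)" by simp
      have "(\<lambda>p::'a \<times> real. indicator (cball 0 1 - {0}) p * g (p /\<^sub>R norm p)) \<in> borel_measurable borel"
        by measurable
      moreover have "(\<lambda>y. (y, z)) \<in> (borel :: 'a measure) \<rightarrow>\<^sub>M borel"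
        unfolding borel_prod[symmetric] by measurable
      ultimately show ?thesis by (rule measurable_compose[rotated])
    qed
    show "(\<integral>\<^sup>+y. indicator (cball 0 1 - {0}) (y :: 'a, z) * g ((y, z) /\<^sub>R norm (y, z)) \<partial>lborel) =
      (\<integral>\<^sup>+r. indicator {0<..} r * ennreal (r ^ (D - 1)) * (?ind r z * G (z / r)) \<partial>lborel)"
    proof (subst nn_integral_polar, measurable, unfold D_def[symmetric], rule nn_integral_cong)
      fix r :: real
      show "indicator {0<..} r * ennreal (r ^ (D - 1)) *
         (\<integral>\<^sup>+u. indicator (cball 0 1 - {0}) (r *\<^sub>R u, z) * g ((r *\<^sub>R u, z) /\<^sub>R norm (r *\<^sub>R u, z)) \<partial>?S) =
        indicator {0<..} r * ennreal (r ^ (D - 1)) * (?ind r z * G (z / r))"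
      proof (cases "r > 0")
        case True
        have eq: "indicator (cball 0 1 - {0}) (r *\<^sub>R u, z) * g ((r *\<^sub>R u, z) /\<^sub>R norm (r *\<^sub>R u, z)) =
           ?ind r z * g ((1 / sqrt (1 + (z / r)\<^sup>2)) *\<^sub>R (u, z / r))" if u: "u \<in> space ?S" for u
        proof -
          have nu: "norm u = 1" using u by simp
          have nrm: "norm (r *\<^sub>R u, z) = sqrt (r\<^sup>2 + z\<^sup>2)" using nu True by (simp add: norm_Pair power_mult_distrib)
          have p: "r\<^sup>2 + z\<^sup>2 > 0" using True by (simp add: add_pos_nonneg)
          have "sqrt (1 + (z / r)\<^sup>2) = sqrt (r\<^sup>2 + z\<^sup>2) / r"
          proof -
            have "1 + (z / r)\<^sup>2 = (r\<^sup>2 + z\<^sup>2) / r\<^sup>2" using True by (simp add: field_simps power_divide)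
            then show ?thesis using True by (simp add: real_sqrt_divide)
          qed
          then have "1 / sqrt (1 + (z / r)\<^sup>2) = inverse (sqrt (r\<^sup>2 + z\<^sup>2)) * r" by (simp add: divide_inverse)
          then have 1: "(1 / sqrt (1 + (z / r)\<^sup>2)) *\<^sub>R (u, z / r) = (r *\<^sub>R u, z) /\<^sub>R norm (r *\<^sub>R u, z)"
            unfolding nrm using True by simp
          have 2: "indicator (cball 0 1 - {0}) (r *\<^sub>R u, z) = ?ind r z"
          proof -
            have "(r *\<^sub>R u, z) \<noteq> 0" using True nu by (auto simp: zero_prod_def)
            moreover have "norm (r *\<^sub>R u, z) \<le> 1 \<longleftrightarrow> r\<^sup>2 + z\<^sup>2 \<le> 1" unfolding nrm by simp
            ultimately show ?thesis by (simp add: indicator_def)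
          qed
          show ?thesis unfolding 1 2 ..
        qed
        have "(\<integral>\<^sup>+u. indicator (cball 0 1 - {0}) (r *\<^sub>R u, z) * g ((r *\<^sub>R u, z) /\<^sub>R norm (r *\<^sub>R u, z)) \<partial>?S) =
          (\<integral>\<^sup>+u. ?ind r z * g ((1 / sqrt (1 + (z / r)\<^sup>2)) *\<^sub>R (u, z / r)) \<partial>?S)"
          by (rule nn_integral_cong) (rule eq)
        also have "\<dots> = ?ind r z * G (z / r)" unfolding G_def
            by (rule nn_integral_cmult) (rule measurable_sphere_measure_borel, measurable)
        finally show ?thesis by (simp only:)
      qed simp
    qed
  qed
  also have "\<dots> = (\<integral>\<^sup>+r. (\<integral>\<^sup>+z. indicator {0<..} r * ennreal (r ^ (D - 1)) * (?ind r z * G (z / r)) \<partial>lborel) \<partial>lborel)"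
    by (rule lborel_pair.Fubini') measurable
  also have "\<dots> = (\<integral>\<^sup>+r. (\<integral>\<^sup>+\<tau>. indicator {0<..} r * ennreal (r ^ D) * (?ind r (r * \<tau>) * G \<tau>) \<partial>lborel) \<partial>lborel)"
  proof (rule nn_integral_cong)
    fix r :: real
    show "(\<integral>\<^sup>+z. indicator {0<..} r * ennreal (r ^ (D - 1)) * (?ind r z * G (z / r)) \<partial>lborel) =
      (\<integral>\<^sup>+\<tau>. indicator {0<..} r * ennreal (r ^ D) * (?ind r (r * \<tau>) * G \<tau>) \<partial>lborel)"
    proof (cases "r > 0")
      case True
      have rD: "ennreal (r ^ D) = ennreal r * ennreal (r ^ (D - 1))"
        using D True by (cases D) (auto simp: ennreal_mult)
      show ?thesis
        using True
        by (subst nn_integral_real_affine[where c = r and t = 0], measurable, simp,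
            subst nn_integral_cmult[symmetric], measurable, intro nn_integral_cong)
          (simp add: rD mult_ac)
    qed simp
  qed
  also have "\<dots> = (\<integral>\<^sup>+\<tau>. (\<integral>\<^sup>+r. indicator {0<..} r * ennreal (r ^ D) * (?ind r (r * \<tau>) * G \<tau>) \<partial>lborel) \<partial>lborel)"
    by (rule lborel_pair.Fubini') measurable
  also have "\<dots> = (\<integral>\<^sup>+\<tau>. ennreal ((1 / sqrt (1 + \<tau>\<^sup>2)) ^ Suc D / Suc D) * G \<tau> \<partial>lborel)"
  proof (rule nn_integral_cong)
    fix \<tau> :: real
    define b where "b = 1 / sqrt (1 + \<tau>\<^sup>2)"
    have p: "1 + \<tau>\<^sup>2 > 0" by (simp add: add_pos_nonneg)
    then have b: "b > 0" by (simp add: b_def)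
    have iff: "r\<^sup>2 + (r * \<tau>)\<^sup>2 \<le> 1 \<longleftrightarrow> r \<le> b" if "r > 0" for r
    proof -
      have "r\<^sup>2 + (r * \<tau>)\<^sup>2 = (r * sqrt (1 + \<tau>\<^sup>2))\<^sup>2" using p by (simp add: power_mult_distrib algebra_simps)
      also have "\<dots> \<le> 1 \<longleftrightarrow> r * sqrt (1 + \<tau>\<^sup>2) \<le> 1"
        using that p by (subst abs_square_le_1) (simp add: abs_mult)
      also have "\<dots> \<longleftrightarrow> r \<le> b" using p by (simp add: b_def field_simps)
      finally show ?thesis .
    qed
    have "(\<integral>\<^sup>+r. indicator {0<..} r * ennreal (r ^ D) * (?ind r (r * \<tau>) * G \<tau>) \<partial>lborel) =
      (\<integral>\<^sup>+r. (ennreal (r ^ D) * indicator {0..b} r) * G \<tau> \<partial>lborel)"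
    proof (rule nn_integral_cong)
      fix r :: real
      show "indicator {0<..} r * ennreal (r ^ D) * (?ind r (r * \<tau>) * G \<tau>) = (ennreal (r ^ D) * indicator {0..b} r) * G \<tau>"
      proof (cases "r > 0")
        case True
        then show ?thesis using iff[OF True] by (simp add: indicator_def mult_ac)
      next
        case False
        then show ?thesis using D by (cases "r = 0") (auto simp: indicator_def)
      qed
    qed
    also have "\<dots> = ennreal (b ^ Suc D / Suc D) * G \<tau>"
      using b by (subst nn_integral_multc, measurable, subst nn_integral_power_initial) auto
    finally show "(\<integral>\<^sup>+r. indicator {0<..} r * ennreal (r ^ D) * (?ind r (r * \<tau>) * G \<tau>) \<partial>lborel) =
       ennreal (b ^ Suc D / Suc D) * G \<tau>" .
  qed
  \<comment> \<open>D + 1 is the dimension of the product space; as the factor of its cone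
    construction it cancels the denominator of the radial integral.\<close>
  also have "of_nat (Suc D) * \<dots> = (\<integral>\<^sup>+\<tau>. ennreal ((1 / sqrt (1 + \<tau>\<^sup>2)) ^ Suc D) * G \<tau> \<partial>lborel)"
    by (subst nn_integral_cmult[symmetric], measurable, intro nn_integral_cong)
       (simp add: mult.assoc[symmetric] ennreal_of_nat_eq_real_of_nat ennreal_mult[symmetric] del: of_nat_Suc power_Suc)
  also have "\<dots> = (\<integral>\<^sup>+t. indicator {-1<..<1} t * ennreal (inverse (sqrt (1 - t\<^sup>2) ^ 3)) *
      (ennreal ((1 / sqrt (1 + (t / sqrt (1 - t\<^sup>2))\<^sup>2)) ^ Suc D) * G (t / sqrt (1 - t\<^sup>2))) \<partial>lborel)"
    by (subst lborel_eq_distr_open_interval) (simp add: nn_integral_distr nn_integral_density del: power_Suc)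
  also have "\<dots> = (\<integral>\<^sup>+t. indicator {-1<..<1} t * ennreal (sqrt (1 - t\<^sup>2) ^ (D - 2)) *
     (\<integral>\<^sup>+u. g (sqrt (1 - t\<^sup>2) *\<^sub>R u, t) \<partial>?S) \<partial>lborel)"
  proof (rule nn_integral_cong)
    fix t :: real
    show "indicator {-1<..<1} t * ennreal (inverse (sqrt (1 - t\<^sup>2) ^ 3)) *
      (ennreal ((1 / sqrt (1 + (t / sqrt (1 - t\<^sup>2))\<^sup>2)) ^ Suc D) * G (t / sqrt (1 - t\<^sup>2))) =
      indicator {-1<..<1} t * ennreal (sqrt (1 - t\<^sup>2) ^ (D - 2)) * (\<integral>\<^sup>+u. g (sqrt (1 - t\<^sup>2) *\<^sub>R u, t) \<partial>?S)"
    proof (cases "t \<in> {-1<..<1}")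
      case True
      then have p: "1 - t\<^sup>2 > 0" by (simp add: abs_square_less_1 abs_less_iff)
      define r where "r = sqrt (1 - t\<^sup>2)"
      have r: "r > 0" "r ^ 2 = 1 - t\<^sup>2" using p by (auto simp: r_def)
      have "1 + (t / r)\<^sup>2 = inverse (r\<^sup>2)" using r by (simp add: power_divide field_simps)
      then have 1: "1 / sqrt (1 + (t / r)\<^sup>2) = r" using r(1) by (simp only: real_sqrt_inverse real_sqrt_abs abs_of_pos inverse_eq_divide) (simp add: real_sqrt_divide)
      \<comment> \<open>The radial integral gives r^(D+1) and the substitution r^(-3), which leaves
        r^(D-2); D >= 2 keeps the natural subtraction honest.\<close>
      have 2: "r ^ Suc D = r ^ 3 * r ^ (D - 2)" using D by (simp add: power_add[symmetric] del: power_Suc)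
      have 3: "G (t / r) = (\<integral>\<^sup>+u. g (r *\<^sub>R u, t) \<partial>?S)" unfolding G_def 1 using r by simp
      have "ennreal (inverse (r ^ 3)) * ennreal (r ^ Suc D) = ennreal (r ^ (D - 2))"
        using r by (simp add: 2 ennreal_mult[symmetric] del: power_Suc)
      then have "ennreal (inverse (r ^ 3)) * (ennreal (r ^ Suc D) * I) = ennreal (r ^ (D - 2)) * I" for I
        by (simp only: mult.assoc[symmetric])
      then show ?thesis unfolding r_def[symmetric] 1 3 by (simp only: mult.assoc)
    qed simp
  qed
  finally show ?thesis unfolding D_def .
qed

text \<open>The orthogonal reflection exchanging (\<theta>, 0) and (0, 1) carries the horizontal slice of height t
  to the slice of points with first component at height t in direction \<theta>.\<close>

definition slice_chart :: "'a::euclidean_space \<Rightarrow> real \<Rightarrow> 'a \<Rightarrow> 'a \<times> real" where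
  "slice_chart \<theta> t v = (t *\<^sub>R \<theta> + sqrt (1 - t\<^sup>2) *\<^sub>R (v - (v \<bullet> \<theta>) *\<^sub>R \<theta>), sqrt (1 - t\<^sup>2) * (v \<bullet> \<theta>))"

lemma nn_integral_sphere_slices:
  fixes g :: "'a::euclidean_space \<times> real \<Rightarrow> ennreal"
  assumes g[measurable]: "g \<in> borel_measurable borel" and D2: "DIM('a) \<ge> 2" and th: "norm \<theta> = 1"
  shows "(\<integral>\<^sup>+x. g x \<partial>sphere_measure) = (\<integral>\<^sup>+t. indicator {-1<..<1} t *
     ennreal (sqrt (1 - t\<^sup>2) ^ (DIM('a) - 2)) * (\<integral>\<^sup>+v. g (slice_chart \<theta> t v) \<partial>sphere_measure) \<partial>lborel)"
proof -
  \<comment> \<open>Since \<open>w\<close> has squared length 2,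
    \<open>x - (x \<bullet> w) *\<^sub>R w\<close> is already the full reflection, the one
    exchanging (\<theta>, 0) and (0, 1).\<close>
  define w where "w = (\<theta>, -1 :: real)"
  define R where "R = (\<lambda>x. x - (x \<bullet> w) *\<^sub>R w)"
  have tt: "\<theta> \<bullet> \<theta> = 1" using th by (simp add: norm_eq_1)
  have ww: "w \<bullet> w = 2" by (simp add: w_def inner_Pair tt)
  have lin: "linear R"
    by (rule linearI) (simp_all add: R_def inner_add_left scaleR_add_left algebra_simps)
  have nrm: "norm (R x) = norm x" for x
  proof -
    have "R x \<bullet> R x = x \<bullet> x" by (simp add: R_def inner_diff inner_commute ww algebra_simps)
    then show ?thesis by (simp add: norm_eq_sqrt_inner)
  qed
  have [measurable]: "R \<in> borel_measurable borel"
    using lin by (rule borel_measurable_linear)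
  have RU: "R (sqrt (1 - t\<^sup>2) *\<^sub>R u, t) = slice_chart \<theta> t u" for t u
    by (simp add: R_def w_def slice_chart_def inner_Pair algebra_simps)
  have "(\<integral>\<^sup>+x. g x \<partial>sphere_measure) = (\<integral>\<^sup>+x. g (R x) \<partial>sphere_measure)"
    by (rule nn_integral_sphere_isometry[OF lin nrm, symmetric]) measurable
  also have "\<dots> = (\<integral>\<^sup>+t. indicator {-1<..<1} t * ennreal (sqrt (1 - t\<^sup>2) ^ (DIM('a) - 2)) *
      (\<integral>\<^sup>+u. g (R (sqrt (1 - t\<^sup>2) *\<^sub>R u, t)) \<partial>sphere_measure) \<partial>lborel)"
    by (rule nn_integral_sphere_prod_real[OF _ D2]) measurable
  finally show ?thesis unfolding RU .
qed

section \<open>The slice measure through an explicit chart\<close>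

text \<open>Two isometries with the same range satisfy L = L' o Q, where Q is the adjoint of L'
  after L and is itself an isometry of the source; the surface measure does not see Q.\<close>

lemma distr_sphere_isometry:
  fixes L L' :: "'a::euclidean_space \<Rightarrow> 'b::euclidean_space"
  assumes L: "linear L" "\<And>v. norm (L v) = norm v" and L': "linear L'" "\<And>v. norm (L' v) = norm v"
    and range: "range L = range L'"
  shows "distr sphere_measure borel L = distr sphere_measure borel L'"
proof -
  have meas[measurable]: "L \<in> borel_measurable borel" "L' \<in> borel_measurable borel"
    using L(1) L'(1) by (auto intro: borel_measurable_linear)
  define Q where "Q = (\<lambda>v. adjoint L' (L v))"
  have inn: "L' x \<bullet> L' y = x \<bullet> y" for x y
    by (simp add: dot_norm linear_add[OF L'(1), symmetric] L'(2))
  have adj: "adjoint L' (L' x) = x" for x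
  proof -
    have "y \<bullet> adjoint L' (L' x) = y \<bullet> x" for y by (simp add: adjoint_works[OF L'(1)] inn)
    then show ?thesis by (metis vector_eq_rdot inner_commute)
  qed
  have LQ: "L' (Q v) = L v" for v
  proof -
    have "L v \<in> range L'" using range by auto
    then obtain x where "L v = L' x" by auto
    then show ?thesis by (simp add: Q_def adj)
  qed
  have linQ: "linear Q" unfolding Q_def
    using linear_compose[OF L(1) adjoint_linear[OF L'(1)]] by (simp add: o_def)
  have nQ: "norm (Q v) = norm v" for v using L'(2)[of "Q v"] L(2)[of v] LQ[of v] by simp
  show ?thesis
  proof (rule measure_eqI)
    fix A assume "A \<in> sets (distr (sphere_measure :: 'a measure) borel L)"
    then have A[measurable]: "A \<in> sets borel" by simp
    have *: "emeasure (distr sphere_measure borel K) A = (\<integral>\<^sup>+v. indicator A (K v) \<partial>(sphere_measure :: 'a measure))"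
      if [measurable]: "K \<in> borel_measurable borel" for K :: "'a \<Rightarrow> 'b"
    proof -
      have "emeasure (distr sphere_measure borel K) A = (\<integral>\<^sup>+x. indicator A x \<partial>distr (sphere_measure :: 'a measure) borel K)" by simp
      also have "\<dots> = (\<integral>\<^sup>+v. indicator A (K v) \<partial>(sphere_measure :: 'a measure))" by (rule nn_integral_distr) (auto intro: measurable_sphere_measure_borel)
      finally show ?thesis .
    qed
    have "(\<integral>\<^sup>+v. indicator A (L' (Q v)) \<partial>(sphere_measure :: 'a measure)) = (\<integral>\<^sup>+v. indicator A (L' v) \<partial>sphere_measure)"
      by (rule nn_integral_sphere_isometry[OF linQ nQ]) measurable
    then show "emeasure (distr sphere_measure borel L) A = emeasure (distr (sphere_measure :: 'a measure) borel L') A"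
      by (simp add: * LQ)
  qed simp
qed

text \<open>Trades the arbitrary choice inside \<open>iso_onto\<close> for a concrete map:
  \<open>L'\<close> is the reflection behind \<open>slice_chart\<close>, restricted to vectors with
  last coordinate 0.\<close>

lemma iso_onto_perp_space:
  fixes \<theta> :: "real^'n"
  assumes th: "norm \<theta> = 1"
  defines "L' \<equiv> \<lambda>v. (v - (v \<bullet> \<theta>) *\<^sub>R \<theta>, v \<bullet> \<theta>)"
  shows "linear (iso_onto (perp_space \<theta>))" "norm (iso_onto (perp_space \<theta>) v) = norm v"
    "distr sphere_measure borel (iso_onto (perp_space \<theta>)) = distr sphere_measure borel L'"
proof -
  have tt: "\<theta> \<bullet> \<theta> = 1" using th by (simp add: norm_eq_1)
  have lin: "linear L'"
    by (rule linearI) (simp_all add: L'_def inner_add_left algebra_simps)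
  have nrm: "norm (L' v) = norm v" for v
  proof -
    have "L' v \<bullet> L' v = v \<bullet> v" by (simp add: L'_def inner_Pair inner_diff inner_commute tt algebra_simps)
    then show ?thesis by (simp add: norm_eq_sqrt_inner)
  qed
  have ran: "range L' = perp_space \<theta>"
  proof (intro equalityI subsetI)
    fix x assume "x \<in> perp_space \<theta>"
    then have "fst x \<bullet> \<theta> = 0" by (simp add: perp_space_def)
    then have "x = L' (fst x + snd x *\<^sub>R \<theta>)"
      by (simp add: L'_def inner_add_left tt prod_eq_iff)
    then show "x \<in> range L'" by blast
  qed (auto simp: L'_def perp_space_def inner_diff_left tt)
  let ?L = "iso_onto (perp_space \<theta>)"
  have "linear ?L \<and> (\<forall>v. norm (?L v) = norm v) \<and> range ?L = perp_space \<theta>"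
    unfolding iso_onto_def by (rule someI[of _ L']) (use lin nrm ran in blast)
  then show "linear ?L" "norm (?L v) = norm v" "distr sphere_measure borel ?L = distr sphere_measure borel L'"
    using distr_sphere_isometry[of ?L L'] lin nrm ran by auto
qed

text \<open>The slice is a unit sphere of R^n scaled by r = sqrt (1 - t^2), hence the Jacobian
  r^(n-1). Measurability is asked only of the extension of f by zero, because values off the half
  sphere never enter.\<close>

lemma V_plus_eq_slice_chart:
  fixes f :: "(real^'n) \<times> real \<Rightarrow> real"
  assumes f[measurable]: "(\<lambda>x. indicator Splus x * f x) \<in> borel_measurable borel"
    and th: "norm \<theta> = 1" and t: "\<bar>t\<bar> \<le> 1"
  shows "V_plus f \<theta> t = sqrt (1 - t\<^sup>2) ^ (CARD('n) - 1) *
    (\<integral>v. indicator Splus (slice_chart \<theta> t v) * f (slice_chart \<theta> t v) \<partial>sphere_measure)"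
proof -
  define r where "r = sqrt (1 - t\<^sup>2)"
  have r0: "r \<ge> 0" using t by (simp add: r_def abs_square_le_1)
  let ?L = "iso_onto (perp_space \<theta>)"
  let ?S = "sphere_measure :: (real^'n) measure"
  define L' where "L' = (\<lambda>v. (v - (v \<bullet> \<theta>) *\<^sub>R \<theta>, v \<bullet> \<theta>))"
  have [measurable]: "?L \<in> borel_measurable borel"
    using iso_onto_perp_space(1)[OF th] by (rule borel_measurable_linear)
  have [measurable]: "L' \<in> borel_measurable borel"
    unfolding L'_def by (intro borel_measurable_continuous_onI continuous_intros)
  let ?h = "\<lambda>x. indicator Splus x * f x"
  define k where "k = (\<lambda>y. ?h ((t *\<^sub>R \<theta>, 0) + r *\<^sub>R y))"
  have [measurable]: "k \<in> borel_measurable borel" unfolding k_def by measurable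
  have "V_plus f \<theta> t = (\<integral>x. ?h x \<partial>distr (scale_measure (ennreal (r ^ (CARD('n) - 1))) ?S)
            borel (\<lambda>v. (t *\<^sub>R \<theta>, 0) + r *\<^sub>R ?L v))"
    unfolding V_plus_def slice_measure_def Let_def r_def set_lebesgue_integral_def by simp
  also have "\<dots> = (\<integral>v. k (?L v) \<partial>scale_measure (ennreal (r ^ (CARD('n) - 1))) ?S)"
  proof -
    have "(\<lambda>v. (t *\<^sub>R \<theta>, 0) + r *\<^sub>R ?L v) \<in> ?S \<rightarrow>\<^sub>M borel"
      by (rule measurable_sphere_measure_borel) measurable
    then show ?thesis unfolding k_def by (intro integral_distr) simp_all
  qed
  also have "\<dots> = r ^ (CARD('n) - 1) * (\<integral>v. k (?L v) \<partial>?S)"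
    unfolding scale_measure_eq_density using r0
    by (subst integral_density) (auto simp: measurable_sphere_measure_borel)
  also have "(\<integral>v. k (?L v) \<partial>?S) = (\<integral>y. k y \<partial>distr ?S borel ?L)"
    by (rule integral_distr[symmetric]) (simp_all add: measurable_sphere_measure_borel)
  also have "\<dots> = (\<integral>y. k y \<partial>distr ?S borel L')" unfolding iso_onto_perp_space(3)[OF th] L'_def ..
  also have "\<dots> = (\<integral>v. k (L' v) \<partial>?S)"
    by (rule integral_distr) (simp_all add: measurable_sphere_measure_borel)
  also have "(\<lambda>v. k (L' v)) = (\<lambda>v. ?h (slice_chart \<theta> t v))"
    by (simp add: fun_eq_iff k_def L'_def slice_chart_def r_def)
  finally show ?thesis unfolding r_def .
qed

section \<open>Beta integrals, Gegenbauer and Jacobi polynomials\<close>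

lemma pos_not_nonpos_Int: "x > 0 \<Longrightarrow> (x :: real) \<notin> \<int>\<^sub>\<le>\<^sub>0"
  by (auto elim!: nonpos_Ints_cases)

lemma Gamma_duplication_real:
  assumes "x > (0::real)"
  shows "Gamma x * Gamma (x + 1/2) = 2 powr (1 - 2*x) * sqrt pi * Gamma (2*x)"
proof -
  have "complex_of_real x \<notin> \<int>\<^sub>\<le>\<^sub>0" "complex_of_real x + 1/2 \<notin> \<int>\<^sub>\<le>\<^sub>0"
    using assms by (auto elim!: nonpos_Ints_cases simp: complex_eq_iff)
  from Gamma_legendre_duplication[OF this]
  have "complex_of_real (Gamma x * Gamma (x + 1/2)) = complex_of_real (exp ((1 - 2*x) * ln 2) * sqrt pi * Gamma (2*x))"
    using assms by (simp add: Gamma_complex_of_real[symmetric] exp_of_real[symmetric])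
  then show ?thesis by (simp only: of_real_eq_iff powr_def) simp
qed

text \<open>Euler's Beta integral after the substitution x = t^2. Squares appear because the radial
  functions depend on the height t through 1 - t^2 and powers of t.\<close>

lemma Beta_integral_squares:
  fixes a b :: real
  assumes a: "a > -1" and b: "b > -1"
  shows "has_bochner_integral lborel
    (\<lambda>t. indicator {0<..<1} t * (t powr (2*a + 1) * (1 - t\<^sup>2) powr b)) (Beta (a+1) (b+1) / 2)"
proof (rule has_bochner_integral_nn_integral)
  have "((\<lambda>t. t powr a * (1 - t) powr b) has_integral Beta (a+1) (b+1)) {0..1}"
    using has_integral_Beta_real[of "a+1" "b+1"] a b by simp
  from nn_integral_has_integral_lebesgue[OF _ this]
  have "ennreal (Beta (a+1) (b+1)) = (\<integral>\<^sup>+t. ennreal (t powr a * (1 - t) powr b * indicator {0^2..1^2} t) \<partial>lborel)"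
    by (simp add: mult_ac ennreal_mult' ennreal_indicator)
  also have "\<dots> = (\<integral>\<^sup>+x. ennreal ((x\<^sup>2) powr a * (1 - x\<^sup>2) powr b * (2 * x) * indicator {0..1} x) \<partial>lborel)"
    by (subst nn_integral_substitution[where g = "\<lambda>x. x ^ 2" and g' = "\<lambda>x. 2 * x"])
       (auto intro!: derivative_eq_intros continuous_intros simp: set_borel_measurable_def)
  also have "\<dots> = (\<integral>\<^sup>+t. ennreal 2 * ennreal (indicator {0<..<1} t * (t powr (2*a + 1) * (1 - t\<^sup>2) powr b)) \<partial>lborel)"
  proof (rule nn_integral_cong_AE)
    show "AE x in lborel. ennreal ((x\<^sup>2) powr a * (1 - x\<^sup>2) powr b * (2 * x) * indicator {0..1} x) =
      ennreal 2 * ennreal (indicator {0<..<1} x * (x powr (2*a + 1) * (1 - x\<^sup>2) powr b))"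
      using AE_lborel_singleton[of "0::real"] AE_lborel_singleton[of "1::real"]
    proof eventually_elim
      case (elim x)
      show ?case
      proof (cases "x \<in> {0<..<1}")
        case True
        then have "(x\<^sup>2) powr a * x = x powr (2*a+1)"
          by (simp add: powr_add powr_powr[symmetric] powr_numeral)
        then have "(x\<^sup>2) powr a * (1 - x\<^sup>2) powr b * (2 * x) = 2 * (x powr (2*a + 1) * (1 - x\<^sup>2) powr b)"
          by (simp add: mult_ac)
        moreover have "indicator {0..1} x = (1::real)" "indicator {0<..<1} x = (1::real)" using True by auto
        ultimately show ?thesis by (simp only: mult_1 mult_1_right) (rule ennreal_mult, auto)
      next
        case False
        then show ?thesis using elim by (auto simp: indicator_def)
      qed
    qed
  qed
  also have "\<dots> = ennreal 2 * (\<integral>\<^sup>+t. ennreal (indicator {0<..<1} t * (t powr (2*a + 1) * (1 - t\<^sup>2) powr b)) \<partial>lborel)"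
    by (rule nn_integral_cmult) measurable
  finally have *: "ennreal (Beta (a+1) (b+1)) = ennreal 2 *
     (\<integral>\<^sup>+t. ennreal (indicator {0<..<1} t * (t powr (2*a + 1) * (1 - t\<^sup>2) powr b)) \<partial>lborel)" .
  have Bpos: "Beta (a+1) (b+1) > 0" using a b by (simp add: Beta_def)
  have "ennreal (1/2) * ennreal (Beta (a+1) (b+1)) =
     (\<integral>\<^sup>+t. ennreal (indicator {0<..<1} t * (t powr (2*a + 1) * (1 - t\<^sup>2) powr b)) \<partial>lborel)"
  proof -
    have "ennreal (1/2) * ennreal 2 = ennreal (1/2 * 2)" by (rule ennreal_mult[symmetric]) auto
    then have "ennreal (1/2) * ennreal 2 = 1" by simp
    then show ?thesis by (simp only: * mult.assoc[symmetric] mult_1)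
  qed
  then show "(\<integral>\<^sup>+t. ennreal (indicator {0<..<1} t * (t powr (2*a + 1) * (1 - t\<^sup>2) powr b)) \<partial>lborel) =
     ennreal (Beta (a+1) (b+1) / 2)"
    using Bpos ennreal_mult[of "1/2" "Beta (a+1) (b+1)"] by simp
  show "0 \<le> Beta (a+1) (b+1) / 2" using Bpos by simp
  show "AE t in lborel. 0 \<le> indicator {0<..<1} t * (t powr (2*a + 1) * (1 - t\<^sup>2) powr b)" by simp
qed measurable

section \<open>Jacobi polynomials: moments and orthogonality\<close>

text \<open>Pascal's rule: a forward difference of order k + 1 is the difference of order k of the
  first differences.\<close>

lemma finite_difference_sum:
  fixes h :: "nat \<Rightarrow> real"
  shows "(\<Sum>p\<le>Suc k. (-1)^(Suc k - p) * real (Suc k choose p) * h p) =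
    (\<Sum>p\<le>k. (-1)^(k - p) * real (k choose p) * (h (Suc p) - h p))"
proof -
  have "(\<Sum>p\<le>Suc k. (-1)^(Suc k - p) * real (Suc k choose p) * h p) =
     (-1)^Suc k * h 0 + (\<Sum>p\<le>k. (-1)^(k - p) * real (k choose p) * h (Suc p)) +
     (\<Sum>p\<le>k. (-1)^(k - p) * real (k choose Suc p) * h (Suc p))"
    by (subst sum.atMost_Suc_shift) (simp add: algebra_simps sum.distrib)
  also have "(\<Sum>p\<le>k. (-1)^(k - p) * real (k choose Suc p) * h (Suc p)) =
      (\<Sum>p<k. (-1)^(k - p) * real (k choose Suc p) * h (Suc p))"
    by (intro sum.mono_neutral_right) auto
  also have "\<dots> = - (\<Sum>p<k. (-1)^(k - Suc p) * real (k choose Suc p) * h (Suc p))"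
    unfolding sum_negf[symmetric]
  proof (rule sum.cong)
    fix p assume "p \<in> {..<k}"
    then have "k - p = Suc (k - Suc p)" by auto
    then show "(-1)^(k - p) * real (k choose Suc p) * h (Suc p) = - ((-1)^(k - Suc p) * real (k choose Suc p) * h (Suc p))"
      by simp
  qed simp
  also have "(-1)^Suc k * h 0 + A + - (\<Sum>p<k. (-1)^(k - Suc p) * real (k choose Suc p) * h (Suc p)) =
      A - (\<Sum>p\<le>k. (-1)^(k - p) * real (k choose p) * h p)" for A
    by (cases k) (simp_all add: sum.atMost_Suc_shift lessThan_Suc_atMost algebra_simps del: sum.atMost_Suc sum.lessThan_Suc)
  finally show ?thesis by (simp add: algebra_simps sum_subtractf)
qed

text \<open>Rising factorials behave under differences like powers under derivatives: one difference
  in p lowers the length i by one and brings down the factor i. The binomial coefficient makes the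
  value vanish for i < k, which is the source of orthogonality.\<close>

lemma finite_difference_pochhammer:
  fixes x :: real
  shows "(\<Sum>p\<le>k. (-1)^(k - p) * real (k choose p) * pochhammer (x + real p) i) =
    fact k * real (i choose k) * pochhammer (x + real k) (i - k)"
proof (induction k arbitrary: x i)
  case (Suc k)
  show ?case
  proof (cases i)
    case 0
    then show ?thesis unfolding finite_difference_sum by simp
  next
    case (Suc i')
    have d: "pochhammer (x + real (Suc p)) i - pochhammer (x + real p) i = real i * pochhammer (x + 1 + real p) i'" for p
    proof -
      have "pochhammer (x + real p) i = (x + real p) * pochhammer (x + 1 + real p) i'"
        by (simp add: Suc pochhammer_rec add_ac)
      moreover have "pochhammer (x + real (Suc p)) i = (x + 1 + real p + real i') * pochhammer (x + 1 + real p) i'"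
        by (simp add: Suc pochhammer_rec' add_ac)
      ultimately show ?thesis by (simp add: Suc algebra_simps)
    qed
    have "(\<Sum>p\<le>Suc k. (-1)^(Suc k - p) * real (Suc k choose p) * pochhammer (x + real p) i) =
      real i * (\<Sum>p\<le>k. (-1)^(k - p) * real (k choose p) * pochhammer (x + 1 + real p) i')"
      unfolding finite_difference_sum d sum_distrib_left by (intro sum.cong) simp_all
    also have "\<dots> = real i * (fact k * real (i' choose k) * pochhammer (x + 1 + real k) (i' - k))"
      by (simp only: Suc.IH)
    also have "real i * real (i' choose k) = real (Suc k) * real (i choose Suc k)"
      unfolding Suc of_nat_mult[symmetric] by (simp only: Suc_times_binomial_eq mult.commute)
    then have "real i * (fact k * real (i' choose k) * Z) = fact k * (real (Suc k) * real (i choose Suc k)) * Z" for Z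
      by (metis mult.assoc mult.left_commute)
    also have "fact k * (real (Suc k) * real (i choose Suc k)) = fact (Suc k) * real (i choose Suc k)"
      by (simp del: of_nat_Suc binomial_Suc_Suc)
    also have "pochhammer (x + 1 + real k) (i' - k) = pochhammer (x + real (Suc k)) (i - Suc k)"
      by (simp add: Suc add_ac)
    finally show ?thesis .
  qed
qed simp

lemma gbinomial_Gamma_real:
  assumes "x - real k + 1 > 0"
  shows "x gchoose k = Gamma (x + 1) / (fact k * Gamma (x - real k + 1))"
proof -
  have "x - real k + 1 \<notin> \<int>\<^sub>\<le>\<^sub>0" using assms by (auto elim!: nonpos_Ints_cases)
  then show ?thesis unfolding gbinomial_pochhammer' by (simp add: pochhammer_Gamma add_ac)
qed

text \<open>Every summand of the polynomial integrates to a Beta value whose Gamma factors cancel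
  against the generalised binomials. What is left is a k-th difference of rising factorials, and it
  replaces Rodrigues' formula.\<close>

lemma jacobiP_integral:
  fixes a b :: real
  assumes a: "a > -1" and b: "b > -1"
  shows "has_bochner_integral lborel
    (\<lambda>t. indicator {0<..<1} t * (t powr (2*a + 1) * (1 - t\<^sup>2) powr (b + real i) * jacobiP k a b (2 * (1 - t\<^sup>2) - 1)))
    (real (i choose k) * Gamma (a + real k + 1) * Gamma (b + real i + 1) / (2 * Gamma (a + b + real k + real i + 2)))"
proof -
  \<comment> \<open>At the argument 2 (1 - t^2) - 1 the two bases of the polynomial are -t^2 and 1 -
    t^2; the sign of the first is absorbed here.\<close>
  define c where "c = (\<lambda>q. ((real k + a) gchoose (k - q)) * ((real k + b) gchoose q) * (-1)^q)"
  have 1: "has_bochner_integral lborel (\<lambda>t. \<Sum>q\<le>k. c q *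
       (indicator {0<..<1} t * (t powr (2*(a + real q) + 1) * (1 - t\<^sup>2) powr (b + real i + real (k - q)))))
     (\<Sum>q\<le>k. c q * (Beta (a + real q + 1) (b + real i + real (k - q) + 1) / 2))"
    using a b by (intro has_bochner_integral_sum has_bochner_integral_mult_right Beta_integral_squares) auto
  have 2: "(\<Sum>q\<le>k. c q * (indicator {0<..<1} t * (t powr (2*(a + real q) + 1) * (1 - t\<^sup>2) powr (b + real i + real (k - q))))) =
    indicator {0<..<1} t * (t powr (2*a + 1) * (1 - t\<^sup>2) powr (b + real i) * jacobiP k a b (2 * (1 - t\<^sup>2) - 1))" for t
  proof (cases "t \<in> {0<..<1}")
    case True
    then have t: "t > 0" "1 - t\<^sup>2 > 0" by (auto simp: power_less_one_iff)
    have tq: "c q * (t powr (2*(a + real q) + 1) * (1 - t\<^sup>2) powr (b + real i + real (k - q))) =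
      t powr (2*a + 1) * (1 - t\<^sup>2) powr (b + real i) * (((real k + a) gchoose (k - q)) * ((real k + b) gchoose q)
        * ((2 * (1 - t\<^sup>2) - 1 - 1) / 2) ^ q * ((2 * (1 - t\<^sup>2) - 1 + 1) / 2) ^ (k - q))" for q
    proof -
      have "t powr (2*(a + real q) + 1) = t powr (2*a+1) * t powr (real (2*q))"
        by (simp add: powr_add[symmetric] algebra_simps)
      also have "t powr (real (2*q)) = (t\<^sup>2)^q" using t by (subst powr_realpow) (auto simp: power_mult)
      finally have e1: "t powr (2*(a + real q) + 1) = t powr (2*a+1) * (t\<^sup>2)^q" .
      have e2: "(1 - t\<^sup>2) powr (b + real i + real (k - q)) = (1 - t\<^sup>2) powr (b + real i) * (1 - t\<^sup>2) ^ (k - q)"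
        using t by (simp add: powr_add powr_realpow)
      have e3: "((2 * (1 - t\<^sup>2) - 1 - 1) / 2) ^ q = (-1)^q * (t\<^sup>2)^q"
        by (simp add: power_mult_distrib[symmetric])
      have e4: "(2 * (1 - t\<^sup>2) - 1 + 1) / 2 = 1 - t\<^sup>2" by simp
      show ?thesis unfolding e1 e2 e3 e4 c_def by (simp only: mult_ac)
    qed
    show ?thesis by (simp only: indicator_simps(1)[OF True] mult_1 tq jacobiP_def sum_distrib_left)
  qed simp
  have 3: "(\<Sum>q\<le>k. c q * (Beta (a + real q + 1) (b + real i + real (k - q) + 1) / 2)) =
    real (i choose k) * Gamma (a + real k + 1) * Gamma (b + real i + 1) / (2 * Gamma (a + b + real k + real i + 2))"
  proof -
    define D where "D = Gamma (a + real k + 1) * Gamma (b + real k + 1) / (2 * fact k * Gamma (a + b + real k + real i + 2))"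
    have summand: "c q * (Beta (a + real q + 1) (b + real i + real (k - q) + 1) / 2) =
       D * ((-1)^q * real (k choose q) * pochhammer (b + 1 + real (k - q)) i)" if q: "q \<le> k" for q
    proof -
      have g1: "(real k + a) gchoose (k - q) = Gamma (a + real k + 1) / (fact (k - q) * Gamma (a + real q + 1))"
        using q a by (subst gbinomial_Gamma_real) (auto simp: of_nat_diff algebra_simps)
      have g2: "(real k + b) gchoose q = Gamma (b + real k + 1) / (fact q * Gamma (b + 1 + real (k - q)))"
        using q b by (subst gbinomial_Gamma_real) (auto simp: of_nat_diff algebra_simps)
      have np: "b + 1 + real (k - q) \<notin> \<int>\<^sub>\<le>\<^sub>0" using b by (auto elim!: nonpos_Ints_cases)
      have g3: "Gamma (b + real i + real (k - q) + 1) = pochhammer (b + 1 + real (k - q)) i * Gamma (b + 1 + real (k - q))"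
        using pochhammer_Gamma[OF np, of i] np by (simp add: Gamma_eq_zero_iff field_simps)
      have g4: "Beta (a + real q + 1) (b + real i + real (k - q) + 1) =
          Gamma (a + real q + 1) * Gamma (b + real i + real (k - q) + 1) / Gamma (a + b + real k + real i + 2)"
        using q unfolding Beta_def by (simp add: of_nat_diff algebra_simps)
      have bin: "real (k choose q) = fact k / (fact q * fact (k - q))" using q by (rule binomial_fact)
      have nz: "Gamma (a + real q + 1) \<noteq> 0" "Gamma (b + 1 + real (k - q)) \<noteq> 0"
        using a b by (auto simp: Gamma_eq_zero_iff elim!: nonpos_Ints_cases)
      have alg: "GA / (fk * ga) * (GB / (fq * gb)) * sg * (ga * (P * gb) / X / 2) = GA * GB / (2 * F * X) * (sg * (F / (fq * fk)) * P)"
        if "ga \<noteq> 0" "gb \<noteq> 0" "F \<noteq> 0" for GA fk ga GB fq gb sg P X F :: real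
        using that by simp
      show ?thesis unfolding c_def g1 g2 g4 g3 D_def bin by (rule alg) (use nz in simp_all)
    qed
    have "(\<Sum>q\<le>k. c q * (Beta (a + real q + 1) (b + real i + real (k - q) + 1) / 2)) =
       D * (\<Sum>q\<le>k. (-1)^q * real (k choose q) * pochhammer (b + 1 + real (k - q)) i)"
      unfolding sum_distrib_left by (intro sum.cong refl summand) simp
    \<comment> \<open>Reversing the summation turns the alternating sum into a forward
      difference.\<close>
    also have "(\<Sum>q\<le>k. (-1)^q * real (k choose q) * pochhammer (b + 1 + real (k - q)) i) =
        (\<Sum>p\<le>k. (-1)^(k - p) * real (k choose p) * pochhammer (b + 1 + real p) i)"
      by (rule sum.reindex_bij_witness[of _ "\<lambda>p. k - p" "\<lambda>p. k - p"]) (simp_all add: binomial_symmetric[symmetric])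
    also have "\<dots> = fact k * real (i choose k) * pochhammer (b + 1 + real k) (i - k)"
      by (rule finite_difference_pochhammer)
    also have "D * \<dots> = real (i choose k) * Gamma (a + real k + 1) * Gamma (b + real i + 1) / (2 * Gamma (a + b + real k + real i + 2))"
    proof (cases "k \<le> i")
      case True
      have np: "b + 1 + real k \<notin> \<int>\<^sub>\<le>\<^sub>0" using b by (auto elim!: nonpos_Ints_cases)
      have "b + 1 + real k + real (i - k) = b + real i + 1" using True by (simp add: of_nat_diff)
      then have "pochhammer (b + 1 + real k) (i - k) * Gamma (b + real k + 1) = Gamma (b + real i + 1)"
        using pochhammer_Gamma[OF np, of "i - k"] np by (simp add: Gamma_eq_zero_iff add_ac)
      then show ?thesis unfolding D_def by (simp add: field_simps)
    qed (simp add: binomial_eq_0)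
    finally show ?thesis .
  qed
  from 1 show ?thesis unfolding 2 3 .
qed

text \<open>In s each product (s - 1)^q s^(k-q) is monic of degree k, so the leading coefficient is
  a sum of binomial products, evaluated by the Vandermonde identity.\<close>

lemma jacobiP_power_expansion:
  obtains e where "\<And>s. jacobiP k a b (2 * s - 1) = (\<Sum>i\<le>k. e i * s ^ i)" "e k = (2 * real k + a + b) gchoose k"
proof -
  define c where "c = (\<lambda>q. ((real k + a) gchoose (k - q)) * ((real k + b) gchoose q))"
  define m where "m = (\<lambda>q. [:-1, 1::real:] ^ q * [:0, 1:] ^ (k - q))"
  define p where "p = (\<Sum>q\<le>k. smult (c q) (m q))"
  have deg: "degree (m q) = k" if "q \<le> k" for q
    using that unfolding m_def by (simp add: degree_mult_eq degree_power_eq)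
  have "lead_coeff (m q) = 1" for q
    unfolding m_def lead_coeff_mult lead_coeff_power by simp
  then have lead: "coeff (m q) k = 1" if "q \<le> k" for q
    using deg[OF that] by metis
  have dp: "degree p \<le> k" unfolding p_def
    by (intro degree_sum_le) (auto intro: order_trans[OF degree_smult_le] simp: deg)
  have "jacobiP k a b (2 * s - 1) = (\<Sum>i\<le>k. coeff p i * s ^ i)" for s
  proof -
    have "jacobiP k a b (2 * s - 1) = poly p s"
    proof -
      have "(2 * s - 1 - 1) / 2 = s - 1" "(2 * s - 1 + 1) / 2 = s" by auto
      then show ?thesis unfolding jacobiP_def p_def c_def m_def
        by (simp only: poly_sum) (simp add: mult_ac add.commute)
    qed
    also have "\<dots> = (\<Sum>i\<le>k. coeff p i * s ^ i)"
      unfolding poly_altdef using dp by (intro sum.mono_neutral_left) (auto simp: coeff_eq_0)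
    finally show ?thesis .
  qed
  moreover have "coeff p k = (2 * real k + a + b) gchoose k"
  proof -
    have "coeff p k = (\<Sum>q\<le>k. c q)"
      unfolding p_def coeff_sum using lead by (intro sum.cong) auto
    also have "\<dots> = (\<Sum>q\<in>{0..k}. ((real k + b) gchoose q) * ((real k + a) gchoose (k - q)))"
      unfolding c_def by (simp add: atMost_atLeast0 mult.commute)
    also have "\<dots> = (2 * real k + a + b) gchoose k"
      unfolding gbinomial_Vandermonde by (simp add: add_ac)
    finally show ?thesis .
  qed
  ultimately show ?thesis by (rule that)
qed

text \<open>Expand the polynomial of smaller degree in powers of 1 - t^2: by
  \<open>jacobiP_integral\<close> all powers below k integrate to zero, so at most the leading term
  survives. The bound on a + b keeps the Gamma arguments of the leading coefficient
  positive.\<close>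

lemma jacobiP_orthogonal:
  fixes a b :: real
  assumes a: "a > -1" and b: "b > -1" and ab: "a + b > -1"
  shows "has_bochner_integral lborel
    (\<lambda>t. indicator {0<..<1} t * (t powr (2*a + 1) * (1 - t\<^sup>2) powr b *
       jacobiP k a b (2 * (1 - t\<^sup>2) - 1) * jacobiP k' a b (2 * (1 - t\<^sup>2) - 1)))
    (if k = k' then Gamma (a + real k + 1) * Gamma (b + real k + 1) /
       (2 * fact k * Gamma (a + b + real k + 1) * (a + b + 2 * real k + 1)) else 0)"
proof (induction k k' rule: linorder_wlog)
  case (sym k k')
  then show ?case by (auto simp: mult_ac)
next
  case (le k' k)
  obtain e where e: "\<And>s. jacobiP k' a b (2 * s - 1) = (\<Sum>i\<le>k'. e i * s ^ i)" and ek: "e k' = (2 * real k' + a + b) gchoose k'"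
    using jacobiP_power_expansion[of k' a b] by blast
  have "has_bochner_integral lborel (\<lambda>t. \<Sum>i\<le>k'. e i * (indicator {0<..<1} t *
      (t powr (2*a + 1) * (1 - t\<^sup>2) powr (b + real i) * jacobiP k a b (2 * (1 - t\<^sup>2) - 1))))
    (\<Sum>i\<le>k'. e i * (real (i choose k) * Gamma (a + real k + 1) * Gamma (b + real i + 1) / (2 * Gamma (a + b + real k + real i + 2))))"
    by (intro has_bochner_integral_sum has_bochner_integral_mult_right jacobiP_integral a b)
  also have "(\<lambda>t. \<Sum>i\<le>k'. e i * (indicator {0<..<1} t *
      (t powr (2*a + 1) * (1 - t\<^sup>2) powr (b + real i) * jacobiP k a b (2 * (1 - t\<^sup>2) - 1)))) =
    (\<lambda>t. indicator {0<..<1} t * (t powr (2*a + 1) * (1 - t\<^sup>2) powr b *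
       jacobiP k' a b (2 * (1 - t\<^sup>2) - 1) * jacobiP k a b (2 * (1 - t\<^sup>2) - 1)))"
  proof
    fix t :: real
    show "(\<Sum>i\<le>k'. e i * (indicator {0<..<1} t *
      (t powr (2*a + 1) * (1 - t\<^sup>2) powr (b + real i) * jacobiP k a b (2 * (1 - t\<^sup>2) - 1)))) =
      indicator {0<..<1} t * (t powr (2*a + 1) * (1 - t\<^sup>2) powr b *
       jacobiP k' a b (2 * (1 - t\<^sup>2) - 1) * jacobiP k a b (2 * (1 - t\<^sup>2) - 1))"
    proof (cases "t \<in> {0<..<1}")
      case True
      then have "1 - t\<^sup>2 > 0" by (auto simp: power_less_one_iff)
      then have "(1 - t\<^sup>2) powr (b + real i) = (1 - t\<^sup>2) powr b * (1 - t\<^sup>2) ^ i" for i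
        by (simp add: powr_add powr_realpow)
      then show ?thesis using True unfolding e by (simp add: sum_distrib_left sum_distrib_right mult_ac)
    qed simp
  qed
  also have "(\<Sum>i\<le>k'. e i * (real (i choose k) * Gamma (a + real k + 1) * Gamma (b + real i + 1) / (2 * Gamma (a + b + real k + real i + 2)))) =
    (if k' = k then Gamma (a + real k' + 1) * Gamma (b + real k' + 1) /
       (2 * fact k' * Gamma (a + b + real k' + 1) * (a + b + 2 * real k' + 1)) else 0)"
  proof (cases "k' = k")
    case True
    have "(\<Sum>i\<le>k'. e i * (real (i choose k) * Gamma (a + real k + 1) * Gamma (b + real i + 1) / (2 * Gamma (a + b + real k + real i + 2)))) =
      (\<Sum>i\<in>{k}. e i * (real (i choose k) * Gamma (a + real k + 1) * Gamma (b + real i + 1) / (2 * Gamma (a + b + real k + real i + 2))))"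
      using True by (intro sum.mono_neutral_right) (auto simp: binomial_eq_0)
    also have "\<dots> = e k * (Gamma (a + real k + 1) * Gamma (b + real k + 1) / (2 * Gamma (a + b + 2 * real k + 2)))"
      by (simp add: algebra_simps)
    also have "e k = Gamma (a + b + 2 * real k + 1) / (fact k * Gamma (a + b + real k + 1))"
      using ek True ab by (subst (asm) gbinomial_Gamma_real) (auto simp: algebra_simps)
    also have "Gamma (a + b + 2 * real k + 2) = (a + b + 2 * real k + 1) * Gamma (a + b + 2 * real k + 1)"
      using Gamma_plus1[OF pos_not_nonpos_Int, of "a + b + 2 * real k + 1"] ab by (simp add: add_ac)
    finally show ?thesis using True ab by (simp add: Gamma_eq_zero_iff) (auto elim!: nonpos_Ints_cases)
  next
    case False
    with le have "k' < k" by simp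
    then show ?thesis using False by (auto intro!: sum.neutral simp: binomial_eq_0)
  qed
  finally show ?case .
qed

section \<open>Gegenbauer polynomials: recurrence, moments and orthogonality\<close>

text \<open>Zero beyond the range 2 i <= j, so that polynomials of different degree can be summed up
  to a common bound and compared coefficientwise.\<close>

definition gegenbauer_coeff :: "real \<Rightarrow> nat \<Rightarrow> nat \<Rightarrow> real" where
  "gegenbauer_coeff lam j i = (if 2*i \<le> j then (-1) ^ i * pochhammer lam (j - i) / (fact i * fact (j - 2*i)) else 0)"

lemma gegenbauerC_eq_sum:
  assumes "j div 2 \<le> N"
  shows "gegenbauerC lam j t = (\<Sum>i\<le>N. gegenbauer_coeff lam j i * (2*t) ^ (j - 2*i))"
proof -
  have "gegenbauerC lam j t = (\<Sum>i\<le>j div 2. gegenbauer_coeff lam j i * (2*t) ^ (j - 2*i))"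
    unfolding gegenbauerC_def gegenbauer_coeff_def by (intro sum.cong) auto
  also have "\<dots> = (\<Sum>i\<le>N. gegenbauer_coeff lam j i * (2*t) ^ (j - 2*i))"
    using assms by (intro sum.mono_neutral_left) (auto simp: gegenbauer_coeff_def)
  finally show ?thesis .
qed

text \<open>The three-term recurrence read off at the power (2t)^(j-2i). For j = 2i the middle
  coefficient lies outside its range and is 0, which is why that case is separate.\<close>

lemma gegenbauer_coeff_Suc_Suc:
  "real (j + 2) * gegenbauer_coeff lam (j + 2) (Suc i) =
    (real j + 1 + lam) * gegenbauer_coeff lam (j + 1) (Suc i) - (real j + 2 * lam) * gegenbauer_coeff lam j i"
proof (cases "2 * i \<le> j")
  case True
  define p where "p = j - 2 * i"
  have j: "j = p + 2 * i" using True by (simp add: p_def)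
  define Q where "Q = pochhammer lam (p + i)"
  have poch: "pochhammer lam (Suc (p + i)) = (lam + real (p + i)) * Q" by (simp add: pochhammer_rec' Q_def)
  have c2: "gegenbauer_coeff lam (j + 2) (Suc i) = (-1)^Suc i * ((lam + real (p + i)) * Q) / (fact (Suc i) * fact p)"
  proof -
    have "2 * Suc i \<le> j + 2" "j + 2 - Suc i = Suc (p + i)" "j + 2 - 2 * Suc i = p" by (auto simp: j)
    then show ?thesis by (simp only: gegenbauer_coeff_def poch if_True)
  qed
  have c0: "gegenbauer_coeff lam j i = (-1)^i * Q / (fact i * fact p)"
    unfolding gegenbauer_coeff_def j Q_def by (simp add: add.commute)
  define r where "r = real i + 1"
  have r: "r \<noteq> 0" "(fact (Suc i) :: real) = r * fact i" "real i = r - 1" by (auto simp: r_def)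
  show ?thesis
  proof (cases p)
    case 0
    have c1: "gegenbauer_coeff lam (j + 1) (Suc i) = 0" unfolding gegenbauer_coeff_def j 0 by simp
    have "real (j + 2) = 2 * r" "real j = 2 * (r - 1)" "real (p + i) = r - 1" by (auto simp: j 0 r_def)
    then show ?thesis unfolding c0 c1 c2 r(2) using r(1) 0 by (simp add: field_simps)
  next
    case (Suc p')
    have c1: "gegenbauer_coeff lam (j + 1) (Suc i) = (-1)^Suc i * Q / (fact (Suc i) * fact p')"
      unfolding gegenbauer_coeff_def j Q_def Suc by (simp add: add.commute)
    define v where "v = real p' + 1"
    have v: "v \<noteq> 0" "(fact p :: real) = v * fact p'" by (auto simp: v_def Suc)
    have e: "real (j + 2) = v + 2 * r" "real j = v + 2 * (r - 1)" "real (p + i) = v + r - 1" by (auto simp: j Suc r_def v_def)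
    show ?thesis unfolding c0 c1 c2 e r(2) v(2) r(3) using r(1) v(1) by (simp add: field_simps)
  qed
qed (simp add: gegenbauer_coeff_def)

lemma gegenbauer_coeff_Suc_Suc_0:
  "real (j + 2) * gegenbauer_coeff lam (j + 2) 0 = (real j + 1 + lam) * gegenbauer_coeff lam (j + 1) 0"
proof -
  have p: "pochhammer lam (j + 2) = (real j + 1 + lam) * pochhammer lam (j + 1)"
    using pochhammer_rec'[of lam "j + 1"] by (simp add: add_ac)
  have f: "(fact (j + 2) :: real) = real (j + 2) * fact (j + 1)" by simp
  show ?thesis by (simp only: gegenbauer_coeff_def mult_0_right diff_zero le0 if_True power_0 fact_0 mult_1 p f) simp
qed

lemma gegenbauerC_recurrence:
  "real (j + 2) * gegenbauerC lam (j + 2) t =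
    2 * (real j + 1 + lam) * (t * gegenbauerC lam (j + 1) t) - (real j + 2 * lam) * gegenbauerC lam j t"
proof -
  let ?c = "gegenbauer_coeff lam"
  have 1: "gegenbauerC lam (j + 2) t = ?c (j + 2) 0 * (2*t)^(j + 2) + (\<Sum>i\<le>j. ?c (j + 2) (Suc i) * (2*t)^(j - 2*i))"
    by (subst gegenbauerC_eq_sum[of _ "Suc j"], simp, subst sum.atMost_Suc_shift) simp
  have 2: "2 * t * gegenbauerC lam (j + 1) t = ?c (j + 1) 0 * (2*t)^(j + 2) + (\<Sum>i\<le>j. ?c (j + 1) (Suc i) * (2*t)^(j - 2*i))"
  proof -
    have "?c (j + 1) (Suc i) * (2*t)^(j + 1 - 2 * Suc i) * (2 * t) = ?c (j + 1) (Suc i) * (2*t)^(j - 2*i)" for i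
    proof (cases "2 * Suc i \<le> j + 1")
      case True
      then have "j - 2*i = Suc (j + 1 - 2 * Suc i)" by simp
      then show ?thesis by (simp only: power_Suc mult_ac)
    qed (simp add: gegenbauer_coeff_def)
    note e = this
    have "2 * t * gegenbauerC lam (j + 1) t = (\<Sum>i\<le>Suc j. ?c (j + 1) i * (2*t)^(j + 1 - 2 * i) * (2 * t))"
      by (subst gegenbauerC_eq_sum[of _ "Suc j"], simp) (simp only: sum_distrib_left mult_ac)
    also have "\<dots> = ?c (j + 1) 0 * (2*t)^(j + 1 - 2 * 0) * (2 * t) + (\<Sum>i\<le>j. ?c (j + 1) (Suc i) * (2*t)^(j - 2*i))"
      by (simp only: sum.atMost_Suc_shift e)
    also have "?c (j + 1) 0 * (2*t)^(j + 1 - 2 * 0) * (2 * t) = ?c (j + 1) 0 * (2*t)^(j + 2)" by simp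
    finally show ?thesis .
  qed
  have 3: "gegenbauerC lam j t = (\<Sum>i\<le>j. ?c j i * (2*t)^(j - 2*i))"
    by (rule gegenbauerC_eq_sum) simp
  have "real (j + 2) * gegenbauerC lam (j + 2) t = (real j + 1 + lam) * ?c (j + 1) 0 * (2*t)^(j + 2) +
      (\<Sum>i\<le>j. ((real j + 1 + lam) * ?c (j + 1) (Suc i) - (real j + 2 * lam) * ?c j i) * (2*t)^(j - 2*i))"
    unfolding 1 distrib_left sum_distrib_left mult.assoc[symmetric] gegenbauer_coeff_Suc_Suc gegenbauer_coeff_Suc_Suc_0 ..
  also have "\<dots> = (real j + 1 + lam) * (2 * t * gegenbauerC lam (j + 1) t) - (real j + 2 * lam) * gegenbauerC lam j t"
    unfolding 2 3 by (simp add: algebra_simps sum_distrib_left sum_subtractf sum.distrib)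
  finally show ?thesis by (simp add: mult_ac)
qed

text \<open>Closed form of the integral of t^l times the j-th polynomial against the weight of
  exponent lam - 1/2. Reciprocal Gammas are used so that the zeros for l < j come from the poles of
  Gamma without a case distinction.\<close>

definition gegenbauer_moment :: "real \<Rightarrow> nat \<Rightarrow> nat \<Rightarrow> real" where
  "gegenbauer_moment lam l j = (if even (l + j) then
     sqrt pi * Gamma (lam + 1/2) * pochhammer (2*lam) j / fact j * fact l / 2^l *
       rGamma ((real l - real j)/2 + 1) * rGamma (lam + (real l + real j)/2 + 1) else 0)"

text \<open>The recurrence of the polynomials integrated against t^l; the factor t there raises l to
  l + 1 here.\<close>

lemma gegenbauer_moment_recurrence:
  "real (j + 2) * gegenbauer_moment lam l (j + 2) =
    2 * (real j + 1 + lam) * gegenbauer_moment lam (l + 1) (j + 1) - (real j + 2 * lam) * gegenbauer_moment lam l j"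
proof (cases "even (l + j)")
  case True
  define y where "y = (real l - real j)/2"
  define z where "z = lam + (real l + real j)/2 + 1"
  define A where "A = sqrt pi * Gamma (lam + 1/2) * pochhammer (2*lam) j / fact (Suc j) * fact l / 2^l"
  have y: "rGamma y = y * rGamma (y + 1)" by (rule rGamma_plus1[symmetric])
  have z: "rGamma z = z * rGamma (z + 1)" by (rule rGamma_plus1[symmetric])
  have "gegenbauer_moment lam l (j + 2) * real (j + 2) = A * (2*lam + real j) * (2*lam + real j + 1) * (rGamma y * rGamma (z + 1))"
  proof -
    have a1: "(real l - real (j + 2))/2 + 1 = y" "lam + (real l + real (j + 2))/2 + 1 = z + 1" by (auto simp: y_def z_def field_simps)
    have a2: "pochhammer (2*lam) (j + 2) = pochhammer (2*lam) j * (2*lam + real j) * (2*lam + real j + 1)"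
      by (simp add: pochhammer_rec' numeral_2_eq_2 mult_ac)
    have a3: "(fact (j + 2) :: real) = real (j + 2) * fact (Suc j)" by simp
    show ?thesis unfolding gegenbauer_moment_def a1 a2 a3 A_def using True by (simp add: mult_ac)
  qed
  moreover have "2 * gegenbauer_moment lam (l + 1) (j + 1) = A * (2*lam + real j) * (real l + 1) * (rGamma (y + 1) * rGamma (z + 1))"
  proof -
    have a1: "(real (l + 1) - real (j + 1))/2 + 1 = y + 1" "lam + (real (l + 1) + real (j + 1))/2 + 1 = z + 1" by (auto simp: y_def z_def field_simps)
    have a2: "pochhammer (2*lam) (j + 1) = pochhammer (2*lam) j * (2*lam + real j)"
      by (simp add: pochhammer_rec' mult_ac)
    have a3: "(fact (l + 1) :: real) = (real l + 1) * fact l" by simp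
    show ?thesis unfolding gegenbauer_moment_def a1 a2 a3 A_def using True by (simp add: mult_ac)
  qed
  moreover have "gegenbauer_moment lam l j = A * (real j + 1) * (rGamma (y + 1) * rGamma z)"
  proof -
    have a3: "(fact (Suc j) :: real) = (real j + 1) * fact j" by simp
    have "C / (J * F) * L / P * J * (R * R') = C / F * L / P * R * R'" if "J \<noteq> 0" for C J F L P R R' :: real
      using that by simp
    moreover have "real j + 1 \<noteq> 0" by linarith
    ultimately show ?thesis unfolding gegenbauer_moment_def y_def[symmetric] z_def[symmetric] A_def a3 using True
      by (simp only: even_add if_True simp_thms)
  qed
  \<comment> \<open>After the functional equation of \<open>rGamma\<close> at y and z, all terms
    share the factor \<open>rGamma (y + 1) * rGamma (z + 1)\<close>, and this identity is what
    remains.\<close>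
  moreover have "(2*lam + real j + 1) * y = (real j + 1 + lam) * (real l + 1) - (real j + 1) * z"
    unfolding y_def z_def by (simp add: field_simps)
  ultimately show ?thesis unfolding y z by algebra
qed (simp add: gegenbauer_moment_def)

text \<open>Fold (-1, 1) onto (0, 1): the two halves cancel for odd l, and for even l they add up to
  a Beta value, whose half-integer Gamma is written with factorials.\<close>

lemma power_moment_Gegenbauer_weight:
  assumes lam: "lam > 0"
  shows "has_bochner_integral lborel (\<lambda>t. indicator {-1<..<1} t * (t ^ l * (1 - t\<^sup>2) powr (lam - 1/2)))
    (gegenbauer_moment lam l 0)"
proof -
  let ?h = "\<lambda>t. indicator {0<..<1} t * (t ^ l * (1 - t\<^sup>2) powr (lam - 1/2))"
  let ?B = "Beta ((real l + 1)/2) (lam + 1/2) / 2"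
  have "has_bochner_integral lborel (\<lambda>t. indicator {0<..<1} t * (t powr (2 * ((real l - 1)/2) + 1) * (1 - t\<^sup>2) powr (lam - 1/2)))
    (Beta ((real l - 1)/2 + 1) (lam - 1/2 + 1) / 2)"
    using lam by (intro Beta_integral_squares) auto
  also have "(\<lambda>t. indicator {0<..<1} t * (t powr (2 * ((real l - 1)/2) + 1) * (1 - t\<^sup>2) powr (lam - 1/2))) = ?h"
  proof -
    have "2 * ((real l - 1)/2) + 1 = real l" by (simp add: field_simps)
    then show ?thesis by (simp only:) (auto simp: fun_eq_iff indicator_def powr_realpow)
  qed
  also have "Beta ((real l - 1)/2 + 1) (lam - 1/2 + 1) / 2 = ?B" by (simp add: field_simps)
  finally have h: "has_bochner_integral lborel ?h ?B" .
  have "has_bochner_integral lborel (\<lambda>t. ?h (- t)) ?B"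
    using lborel_has_bochner_integral_real_affine_iff[of "-1" ?h ?B 0] h by simp
  then have h': "has_bochner_integral lborel (\<lambda>t. (-1)^l * ?h (- t)) ((-1)^l * ?B)"
    by (rule has_bochner_integral_mult_right)
  have s: "has_bochner_integral lborel (\<lambda>t. ?h t + (-1)^l * ?h (- t)) (?B + (-1)^l * ?B)"
    using has_bochner_integral_add[OF h h'] .
  have "has_bochner_integral lborel (\<lambda>t. indicator {-1<..<1} t * (t ^ l * (1 - t\<^sup>2) powr (lam - 1/2))) (?B + (-1)^l * ?B)"
  proof (rule has_bochner_integralI_AE[OF s])
    show "AE t in lborel. ?h t + (-1)^l * ?h (- t) = indicator {-1<..<1} t * (t ^ l * (1 - t\<^sup>2) powr (lam - 1/2))"
      using AE_lborel_singleton[of "0::real"]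
    proof eventually_elim
      case (elim t)
      have "(-1)^l * (- t)^l = t^l" by (simp add: power_mult_distrib[symmetric])
      then show ?case using elim by (auto simp: indicator_def mult.assoc[symmetric])
    qed
  qed measurable
  moreover have "?B + (-1)^l * ?B = gegenbauer_moment lam l 0"
  proof (cases "even l")
    case True
    then obtain q where q: "l = 2 * q" by (auto elim: evenE)
    have G: "Gamma (1/2 + real q) = sqrt pi * fact (2*q) / (2^(2*q) * fact q)"
    proof -
      have "(fact (2*q) :: real) = 2^(2*q) * pochhammer (1/2) q * fact q"
        using fact_double[of q, where 'a = real] by (simp add: power_mult)
      moreover have "pochhammer (1/2::real) q = Gamma (1/2 + real q) / sqrt pi"
        by (subst pochhammer_Gamma) (auto simp: Gamma_one_half_real elim!: nonpos_Ints_cases)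
      ultimately show ?thesis by (simp add: field_simps)
    qed
    have R: "rGamma (real q + 1) = 1 / fact q"
      using Gamma_fact[of q, where 'a = real] by (simp add: rGamma_inverse_Gamma field_simps add.commute)
    have e: "(real (2*q) + 1)/2 = 1/2 + real q" "1/2 + real q + (lam + 1/2) = lam + real q + 1"
      "(real (2*q) - real 0)/2 + 1 = real q + 1" "lam + (real (2*q) + real 0)/2 + 1 = lam + real q + 1"
      by (auto simp: field_simps)
    show ?thesis unfolding gegenbauer_moment_def Beta_def q e G R rGamma_inverse_Gamma[of "lam + real q + 1"]
      by (simp add: inverse_eq_divide mult_ac)
  qed (simp add: gegenbauer_moment_def)
  ultimately show ?thesis by simp
qed

text \<open>Polynomials and claimed moments obey the same recurrence in j, so the degrees 0 and 1
  suffice as a start. The order l must stay arbitrary because the recurrence raises it.\<close>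

lemma gegenbauerC_moment:
  assumes lam: "lam > 0"
  shows "has_bochner_integral lborel (\<lambda>t. indicator {-1<..<1} t * (t ^ l * gegenbauerC lam j t * (1 - t\<^sup>2) powr (lam - 1/2)))
    (gegenbauer_moment lam l j)"
proof (induction j arbitrary: l rule: nat_less_induct)
  case (1 j)
  have c0: "gegenbauerC lam 0 t = 1" and c1: "gegenbauerC lam 1 t = 2 * lam * t" for t
    by (simp_all add: gegenbauerC_def)
  consider "j = 0" | "j = 1" | i where "j = i + 2" by (metis One_nat_def Suc_1 add_2_eq_Suc' not0_implies_Suc)
  then show ?case
  proof cases
    case 1
    then show ?thesis using power_moment_Gegenbauer_weight[OF lam, of l] by (simp add: c0)
  next
    case 2
    have "has_bochner_integral lborel (\<lambda>t. (2 * lam) * (indicator {-1<..<1} t * (t ^ (l + 1) * (1 - t\<^sup>2) powr (lam - 1/2))))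
      ((2 * lam) * gegenbauer_moment lam (l + 1) 0)"
      by (intro has_bochner_integral_mult_right power_moment_Gegenbauer_weight lam)
    also have "(2 * lam) * gegenbauer_moment lam (l + 1) 0 = gegenbauer_moment lam l 1"
    proof (cases "even (l + 1)")
      case True
      define y where "y = (real l - 1)/2 + 1"
      have y: "rGamma y = y * rGamma (y + 1)" by (rule rGamma_plus1[symmetric])
      have a: "(real (l + 1) - real 0)/2 + 1 = y + 1" "lam + (real (l + 1) + real 0)/2 + 1 = lam + y + 1"
        "lam + (real l + real 1)/2 + 1 = lam + y + 1"
        "(real l - real 1)/2 + 1 = y" "fact (l + 1) = (2::real) * y * fact l" by (auto simp: y_def field_simps)
      show ?thesis unfolding gegenbauer_moment_def a y using True by simp
    qed (simp add: gegenbauer_moment_def)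
    also have "(\<lambda>t. (2 * lam) * (indicator {-1<..<1} t * (t ^ (l + 1) * (1 - t\<^sup>2) powr (lam - 1/2)))) =
      (\<lambda>t. indicator {-1<..<1} t * (t ^ l * gegenbauerC lam j t * (1 - t\<^sup>2) powr (lam - 1/2)))"
      by (simp add: fun_eq_iff c1 2 power_add del: One_nat_def)
    finally show ?thesis using 2 by simp
  next
    case (3 i)
    from 1 have IH: "has_bochner_integral lborel (\<lambda>t. indicator {-1<..<1} t * (t ^ l * gegenbauerC lam m t * (1 - t\<^sup>2) powr (lam - 1/2)))
      (gegenbauer_moment lam l m)" if "m < j" for m l using that by blast
    have "has_bochner_integral lborel (\<lambda>t. inverse (real (i + 2)) *
       (2 * (real i + 1 + lam) * (indicator {-1<..<1} t * (t ^ (l + 1) * gegenbauerC lam (i + 1) t * (1 - t\<^sup>2) powr (lam - 1/2))) -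
        (real i + 2 * lam) * (indicator {-1<..<1} t * (t ^ l * gegenbauerC lam i t * (1 - t\<^sup>2) powr (lam - 1/2)))))
      (inverse (real (i + 2)) * (2 * (real i + 1 + lam) * gegenbauer_moment lam (l + 1) (i + 1) - (real i + 2 * lam) * gegenbauer_moment lam l i))"
      by (intro has_bochner_integral_mult_right has_bochner_integral_diff IH) (simp_all add: 3)
    also have "inverse (real (i + 2)) * (2 * (real i + 1 + lam) * gegenbauer_moment lam (l + 1) (i + 1) - (real i + 2 * lam) * gegenbauer_moment lam l i) =
      gegenbauer_moment lam l j" unfolding gegenbauer_moment_recurrence[symmetric] 3 by (simp add: field_simps)
    also have "(\<lambda>t. inverse (real (i + 2)) *
       (2 * (real i + 1 + lam) * (indicator {-1<..<1} t * (t ^ (l + 1) * gegenbauerC lam (i + 1) t * (1 - t\<^sup>2) powr (lam - 1/2))) -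
        (real i + 2 * lam) * (indicator {-1<..<1} t * (t ^ l * gegenbauerC lam i t * (1 - t\<^sup>2) powr (lam - 1/2))))) =
      (\<lambda>t. indicator {-1<..<1} t * (t ^ l * gegenbauerC lam j t * (1 - t\<^sup>2) powr (lam - 1/2)))"
    proof
      fix t
      have "gegenbauerC lam j t = inverse (real (i + 2)) * (2 * (real i + 1 + lam) * (t * gegenbauerC lam (i + 1) t) - (real i + 2 * lam) * gegenbauerC lam i t)"
        unfolding gegenbauerC_recurrence[symmetric] 3 by simp
      moreover have "v * (A * (J * (T * t * G1 * W)) - B * (J * (T * G0 * W))) = J * (T * (v * (A * (t * G1) - B * G0)) * W)"
        for v A J T G1 W B G0 :: real by (simp add: algebra_simps)
      ultimately show "inverse (real (i + 2)) *
       (2 * (real i + 1 + lam) * (indicator {-1<..<1} t * (t ^ (l + 1) * gegenbauerC lam (i + 1) t * (1 - t\<^sup>2) powr (lam - 1/2))) -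
        (real i + 2 * lam) * (indicator {-1<..<1} t * (t ^ l * gegenbauerC lam i t * (1 - t\<^sup>2) powr (lam - 1/2)))) =
       indicator {-1<..<1} t * (t ^ l * gegenbauerC lam j t * (1 - t\<^sup>2) powr (lam - 1/2))"
        by (simp only: power_add power_one_right)
    qed
    finally show ?thesis .
  qed
qed

lemma gegenbauer_moment_eq_0: "l < j \<Longrightarrow> gegenbauer_moment lam l j = 0"
proof (cases "even (l + j)")
  case True
  assume "l < j"
  with True obtain d where d: "j = l + 2 * Suc d"
    by (metis add_diff_inverse_nat dvd_diff_nat even_add evenE less_imp_le_nat less_imp_not_less mult_0_right not0_implies_Suc not_less_iff_gr_or_eq add_0_right even_diff_nat)
  have "(real l - real j)/2 + 1 = - real d" by (simp add: d field_simps)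
  then show ?thesis unfolding gegenbauer_moment_def by (simp add: rGamma_eq_zero_iff)
qed (simp add: gegenbauer_moment_def)

text \<open>As for Jacobi: expand the polynomial of smaller degree; its monomials of degree below j
  have moment zero, so only the leading term (index 0 of the coefficients) can contribute.\<close>

lemma gegenbauerC_orthogonal:
  assumes lam: "lam > 0"
  shows "has_bochner_integral lborel (\<lambda>t. indicator {-1<..<1} t * (gegenbauerC lam j t * gegenbauerC lam j' t * (1 - t\<^sup>2) powr (lam - 1/2)))
    (if j = j' then sqrt pi * Gamma (lam + 1/2) * pochhammer (2*lam) j * pochhammer lam j * rGamma (lam + real j + 1) / fact j else 0)"
proof (induction j j' rule: linorder_wlog)
  case (sym j j')
  then show ?case by (auto simp: mult_ac)
next
  case (le j' j)
  let ?c = "gegenbauer_coeff lam"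
  have "has_bochner_integral lborel (\<lambda>t. \<Sum>i\<le>j'. (?c j' i * 2 ^ (j' - 2*i)) * (indicator {-1<..<1} t * (t ^ (j' - 2*i) * gegenbauerC lam j t * (1 - t\<^sup>2) powr (lam - 1/2))))
    (\<Sum>i\<le>j'. (?c j' i * 2 ^ (j' - 2*i)) * gegenbauer_moment lam (j' - 2*i) j)"
    by (intro has_bochner_integral_sum has_bochner_integral_mult_right gegenbauerC_moment lam)
  also have "(\<lambda>t. \<Sum>i\<le>j'. (?c j' i * 2 ^ (j' - 2*i)) * (indicator {-1<..<1} t * (t ^ (j' - 2*i) * gegenbauerC lam j t * (1 - t\<^sup>2) powr (lam - 1/2)))) =
    (\<lambda>t. indicator {-1<..<1} t * (gegenbauerC lam j' t * gegenbauerC lam j t * (1 - t\<^sup>2) powr (lam - 1/2)))"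
  proof -
    have "gegenbauerC lam j' t = (\<Sum>i\<le>j'. ?c j' i * (2*t) ^ (j' - 2*i))" for t
      by (rule gegenbauerC_eq_sum) simp
    then show ?thesis
      by (simp add: fun_eq_iff sum_distrib_left sum_distrib_right power_mult_distrib mult_ac)
  qed
  also have "(\<Sum>i\<le>j'. (?c j' i * 2 ^ (j' - 2*i)) * gegenbauer_moment lam (j' - 2*i) j) =
    (if j' = j then sqrt pi * Gamma (lam + 1/2) * pochhammer (2*lam) j' * pochhammer lam j' * rGamma (lam + real j' + 1) / fact j' else 0)"
  proof (cases "j' = j")
    case True
    have "(\<Sum>i\<le>j'. (?c j' i * 2 ^ (j' - 2*i)) * gegenbauer_moment lam (j' - 2*i) j) =
      (\<Sum>i\<in>{0}. (?c j' i * 2 ^ (j' - 2*i)) * gegenbauer_moment lam (j' - 2*i) j)"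
      using True by (intro sum.mono_neutral_right) (auto intro!: gegenbauer_moment_eq_0 simp: gegenbauer_coeff_def)
    then show ?thesis using True by (simp add: gegenbauer_coeff_def gegenbauer_moment_def field_simps)
  next
    case False
    with le show ?thesis by (auto intro!: sum.neutral gegenbauer_moment_eq_0)
  qed
  finally show ?case .
qed

section \<open>Directional derivatives of polynomials and the Funk--Hecke formula for powers\<close>

text \<open>The direction comes first, so that \<open>dirD a P\<close> is again a function and
  derivatives can be iterated.\<close>

definition dirD :: "'a::euclidean_space \<Rightarrow> ('a \<Rightarrow> real) \<Rightarrow> 'a \<Rightarrow> real" where
  "dirD a P x = frechet_derivative P (at x) a"

lemma dirD_eqI: "(P has_derivative D) (at x) \<Longrightarrow> dirD a P x = D a"
  unfolding dirD_def by (metis frechet_derivative_at)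

lemma has_derivative_dirD:
  assumes "real_polynomial_function P"
  shows "(P has_derivative (\<lambda>a. dirD a P x)) (at x)"
  using differentiable_at_real_polynomial_function[OF assms, of x UNIV]
  unfolding dirD_def by (simp add: frechet_derivative_works)

lemma dirD_linear: "bounded_linear f \<Longrightarrow> dirD a f = (\<lambda>x. f a)"
  by (rule ext, rule dirD_eqI) (rule bounded_linear_imp_has_derivative)

lemma dirD_const: "dirD a (\<lambda>x. c) = (\<lambda>x. 0)"
  by (rule ext, rule dirD_eqI) (rule has_derivative_const)

lemma dirD_add:
  "real_polynomial_function f \<Longrightarrow> real_polynomial_function g \<Longrightarrow>
    dirD a (\<lambda>x. f x + g x) = (\<lambda>x. dirD a f x + dirD a g x)"
  by (rule ext, rule dirD_eqI) (intro has_derivative_add has_derivative_dirD)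

lemma dirD_mult:
  "real_polynomial_function f \<Longrightarrow> real_polynomial_function g \<Longrightarrow>
    dirD a (\<lambda>x. f x * g x) = (\<lambda>x. f x * dirD a g x + dirD a f x * g x)"
  by (rule ext, rule dirD_eqI) (intro has_derivative_mult has_derivative_dirD)

lemma dirD_power:
  assumes f: "real_polynomial_function f"
  shows "dirD a (\<lambda>x. f x ^ Suc l) = (\<lambda>x. real (Suc l) * f x ^ l * dirD a f x)"
proof (induction l)
  case (Suc l)
  have "dirD a (\<lambda>x. f x ^ Suc (Suc l)) = dirD a (\<lambda>x. f x * f x ^ Suc l)" by simp
  also have "\<dots> = (\<lambda>x. f x * dirD a (\<lambda>x. f x ^ Suc l) x + dirD a f x * f x ^ Suc l)"
    using f by (intro dirD_mult) auto
  finally show ?case unfolding Suc by (simp add: fun_eq_iff algebra_simps)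
qed simp

lemma real_polynomial_dirD: "real_polynomial_function P \<Longrightarrow> real_polynomial_function (dirD a P)"
proof (induction P rule: real_polynomial_function.induct)
  case (mult f g)
  then show ?case by (subst dirD_mult) auto
next
  case (add f g)
  then show ?case by (subst dirD_add) auto
qed (auto simp: dirD_linear dirD_const)

text \<open>Induction over the construction of the polynomial: in the product rule the two mixed
  terms merely change places.\<close>

lemma dirD_commute: "real_polynomial_function P \<Longrightarrow> dirD a (dirD b P) = dirD b (dirD a P)"
proof (induction P rule: real_polynomial_function.induct)
  case (mult f g)
  note p = mult.hyps real_polynomial_dirD[OF mult.hyps(1)] real_polynomial_dirD[OF mult.hyps(2)]
  have *: "dirD c (dirD d (\<lambda>x. f x * g x)) =
    (\<lambda>x. f x * dirD c (dirD d g) x + dirD c f x * dirD d g x + (dirD d f x * dirD c g x + dirD c (dirD d f) x * g x))" for c d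
    using p by (subst dirD_mult, simp, simp, subst dirD_add) (auto simp: dirD_mult)
  show ?case unfolding * mult.IH by (simp add: fun_eq_iff algebra_simps)
next
  case (add f g)
  then show ?case by (simp add: dirD_add real_polynomial_dirD)
qed (simp_all add: dirD_linear dirD_const)

lemma linear_dirD: "real_polynomial_function P \<Longrightarrow> linear (\<lambda>a. dirD a P x)"
  by (rule has_derivative_linear[OF has_derivative_dirD])

lemma dirD_add_direction:
  "real_polynomial_function P \<Longrightarrow> dirD (a + b) P x = dirD a P x + dirD b P x"
  using linear_add[OF linear_dirD] by blast

lemma dirD_scale_direction:
  "real_polynomial_function P \<Longrightarrow> dirD (c *\<^sub>R a) P x = c * dirD a P x"
  using linear_scale[OF linear_dirD, of P c a x] by simp

lemma dirD_sum_Basis: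
  assumes "real_polynomial_function P"
  shows "dirD a P x = (\<Sum>b\<in>Basis. (a \<bullet> b) * dirD b P x)"
proof -
  have "linear (\<lambda>a. dirD a P x)" by (rule linear_dirD[OF assms])
  then have "dirD (\<Sum>b\<in>Basis. (a \<bullet> b) *\<^sub>R b) P x = (\<Sum>b\<in>Basis. dirD ((a \<bullet> b) *\<^sub>R b) P x)"
    by (rule linear_sum)
  then show ?thesis by (simp add: euclidean_representation dirD_scale_direction[OF assms])
qed

lemma continuous_real_polynomial: "real_polynomial_function P \<Longrightarrow> continuous_on S P"
  by (meson continuous_at_imp_continuous_on continuous_real_polymonial_function)

definition homogeneous :: "nat \<Rightarrow> ('a::real_vector \<Rightarrow> real) \<Rightarrow> bool" where
  "homogeneous m P \<longleftrightarrow> (\<forall>c x. P (c *\<^sub>R x) = c ^ m * P x)"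

lemma homogeneous_dirD_scale:
  assumes P: "real_polynomial_function P" and hom: "homogeneous m P"
  shows "c * dirD a P (c *\<^sub>R x) = c ^ m * dirD a P x"
proof -
  have "((\<lambda>y. P (c *\<^sub>R y)) has_derivative (\<lambda>h. dirD (c *\<^sub>R h) P (c *\<^sub>R x))) (at x)"
    using diff_chain_at[OF has_derivative_scaleR_right[OF has_derivative_ident, of c] has_derivative_dirD[OF P]]
    by (simp add: o_def)
  moreover have "((\<lambda>y. c ^ m * P y) has_derivative (\<lambda>h. c ^ m * dirD h P x)) (at x)"
    by (rule has_derivative_mult_right[OF has_derivative_dirD[OF P]])
  ultimately have "dirD (c *\<^sub>R a) P (c *\<^sub>R x) = c ^ m * dirD a P x"
    using hom has_derivative_unique unfolding homogeneous_def by (metis (no_types, lifting) ext)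
  then show ?thesis by (simp add: dirD_scale_direction[OF P])
qed

text \<open>For c nonzero a factor c cancels from the differentiated homogeneity relation. The value
  at c = 0 follows by continuity, and it is not always zero since 0 ^ 0 = 1.\<close>

lemma homogeneous_dirD:
  assumes P: "real_polynomial_function P" and hom: "homogeneous (Suc m) P"
  shows "homogeneous m (dirD a P)"
  unfolding homogeneous_def
proof (intro allI)
  fix c x
  have nz: "dirD a P (d *\<^sub>R x) = d ^ m * dirD a P x" if "d \<noteq> 0" for d
    using homogeneous_dirD_scale[OF P hom, of d a x] that by simp
  show "dirD a P (c *\<^sub>R x) = c ^ m * dirD a P x"
  proof (cases "c = 0")
    case True
    have c: "isCont (dirD a P) y" for y
      using real_polynomial_dirD[OF P] continuous_real_polymonial_function by blast
    have "isCont (\<lambda>d. dirD a P (d *\<^sub>R x)) 0"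
      by (rule isCont_o2[of 0 "\<lambda>d. d *\<^sub>R x" "dirD a P"]) (auto intro: c continuous_intros)
    then have 1: "(\<lambda>d. dirD a P (d *\<^sub>R x)) \<midarrow>0\<rightarrow> dirD a P (0 *\<^sub>R x)" by (simp add: isCont_def)
    have "isCont (\<lambda>d::real. d ^ m * dirD a P x) 0" by (intro continuous_intros)
    then have "(\<lambda>d. d ^ m * dirD a P x) \<midarrow>0\<rightarrow> 0 ^ m * dirD a P x" by (simp add: isCont_def)
    then have "(\<lambda>d. dirD a P (d *\<^sub>R x)) \<midarrow>0\<rightarrow> 0 ^ m * dirD a P x"
      by (rule Lim_transform_eventually) (auto simp: eventually_at_filter nz)
    with 1 show ?thesis unfolding True by (rule LIM_unique)
  qed (rule nz)
qed

lemma homogeneous_0_const: "homogeneous 0 P \<Longrightarrow> P x = P y"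
  unfolding homogeneous_def by (metis mult_1 power_0 scaleR_zero_left)

lemma dirD_homogeneous_0: "homogeneous 0 P \<Longrightarrow> dirD a P x = 0"
proof -
  assume "homogeneous 0 P"
  then have "P = (\<lambda>_. P 0)" using homogeneous_0_const[of P] by (intro ext) blast
  then show ?thesis using dirD_const[of a "P 0"] by metis
qed

lemma euler_homogeneous:
  assumes P: "real_polynomial_function P" and hom: "homogeneous m P"
  shows "dirD x P x = real m * P x"
proof -
  have 1: "((\<lambda>c::real. c *\<^sub>R x) has_derivative (\<lambda>h. h *\<^sub>R x)) (at 1)"
    by (auto intro!: derivative_eq_intros)
  have "((\<lambda>c. P (c *\<^sub>R x)) has_derivative (\<lambda>h. dirD (h *\<^sub>R x) P (1 *\<^sub>R x))) (at (1::real))"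
    using diff_chain_at[OF 1 has_derivative_dirD[OF P]]
    by (simp add: o_def)
  moreover have "((\<lambda>c::real. c ^ m * P x) has_derivative (\<lambda>h. real m * h * P x)) (at 1)"
    by (auto intro!: derivative_eq_intros)
  ultimately have "dirD (1 *\<^sub>R x) P (1 *\<^sub>R x) = real m * 1 * P x"
    using hom has_derivative_unique unfolding homogeneous_def by (metis (no_types, lifting) ext)
  then show ?thesis by simp
qed

section \<open>Integration by parts on the sphere\<close>

lemma integrable_sphere_continuous:
  fixes g :: "'a::euclidean_space \<Rightarrow> real"
  assumes "continuous_on UNIV g"
  shows "integrable sphere_measure g"
proof -
  interpret finite_measure "sphere_measure :: 'a measure" by (rule finite_measure_sphere_measure)
  have "compact (g ` sphere 0 1)" by (intro compact_continuous_image continuous_on_subset[OF assms]) auto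
  then obtain B where B: "\<And>x. x \<in> sphere 0 1 \<Longrightarrow> norm (g x) \<le> B"
    using compact_imp_bounded bounded_iff by (metis imageI)
  show ?thesis
    by (rule integrable_const_bound[of _ B])
      (use B assms in \<open>auto intro: measurable_sphere_measure_borel borel_measurable_continuous_onI\<close>)
qed

lemma integrable_sphere_polynomial:
  "real_polynomial_function P \<Longrightarrow> integrable sphere_measure P"
  by (intro integrable_sphere_continuous continuous_real_polynomial)

lemma integral_sphere_isometry:
  fixes U :: "'a::euclidean_space \<Rightarrow> 'a" and g :: "'a \<Rightarrow> real"
  assumes "linear U" "\<And>x. norm (U x) = norm x" and [measurable]: "g \<in> borel_measurable borel"
  shows "(\<integral>u. g (U u) \<partial>sphere_measure) = (\<integral>u. g u \<partial>sphere_measure)"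
proof -
  have sur: "range U = range (\<lambda>x. x)"
  proof -
    have "inj U" using assms(1,2) by (metis linear_injective_0 norm_eq_zero)
    then show ?thesis using assms(1) by (simp add: linear_injective_imp_surjective)
  qed
  have eq: "distr sphere_measure borel U = distr sphere_measure borel (\<lambda>x. x)"
    using assms sur by (intro distr_sphere_isometry) (auto simp: linear_id[unfolded id_def])
  have "(\<integral>u. g (U u) \<partial>sphere_measure) = (\<integral>u. g u \<partial>distr sphere_measure borel U)"
    by (rule integral_distr[symmetric]) (auto intro!: measurable_sphere_measure_borel borel_measurable_linear assms(1))
  also have "\<dots> = (\<integral>u. g u \<partial>sphere_measure)"
    unfolding eq by (rule integral_distr) (auto intro!: measurable_sphere_measure_borel)
  finally show ?thesis .
qed

text \<open>Differentiating the rotation invariance of the surface measure in the plane of i and j.\<close>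

lemma integral_sphere_rotation_field:
  fixes g :: "'a::euclidean_space \<Rightarrow> real"
  assumes g: "real_polynomial_function g" and ij: "i \<in> Basis" "j \<in> Basis" "i \<noteq> j"
  shows "(\<integral>u. (u \<bullet> i) * dirD j g u - (u \<bullet> j) * dirD i g u \<partial>sphere_measure) = 0"
proof -
  interpret finite_measure "sphere_measure :: 'a measure" by (rule finite_measure_sphere_measure)
  have b: "i \<bullet> i = 1" "j \<bullet> j = 1" "i \<bullet> j = 0" "j \<bullet> i = 0" using ij by (auto simp: inner_Basis)
  \<comment> \<open>Rotation by the angle s in the plane of i and j, written as the identity plus a
    correction so that the other coordinates stay put.\<close>
  define R where "R = (\<lambda>s x. x + ((cos s - 1) * (x \<bullet> i) - sin s * (x \<bullet> j)) *\<^sub>R i +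
      ((cos s - 1) * (x \<bullet> j) + sin s * (x \<bullet> i)) *\<^sub>R j)"
  define K where "K = (\<lambda>u. (u \<bullet> i) * dirD j g u - (u \<bullet> j) * dirD i g u)"
  have linR: "linear (R s)" for s
    by (rule linearI) (simp_all add: R_def algebra_simps)
  have Ri: "R s x \<bullet> i = cos s * (x \<bullet> i) - sin s * (x \<bullet> j)" and Rj: "R s x \<bullet> j = cos s * (x \<bullet> j) + sin s * (x \<bullet> i)" for s x
    by (simp_all add: R_def b inner_add_left algebra_simps)
  have nR: "norm (R s x) = norm x" for s x
  proof -
    define A where "A = (cos s - 1) * (x \<bullet> i) - sin s * (x \<bullet> j)"
    define B where "B = (cos s - 1) * (x \<bullet> j) + sin s * (x \<bullet> i)"
    have e1: "R s x \<bullet> R s x = x \<bullet> x + 2 * A * (x \<bullet> i) + 2 * B * (x \<bullet> j) + A\<^sup>2 + B\<^sup>2"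
      unfolding R_def A_def[symmetric] B_def[symmetric]
      by (simp add: b inner_add_left inner_add_right inner_commute algebra_simps power2_eq_square)
    have e2: "2 * A * (x \<bullet> i) + 2 * B * (x \<bullet> j) + A\<^sup>2 + B\<^sup>2 =
       ((sin s)\<^sup>2 + (cos s)\<^sup>2 - 1) * ((x \<bullet> i)\<^sup>2 + (x \<bullet> j)\<^sup>2)"
      unfolding A_def B_def by algebra
    have "R s x \<bullet> R s x = x \<bullet> x" using e1 e2 by simp
    then show ?thesis by (simp add: norm_eq_sqrt_inner)
  qed
  have polyK: "real_polynomial_function K" unfolding K_def
    by (intro real_polynomial_function_diff real_polynomial_function.intros(4) real_polynomial_dirD g
        real_polynomial_function.intros(1) bounded_linear_inner_left)
  have der: "((\<lambda>s. g (R s x)) has_real_derivative K (R s x)) (at s)" for s x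
  proof -
    have dR: "((\<lambda>s. R s x) has_vector_derivative ((- (R s x \<bullet> j)) *\<^sub>R i + (R s x \<bullet> i) *\<^sub>R j)) (at s)"
      unfolding Ri Rj unfolding R_def
      by (auto intro!: derivative_eq_intros simp: algebra_simps)
    have "((\<lambda>s. g (R s x)) has_derivative (\<lambda>h. dirD (h *\<^sub>R ((- (R s x \<bullet> j)) *\<^sub>R i + (R s x \<bullet> i) *\<^sub>R j)) g (R s x))) (at s)"
      using diff_chain_at[OF dR[unfolded has_vector_derivative_def] has_derivative_dirD[OF g]] by (simp add: o_def)
    also have "(\<lambda>h. dirD (h *\<^sub>R ((- (R s x \<bullet> j)) *\<^sub>R i + (R s x \<bullet> i) *\<^sub>R j)) g (R s x)) = (*) (K (R s x))"
      by (simp only: dirD_scale_direction[OF g] dirD_add_direction[OF g] K_def) (simp add: fun_eq_iff algebra_simps)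
    finally show ?thesis by (simp add: has_field_derivative_def)
  qed
  have "compact (K ` sphere 0 1)" by (intro compact_continuous_image continuous_real_polynomial polyK) auto
  then obtain C where C: "\<And>x. x \<in> sphere 0 1 \<Longrightarrow> norm (K x) \<le> C"
    using compact_imp_bounded bounded_iff by (metis imageI)
  \<comment> \<open>Difference quotients at angle 1 / (N + 1). Their integrals vanish by rotation
    invariance, the mean value theorem bounds them by the maximum of \<open>K\<close> on the sphere,
    and dominated convergence passes to \<open>K\<close>.\<close>
  define q where "q = (\<lambda>N u. (g (R (inverse (real (Suc N))) u) - g u) / inverse (real (Suc N)))"
  have lim: "(\<lambda>N. q N u) \<longlonglongrightarrow> K u" for u
  proof -
    have R0: "R 0 u = u" by (simp add: R_def)
    have "((\<lambda>h. (g (R (0 + h) u) - g (R 0 u)) / h) \<longlongrightarrow> K (R 0 u)) (at 0)"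
      using der[of u 0] by (simp add: DERIV_def)
    then have "((\<lambda>h. (g (R h u) - g u) / h) \<longlongrightarrow> K u) (at 0)" by (simp add: R0)
    moreover have "filterlim (\<lambda>N. inverse (real (Suc N))) (at 0) sequentially"
      using LIMSEQ_inverse_real_of_nat by (auto simp: filterlim_at)
    ultimately show ?thesis unfolding q_def by (rule filterlim_compose)
  qed
  have bound: "norm (q N u) \<le> C" if u: "u \<in> sphere 0 1" for N u
  proof -
    let ?s = "inverse (real (Suc N))"
    obtain z where "g (R ?s u) - g (R 0 u) = (?s - 0) * K (R z u)"
      using MVT2[of 0 ?s "\<lambda>s. g (R s u)" "\<lambda>s. K (R s u)"] der by auto
    then have "q N u = K (R z u)" unfolding q_def by (simp add: R_def)
    then show ?thesis using C[of "R z u"] u by (simp add: nR)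
  qed
  have gm: "g \<in> borel_measurable borel" by (intro borel_measurable_continuous_onI continuous_real_polynomial g)
  have qm: "q N \<in> borel_measurable sphere_measure" for N
    unfolding q_def
    by (intro measurable_sphere_measure_borel borel_measurable_divide borel_measurable_diff gm
        measurable_compose[OF borel_measurable_linear[OF linR] gm]) auto
  have int0: "(\<integral>u. q N u \<partial>sphere_measure) = 0" for N
  proof -
    have i1: "integrable sphere_measure g" by (rule integrable_sphere_polynomial[OF g])
    have i2: "integrable sphere_measure (\<lambda>u. g (R s u))" for s
      using linear_continuous_on[of "R s" UNIV] linR[of s]
      by (intro integrable_sphere_continuous continuous_on_compose2[OF continuous_real_polynomial[OF g, of UNIV]])
         (auto simp: linear_conv_bounded_linear)
    show ?thesis unfolding q_def
      using i1 i2 integral_sphere_isometry[OF linR nR gm] by simp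
  qed
  have "(\<lambda>N. \<integral>u. q N u \<partial>sphere_measure) \<longlonglongrightarrow> (\<integral>u. K u \<partial>sphere_measure)"
    by (rule integral_dominated_convergence[where w = "\<lambda>_. C"])
      (use lim bound qm in \<open>auto intro!: AE_I2 measurable_sphere_measure_borel borel_measurable_continuous_onI continuous_real_polynomial polyK\<close>)
  then show ?thesis unfolding int0 K_def by (simp add: LIMSEQ_const_iff)
qed

text \<open>Integration by parts: multiplication by a linear form is traded for a derivative. For a
  basis vector i, apply the rotation fields to (u . j) G and sum over j different from i; Euler's
  identity and |u| = 1 collapse the sum to (d + D - 1) (u . i) G minus the i-th derivative of
  G.\<close>

lemma integral_sphere_inner_homogeneous:
  fixes G :: "'a::euclidean_space \<Rightarrow> real"
  assumes G: "real_polynomial_function G" and hom: "homogeneous d G"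
  shows "(real d + real DIM('a) - 1) * (\<integral>u. (u \<bullet> a) * G u \<partial>sphere_measure) = (\<integral>u. dirD a G u \<partial>sphere_measure)"
proof -
  have lin: "real_polynomial_function (\<lambda>u. u \<bullet> b)" for b :: 'a
    by (rule real_polynomial_function.intros(1)) (rule bounded_linear_inner_left)
  note polys = real_polynomial_function.intros(4) real_polynomial_dirD G lin real_polynomial_function_diff real_polynomial_function_sum real_polynomial_function.intros(3) real_polynomial_function.intros(2)
  have basis: "(real d + real DIM('a) - 1) * (\<integral>u. (u \<bullet> i) * G u \<partial>sphere_measure) = (\<integral>u. dirD i G u \<partial>sphere_measure)"
    if i: "i \<in> Basis" for i :: 'a
  proof -
    define L where "L = (\<lambda>j u. (u \<bullet> i) * dirD j (\<lambda>u. (u \<bullet> j) * G u) u - (u \<bullet> j) * dirD i (\<lambda>u. (u \<bullet> j) * G u) u)"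
    have Lint: "integrable sphere_measure (L j)" for j
      unfolding L_def by (intro integrable_sphere_polynomial polys)
    have L0: "(\<integral>u. L j u \<partial>sphere_measure) = 0" if "j \<in> Basis - {i}" for j
      unfolding L_def using that i by (intro integral_sphere_rotation_field polys) auto
    have dl: "dirD c (\<lambda>u. (u \<bullet> j) * G u) u = (u \<bullet> j) * dirD c G u + (c \<bullet> j) * G u" for c j u :: 'a
      by (subst dirD_mult[OF lin G]) (simp add: dirD_linear[OF bounded_linear_inner_left])
    have pt: "(\<Sum>j\<in>Basis - {i}. L j u) = (real d + real DIM('a) - 1) * ((u \<bullet> i) * G u) - dirD i G u"
      if u: "u \<in> space sphere_measure" for u
    proof -
      have nu: "u \<bullet> u = 1" using u by (simp add: norm_eq_1)
      have Lj: "L j u = (u \<bullet> i) * ((u \<bullet> j) * dirD j G u) + (u \<bullet> i) * G u - (u \<bullet> j)\<^sup>2 * dirD i G u" if "j \<in> Basis - {i}" for j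
        using that i unfolding L_def dl by (auto simp: inner_Basis algebra_simps power2_eq_square)
      have "(\<Sum>j\<in>Basis - {i}. L j u) = (u \<bullet> i) * (\<Sum>j\<in>Basis - {i}. (u \<bullet> j) * dirD j G u)
          + real (card (Basis - {i})) * ((u \<bullet> i) * G u) - (\<Sum>j\<in>Basis - {i}. (u \<bullet> j)\<^sup>2) * dirD i G u"
        by (simp add: Lj sum.distrib sum_subtractf sum_distrib_left sum_distrib_right)
      also have "(\<Sum>j\<in>Basis - {i}. (u \<bullet> j) * dirD j G u) = real d * G u - (u \<bullet> i) * dirD i G u"
        using i dirD_sum_Basis[OF G, of u u] euler_homogeneous[OF G hom, of u] by (simp add: sum_diff1)
      also have "(\<Sum>j\<in>Basis - {i}. (u \<bullet> j)\<^sup>2) = 1 - (u \<bullet> i)\<^sup>2"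
      proof -
        have "(\<Sum>j\<in>Basis. (u \<bullet> j)\<^sup>2) = 1"
          using nu euclidean_inner[of u u] by (simp add: power2_eq_square)
        then show ?thesis using i by (simp add: sum_diff1)
      qed
      also have "real (card (Basis - {i})) = real DIM('a) - 1"
        using i DIM_positive[where 'a = 'a] by (simp add: card_Diff_singleton of_nat_diff)
      finally show ?thesis by (simp add: algebra_simps power2_eq_square)
    qed
    have "0 = (\<integral>u. (\<Sum>j\<in>Basis - {i}. L j u) \<partial>sphere_measure)"
      by (subst Bochner_Integration.integral_sum) (simp_all add: Lint L0)
    also have "\<dots> = (\<integral>u. (real d + real DIM('a) - 1) * ((u \<bullet> i) * G u) - dirD i G u \<partial>sphere_measure)"
      by (rule Bochner_Integration.integral_cong) (simp_all only: pt)
    also have "\<dots> = (real d + real DIM('a) - 1) * (\<integral>u. (u \<bullet> i) * G u \<partial>sphere_measure) - (\<integral>u. dirD i G u \<partial>sphere_measure)"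
    proof -
      have "integrable sphere_measure (\<lambda>u. (u \<bullet> i) * G u)" "integrable sphere_measure (dirD i G)"
        by (intro integrable_sphere_polynomial polys)+
      then show ?thesis by (subst Bochner_Integration.integral_diff) auto
    qed
    finally show ?thesis by simp
  qed
  \<comment> \<open>Both sides are linear in the direction, so the case of basis vectors extends to
    every a.\<close>
  have I1: "integrable sphere_measure (\<lambda>u. (u \<bullet> i) * G u)" and I2: "integrable sphere_measure (dirD i G)" for i
    by (intro integrable_sphere_polynomial polys)+
  have "(\<integral>u. (u \<bullet> a) * G u \<partial>sphere_measure) = (\<integral>u. (\<Sum>i\<in>Basis. (a \<bullet> i) * ((u \<bullet> i) * G u)) \<partial>sphere_measure)"
    by (subst euclidean_inner) (simp add: sum_distrib_left sum_distrib_right mult_ac)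
  also have "\<dots> = (\<Sum>i\<in>Basis. (a \<bullet> i) * (\<integral>u. (u \<bullet> i) * G u \<partial>sphere_measure))"
    by (subst Bochner_Integration.integral_sum) (simp_all add: I1)
  finally have "(real d + real DIM('a) - 1) * (\<integral>u. (u \<bullet> a) * G u \<partial>sphere_measure) =
      (\<Sum>i\<in>Basis. (a \<bullet> i) * ((real d + real DIM('a) - 1) * (\<integral>u. (u \<bullet> i) * G u \<partial>sphere_measure)))"
    by (simp add: sum_distrib_left mult_ac)
  also have "\<dots> = (\<Sum>i\<in>Basis. (a \<bullet> i) * (\<integral>u. dirD i G u \<partial>sphere_measure))" by (simp add: basis)
  also have "\<dots> = (\<integral>u. (\<Sum>i\<in>Basis. (a \<bullet> i) * dirD i G u) \<partial>sphere_measure)"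
    by (subst Bochner_Integration.integral_sum) (simp_all add: I2)
  also have "\<dots> = (\<integral>u. dirD a G u \<partial>sphere_measure)"
    by (subst dirD_sum_Basis[OF G, of a]) simp
  finally show ?thesis .
qed

section \<open>Funk--Hecke eigenvalues of power kernels\<close>

text \<open>The eigenvalue of the kernel (u . a)^l on harmonics of degree m in R^n. The first
  reciprocal Gamma vanishes for l < m of equal parity, as it must, since harmonics are orthogonal to
  polynomials of lower degree.\<close>

definition funk_hecke_coeff :: "nat \<Rightarrow> nat \<Rightarrow> nat \<Rightarrow> real" where
  "funk_hecke_coeff n l m = (if even (l + m) then 2 * pi powr (real n / 2) * fact l / 2^l *
     rGamma ((real l - real m)/2 + 1) * rGamma ((real l + real m + real n)/2) else 0)"

text \<open>The relation that \<open>integral_sphere_inner_homogeneous\<close> forces on the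
  eigenvalues, verified for the closed form.\<close>

lemma funk_hecke_coeff_recurrence:
  "(real l + real (Suc m) + real n - 1) * funk_hecke_coeff n (Suc l) (Suc m) =
    real l * funk_hecke_coeff n (l - 1) (Suc m) + real (Suc m) * funk_hecke_coeff n l m"
  "(real l + real n - 1) * funk_hecke_coeff n (Suc l) 0 = real l * funk_hecke_coeff n (l - 1) 0"
proof -
  \<comment> \<open>One formula for all l and m: wherever l - 1 or m - 1 is truncated, the factor in
    front is 0.\<close>
  have main: "(real l + real m + real n - 1) * funk_hecke_coeff n (Suc l) m =
    real l * funk_hecke_coeff n (l - 1) m + real m * funk_hecke_coeff n l (m - 1)" for m
  proof (cases "even (Suc l + m)")
    case True
    define A where "A = 2 * pi powr (real n / 2) * fact l / 2^l"
    define y where "y = (real (Suc l) - real m)/2"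
    define z where "z = (real l + real m + real n - 1)/2"
    have ry: "rGamma y = y * rGamma (y + 1)" and rz: "rGamma z = z * rGamma (z + 1)" by (simp_all add: rGamma_plus1)
    have L: "2 * funk_hecke_coeff n (Suc l) m = (real l + 1) * A * (rGamma (y + 1) * rGamma (z + 1))"
    proof -
      have e: "(real (Suc l) - real m)/2 + 1 = y + 1" "(real (Suc l) + real m + real n)/2 = z + 1"
        "fact (Suc l) = (real l + 1) * fact l" by (auto simp: y_def z_def field_simps)
      show ?thesis unfolding funk_hecke_coeff_def e A_def using True by simp
    qed
    have R1: "real l * funk_hecke_coeff n (l - 1) m = 2 * A * (rGamma y * rGamma z)"
    proof (cases l)
      case 0
      \<comment> \<open>For l = 0 the left side has the factor 0; the right side vanishes because m
        is odd, so that y is a nonpositive integer.\<close>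
      have "A * (rGamma y * rGamma z) = 0" if "\<not> False"
      proof -
        from True 0 have "odd m" by simp
        then obtain q where "m = 2 * q + 1" by (elim oddE)
        then have "y = - real q" by (simp add: y_def 0)
        then show ?thesis by (simp add: rGamma_eq_zero_iff)
      qed
      then show ?thesis by (simp add: 0)
    next
      case (Suc l')
      have "(real l' - real m)/2 + 1 = y" "(real l' + real m + real n)/2 = z"
        "fact l = (real l) * fact l'" by (auto simp: y_def z_def Suc field_simps)
      moreover have "even (l' + m)" using True Suc by simp
      ultimately show ?thesis unfolding funk_hecke_coeff_def A_def Suc by simp
    qed
    have R2: "real m * funk_hecke_coeff n l (m - 1) = real m * A * (rGamma (y + 1) * rGamma z)"
    proof (cases m)
      case (Suc m')
      have "(real l - real m')/2 + 1 = y + 1" "(real l + real m' + real n)/2 = z"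
        by (auto simp: y_def z_def Suc field_simps)
      moreover have "even (l + m')" using True Suc by simp
      ultimately show ?thesis unfolding funk_hecke_coeff_def A_def Suc by simp
    qed simp
    have "(real l + real m + real n - 1) * funk_hecke_coeff n (Suc l) m = z * (2 * funk_hecke_coeff n (Suc l) m)"
      by (simp add: z_def)
    also have "\<dots> = 2 * A * (rGamma y * rGamma z) + real m * A * (rGamma (y + 1) * rGamma z)"
      unfolding L ry rz by (simp add: y_def field_simps)
    finally show ?thesis unfolding R1 R2 .
  next
    case False
    then have "funk_hecke_coeff n (Suc l) m = 0" by (simp add: funk_hecke_coeff_def)
    moreover have "real l * funk_hecke_coeff n (l - 1) m = 0" using False by (cases l) (auto simp: funk_hecke_coeff_def)
    moreover have "real m * funk_hecke_coeff n l (m - 1) = 0" using False by (cases m) (auto simp: funk_hecke_coeff_def)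
    ultimately show ?thesis by (simp only: mult_zero_right add_0_right)
  qed
  from main[of "Suc m"] show "(real l + real (Suc m) + real n - 1) * funk_hecke_coeff n (Suc l) (Suc m) =
    real l * funk_hecke_coeff n (l - 1) (Suc m) + real (Suc m) * funk_hecke_coeff n l m" by simp
  from main[of 0] show "(real l + real n - 1) * funk_hecke_coeff n (Suc l) 0 = real l * funk_hecke_coeff n (l - 1) 0" by simp
qed

text \<open>Dimension times the volume of the unit ball, written as the eigenvalue for l = m = 0,
  which starts the Funk--Hecke induction.\<close>

lemma measure_sphere_measure:
  "measure (sphere_measure :: 'a::euclidean_space measure) (sphere 0 1) = 2 * pi powr (real DIM('a) / 2) * rGamma (real DIM('a) / 2)"
proof -
  let ?D = "DIM('a)"
  let ?S = "sphere_measure :: 'a measure"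
  have "emeasure ?S (sphere 0 1) = (\<integral>\<^sup>+u. 1 \<partial>?S)"
    using nn_integral_const[of ?S 1] by simp
  also have "\<dots> = of_nat ?D * emeasure lborel (cball 0 1 - {0::'a})"
    by (subst nn_integral_sphere_measure) auto
  also have "emeasure lborel (cball 0 1 - {0::'a}) = emeasure lborel (cball (0::'a) 1)"
    by (rule emeasure_Diff_null_set) (auto intro: finite_imp_null_set_lborel)
  also have "\<dots> = ennreal (unit_ball_vol ?D)" by (subst emeasure_cball) auto
  also have "of_nat ?D * ennreal (unit_ball_vol ?D) = ennreal (real ?D * unit_ball_vol ?D)"
    by (simp add: ennreal_mult ennreal_of_nat_eq_real_of_nat)
  finally have "measure ?S (sphere 0 1) = real ?D * unit_ball_vol ?D"
    by (simp add: measure_def)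
  also have "\<dots> = 2 * pi powr (real ?D / 2) * rGamma (real ?D / 2)"
  proof -
    have "unit_ball_vol ?D = pi powr (real ?D / 2) * rGamma (real ?D / 2 + 1)"
      unfolding unit_ball_vol_def rGamma_inverse_Gamma by (simp only: divide_inverse)
    moreover have "real ?D * (p * q) = 2 * p * (real ?D / 2 * q)" for p q :: real by simp
    ultimately show ?thesis by (simp only: rGamma_plus1)
  qed
  finally show ?thesis .
qed

definition harmonic_polynomial :: "('a::euclidean_space \<Rightarrow> real) \<Rightarrow> bool" where
  "harmonic_polynomial H \<longleftrightarrow> real_polynomial_function H \<and> (\<forall>x. (\<Sum>b\<in>Basis. dirD b (dirD b H) x) = 0)"

lemma harmonic_polynomial_dirD:
  assumes "harmonic_polynomial H"
  shows "harmonic_polynomial (dirD a H)"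
proof -
  have H: "real_polynomial_function H" and 0: "\<And>x. (\<Sum>b\<in>Basis. dirD b (dirD b H) x) = 0"
    using assms by (auto simp: harmonic_polynomial_def)
  have "(\<Sum>b\<in>Basis. dirD b (dirD b (dirD a H)) x) = 0" for x
  proof -
    have "((\<lambda>x. \<Sum>b\<in>Basis. dirD b (dirD b H) x) has_derivative (\<lambda>h. \<Sum>b\<in>Basis. dirD h (dirD b (dirD b H)) x)) (at x)"
      by (intro has_derivative_sum has_derivative_dirD real_polynomial_dirD H)
    then have "dirD a (\<lambda>x. \<Sum>b\<in>Basis. dirD b (dirD b H) x) x = (\<Sum>b\<in>Basis. dirD a (dirD b (dirD b H)) x)"
      by (rule dirD_eqI)
    then have "(\<Sum>b\<in>Basis. dirD a (dirD b (dirD b H)) x) = 0"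
      unfolding 0 using dirD_const[of a 0] by simp
    moreover have "dirD a (dirD b (dirD b H)) = dirD b (dirD b (dirD a H))" for b
      using dirD_commute[OF real_polynomial_dirD[OF H], of a b b] dirD_commute[OF H, of a b] by simp
    ultimately show ?thesis by simp
  qed
  then show ?thesis using real_polynomial_dirD[OF H] by (simp add: harmonic_polynomial_def)
qed

text \<open>By Euler's identity a multiple of H is the sum of (u . b) times the b-th derivative;
  integration by parts turns this sum into the Laplacian. D >= 2 keeps the constant in front
  positive.\<close>

lemma integral_sphere_harmonic_eq_0:
  fixes H :: "'a::euclidean_space \<Rightarrow> real"
  assumes harm: "harmonic_polynomial H" and hom: "homogeneous (Suc m) H" and D: "DIM('a) \<ge> 2"
  shows "(\<integral>u. H u \<partial>sphere_measure) = 0"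
proof -
  have H: "real_polynomial_function H" and 0: "\<And>x. (\<Sum>b\<in>Basis. dirD b (dirD b H) x) = 0"
    using harm by (auto simp: harmonic_polynomial_def)
  have lin: "real_polynomial_function (\<lambda>u. u \<bullet> b)" for b :: 'a
    by (rule real_polynomial_function.intros(1)) (rule bounded_linear_inner_left)
  let ?c = "real m + real DIM('a) - 1"
  have I: "integrable sphere_measure (\<lambda>u. (u \<bullet> b) * dirD b H u)" "integrable sphere_measure (dirD b (dirD b H))" for b
    by (intro integrable_sphere_polynomial real_polynomial_function.intros(4) lin real_polynomial_dirD H)+
  have "?c * (\<integral>u. real (Suc m) * H u \<partial>sphere_measure) = ?c * (\<integral>u. (\<Sum>b\<in>Basis. (u \<bullet> b) * dirD b H u) \<partial>sphere_measure)"
    by (simp only: euler_homogeneous[OF H hom, symmetric] dirD_sum_Basis[OF H, symmetric])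
  also have "\<dots> = (\<Sum>b\<in>Basis. ?c * (\<integral>u. (u \<bullet> b) * dirD b H u \<partial>sphere_measure))"
    by (subst Bochner_Integration.integral_sum) (simp_all add: I sum_distrib_left)
  also have "\<dots> = (\<Sum>b\<in>Basis. \<integral>u. dirD b (dirD b H) u \<partial>sphere_measure)"
    by (intro sum.cong refl integral_sphere_inner_homogeneous homogeneous_dirD real_polynomial_dirD H hom)
  also have "\<dots> = (\<integral>u. (\<Sum>b\<in>Basis. dirD b (dirD b H) u) \<partial>sphere_measure)"
    by (subst Bochner_Integration.integral_sum) (simp_all add: I)
  also have "\<dots> = 0" by (simp add: 0)
  finally show ?thesis using D by simp
qed

text \<open>Induction on l. Split off one factor (u . a), integrate by parts, and use the product
  rule with a . a = 1: the results are the case l - 2 for H and the case l - 1 for the derivative of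
  H along a, again harmonic of degree m - 1. At the point a that derivative equals m H(a) by Euler,
  so both terms are multiples of H(a).\<close>

theorem funk_hecke_power:
  fixes H :: "'a::euclidean_space \<Rightarrow> real"
  assumes D: "DIM('a) \<ge> 2" and a: "norm a = 1"
    and "harmonic_polynomial H" "homogeneous m H"
  shows "(\<integral>u. (u \<bullet> a) ^ l * H u \<partial>sphere_measure) = funk_hecke_coeff DIM('a) l m * H a"
  using assms(3,4)
proof (induction l arbitrary: m H rule: less_induct)
  case (less l)
  let ?n = "DIM('a)"
  have H: "real_polynomial_function H" using less.prems by (simp add: harmonic_polynomial_def)
  have lin: "real_polynomial_function (\<lambda>u. u \<bullet> b)" for b :: 'a
    by (rule real_polynomial_function.intros(1)) (rule bounded_linear_inner_left)
  have aa: "a \<bullet> a = 1" using a by (simp add: norm_eq_1)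
  show ?case
  proof (cases l)
    case 0
    show ?thesis
    proof (cases m)
      case m: 0
      have "(\<integral>u. H u \<partial>sphere_measure) = (\<integral>u. H a \<partial>(sphere_measure :: 'a measure))"
        using homogeneous_0_const[OF less.prems(2)[unfolded m]] by (metis (no_types))
      also have "\<dots> = measure (sphere_measure :: 'a measure) (sphere 0 1) * H a" by simp
      finally show ?thesis unfolding measure_sphere_measure by (simp add: 0 m funk_hecke_coeff_def)
    next
      case m: (Suc m')
      have "funk_hecke_coeff ?n 0 m = 0"
      proof (cases "even m")
        case True
        then obtain q where "m = 2 * q" by (elim evenE)
        with m obtain q' where "m = 2 * Suc q'" by (cases q) auto
        then have "(real 0 - real m)/2 + 1 = - real q'" by (simp add: field_simps)
        then show ?thesis unfolding funk_hecke_coeff_def by (simp add: rGamma_eq_zero_iff)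
      qed (simp add: funk_hecke_coeff_def)
      then show ?thesis using integral_sphere_harmonic_eq_0[OF less.prems(1) less.prems(2)[unfolded m] D] by (simp add: 0)
    qed
  next
    case (Suc l')
    define G where "G = (\<lambda>u. (u \<bullet> a) ^ l' * H u)"
    have G: "real_polynomial_function G" unfolding G_def
      by (intro real_polynomial_function.intros(4) real_polynomial_function_power lin H)
    have homG: "homogeneous (l' + m) G"
      using less.prems(2) by (simp add: homogeneous_def G_def power_add power_mult_distrib mult_ac)
    have dG: "dirD a G u = real l' * ((u \<bullet> a) ^ (l' - 1) * H u) + (u \<bullet> a) ^ l' * dirD a H u" for u
    proof -
      have "dirD a (\<lambda>u. (u \<bullet> a) ^ l') u = real l' * (u \<bullet> a) ^ (l' - 1)"
        by (cases l') (simp_all add: dirD_const dirD_power[OF lin] dirD_linear[OF bounded_linear_inner_left] aa del: power_Suc)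
      then show ?thesis unfolding G_def
        by (subst dirD_mult[OF real_polynomial_function_power[OF lin] H]) simp
    qed
    have pos: "real l' + real m + real ?n - 1 > 0" using D by simp
    have "(real l' + real m + real ?n - 1) * (\<integral>u. (u \<bullet> a) ^ l * H u \<partial>sphere_measure) =
      (real (l' + m) + real ?n - 1) * (\<integral>u. (u \<bullet> a) * G u \<partial>sphere_measure)"
      by (simp add: G_def Suc mult_ac)
    also have "\<dots> = (\<integral>u. dirD a G u \<partial>sphere_measure)"
      by (rule integral_sphere_inner_homogeneous[OF G homG])
    also have "\<dots> = real l' * (\<integral>u. (u \<bullet> a) ^ (l' - 1) * H u \<partial>sphere_measure) + (\<integral>u. (u \<bullet> a) ^ l' * dirD a H u \<partial>sphere_measure)"
    proof -
      have "integrable sphere_measure (\<lambda>u. (u \<bullet> a) ^ (l' - 1) * H u)" "integrable sphere_measure (\<lambda>u. (u \<bullet> a) ^ l' * dirD a H u)"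
        by (intro integrable_sphere_polynomial real_polynomial_function.intros(4) real_polynomial_function_power lin H real_polynomial_dirD)+
      then show ?thesis unfolding dG by simp
    qed
    also have "real l' * (\<integral>u. (u \<bullet> a) ^ (l' - 1) * H u \<partial>sphere_measure) = real l' * (funk_hecke_coeff ?n (l' - 1) m * H a)"
      using less.IH[OF _ less.prems, of "l' - 1"] Suc by simp
    finally have eq: "(real l' + real m + real ?n - 1) * (\<integral>u. (u \<bullet> a) ^ l * H u \<partial>sphere_measure) =
      real l' * (funk_hecke_coeff ?n (l' - 1) m * H a) + (\<integral>u. (u \<bullet> a) ^ l' * dirD a H u \<partial>sphere_measure)" .
    have "(real l' + real m + real ?n - 1) * (\<integral>u. (u \<bullet> a) ^ l * H u \<partial>sphere_measure) =
      (real l' + real m + real ?n - 1) * (funk_hecke_coeff ?n l m * H a)"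
    proof (cases m)
      case m: 0
      have "dirD a H u = 0" for u using less.prems(2) dirD_homogeneous_0 unfolding m by blast
      then show ?thesis unfolding eq using funk_hecke_coeff_recurrence(2)[of l' ?n] by (simp add: m Suc mult.assoc[symmetric])
    next
      case m: (Suc m')
      have hom': "homogeneous m' (dirD a H)" using homogeneous_dirD[OF H] less.prems(2) unfolding m by blast
      have "(\<integral>u. (u \<bullet> a) ^ l' * dirD a H u \<partial>sphere_measure) = funk_hecke_coeff ?n l' m' * dirD a H a"
        by (rule less.IH[OF _ harmonic_polynomial_dirD[OF less.prems(1)] hom']) (simp add: Suc)
      also have "dirD a H a = real m * H a" by (rule euler_homogeneous[OF H less.prems(2)])
      finally show ?thesis unfolding eq
        using funk_hecke_coeff_recurrence(1)[of l' m' ?n] unfolding m Suc by algebra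
    qed
    then show ?thesis using pos by simp
  qed
qed

text \<open>Passes from \<open>laplacian\<close>, which iterates \<open>deriv\<close> along
  coordinate lines, to iterated \<open>dirD\<close>, for which the calculus above is
  available.\<close>

lemma spherical_harmonic_polynomial:
  fixes Y :: "real^'n \<Rightarrow> real"
  assumes "spherical_harmonic m Y"
  obtains H where "harmonic_polynomial H" "homogeneous m H" "\<And>u. norm u = 1 \<Longrightarrow> Y u = H u"
proof -
  obtain P where P: "real_polynomial_function P" "\<forall>c x. P (c *\<^sub>R x) = c ^ m * P x" "\<forall>x. laplacian P x = 0"
    "\<forall>\<theta>\<in>sphere 0 1. Y \<theta> = P \<theta>" using assms unfolding spherical_harmonic_def by blast
  have line: "deriv (\<lambda>s. Q (x + s *\<^sub>R b)) = (\<lambda>s. dirD b Q (x + s *\<^sub>R b))" if Q: "real_polynomial_function Q" for Q :: "real^'n \<Rightarrow> real" and x b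
  proof
    fix s
    have "((\<lambda>s. x + s *\<^sub>R b) has_derivative (\<lambda>h. h *\<^sub>R b)) (at s)"
      by (auto intro!: derivative_eq_intros)
    from diff_chain_at[OF this has_derivative_dirD[OF Q]]
    have "((\<lambda>s. Q (x + s *\<^sub>R b)) has_derivative (\<lambda>h. dirD (h *\<^sub>R b) Q (x + s *\<^sub>R b))) (at s)"
      by (simp add: o_def)
    also have "(\<lambda>h. dirD (h *\<^sub>R b) Q (x + s *\<^sub>R b)) = (*) (dirD b Q (x + s *\<^sub>R b))"
      by (simp add: dirD_scale_direction[OF Q] fun_eq_iff)
    finally show "deriv (\<lambda>s. Q (x + s *\<^sub>R b)) s = dirD b Q (x + s *\<^sub>R b)"
      by (intro DERIV_imp_deriv) (simp add: has_field_derivative_def)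
  qed
  have "laplacian P x = (\<Sum>b\<in>Basis. dirD b (dirD b P) x)" for x
  proof -
    have "laplacian P x = (\<Sum>i\<in>UNIV. dirD (axis i 1) (dirD (axis i 1) P) x)"
      unfolding laplacian_def
      by (simp add: line[OF P(1)] line[OF real_polynomial_dirD[OF P(1)]])
    also have "\<dots> = (\<Sum>b\<in>Basis. dirD b (dirD b P) x)"
      by (rule sum.reindex_bij_betw[where h = "\<lambda>i. axis i 1"])
        (auto simp: bij_betw_def inj_on_def axis_eq_axis Basis_vec_def)
    finally show ?thesis .
  qed
  with P(1,3) have "harmonic_polynomial P" by (simp add: harmonic_polynomial_def)
  moreover have "homogeneous m P" using P(2) by (simp add: homogeneous_def)
  moreover have "Y u = P u" if "norm u = 1" for u using P(4) that by simp
  ultimately show ?thesis by (rule that)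
qed

section \<open>Moments and orthonormal systems\<close>

text \<open>The class of functions integrating to zero against h grows from polynomials to
  continuous functions (Weierstrass on the compact support) and to indicators of rays. Hence the
  positive and negative parts of h define finite measures agreeing on rays, so they are
  equal.\<close>

lemma moments_zero_imp_AE_zero:
  fixes h :: "real \<Rightarrow> real"
  assumes h: "integrable lborel h" and supp: "\<And>t. t \<notin> {a..b} \<Longrightarrow> h t = 0"
    and mom: "\<And>l::nat. (\<integral>t. t ^ l * h t \<partial>lborel) = 0"
  shows "AE t in lborel. h t = 0"
proof -
  have hm[measurable]: "h \<in> borel_measurable borel" using h by simp
  have bint: "integrable lborel (\<lambda>t. g t * h t)" if "continuous_on UNIV g" for g
  proof -
    have [measurable]: "g \<in> borel_measurable borel" using that by (rule borel_measurable_continuous_onI)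
    have "compact (g ` {a..b})" by (intro compact_continuous_image continuous_on_subset[OF that]) auto
    then obtain B where B: "\<And>x. x \<in> {a..b} \<Longrightarrow> norm (g x) \<le> B"
      using compact_imp_bounded bounded_iff by (metis imageI)
    show ?thesis
    proof (rule Bochner_Integration.integrable_bound[of lborel "\<lambda>t. B * h t"])
      show "AE t in lborel. norm (g t * h t) \<le> norm (B * h t)"
      proof (rule AE_I2)
        fix t
        show "norm (g t * h t) \<le> norm (B * h t)"
        proof (cases "t \<in> {a..b}")
          case True
          then have "\<bar>g t\<bar> \<le> \<bar>B\<bar>" using B[OF True] by simp
          then show ?thesis by (simp add: abs_mult mult_right_mono)
        qed (simp add: supp)
      qed
    qed (use h in auto)
  qed
  have poly: "(\<integral>t. p t * h t \<partial>lborel) = 0" if p: "real_polynomial_function p" for p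
  proof -
    obtain c n where p: "p = (\<lambda>x. \<Sum>i\<le>n. c i * x ^ i)"
      using p real_polynomial_function_iff_sum by blast
    have "(\<integral>t. p t * h t \<partial>lborel) = (\<integral>t. (\<Sum>i\<le>n. c i * (t ^ i * h t)) \<partial>lborel)"
      unfolding p by (simp add: sum_distrib_right mult.assoc)
    also have "\<dots> = (\<Sum>i\<le>n. c i * (\<integral>t. t ^ i * h t \<partial>lborel))"
      by (subst Bochner_Integration.integral_sum) (auto intro!: bint continuous_intros)
    finally show ?thesis by (simp add: mom)
  qed
  have cont: "(\<integral>t. g t * h t \<partial>lborel) = 0" if g: "continuous_on UNIV g" for g
  proof -
    define H where "H = (\<integral>t. \<bar>h t\<bar> \<partial>lborel)"
    have H0: "H \<ge> 0" by (simp add: H_def)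
    have le: "\<bar>\<integral>t. g t * h t \<partial>lborel\<bar> \<le> e * H" if e: "e > 0" for e
    proof -
      obtain p where p: "real_polynomial_function p" "\<And>x. x \<in> {a..b} \<Longrightarrow> \<bar>g x - p x\<bar> < e"
        using Stone_Weierstrass_real_polynomial_function[OF compact_Icc continuous_on_subset[OF g subset_UNIV] e] by blast
      note ip = bint[OF continuous_real_polynomial[OF p(1)]] and ig = bint[OF g]
      have "(\<integral>t. g t * h t \<partial>lborel) = (\<integral>t. g t * h t - p t * h t \<partial>lborel)"
        by (subst Bochner_Integration.integral_diff[OF ig ip]) (simp add: poly[OF p(1)])
      also have "\<bar>\<dots>\<bar> \<le> (\<integral>t. \<bar>g t * h t - p t * h t\<bar> \<partial>lborel)" by (rule integral_abs_bound)
      also have "\<dots> \<le> (\<integral>t. e * \<bar>h t\<bar> \<partial>lborel)"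
      proof (rule integral_mono)
        show "integrable lborel (\<lambda>t. \<bar>g t * h t - p t * h t\<bar>)" using ip ig by auto
        show "integrable lborel (\<lambda>t. e * \<bar>h t\<bar>)" using h by auto
        fix t
        show "\<bar>g t * h t - p t * h t\<bar> \<le> e * \<bar>h t\<bar>"
        proof (cases "t \<in> {a..b}")
          case True
          have "\<bar>g t * h t - p t * h t\<bar> = \<bar>g t - p t\<bar> * \<bar>h t\<bar>" by (simp add: abs_mult[symmetric] algebra_simps)
          then show ?thesis using p(2)[OF True] by (simp add: mult_right_mono)
        qed (simp add: supp)
      qed
      finally show ?thesis by (simp add: H_def)
    qed
    show ?thesis
    proof (rule ccontr)
      assume n: "(\<integral>t. g t * h t \<partial>lborel) \<noteq> 0"
      define J where "J = \<bar>\<integral>t. g t * h t \<partial>lborel\<bar>"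
      have J: "J > 0" using n by (simp add: J_def)
      \<comment> \<open>This choice of e gives e H < J also when H = 0.\<close>
      have "J \<le> J / (2 * (H + 1)) * H" unfolding J_def using J H0 by (intro le) (simp add: J_def)
      also have "\<dots> < J" using J H0 by (simp add: field_simps add_nonneg_pos)
      finally show False by simp
    qed
  qed
  have ray: "(\<integral>t. indicator {x<..} t * h t \<partial>lborel) = 0" for x
  proof -
    \<comment> \<open>Ramps with values in [0, 1], rising from x with slope k: continuous, and
      convergent to the indicator of the ray.\<close>
    define g where "g = (\<lambda>k t. max 0 (min 1 (real k * (t - x))))"
    have "(\<lambda>k. \<integral>t. g k t * h t \<partial>lborel) \<longlonglongrightarrow> (\<integral>t. indicator {x<..} t * h t \<partial>lborel)"
    proof (rule integral_dominated_convergence[where w = "\<lambda>t. \<bar>h t\<bar>"])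
      show "integrable lborel (\<lambda>t. \<bar>h t\<bar>)" using h by auto
      show "AE t in lborel. (\<lambda>k. g k t * h t) \<longlonglongrightarrow> indicator {x<..} t * h t"
      proof (rule AE_I2)
        fix t
        have "(\<lambda>k. g k t) \<longlonglongrightarrow> indicator {x<..} t"
        proof (cases "t > x")
          case True
          obtain N where N: "real N * (t - x) > 1" using True by (meson diff_gt_0_iff_gt ex_less_of_nat_mult)
          have "g k t = 1" if "k \<ge> N" for k
          proof -
            have "real N * (t - x) \<le> real k * (t - x)" using that True by (intro mult_right_mono) auto
            then show ?thesis using N by (simp add: g_def)
          qed
          then have "eventually (\<lambda>k. g k t = indicator {x<..} t) sequentially"
            using True by (auto simp: eventually_sequentially)
          then show ?thesis by (rule tendsto_eventually)
        next
          case False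
          have "g k t = 0" for k
          proof -
            have "real k * (t - x) \<le> 0" using False by (simp add: mult_nonneg_nonpos)
            then show ?thesis by (simp add: g_def)
          qed
          then show ?thesis using False by simp
        qed
        then show "(\<lambda>k. g k t * h t) \<longlonglongrightarrow> indicator {x<..} t * h t" by (rule tendsto_mult_right)
      qed
      show "AE t in lborel. norm (g k t * h t) \<le> \<bar>h t\<bar>" for k
      proof (rule AE_I2)
        fix t
        have "\<bar>g k t\<bar> \<le> 1" by (simp add: g_def)
        then have "\<bar>g k t\<bar> * \<bar>h t\<bar> \<le> 1 * \<bar>h t\<bar>" by (rule mult_right_mono) simp
        then show "norm (g k t * h t) \<le> \<bar>h t\<bar>" by (simp add: abs_mult)
      qed
    qed (simp_all add: g_def)
    moreover have "(\<integral>t. g k t * h t \<partial>lborel) = 0" for k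
      unfolding g_def by (intro cont continuous_intros)
    ultimately show ?thesis by (simp add: LIMSEQ_const_iff)
  qed
  \<comment> \<open>\<open>ennreal\<close> truncates negative numbers to 0, so these densities are
    the positive and the negative part of h.\<close>
  let ?P = "density lborel (\<lambda>t. ennreal (h t))" and ?N = "density lborel (\<lambda>t. ennreal (- h t))"
  have em: "emeasure (density lborel (\<lambda>t. ennreal (k t))) A = ennreal (\<integral>t. indicator A t * max 0 (k t) \<partial>lborel)"
    if A[measurable]: "A \<in> sets borel" and k: "integrable lborel k" for k :: "real \<Rightarrow> real" and A
  proof -
    have [measurable]: "k \<in> borel_measurable borel" using k by simp
    have "emeasure (density lborel (\<lambda>t. ennreal (k t))) A = (\<integral>\<^sup>+t. ennreal (indicator A t * max 0 (k t)) \<partial>lborel)"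
      by (subst emeasure_density) (auto intro!: nn_integral_cong simp: indicator_def max_def ennreal_neg)
    also have "\<dots> = ennreal (\<integral>t. indicator A t * max 0 (k t) \<partial>lborel)"
    proof (rule nn_integral_eq_integral)
      show "integrable lborel (\<lambda>t. indicator A t * max 0 (k t))"
        by (rule Bochner_Integration.integrable_bound[OF k]) (auto simp: indicator_def)
    qed (simp add: indicator_def)
    finally show ?thesis .
  qed
  have "?P = ?N"
  proof (rule measure_eqI_lessThan)
    fix x :: real
    have nh: "integrable lborel (\<lambda>t. - h t)" using h by simp
    show "emeasure ?P {x<..} < \<infinity>" by (subst em[OF _ h]) auto
    have ii: "integrable lborel (\<lambda>t. indicator {x<..} t * max 0 (k t))" if k: "integrable lborel k" for k :: "real \<Rightarrow> real"
    proof -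
      have [measurable]: "k \<in> borel_measurable borel" using k by simp
      show ?thesis by (rule Bochner_Integration.integrable_bound[OF k]) (auto simp: indicator_def)
    qed
    have "(\<integral>t. indicator {x<..} t * max 0 (h t) \<partial>lborel) - (\<integral>t. indicator {x<..} t * max 0 (- h t) \<partial>lborel) =
      (\<integral>t. indicator {x<..} t * h t \<partial>lborel)"
      by (subst Bochner_Integration.integral_diff[OF ii[OF h] ii[OF nh], symmetric])
         (auto intro!: Bochner_Integration.integral_cong simp: indicator_def)
    then have "(\<integral>t. indicator {x<..} t * max 0 (h t) \<partial>lborel) = (\<integral>t. indicator {x<..} t * max 0 (- h t) \<partial>lborel)"
      unfolding ray by simp
    then show "emeasure ?P {x<..} = emeasure ?N {x<..}" by (subst (1 2) em) (auto simp: h nh)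
  qed auto
  then have "AE t in lborel. ennreal (h t) = ennreal (- h t)"
    by (intro sigma_finite_measure.density_unique[OF sigma_finite_lborel]) auto
  then show ?thesis
  proof eventually_elim
    case (elim t)
    \<comment> \<open>At each point one of the two parts is zero; if they agree, both are.\<close>
    then show ?case by (cases "h t" "0 :: real" rule: linorder_cases) (auto simp: ennreal_neg)
  qed
qed

section \<open>Square-integrable functions and orthonormal expansions\<close>

lemma integrable_mult_square:
  fixes f g :: "'a \<Rightarrow> real"
  assumes [measurable]: "f \<in> borel_measurable M" "g \<in> borel_measurable M"
    and "integrable M (\<lambda>x. (f x)\<^sup>2)" "integrable M (\<lambda>x. (g x)\<^sup>2)"
  shows "integrable M (\<lambda>x. f x * g x)"
proof (rule Bochner_Integration.integrable_bound[of M "\<lambda>x. (f x)\<^sup>2 + (g x)\<^sup>2"])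
  show "AE x in M. norm (f x * g x) \<le> norm ((f x)\<^sup>2 + (g x)\<^sup>2)"
  proof (rule AE_I2)
    fix x
    have "0 \<le> (\<bar>f x\<bar> - \<bar>g x\<bar>)\<^sup>2" by simp
    then have "2 * (\<bar>f x\<bar> * \<bar>g x\<bar>) \<le> (f x)\<^sup>2 + (g x)\<^sup>2" by (simp add: power2_eq_square algebra_simps)
    moreover have "0 \<le> \<bar>f x\<bar> * \<bar>g x\<bar>" by simp
    ultimately have "\<bar>f x * g x\<bar> \<le> (f x)\<^sup>2 + (g x)\<^sup>2" unfolding abs_mult by linarith
    then show "norm (f x * g x) \<le> norm ((f x)\<^sup>2 + (g x)\<^sup>2)" by simp
  qed
qed (use assms in auto)

text \<open>Cauchy--Schwarz from the nonnegative quadratic s -> integral of (s f + g)^2, evaluated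
  at its minimum.\<close>

lemma integral_mult_square_bound:
  fixes f g :: "'a \<Rightarrow> real"
  assumes [measurable]: "f \<in> borel_measurable M" "g \<in> borel_measurable M"
    and f: "integrable M (\<lambda>x. (f x)\<^sup>2)" and g: "integrable M (\<lambda>x. (g x)\<^sup>2)"
  shows "(\<integral>x. f x * g x \<partial>M)\<^sup>2 \<le> (\<integral>x. (f x)\<^sup>2 \<partial>M) * (\<integral>x. (g x)\<^sup>2 \<partial>M)"
proof -
  let ?A = "\<integral>x. (f x)\<^sup>2 \<partial>M" and ?B = "\<integral>x. f x * g x \<partial>M" and ?C = "\<integral>x. (g x)\<^sup>2 \<partial>M"
  note fg = integrable_mult_square[OF assms]
  have q: "0 \<le> ?A * s\<^sup>2 + 2 * ?B * s + ?C" for s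
  proof -
    have "0 \<le> (\<integral>x. (s * f x + g x)\<^sup>2 \<partial>M)" by (intro integral_nonneg_AE) simp
    also have "\<dots> = (\<integral>x. s\<^sup>2 * (f x)\<^sup>2 + 2 * s * (f x * g x) + (g x)\<^sup>2 \<partial>M)"
      by (intro Bochner_Integration.integral_cong) (auto simp: power2_eq_square algebra_simps)
    also have "\<dots> = s\<^sup>2 * ?A + 2 * s * ?B + ?C" using f g fg by simp
    finally show ?thesis by (simp add: mult_ac)
  qed
  have A0: "?A \<ge> 0" and C0: "?C \<ge> 0" by simp_all
  show ?thesis
  proof (cases "?A = 0")
    case True
    have "?B = 0"
    proof (rule ccontr)
      assume B: "?B \<noteq> 0"
      \<comment> \<open>If the quadratic term is absent, a nonzero slope would make the remaining
        affine function equal to -1 at this s.\<close>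
      have "2 * ?B * (- (?C + 1) / (2 * ?B)) = - (?C + 1)" using B by simp
      then show False using q[of "- (?C + 1) / (2 * ?B)"] True by simp
    qed
    then show ?thesis using A0 C0 by simp
  next
    case False
    then have A: "?A > 0" using A0 by linarith
    have "?A * (- ?B / ?A)\<^sup>2 + 2 * ?B * (- ?B / ?A) + ?C = ?C - ?B\<^sup>2 / ?A"
      using A by (simp add: power2_eq_square field_simps)
    then have "?B\<^sup>2 / ?A \<le> ?C" using q[of "- ?B / ?A"] by simp
    then show ?thesis using A by (simp add: field_simps)
  qed
qed

text \<open>The inner product is unweighted; square roots of the weights are absorbed into the
  functions, so one theory serves both the half sphere and the cylinder.\<close>

locale orthonormal_system =
  fixes M :: "'a measure" and e :: "'i \<Rightarrow> 'a \<Rightarrow> real" and I :: "'i set"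
  assumes e_measurable [measurable]: "i \<in> I \<Longrightarrow> e i \<in> borel_measurable M"
    and e_square: "i \<in> I \<Longrightarrow> integrable M (\<lambda>x. (e i x)\<^sup>2)"
    and e_orth: "i \<in> I \<Longrightarrow> j \<in> I \<Longrightarrow> (\<integral>x. e i x * e j x \<partial>M) = (if i = j then 1 else 0)"
begin

lemma sum_square_integrable:
  assumes "S \<subseteq> I"
  shows "(\<lambda>x. \<Sum>i\<in>S. c i * e i x) \<in> borel_measurable M" "integrable M (\<lambda>x. (\<Sum>i\<in>S. c i * e i x)\<^sup>2)"
    "(\<integral>x. (\<Sum>i\<in>S. c i * e i x)\<^sup>2 \<partial>M) = (\<Sum>i\<in>S. (c i)\<^sup>2)"
proof -
  have e': "i \<in> S \<Longrightarrow> e i \<in> borel_measurable M" for i using assms by (auto intro: e_measurable)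
  show "(\<lambda>x. \<Sum>i\<in>S. c i * e i x) \<in> borel_measurable M"
    by (intro borel_measurable_sum borel_measurable_times borel_measurable_const e')
  have sq: "(\<Sum>i\<in>S. c i * e i x)\<^sup>2 = (\<Sum>i\<in>S. \<Sum>j\<in>S. c i * c j * (e i x * e j x))" for x
    by (simp add: power2_eq_square sum_product mult_ac)
  have int: "integrable M (\<lambda>x. c i * c j * (e i x * e j x))" if "i \<in> S" "j \<in> S" for i j
    using that assms by (intro integrable_mult_right integrable_mult_square e_measurable e_square) auto
  show "integrable M (\<lambda>x. (\<Sum>i\<in>S. c i * e i x)\<^sup>2)"
    unfolding sq by (intro Bochner_Integration.integrable_sum int)
  have "(\<integral>x. (\<Sum>i\<in>S. c i * e i x)\<^sup>2 \<partial>M) = (\<Sum>i\<in>S. \<Sum>j\<in>S. \<integral>x. c i * c j * (e i x * e j x) \<partial>M)"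
    unfolding sq by (subst Bochner_Integration.integral_sum, intro Bochner_Integration.integrable_sum int, assumption+,
        intro sum.cong refl Bochner_Integration.integral_sum int)
  also have "\<dots> = (\<Sum>i\<in>S. \<Sum>j\<in>S. if i = j then c i * c j else 0)"
    using assms by (intro sum.cong refl) (auto simp: e_orth subset_iff)
  also have "\<dots> = (\<Sum>i\<in>S. (c i)\<^sup>2)"
    by (cases "finite S") (simp_all add: power2_eq_square sum.delta)
  finally show "(\<integral>x. (\<Sum>i\<in>S. c i * e i x)\<^sup>2 \<partial>M) = (\<Sum>i\<in>S. (c i)\<^sup>2)" .
qed

lemma integral_sum_mult:
  assumes "S \<subseteq> I" and f: "f \<in> borel_measurable M" "integrable M (\<lambda>x. (f x)\<^sup>2)"
  shows "(\<integral>x. (\<Sum>i\<in>S. c i * e i x) * f x \<partial>M) = (\<Sum>i\<in>S. c i * (\<integral>x. f x * e i x \<partial>M))"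
proof -
  have "integrable M (\<lambda>x. c i * (f x * e i x))" if "i \<in> S" for i
    using that assms by (intro integrable_mult_right integrable_mult_square e_measurable e_square f) auto
  note int = this
  have "(\<integral>x. (\<Sum>i\<in>S. c i * e i x) * f x \<partial>M) = (\<integral>x. (\<Sum>i\<in>S. c i * (f x * e i x)) \<partial>M)"
    by (simp add: sum_distrib_right sum_distrib_left mult_ac)
  also have "\<dots> = (\<Sum>i\<in>S. \<integral>x. c i * (f x * e i x) \<partial>M)"
    by (rule Bochner_Integration.integral_sum) (rule int)
  finally show ?thesis by simp
qed

lemma bessel_identity:
  assumes "finite S" "S \<subseteq> I" and f: "f \<in> borel_measurable M" "integrable M (\<lambda>x. (f x)\<^sup>2)"
  defines "c \<equiv> \<lambda>i. \<integral>x. f x * e i x \<partial>M"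
  shows "integrable M (\<lambda>x. ((\<Sum>i\<in>S. c i * e i x) - f x)\<^sup>2)"
    "(\<integral>x. ((\<Sum>i\<in>S. c i * e i x) - f x)\<^sup>2 \<partial>M) = (\<integral>x. (f x)\<^sup>2 \<partial>M) - (\<Sum>i\<in>S. (c i)\<^sup>2)"
proof -
  let ?g = "\<lambda>x. \<Sum>i\<in>S. c i * e i x"
  note g = sum_square_integrable[OF assms(2), of c]
  have gf: "integrable M (\<lambda>x. ?g x * f x)" by (rule integrable_mult_square[OF g(1) f(1) g(2) f(2)])
  have sq: "(?g x - f x)\<^sup>2 = (?g x)\<^sup>2 - 2 * (?g x * f x) + (f x)\<^sup>2" for x
    by (simp add: power2_eq_square algebra_simps)
  show "integrable M (\<lambda>x. (?g x - f x)\<^sup>2)"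
    unfolding sq using g(2) gf f(2) by (intro Bochner_Integration.integrable_add Bochner_Integration.integrable_diff integrable_mult_right)
  have "(\<integral>x. (?g x - f x)\<^sup>2 \<partial>M) = (\<integral>x. (?g x)\<^sup>2 \<partial>M) - 2 * (\<integral>x. ?g x * f x \<partial>M) + (\<integral>x. (f x)\<^sup>2 \<partial>M)"
    unfolding sq using g(2) gf f(2) by simp
  also have "(\<integral>x. ?g x * f x \<partial>M) = (\<Sum>i\<in>S. (c i)\<^sup>2)"
    unfolding integral_sum_mult[OF assms(2) f] by (simp add: c_def power2_eq_square)
  finally show "(\<integral>x. (?g x - f x)\<^sup>2 \<partial>M) = (\<integral>x. (f x)\<^sup>2 \<partial>M) - (\<Sum>i\<in>S. (c i)\<^sup>2)"
    unfolding g(3) by simp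
qed

text \<open>Riesz--Fischer: a subsequence of partial sums with increments d k satisfies
  that the sum of 2^k (d k)^2 is integrable, and this function dominates the squared tails.\<close>

lemma fourier_series_converges:
  assumes complete: "\<And>g. g \<in> borel_measurable M \<Longrightarrow> integrable M (\<lambda>x. (g x)\<^sup>2) \<Longrightarrow>
      (\<And>i. i \<in> I \<Longrightarrow> (\<integral>x. g x * e i x \<partial>M) = 0) \<Longrightarrow> AE x in M. g x = 0"
    and f: "f \<in> borel_measurable M" "integrable M (\<lambda>x. (f x)\<^sup>2)"
  defines "c \<equiv> \<lambda>i. \<integral>x. f x * e i x \<partial>M"
  shows "((\<lambda>S. \<integral>x. ((\<Sum>i\<in>S. c i * e i x) - f x)\<^sup>2 \<partial>M) \<longlongrightarrow> 0) (finite_subsets_at_top I)"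
proof -
  define N where "N = (\<lambda>S. \<Sum>i\<in>S. (c i)\<^sup>2)"
  define g where "g = (\<lambda>S x. \<Sum>i\<in>S. c i * e i x)"
  have fm0[measurable]: "f \<in> borel_measurable M" by (rule f(1))
  define F where "F = {S. finite S \<and> S \<subseteq> I}"
  have bi: "integrable M (\<lambda>x. ((\<Sum>i\<in>S. c i * e i x) - f x)\<^sup>2)"
    "(\<integral>x. ((\<Sum>i\<in>S. c i * e i x) - f x)\<^sup>2 \<partial>M) = (\<integral>x. (f x)\<^sup>2 \<partial>M) - (\<Sum>i\<in>S. (c i)\<^sup>2)"
    if "finite S" "S \<subseteq> I" for S
    unfolding c_def by (rule bessel_identity[OF that f])+
  have N_le: "N S \<le> (\<integral>x. (f x)\<^sup>2 \<partial>M)" if "S \<in> F" for S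
  proof -
    have "0 \<le> (\<integral>x. ((\<Sum>i\<in>S. c i * e i x) - f x)\<^sup>2 \<partial>M)" by (intro integral_nonneg_AE) simp
    moreover have "(\<integral>x. ((\<Sum>i\<in>S. c i * e i x) - f x)\<^sup>2 \<partial>M) = (\<integral>x. (f x)\<^sup>2 \<partial>M) - N S"
      using that bi(2)[of S] by (simp add: N_def F_def)
    ultimately show ?thesis by linarith
  qed
  have N_mono: "N S \<le> N T" if "S \<subseteq> T" "T \<in> F" for S T
    unfolding N_def using that by (intro sum_mono2) (auto simp: F_def)
  \<comment> \<open>By Bessel's inequality the coefficient energies of finite index sets are
    bounded; \<open>s\<close> is their supremum, not yet known to be the energy of f.\<close>
  define s where "s = Sup (N ` F)"
  have bdd: "bdd_above (N ` F)" using N_le by (auto simp: bdd_above_def)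
  have Fne: "{} \<in> F" by (simp add: F_def)
  have N_s: "N S \<le> s" if "S \<in> F" for S unfolding s_def by (intro cSup_upper bdd imageI that)
  have "\<exists>S\<in>F. s - N S < (1/4)^k" for k :: nat
  proof -
    have "s - (1/4)^k < Sup (N ` F)" by (simp add: s_def)
    then obtain y where "y \<in> N ` F" "s - (1/4)^k < y" using less_cSupD[of "N ` F"] Fne by blast
    then obtain S' where "S' \<in> F" "y = N S'" by blast
    moreover have "s - y < (1/4)^k" using \<open>s - (1/4)^k < y\<close> by linarith
    ultimately show ?thesis by blast
  qed
  then obtain S0 where S0: "\<And>k. S0 k \<in> F" "\<And>k. s - N (S0 k) < (1/4)^k" by metis
  \<comment> \<open>Unions make the nearly optimal finite sets increasing, and enlarging them only
    improves the energy.\<close>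
  define S where "S = (\<lambda>k. \<Union>j\<le>k. S0 j)"
  have SF: "S k \<in> F" for k using S0(1) by (auto simp: S_def F_def)
  have S_mono: "S k \<subseteq> S l" if "k \<le> l" for k l using that by (auto simp: S_def intro: order_trans)
  have S_N: "s - N (S k) < (1/4)^k" for k
  proof -
    have "N (S0 k) \<le> N (S k)" by (rule N_mono[OF _ SF]) (auto simp: S_def)
    then show ?thesis using S0(2)[of k] by linarith
  qed
  define d where "d = (\<lambda>k x. g (S (Suc k)) x - g (S k) x)"
  have d_eq: "d k = g (S (Suc k) - S k)" for k
  proof
    fix x
    have "finite (S (Suc k))" using SF by (auto simp: F_def)
    then show "d k x = g (S (Suc k) - S k) x"
      unfolding d_def g_def using S_mono[of k "Suc k"] by (simp add: sum_diff)
  qed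
  have dF: "S (Suc k) - S k \<subseteq> I" for k using SF[of "Suc k"] by (auto simp: F_def)
  have gm[measurable]: "T \<subseteq> I \<Longrightarrow> g T \<in> borel_measurable M" for T unfolding g_def by (rule sum_square_integrable(1))
  have SI: "S k \<subseteq> I" for k using SF[of k] by (simp add: F_def)
  have gSm[measurable]: "g (S k) \<in> borel_measurable M" for k by (rule gm[OF SI])
  have dm[measurable]: "d k \<in> borel_measurable M" for k unfolding d_eq by (rule gm[OF dF])
  have dint: "integrable M (\<lambda>x. (d k x)\<^sup>2)" and dle: "(\<integral>x. (d k x)\<^sup>2 \<partial>M) \<le> (1/4)^k" for k
  proof -
    show "integrable M (\<lambda>x. (d k x)\<^sup>2)" unfolding d_eq g_def by (rule sum_square_integrable(2)[OF dF])
    have "(\<integral>x. (d k x)\<^sup>2 \<partial>M) = N (S (Suc k) - S k)"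
      unfolding d_eq g_def N_def by (rule sum_square_integrable(3)[OF dF])
    also have "\<dots> = N (S (Suc k)) - N (S k)"
      unfolding N_def using S_mono[of k "Suc k"] SF[of "Suc k"] by (simp add: sum_diff F_def)
    also have "\<dots> \<le> (1/4)^k" using S_N[of k] N_s[OF SF[of "Suc k"]] by linarith
    finally show "(\<integral>x. (d k x)\<^sup>2 \<partial>M) \<le> (1/4)^k" .
  qed
  \<comment> \<open>The k-th increment has squared norm at most 4^(-k), so the weight 2^k leaves a
    summable bound 2^(-k) and still forces pointwise convergence.\<close>
  define P where "P = (\<lambda>x. \<Sum>k. ennreal (2^k * (d k x)\<^sup>2))"
  have [measurable]: "P \<in> borel_measurable M" unfolding P_def by measurable
  have "(\<integral>\<^sup>+x. P x \<partial>M) = (\<Sum>k. \<integral>\<^sup>+x. ennreal (2^k * (d k x)\<^sup>2) \<partial>M)"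
    unfolding P_def by (rule nn_integral_suminf) measurable
  also have "\<dots> \<le> (\<Sum>k. ennreal ((1/2)^k))"
  proof (rule suminf_le)
    fix k
    have "(\<integral>\<^sup>+x. ennreal (2^k * (d k x)\<^sup>2) \<partial>M) = ennreal (\<integral>x. 2^k * (d k x)\<^sup>2 \<partial>M)"
      by (rule nn_integral_eq_integral) (auto intro!: integrable_mult_right dint)
    also have "\<dots> \<le> ennreal ((1/2)^k)"
    proof (rule ennreal_leI)
      have "(\<integral>x. 2^k * (d k x)\<^sup>2 \<partial>M) \<le> 2^k * (1/4)^k" using dle[of k] by simp
      also have "\<dots> = (1/2)^k" by (simp add: power_mult_distrib[symmetric])
      finally show "(\<integral>x. 2^k * (d k x)\<^sup>2 \<partial>M) \<le> (1/2)^k" .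
    qed
    finally show "(\<integral>\<^sup>+x. ennreal (2^k * (d k x)\<^sup>2) \<partial>M) \<le> ennreal ((1/2)^k)" .
  qed auto
  also have "\<dots> = ennreal (\<Sum>k. (1/2)^k)" by (rule suminf_ennreal2) (auto intro: summable_geometric)
  finally have Pfin: "(\<integral>\<^sup>+x. P x \<partial>M) < \<infinity>" by (simp add: le_less_trans)
  then have PAE: "AE x in M. P x \<noteq> \<infinity>" by (intro nn_integral_PInf_AE) auto
  define p where "p = (\<lambda>x. enn2real (P x))"
  have pint: "integrable M p"
  proof (rule integrableI_nonneg)
    have "(\<integral>\<^sup>+x. ennreal (p x) \<partial>M) \<le> (\<integral>\<^sup>+x. P x \<partial>M)"
      unfolding p_def by (intro nn_integral_mono) (simp add: ennreal_enn2real_if)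
    then show "(\<integral>\<^sup>+x. ennreal (p x) \<partial>M) < \<infinity>" using Pfin by (rule le_less_trans)
  qed (auto simp: p_def)
  \<comment> \<open>Cauchy--Schwarz for the increments split as 2^(-j/2) times 2^(j/2)
    \<open>d j\<close>: the first factor is a geometric tail, the second is at most
    \<open>p\<close>.\<close>
  have tail: "(g (S n) x - g (S k) x)\<^sup>2 \<le> 2 * (1/2)^k * p x" if kn: "k \<le> n" and Px: "P x \<noteq> \<infinity>" for k n x
  proof -
    have diff: "g (S n) x - g (S k) x = (\<Sum>j\<in>{k..<n}. d j x)"
      unfolding d_def by (rule sum_Suc_diff'[OF kn, of "\<lambda>j. g (S j) x", symmetric])
    have psum: "(\<Sum>j\<in>{k..<n}. 2^j * (d j x)\<^sup>2) \<le> p x"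
    proof -
      have "ennreal (\<Sum>j\<in>{k..<n}. 2^j * (d j x)\<^sup>2) = (\<Sum>j\<in>{k..<n}. ennreal (2^j * (d j x)\<^sup>2))"
        by (simp add: sum_ennreal)
      also have "\<dots> \<le> P x" unfolding P_def by (rule sum_le_suminf) auto
      finally have "ennreal (\<Sum>j\<in>{k..<n}. 2^j * (d j x)\<^sup>2) \<le> ennreal (p x)"
        unfolding p_def using Px by (subst ennreal_enn2real) (simp_all add: top.not_eq_extremum)
      moreover have "0 \<le> p x" by (simp add: p_def)
      ultimately show ?thesis using ennreal_le_iff by blast
    qed
    have geo: "(\<Sum>j\<in>{k..<n}. (1/2::real)^j) \<le> 2 * (1/2)^k"
    proof -
      have "(\<Sum>j\<in>{k..<n}. (1/2::real)^j) = 2 * (1/2)^k - 2 * (1/2)^n"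
        using kn
      proof (induction n rule: dec_induct)
        case (step n)
        have "(1/2::real)^n = 2 * (1/2)^Suc n" by simp
        then show ?case using step by (simp only: sum.atLeastLessThan_Suc)
      qed simp
      then show ?thesis by simp
    qed
    have "sqrt ((1/2)^j) * (sqrt (2^j) * y) = y" for j and y :: real
    proof -
      have "sqrt ((1/2)^j) * sqrt (2^j) = sqrt ((1/2 * 2)^j)" by (simp only: real_sqrt_mult power_mult_distrib)
      then have "sqrt ((1/2)^j) * sqrt (2^j) = 1" by simp
      then show ?thesis by (metis mult.assoc mult_1)
    qed
    then have "(\<Sum>j\<in>{k..<n}. d j x)\<^sup>2 = (\<Sum>j\<in>{k..<n}. sqrt ((1/2)^j) * (sqrt (2^j) * d j x))\<^sup>2"
      by (simp only:)
    also have "\<dots> \<le> (\<Sum>j\<in>{k..<n}. (sqrt ((1/2)^j))\<^sup>2) * (\<Sum>j\<in>{k..<n}. (sqrt (2^j) * d j x)\<^sup>2)"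
      by (rule Cauchy_Schwarz_ineq_sum)
    also have "\<dots> = (\<Sum>j\<in>{k..<n}. (1/2)^j) * (\<Sum>j\<in>{k..<n}. 2^j * (d j x)\<^sup>2)"
      by (simp add: power_mult_distrib)
    also have "\<dots> \<le> 2 * (1/2)^k * p x"
      using geo psum by (intro mult_mono) (auto intro!: sum_nonneg)
    finally show ?thesis unfolding diff .
  qed
  define G where "G = (\<lambda>x. lim (\<lambda>k. g (S k) x))"
  have small: "(\<lambda>k. 2 * (1/2)^k * y) \<longlonglongrightarrow> 0" for y :: real
  proof -
    have "(\<lambda>k. (1/2::real)^k) \<longlonglongrightarrow> 0" by (rule LIMSEQ_power_zero) simp
    from tendsto_mult[OF tendsto_mult[OF tendsto_const[of 2] this] tendsto_const[of y]] show ?thesis by simp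
  qed
  have conv: "(\<lambda>k. g (S k) x) \<longlonglongrightarrow> G x" if Px: "P x \<noteq> \<infinity>" for x
  proof -
    have "Cauchy (\<lambda>k. g (S k) x)"
    proof (rule CauchyI')
      fix r :: real assume r: "r > 0"
      have "eventually (\<lambda>k. 2 * (1/2)^k * p x < r\<^sup>2) sequentially"
        using small[of "p x"] r by (intro order_tendstoD) auto
      then obtain k where k: "2 * (1/2)^k * p x < r\<^sup>2" by (auto simp: eventually_sequentially)
      show "\<exists>M0. \<forall>m\<ge>M0. \<forall>n>m. dist (g (S m) x) (g (S n) x) < r"
      proof (intro exI[of _ k] allI impI)
        fix m n assume mn: "k \<le> m" "m < n"
        have "(1/2::real)^m \<le> (1/2)^k" using mn by (intro power_decreasing) auto
        then have "2 * (1/2)^m * p x \<le> 2 * (1/2)^k * p x" by (intro mult_right_mono) (auto simp: p_def)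
        then have "(g (S n) x - g (S m) x)\<^sup>2 < r\<^sup>2" using tail[OF less_imp_le[OF mn(2)] Px] k by linarith
        then have "\<bar>g (S n) x - g (S m) x\<bar> < r"
          using r by (intro power2_less_imp_less[of _ r]) auto
        then show "dist (g (S m) x) (g (S n) x) < r" by (simp add: dist_real_def abs_minus_commute)
      qed
    qed
    then show ?thesis unfolding G_def using Cauchy_convergent convergent_LIMSEQ_iff by blast
  qed
  \<comment> \<open>Redefined as 0 where \<open>P\<close> is infinite, so that the limit exists
    everywhere and measurability passes to it.\<close>
  define G' where "G' = (\<lambda>x. if P x = \<infinity> then 0 else G x)"
  have [measurable]: "G' \<in> borel_measurable M"
  proof (rule borel_measurable_LIMSEQ_real[of _ "\<lambda>k x. if P x = \<infinity> then 0 else g (S k) x"])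
    fix x show "(\<lambda>k. if P x = \<infinity> then 0 else g (S k) x) \<longlonglongrightarrow> G' x"
      using conv[of x] by (cases "P x = \<infinity>") (auto simp: G'_def)
  qed measurable
  have Gtail: "AE x in M. (G' x - g (S k) x)\<^sup>2 \<le> 2 * (1/2)^k * p x" for k
    using PAE
  proof eventually_elim
    case (elim x)
    have "(\<lambda>n. (g (S n) x - g (S k) x)\<^sup>2) \<longlonglongrightarrow> (G x - g (S k) x)\<^sup>2"
      by (intro tendsto_intros conv elim)
    then have "(G x - g (S k) x)\<^sup>2 \<le> 2 * (1/2)^k * p x"
      by (rule LIMSEQ_le_const2) (use tail elim in blast)
    then show ?case using elim by (simp add: G'_def)
  qed
  have bint: "integrable M (\<lambda>x. 2 * (1/2)^k * p x)" for k using pint by (rule integrable_mult_right)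
  have Gint: "integrable M (\<lambda>x. (G' x - g (S k) x)\<^sup>2)" for k
  proof (rule Bochner_Integration.integrable_bound[OF bint[of k]])
    show "AE x in M. norm ((G' x - g (S k) x)\<^sup>2) \<le> norm (2 * (1/2)^k * p x)"
      using Gtail[of k] by eventually_elim simp
  qed measurable
  have Gle: "(\<integral>x. (G' x - g (S k) x)\<^sup>2 \<partial>M) \<le> 2 * (1/2)^k * (\<integral>x. p x \<partial>M)" for k
    using integral_mono_AE[OF Gint[of k] bint[of k] Gtail[of k]] by simp
  \<comment> \<open>\<open>h\<close> is the part of f that the series might miss. It is orthogonal
    to every \<open>e i\<close>, so completeness removes it.\<close>
  define h where "h = (\<lambda>x. f x - G' x)"
  have hm[measurable]: "h \<in> borel_measurable M" unfolding h_def by measurable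
  have rint: "integrable M (\<lambda>x. (g (S k) x - f x)\<^sup>2)" for k
    unfolding g_def by (rule bi(1)) (use SF[of k] in \<open>auto simp: F_def\<close>)
  have hint: "integrable M (\<lambda>x. (h x)\<^sup>2)"
  proof (rule Bochner_Integration.integrable_bound[of M "\<lambda>x. 2 * (g (S 0) x - f x)\<^sup>2 + 2 * (G' x - g (S 0) x)\<^sup>2"])
    show "integrable M (\<lambda>x. 2 * (g (S 0) x - f x)\<^sup>2 + 2 * (G' x - g (S 0) x)\<^sup>2)"
      by (intro Bochner_Integration.integrable_add integrable_mult_right rint Gint)
    show "AE x in M. norm ((h x)\<^sup>2) \<le> norm (2 * (g (S 0) x - f x)\<^sup>2 + 2 * (G' x - g (S 0) x)\<^sup>2)"
    proof (rule AE_I2)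
      fix x
      have "(h x)\<^sup>2 \<le> 2 * (g (S 0) x - f x)\<^sup>2 + 2 * (G' x - g (S 0) x)\<^sup>2"
      proof -
        have "0 \<le> ((g (S 0) x - f x) - (G' x - g (S 0) x))\<^sup>2" by simp
        then show ?thesis unfolding h_def by (simp add: power2_eq_square algebra_simps)
      qed
      then show "norm ((h x)\<^sup>2) \<le> norm (2 * (g (S 0) x - f x)\<^sup>2 + 2 * (G' x - g (S 0) x)\<^sup>2)" by simp
    qed
  qed measurable
  have "AE x in M. h x = 0"
  proof (rule complete[OF hm hint])
    fix i assume i: "i \<in> I"
    note ei = e_measurable[OF i] e_square[OF i]
    have e1: "(\<integral>x. (e i x)\<^sup>2 \<partial>M) = 1" using e_orth[OF i i] by (simp add: power2_eq_square)
    \<comment> \<open>Insert the partial sum between f and G'. The coefficient of f minus the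
      partial sum is 0 or, while i is outside \<open>S k\<close>, equal to c i; the other part is
      controlled by the tail estimate.\<close>
    have bound: "\<bar>\<integral>x. h x * e i x \<partial>M\<bar> \<le> sqrt ((1/4)^k) + sqrt (2 * (1/2)^k * (\<integral>x. p x \<partial>M))" for k
    proof -
      have fm: "(\<lambda>x. f x - g (S k) x) \<in> borel_measurable M" by measurable
      have Gm: "(\<lambda>x. g (S k) x - G' x) \<in> borel_measurable M" by measurable
      have r1: "integrable M (\<lambda>x. (f x - g (S k) x)\<^sup>2)" using rint[of k] by (simp add: power2_commute)
      have r2: "integrable M (\<lambda>x. (g (S k) x - G' x)\<^sup>2)" using Gint[of k] by (simp add: power2_commute)
      note i1 = integrable_mult_square[OF fm ei(1) r1 ei(2)] and i2 = integrable_mult_square[OF Gm ei(1) r2 ei(2)]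
      have "(\<integral>x. h x * e i x \<partial>M) = (\<integral>x. (f x - g (S k) x) * e i x + (g (S k) x - G' x) * e i x \<partial>M)"
        by (intro Bochner_Integration.integral_cong) (auto simp: h_def algebra_simps)
      also have "\<dots> = (\<integral>x. (f x - g (S k) x) * e i x \<partial>M) + (\<integral>x. (g (S k) x - G' x) * e i x \<partial>M)"
        using i1 i2 by simp
      finally have split: "(\<integral>x. h x * e i x \<partial>M) = (\<integral>x. (f x - g (S k) x) * e i x \<partial>M) + (\<integral>x. (g (S k) x - G' x) * e i x \<partial>M)" .
      have "(\<integral>x. (g (S k) x - G' x) * e i x \<partial>M)\<^sup>2 \<le> 2 * (1/2)^k * (\<integral>x. p x \<partial>M)"
        using integral_mult_square_bound[OF Gm ei(1) r2 ei(2)] Gle[of k] by (simp add: e1 power2_commute)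
      then have b2: "\<bar>\<integral>x. (g (S k) x - G' x) * e i x \<partial>M\<bar> \<le> sqrt (2 * (1/2)^k * (\<integral>x. p x \<partial>M))"
        by (intro real_le_rsqrt) simp
      have gk: "integrable M (\<lambda>x. (g (S k) x)\<^sup>2)"
        unfolding g_def by (rule sum_square_integrable(2)[OF SI])
      note ig = integrable_mult_square[OF gSm ei(1) gk ei(2)] and if' = integrable_mult_square[OF f(1) ei(1) f(2) ei(2)]
      have "(\<integral>x. (f x - g (S k) x) * e i x \<partial>M) = c i - (\<integral>x. g (S k) x * e i x \<partial>M)"
        using ig if' by (simp add: left_diff_distrib c_def)
      also have "(\<integral>x. g (S k) x * e i x \<partial>M) = (\<Sum>j\<in>S k. c j * (\<integral>x. e i x * e j x \<partial>M))"
        unfolding g_def by (rule integral_sum_mult[OF SI ei])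
      also have "\<dots> = (\<Sum>j\<in>S k. if j = i then c i else 0)"
        using SI[of k] i by (intro sum.cong) (auto simp: e_orth subset_iff)
      also have "\<dots> = (if i \<in> S k then c i else 0)" using SF[of k] by (simp add: F_def)
      finally have first: "(\<integral>x. (f x - g (S k) x) * e i x \<partial>M) = (if i \<in> S k then 0 else c i)" by simp
      have b1: "\<bar>if i \<in> S k then 0 else c i\<bar> \<le> sqrt ((1/4)^k)"
      proof (cases "i \<in> S k")
        case False
        \<comment> \<open>Adding a missing index cannot push the energy above the supremum, which
          bounds its coefficient by the remaining gap.\<close>
        have "insert i (S k) \<in> F" using SF[of k] i by (auto simp: F_def)
        then have "N (insert i (S k)) \<le> s" by (rule N_s)
        moreover have "N (insert i (S k)) = (c i)\<^sup>2 + N (S k)" using False SF[of k] by (simp add: N_def F_def)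
        ultimately have "(c i)\<^sup>2 \<le> (1/4)^k" using S_N[of k] by linarith
        then have "\<bar>c i\<bar> \<le> sqrt ((1/4)^k)" by (intro real_le_rsqrt) simp
        then show ?thesis using False by simp
      qed simp
      show ?thesis unfolding split first using b1 b2 by linarith
    qed
    have "(\<lambda>k. sqrt ((1/4)^k) + sqrt (2 * (1/2)^k * (\<integral>x. p x \<partial>M))) \<longlonglongrightarrow> sqrt 0 + sqrt 0"
      by (intro tendsto_add tendsto_real_sqrt small LIMSEQ_power_zero) simp
    then have "\<bar>\<integral>x. h x * e i x \<partial>M\<bar> \<le> sqrt 0 + sqrt 0"
      by (rule LIMSEQ_le_const) (use bound in blast)
    then show "(\<integral>x. h x * e i x \<partial>M) = 0" by simp
  qed
  \<comment> \<open>As f = G' almost everywhere, the residual energy for \<open>S k\<close> is the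
    squared tail, and it tends to 0.\<close>
  then have res: "(\<integral>x. (f x)\<^sup>2 \<partial>M) - N (S k) \<le> 2 * (1/2)^k * (\<integral>x. p x \<partial>M)" for k
  proof -
    have "(\<integral>x. (f x)\<^sup>2 \<partial>M) - N (S k) = (\<integral>x. (g (S k) x - f x)\<^sup>2 \<partial>M)"
      unfolding g_def N_def using SF[of k] by (subst bi(2)) (auto simp: F_def)
    also have "\<dots> = (\<integral>x. (G' x - g (S k) x)\<^sup>2 \<partial>M)"
    proof (rule integral_cong_AE)
      show "AE x in M. (g (S k) x - f x)\<^sup>2 = (G' x - g (S k) x)\<^sup>2"
        using \<open>AE x in M. h x = 0\<close> by eventually_elim (simp add: h_def power2_commute)
    qed measurable
    also have "\<dots> \<le> 2 * (1/2)^k * (\<integral>x. p x \<partial>M)" by (rule Gle)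
    finally show ?thesis .
  qed
  show ?thesis
  proof (rule tendstoI)
    fix r :: real assume r: "r > 0"
    have "eventually (\<lambda>k. 2 * (1/2)^k * (\<integral>x. p x \<partial>M) < r) sequentially"
      using small r by (intro order_tendstoD) auto
    then obtain k where k: "2 * (1/2)^k * (\<integral>x. p x \<partial>M) < r" by (auto simp: eventually_sequentially)
    \<comment> \<open>The residual decreases as the index set grows, so one good \<open>S k\<close>
      controls every larger finite set: the sequence yields convergence of the net.\<close>
    have "\<forall>T. finite T \<and> S k \<subseteq> T \<and> T \<subseteq> I \<longrightarrow> dist (\<integral>x. ((\<Sum>i\<in>T. c i * e i x) - f x)\<^sup>2 \<partial>M) 0 < r"
    proof (intro allI impI)
      fix T assume T: "finite T \<and> S k \<subseteq> T \<and> T \<subseteq> I"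
      have eq: "(\<integral>x. ((\<Sum>i\<in>T. c i * e i x) - f x)\<^sup>2 \<partial>M) = (\<integral>x. (f x)\<^sup>2 \<partial>M) - N T"
        using T bi(2)[of T] by (simp add: N_def)
      have "0 \<le> (\<integral>x. ((\<Sum>i\<in>T. c i * e i x) - f x)\<^sup>2 \<partial>M)" by (intro integral_nonneg_AE) simp
      moreover have "N (S k) \<le> N T" by (rule N_mono) (use T in \<open>auto simp: F_def\<close>)
      ultimately show "dist (\<integral>x. ((\<Sum>i\<in>T. c i * e i x) - f x)\<^sup>2 \<partial>M) 0 < r"
        using res[of k] k unfolding eq dist_real_def by linarith
    qed
    then show "eventually (\<lambda>T. dist (\<integral>x. ((\<Sum>i\<in>T. c i * e i x) - f x)\<^sup>2 \<partial>M) 0 < r) (finite_subsets_at_top I)"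
      unfolding eventually_finite_subsets_at_top using SF[of k] by (intro exI[of _ "S k"]) (auto simp: F_def)
  qed
qed

end

section \<open>Change of variables on the half sphere\<close>

text \<open>Polar coordinates (u, t) of the half sphere. The open interval leaves out only the
  equator and the pole, both null sets.\<close>

definition half_cyl_measure :: "((real^'n) \<times> real) measure" where
  "half_cyl_measure = (sphere_measure :: (real^'n) measure) \<Otimes>\<^sub>M restrict_space lborel {0<..<1}"

lemma sigma_finite_restrict_lborel:
  "A \<in> sets borel \<Longrightarrow> sigma_finite_measure (restrict_space lborel (A :: real set))"
  by (rule sigma_finite_measure_restrict_space[OF sigma_finite_lborel]) simp

lemma pair_sigma_finite_sphere:
  "A \<in> sets borel \<Longrightarrow> pair_sigma_finite (sphere_measure :: 'a::euclidean_space measure) (restrict_space lborel (A :: real set))"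
  using finite_measure.axioms(1)[OF finite_measure_sphere_measure] sigma_finite_restrict_lborel
  by (simp add: pair_sigma_finite_def)

lemma sets_sphere_pair [measurable_cong]:
  "sets ((sphere_measure :: 'a::euclidean_space measure) \<Otimes>\<^sub>M restrict_space lborel (A :: real set)) =
    sets (restrict_space borel (sphere 0 1) \<Otimes>\<^sub>M restrict_space borel A)"
  by (intro sets_pair_measure_cong sets_sphere_measure sets_restrict_space_cong) simp

lemma measurable_sphere_pair:
  assumes "f \<in> borel \<rightarrow>\<^sub>M N"
  shows "f \<in> (sphere_measure :: 'a::euclidean_space measure) \<Otimes>\<^sub>M restrict_space lborel (A :: real set) \<rightarrow>\<^sub>M N"
proof -
  have "(\<lambda>p. (fst p, snd p)) \<in> (sphere_measure :: 'a measure) \<Otimes>\<^sub>M restrict_space lborel A \<rightarrow>\<^sub>M borel \<Otimes>\<^sub>M borel"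
  proof (rule measurable_Pair)
    show "fst \<in> (sphere_measure :: 'a measure) \<Otimes>\<^sub>M restrict_space lborel A \<rightarrow>\<^sub>M borel"
      by (rule measurable_compose[OF measurable_fst, of "\<lambda>u. u"]) (simp add: measurable_sphere_measure_borel)
    show "snd \<in> (sphere_measure :: 'a measure) \<Otimes>\<^sub>M restrict_space lborel A \<rightarrow>\<^sub>M borel"
      by (rule measurable_compose[OF measurable_snd, of "\<lambda>u. u"]) (simp add: measurable_restrict_space1)
  qed
  from measurable_compose[OF this] assms show ?thesis by (simp add: borel_prod)
qed

lemma nn_integral_sphere_pair:
  fixes f :: "'a::euclidean_space \<times> real \<Rightarrow> ennreal"
  assumes f: "f \<in> borel_measurable (sphere_measure \<Otimes>\<^sub>M restrict_space lborel A)" and A: "A \<in> sets borel"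
  shows "(\<integral>\<^sup>+p. f p \<partial>(sphere_measure \<Otimes>\<^sub>M restrict_space lborel A)) =
    (\<integral>\<^sup>+t. indicator A t * (\<integral>\<^sup>+u. f (u, t) \<partial>sphere_measure) \<partial>lborel)"
proof -
  interpret pair_sigma_finite "sphere_measure :: 'a measure" "restrict_space lborel A"
    by (rule pair_sigma_finite_sphere[OF A])
  have "(\<integral>\<^sup>+p. f p \<partial>(sphere_measure \<Otimes>\<^sub>M restrict_space lborel A)) =
    (\<integral>\<^sup>+t. (\<integral>\<^sup>+u. f (u, t) \<partial>sphere_measure) \<partial>restrict_space lborel A)"
    by (rule nn_integral_snd[symmetric, OF f])
  also have "\<dots> = (\<integral>\<^sup>+t. indicator A t * (\<integral>\<^sup>+u. f (u, t) \<partial>sphere_measure) \<partial>lborel)"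
    using A by (subst nn_integral_restrict_space) (simp_all add: mult.commute)
  finally show ?thesis .
qed

lemma closed_Splus: "closed (Splus :: ((real^'n) \<times> real) set)"
proof -
  have "Splus = sphere 0 1 \<inter> {x :: (real^'n) \<times> real. 0 \<le> snd x}" by (auto simp: Splus_def)
  moreover have "closed {x :: (real^'n) \<times> real. 0 \<le> snd x}"
    by (intro closed_Collect_le continuous_intros)
  ultimately show ?thesis by (metis closed_Int closed_sphere)
qed

lemma Splus_borel [measurable]: "(Splus :: ((real^'n) \<times> real) set) \<in> sets borel"
  by (rule borel_closed[OF closed_Splus])

lemma sets_Splus_measure [measurable_cong]:
  "sets (Splus_measure :: ((real^'n) \<times> real) measure) = sets (restrict_space borel Splus)"
proof -
  have "sets (Splus_measure :: ((real^'n) \<times> real) measure) = sets (restrict_space (restrict_space borel (sphere 0 1)) Splus)"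
    unfolding Splus_measure_def by (intro sets_restrict_space_cong sets_sphere_measure)
  also have "\<dots> = sets (restrict_space borel (sphere 0 1 \<inter> Splus))"
    by (subst sets_restrict_restrict_space) simp
  also have "sphere 0 1 \<inter> Splus = (Splus :: ((real^'n) \<times> real) set)" by (auto simp: Splus_def)
  finally show ?thesis .
qed

lemma Splus_measurable_iff:
  fixes f :: "(real^'n) \<times> real \<Rightarrow> real"
  shows "f \<in> borel_measurable Splus_measure \<longleftrightarrow> (\<lambda>x. indicator Splus x * f x) \<in> borel_measurable borel"
proof -
  have "f \<in> borel_measurable Splus_measure \<longleftrightarrow> f \<in> borel_measurable (restrict_space borel Splus)"
    by (simp only: measurable_cong_sets[OF sets_Splus_measure refl])
  also have "\<dots> \<longleftrightarrow> (\<lambda>x. indicator Splus x * f x) \<in> borel_measurable borel"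
    using borel_measurable_restrict_space_iff[of Splus borel f] Splus_borel by simp
  finally show ?thesis .
qed

lemma nn_integral_Splus_measure:
  "(\<integral>\<^sup>+x. g x \<partial>(Splus_measure :: ((real^'n) \<times> real) measure)) = (\<integral>\<^sup>+x. indicator Splus x * g x \<partial>sphere_measure)"
proof -
  have "Splus \<in> sets (sphere_measure :: ((real^'n) \<times> real) measure)"
    unfolding sets_sphere_measure using Splus_borel
    by (subst sets_restrict_space_iff) (simp_all, auto simp: Splus_def)
  moreover have "Splus \<inter> space sphere_measure = (Splus :: ((real^'n) \<times> real) set)" by (auto simp: Splus_def)
  ultimately show ?thesis unfolding Splus_measure_def
    by (subst nn_integral_restrict_space) (simp_all add: mult.commute)
qed

lemma half_cyl_chart_measurable:
  "(\<lambda>p :: (real^'n) \<times> real. (sqrt (1 - (snd p)\<^sup>2) *\<^sub>R fst p, snd p)) \<in> half_cyl_measure \<rightarrow>\<^sub>M restrict_space borel Splus"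
    (is "?m \<in> _")
proof (rule measurable_restrict_space2)
  have "?m \<in> borel \<rightarrow>\<^sub>M borel" unfolding borel_prod[symmetric] by measurable
  then show "?m \<in> half_cyl_measure \<rightarrow>\<^sub>M borel" unfolding half_cyl_measure_def by (rule measurable_sphere_pair)
  show "?m \<in> space half_cyl_measure \<rightarrow> Splus"
    by (auto simp: half_cyl_measure_def space_pair_measure space_restrict_space Splus_def norm_Pair power_mult_distrib abs_square_le_1)
qed

text \<open>The slicing formula as an equality of measures, so that integrability and signed
  integrals transfer together. The equator t = 0 is discarded as a null set.\<close>

lemma Splus_measure_eq_distr:
  assumes n2: "CARD('n) \<ge> 2"
  shows "(Splus_measure :: ((real^'n) \<times> real) measure) =
    distr (density half_cyl_measure (\<lambda>p. ennreal (sqrt (1 - (snd p)\<^sup>2) ^ (CARD('n) - 2))))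
      (restrict_space borel Splus) (\<lambda>p. (sqrt (1 - (snd p)\<^sup>2) *\<^sub>R fst p, snd p))"
    (is "_ = distr (density _ ?d) _ ?m")
proof (rule measure_eqI)
  fix A :: "((real^'n) \<times> real) set" assume "A \<in> sets Splus_measure"
  then obtain B where A: "A = Splus \<inter> B" "B \<in> sets borel"
    unfolding sets_Splus_measure by (auto simp: sets_restrict_space)
  then have AS: "A \<subseteq> Splus" and Ab[measurable]: "A \<in> sets borel" using Splus_borel by auto
  have mb[measurable]: "?m \<in> borel \<rightarrow>\<^sub>M borel" unfolding borel_prod[symmetric] by measurable
  have db[measurable]: "?d \<in> borel_measurable borel" unfolding borel_prod[symmetric] by measurable
  note mM = half_cyl_chart_measurable[where 'n = 'n]
  have "emeasure Splus_measure A = (\<integral>\<^sup>+x. indicator A x \<partial>Splus_measure)"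
    using \<open>A \<in> sets Splus_measure\<close> by simp
  also have "\<dots> = (\<integral>\<^sup>+x. indicator A x \<partial>sphere_measure)"
    unfolding nn_integral_Splus_measure using AS by (intro nn_integral_cong) (auto simp: indicator_def)
  also have "\<dots> = (\<integral>\<^sup>+t. indicator {-1<..<1} t * ennreal (sqrt (1 - t\<^sup>2) ^ (CARD('n) - 2)) *
      (\<integral>\<^sup>+u. indicator A (sqrt (1 - t\<^sup>2) *\<^sub>R u, t) \<partial>(sphere_measure :: (real^'n) measure)) \<partial>lborel)"
    using n2 by (subst nn_integral_sphere_prod_real) auto
  also have "\<dots> = (\<integral>\<^sup>+t. indicator {0<..<1} t * (\<integral>\<^sup>+u. ?d (u, t) * indicator A (?m (u, t)) \<partial>(sphere_measure :: (real^'n) measure)) \<partial>lborel)"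
  proof (rule nn_integral_cong_AE)
    show "AE t in lborel. indicator {-1<..<1} t * ennreal (sqrt (1 - t\<^sup>2) ^ (CARD('n) - 2)) *
      (\<integral>\<^sup>+u. indicator A (sqrt (1 - t\<^sup>2) *\<^sub>R u, t) \<partial>(sphere_measure :: (real^'n) measure)) =
      indicator {0<..<1} t * (\<integral>\<^sup>+u. ?d (u, t) * indicator A (?m (u, t)) \<partial>(sphere_measure :: (real^'n) measure))"
      using AE_lborel_singleton[of "0::real"]
    proof eventually_elim
      case (elim t)
      have meas: "(\<lambda>u. indicator A (sqrt (1 - t\<^sup>2) *\<^sub>R u, t) :: ennreal) \<in> borel_measurable (sphere_measure :: (real^'n) measure)"
        by (rule measurable_sphere_measure_borel) measurable
      show ?case
      proof (cases "t > 0")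
        case True
        then have "indicator {-1<..<1} t = (indicator {0<..<1} t :: ennreal)" by (auto simp: indicator_def)
        then show ?thesis by (simp add: nn_integral_cmult[OF meas] mult.assoc)
      next
        case False
        then have "(sqrt (1 - t\<^sup>2) *\<^sub>R u, t) \<notin> A" for u using AS elim by (auto simp: Splus_def)
        then show ?thesis using False by simp
      qed
    qed
  qed
  also have "\<dots> = (\<integral>\<^sup>+p. ?d p * indicator A (?m p) \<partial>half_cyl_measure)"
    unfolding half_cyl_measure_def
    by (intro nn_integral_sphere_pair[symmetric] measurable_sphere_pair borel_measurable_times_ennreal
        db measurable_compose[OF mb borel_measurable_indicator] Ab) auto
  also have "\<dots> = emeasure (distr (density half_cyl_measure ?d) (restrict_space borel Splus) ?m) A"
  proof -
    have "A \<in> sets (restrict_space borel Splus)" using A by (auto simp: sets_restrict_space)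
    moreover have dM: "?d \<in> borel_measurable half_cyl_measure"
      unfolding half_cyl_measure_def by (rule measurable_sphere_pair[OF db])
    ultimately have "emeasure (distr (density half_cyl_measure ?d) (restrict_space borel Splus) ?m) A =
      (\<integral>\<^sup>+p. ?d p * indicator (?m -` A \<inter> space half_cyl_measure) p \<partial>half_cyl_measure)"
      using mM measurable_sets[OF mM] by (simp add: emeasure_distr emeasure_density)
    also have "\<dots> = (\<integral>\<^sup>+p. ?d p * indicator A (?m p) \<partial>half_cyl_measure)"
      by (intro nn_integral_cong) (auto simp: indicator_def)
    finally show ?thesis by simp
  qed
  finally show "emeasure Splus_measure A = emeasure (distr (density half_cyl_measure ?d) (restrict_space borel Splus) ?m) A" .
qed (simp add: sets_Splus_measure)

lemma Splus_integral_half_cyl: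
  fixes g :: "(real^'n) \<times> real \<Rightarrow> real"
  assumes n2: "CARD('n) \<ge> 2" and g: "g \<in> borel_measurable Splus_measure"
  defines "G \<equiv> \<lambda>p. sqrt (1 - (snd p)\<^sup>2) ^ (CARD('n) - 2) * g (sqrt (1 - (snd p)\<^sup>2) *\<^sub>R fst p, snd p)"
  shows "integrable Splus_measure g \<longleftrightarrow> integrable half_cyl_measure G"
    "(\<integral>x. g x \<partial>Splus_measure) = (\<integral>p. G p \<partial>half_cyl_measure)"
    "G \<in> borel_measurable half_cyl_measure"
proof -
  let ?d = "\<lambda>p :: (real^'n) \<times> real. sqrt (1 - (snd p)\<^sup>2) ^ (CARD('n) - 2)"
  let ?m = "\<lambda>p :: (real^'n) \<times> real. (sqrt (1 - (snd p)\<^sup>2) *\<^sub>R fst p, snd p)"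
  have mb: "?m \<in> borel \<rightarrow>\<^sub>M borel" unfolding borel_prod[symmetric] by measurable
  have db: "?d \<in> borel_measurable borel" unfolding borel_prod[symmetric] by measurable
  have dM: "?d \<in> borel_measurable half_cyl_measure"
    unfolding half_cyl_measure_def by (rule measurable_sphere_pair[OF db])
  note mM = half_cyl_chart_measurable[where 'n = 'n]
  have gR: "g \<in> borel_measurable (restrict_space borel Splus)"
    using g by (simp cong: measurable_cong_sets)
  have gm: "(\<lambda>p. g (?m p)) \<in> borel_measurable half_cyl_measure" by (rule measurable_compose[OF mM gR])
  then show "G \<in> borel_measurable half_cyl_measure" unfolding G_def using dM by (rule borel_measurable_times[rotated])
  have d0: "AE p in half_cyl_measure. 0 \<le> ?d p"
    by (rule AE_I2) (auto simp: half_cyl_measure_def space_pair_measure space_restrict_space abs_square_le_1)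
  have mD: "?m \<in> density half_cyl_measure (\<lambda>p. ennreal (?d p)) \<rightarrow>\<^sub>M restrict_space borel Splus" using mM by simp
  show "integrable Splus_measure g \<longleftrightarrow> integrable half_cyl_measure G"
    unfolding Splus_measure_eq_distr[OF n2] G_def
    by (subst integrable_distr_eq[OF mD gR], subst integrable_density[OF gm dM d0]) simp
  show "(\<integral>x. g x \<partial>Splus_measure) = (\<integral>p. G p \<partial>half_cyl_measure)"
    unfolding Splus_measure_eq_distr[OF n2] G_def
    by (subst integral_distr[OF mD gR], subst integral_density[OF gm dM d0]) simp
qed

lemma slice_chart_measurable:
  "(\<lambda>((\<theta>, t), v). slice_chart \<theta> t v) \<in> (borel :: (((real^'n) \<times> real) \<times> (real^'n)) measure) \<rightarrow>\<^sub>M borel"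
  unfolding slice_chart_def case_prod_beta
  by (intro borel_measurable_continuous_onI continuous_intros)

lemma norm_slice_chart:
  assumes th: "norm \<theta> = 1" and v: "norm v = 1" and t: "\<bar>t\<bar> \<le> 1"
  shows "norm (slice_chart \<theta> t v) = 1"
proof -
  have e: "\<theta> \<bullet> \<theta> = 1" "v \<bullet> v = 1" using th v by (auto simp: norm_eq_1)
  define r where "r = sqrt (1 - t\<^sup>2)"
  have r: "r * r = 1 - t\<^sup>2" using t by (simp add: r_def abs_square_le_1)
  have "slice_chart \<theta> t v \<bullet> slice_chart \<theta> t v = t\<^sup>2 + r * r"
    unfolding slice_chart_def r_def[symmetric] inner_Pair
    using e by (simp add: inner_add_left inner_add_right inner_diff_left inner_diff_right inner_commute algebra_simps power2_eq_square)
  then show ?thesis using r by (simp add: norm_eq_1)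
qed

lemma fst_slice_chart_inner:
  "norm \<theta> = 1 \<Longrightarrow> fst (slice_chart \<theta> t v) \<bullet> \<theta> = t"
  by (simp add: slice_chart_def inner_add_left inner_diff_left norm_eq_1)

lemma slice_chart_in_Splus:
  assumes "norm \<theta> = 1" "norm v = 1" "\<bar>t\<bar> < 1"
  shows "slice_chart \<theta> t v \<in> Splus \<longleftrightarrow> 0 \<le> v \<bullet> \<theta>"
proof -
  have "sqrt (1 - t\<^sup>2) > 0" using assms by (simp add: abs_square_less_1)
  then have "0 \<le> sqrt (1 - t\<^sup>2) * (v \<bullet> \<theta>) \<longleftrightarrow> 0 \<le> v \<bullet> \<theta>" by (simp add: zero_le_mult_iff)
  then show ?thesis using norm_slice_chart[of \<theta> v t] assms by (simp add: Splus_def) (simp add: slice_chart_def)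
qed

text \<open>Here \<open>cyl_measure\<close> plays another role: its first component is the parameter
  v running over one slice, while the direction \<theta> is fixed.\<close>

lemma cyl_integral_slices:
  fixes g :: "(real^'n) \<times> real \<Rightarrow> real"
  assumes n2: "CARD('n) \<ge> 2" and g: "g \<in> borel_measurable borel" and th: "norm \<theta> = 1"
  defines "G \<equiv> \<lambda>p. sqrt (1 - (snd p)\<^sup>2) ^ (CARD('n) - 2) * g (slice_chart \<theta> (snd p) (fst p))"
  shows "integrable sphere_measure g \<longleftrightarrow> integrable cyl_measure G"
    "(\<integral>x. g x \<partial>sphere_measure) = (\<integral>p. G p \<partial>cyl_measure)"
proof -
  let ?d = "\<lambda>p :: (real^'n) \<times> real. sqrt (1 - (snd p)\<^sup>2) ^ (CARD('n) - 2)"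
  let ?m = "\<lambda>p :: (real^'n) \<times> real. slice_chart \<theta> (snd p) (fst p)"
  have mb[measurable]: "?m \<in> borel \<rightarrow>\<^sub>M borel"
    unfolding slice_chart_def by (intro borel_measurable_continuous_onI continuous_intros)
  have db: "?d \<in> borel_measurable borel" unfolding borel_prod[symmetric] by measurable
  have dM: "?d \<in> borel_measurable cyl_measure"
    unfolding cyl_measure_def by (rule measurable_sphere_pair[OF db])
  have mM: "?m \<in> cyl_measure \<rightarrow>\<^sub>M borel" unfolding cyl_measure_def by (rule measurable_sphere_pair[OF mb])
  have d0: "AE p in cyl_measure. 0 \<le> ?d p"
    by (rule AE_I2) (auto simp: cyl_measure_def space_pair_measure space_restrict_space abs_square_le_1)
  have mD: "?m \<in> density cyl_measure (\<lambda>p. ennreal (?d p)) \<rightarrow>\<^sub>M borel" using mM by simp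
  \<comment> \<open>Pushing forward by the identity replaces the sigma-algebra on the sphere by the
    Borel sets of the whole space, which makes the two measures comparable.\<close>
  have eq: "distr sphere_measure borel (\<lambda>x. x) = distr (density cyl_measure (\<lambda>p. ennreal (?d p))) borel ?m"
  proof (rule measure_eqI)
    fix A :: "((real^'n) \<times> real) set" assume "A \<in> sets (distr sphere_measure borel (\<lambda>x. x))"
    then have A[measurable]: "A \<in> sets borel" by simp
    have "emeasure (distr sphere_measure borel (\<lambda>x. x)) A = (\<integral>\<^sup>+x. indicator A x \<partial>distr sphere_measure borel (\<lambda>x. x))" by simp
    also have "\<dots> = (\<integral>\<^sup>+x. indicator A x \<partial>sphere_measure)"
      by (rule nn_integral_distr) (auto intro: measurable_sphere_measure_borel)
    also have "\<dots> = (\<integral>\<^sup>+t. indicator {-1<..<1} t * ennreal (sqrt (1 - t\<^sup>2) ^ (CARD('n) - 2)) *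
       (\<integral>\<^sup>+v. indicator A (slice_chart \<theta> t v) \<partial>(sphere_measure :: (real^'n) measure)) \<partial>lborel)"
      using n2 th by (subst nn_integral_sphere_slices[of _ \<theta>]) auto
    also have "\<dots> = (\<integral>\<^sup>+t. indicator {-1<..<1} t * (\<integral>\<^sup>+v. ennreal (?d (v, t)) * indicator A (?m (v, t)) \<partial>(sphere_measure :: (real^'n) measure)) \<partial>lborel)"
    proof (rule nn_integral_cong)
      fix t
      have "(\<lambda>v. slice_chart \<theta> t v) \<in> borel \<rightarrow>\<^sub>M borel"
        unfolding slice_chart_def by (intro borel_measurable_continuous_onI continuous_intros)
      then have "(\<lambda>v. indicator A (slice_chart \<theta> t v) :: ennreal) \<in> borel_measurable (sphere_measure :: (real^'n) measure)"
        by (intro measurable_sphere_measure_borel) measurable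
      then show "indicator {-1<..<1} t * ennreal (sqrt (1 - t\<^sup>2) ^ (CARD('n) - 2)) *
       (\<integral>\<^sup>+v. indicator A (slice_chart \<theta> t v) \<partial>(sphere_measure :: (real^'n) measure)) =
        indicator {-1<..<1} t * (\<integral>\<^sup>+v. ennreal (?d (v, t)) * indicator A (?m (v, t)) \<partial>(sphere_measure :: (real^'n) measure))"
        by (simp add: nn_integral_cmult mult.assoc)
    qed
    also have "\<dots> = (\<integral>\<^sup>+p. ennreal (?d p) * indicator A (?m p) \<partial>cyl_measure)"
      unfolding cyl_measure_def
      by (intro nn_integral_sphere_pair[symmetric] measurable_sphere_pair borel_measurable_times_ennreal
        measurable_compose[OF db measurable_ennreal] measurable_compose[OF mb borel_measurable_indicator] A) auto
    also have "\<dots> = emeasure (distr (density cyl_measure (\<lambda>p. ennreal (?d p))) borel ?m) A"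
    proof -
      have "emeasure (distr (density cyl_measure (\<lambda>p. ennreal (?d p))) borel ?m) A =
        (\<integral>\<^sup>+p. ennreal (?d p) * indicator (?m -` A \<inter> space cyl_measure) p \<partial>cyl_measure)"
        using mM measurable_sets[OF mM A] dM by (simp add: emeasure_distr emeasure_density)
      also have "\<dots> = (\<integral>\<^sup>+p. ennreal (?d p) * indicator A (?m p) \<partial>cyl_measure)"
        by (intro nn_integral_cong) (auto simp: indicator_def)
      finally show ?thesis by simp
    qed
    finally show "emeasure (distr sphere_measure borel (\<lambda>x. x)) A = emeasure (distr (density cyl_measure (\<lambda>p. ennreal (?d p))) borel ?m) A" .
  qed simp
  have idm: "(\<lambda>x. x) \<in> (sphere_measure :: ((real^'n) \<times> real) measure) \<rightarrow>\<^sub>M borel"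
    by (rule measurable_sphere_measure_borel) simp
  have gm: "(\<lambda>p. g (?m p)) \<in> borel_measurable cyl_measure" by (rule measurable_compose[OF mM g])
  have "integrable sphere_measure g \<longleftrightarrow> integrable (distr sphere_measure borel (\<lambda>x. x)) g"
    by (rule integrable_distr_eq[OF idm g, symmetric])
  also have "\<dots> \<longleftrightarrow> integrable cyl_measure G"
    unfolding eq G_def by (subst integrable_distr_eq[OF mD g], subst integrable_density[OF gm dM d0]) simp
  finally show "integrable sphere_measure g \<longleftrightarrow> integrable cyl_measure G" .
  have "(\<integral>x. g x \<partial>sphere_measure) = (\<integral>x. g x \<partial>distr sphere_measure borel (\<lambda>x. x))"
    by (rule integral_distr[OF idm g, symmetric])
  also have "\<dots> = (\<integral>p. G p \<partial>cyl_measure)"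
    unfolding eq G_def by (subst integral_distr[OF mD g], subst integral_density[OF gm dM d0]) simp
  finally show "(\<integral>x. g x \<partial>sphere_measure) = (\<integral>p. G p \<partial>cyl_measure)" .
qed

lemma (in pair_sigma_finite) integrable_prod_mult:
  fixes f g :: "_ \<Rightarrow> real"
  assumes f: "integrable M1 f" and g: "integrable M2 g"
  shows "integrable (M1 \<Otimes>\<^sub>M M2) (\<lambda>p. f (fst p) * g (snd p))"
    "(\<integral>p. f (fst p) * g (snd p) \<partial>(M1 \<Otimes>\<^sub>M M2)) = (\<integral>x. f x \<partial>M1) * (\<integral>y. g y \<partial>M2)"
proof -
  have [measurable]: "f \<in> borel_measurable M1" "g \<in> borel_measurable M2" using f g by auto
  show int: "integrable (M1 \<Otimes>\<^sub>M M2) (\<lambda>p. f (fst p) * g (snd p))"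
  proof (rule Fubini_integrable)
    show "integrable M1 (\<lambda>x. \<integral>y. norm (f (fst (x, y)) * g (snd (x, y))) \<partial>M2)"
      using f by (simp add: abs_mult)
    show "AE x in M1. integrable M2 (\<lambda>y. f (fst (x, y)) * g (snd (x, y)))"
      using g by simp
  qed measurable
  have "(\<integral>p. f (fst p) * g (snd p) \<partial>(M1 \<Otimes>\<^sub>M M2)) = (\<integral>x. (\<integral>y. f x * g y \<partial>M2) \<partial>M1)"
    using integral_fst'[OF int] by simp
  also have "\<dots> = (\<integral>x. f x \<partial>M1) * (\<integral>y. g y \<partial>M2)" by simp
  finally show "(\<integral>p. f (fst p) * g (snd p) \<partial>(M1 \<Otimes>\<^sub>M M2)) = (\<integral>x. f x \<partial>M1) * (\<integral>y. g y \<partial>M2)" .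
qed

section \<open>Boundedness of the transform\<close>

text \<open>Both arguments describe the same slice. As \<open>iso_onto\<close> depends only on the
  subspace, even the chosen isometries coincide, and so do the slice measures.\<close>

lemma V_plus_even: "V_plus f (- \<theta>) (- t) = V_plus f \<theta> t"
proof -
  have "perp_space (- \<theta>) = perp_space \<theta>" by (simp add: perp_space_def)
  then show ?thesis by (simp add: V_plus_def slice_measure_def)
qed

text \<open>The cone over a great subsphere lies in a hyperplane, which is Lebesgue null. On slices
  this disposes of the points of height 0, where the weight degenerates.\<close>

lemma AE_sphere_inner_nonzero:
  fixes \<theta> :: "'a::euclidean_space"
  assumes "\<theta> \<noteq> 0"
  shows "AE v in sphere_measure. v \<bullet> \<theta> \<noteq> 0"
proof -
  have "negligible {x. \<theta> \<bullet> x = 0}" using assms by (intro negligible_hyperplane) auto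
  moreover have cl: "closed {x. \<theta> \<bullet> x = 0}" by (intro closed_Collect_eq continuous_intros)
  ultimately have "emeasure lborel {x. \<theta> \<bullet> x = 0} = 0"
    by (simp add: negligible_iff_null_sets null_sets_def emeasure_completion[symmetric])
  then have "{x. \<theta> \<bullet> x = 0} \<in> null_sets lborel" using cl by (auto intro!: null_setsI borel_closed)
  then have ae: "AE x in lborel. \<theta> \<bullet> x \<noteq> 0" by (rule AE_I') auto
  let ?Z = "{v. v \<bullet> \<theta> = 0}"
  have Zcl: "closed ?Z" by (intro closed_Collect_eq continuous_intros)
  then have [measurable]: "?Z \<in> sets borel" by (rule borel_closed)
  have "(\<integral>\<^sup>+v. indicator ?Z v \<partial>sphere_measure) =
     of_nat DIM('a) * (\<integral>\<^sup>+x. indicator (cball 0 1 - {0}) x * indicator ?Z (x /\<^sub>R norm x) \<partial>lborel)"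
    by (rule nn_integral_sphere_measure) measurable
  also have "(\<integral>\<^sup>+x. indicator (cball 0 1 - {0}) x * indicator ?Z (x /\<^sub>R norm x) \<partial>lborel) = (\<integral>\<^sup>+(x::'a). 0 \<partial>lborel)"
    using ae by (intro nn_integral_cong_AE) (auto elim!: eventually_mono simp: indicator_def inner_commute)
  finally have 0: "(\<integral>\<^sup>+v. indicator ?Z v \<partial>sphere_measure) = 0" by simp
  have "(\<lambda>v. indicator ?Z v :: ennreal) \<in> borel_measurable (sphere_measure :: 'a measure)"
    by (rule measurable_sphere_measure_borel) measurable
  from nn_integral_0_iff_AE[OF this] 0 have "AE v in sphere_measure. indicator ?Z v = (0::ennreal)" by simp
  then show ?thesis by eventually_elim (simp add: indicator_def split: if_splits)
qed

lemma cyl_sphere_chart_measurable: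
  "(\<lambda>q :: ((real^'n) \<times> real) \<times> (real^'n). slice_chart (fst (fst q)) (snd (fst q)) (snd q)) \<in> cyl_measure \<Otimes>\<^sub>M sphere_measure \<rightarrow>\<^sub>M borel"
proof -
  have "(\<lambda>q. (fst q, snd q)) \<in> (cyl_measure :: ((real^'n) \<times> real) measure) \<Otimes>\<^sub>M (sphere_measure :: (real^'n) measure) \<rightarrow>\<^sub>M borel \<Otimes>\<^sub>M borel"
  proof (rule measurable_Pair)
    show "fst \<in> (cyl_measure :: ((real^'n) \<times> real) measure) \<Otimes>\<^sub>M (sphere_measure :: (real^'n) measure) \<rightarrow>\<^sub>M borel"
      by (rule measurable_compose[OF measurable_fst, of "\<lambda>u. u"]) (simp add: measurable_sphere_pair cyl_measure_def)
    show "snd \<in> (cyl_measure :: ((real^'n) \<times> real) measure) \<Otimes>\<^sub>M (sphere_measure :: (real^'n) measure) \<rightarrow>\<^sub>M borel"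
      by (rule measurable_compose[OF measurable_snd, of "\<lambda>u. u"]) (simp add: measurable_sphere_measure_borel)
  qed
  then have "(\<lambda>q. (fst q, snd q)) \<in> (cyl_measure :: ((real^'n) \<times> real) measure) \<Otimes>\<^sub>M (sphere_measure :: (real^'n) measure) \<rightarrow>\<^sub>M borel"
    by (simp only: borel_prod)
  from measurable_compose[OF this slice_chart_measurable] show ?thesis by (simp add: case_prod_beta)
qed

lemma space_cyl_measure: "space (cyl_measure :: ((real^'n) \<times> real) measure) = sphere 0 1 \<times> {-1<..<1}"
  by (simp add: cyl_measure_def space_pair_measure space_restrict_space)

lemma V_plus_cyl:
  fixes f :: "(real^'n) \<times> real \<Rightarrow> real"
  assumes f: "f \<in> borel_measurable Splus_measure" and p: "p \<in> space cyl_measure"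
  shows "V_plus f (fst p) (snd p) = sqrt (1 - (snd p)\<^sup>2) ^ (CARD('n) - 1) *
    (\<integral>v. indicator Splus (slice_chart (fst p) (snd p) v) * f (slice_chart (fst p) (snd p) v) \<partial>sphere_measure)"
  using f p by (intro V_plus_eq_slice_chart) (auto simp: Splus_measurable_iff space_cyl_measure)

lemma V_plus_measurable:
  fixes f :: "(real^'n) \<times> real \<Rightarrow> real"
  assumes f: "f \<in> borel_measurable Splus_measure"
  shows "(\<lambda>p. V_plus f (fst p) (snd p)) \<in> borel_measurable cyl_measure"
proof -
  interpret S: finite_measure "sphere_measure :: (real^'n) measure" by (rule finite_measure_sphere_measure)
  have f1: "(\<lambda>x. indicator Splus x * f x) \<in> borel_measurable borel" using f by (simp add: Splus_measurable_iff)
  have "(\<lambda>p. \<integral>v. indicator Splus (slice_chart (fst p) (snd p) v) * f (slice_chart (fst p) (snd p) v) \<partial>(sphere_measure :: (real^'n) measure))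
    \<in> borel_measurable cyl_measure"
    using measurable_compose[OF cyl_sphere_chart_measurable f1]
    by (intro S.borel_measurable_lebesgue_integral) (simp add: case_prod_beta)
  moreover have "(\<lambda>p. sqrt (1 - (snd p)\<^sup>2) ^ (CARD('n) - 1)) \<in> borel_measurable (cyl_measure :: ((real^'n) \<times> real) measure)"
    unfolding cyl_measure_def by (rule measurable_sphere_pair) (unfold borel_prod[symmetric], measurable)
  ultimately have "(\<lambda>p. sqrt (1 - (snd p)\<^sup>2) ^ (CARD('n) - 1) *
     (\<integral>v. indicator Splus (slice_chart (fst p) (snd p) v) * f (slice_chart (fst p) (snd p) v) \<partial>(sphere_measure :: (real^'n) measure)))
    \<in> borel_measurable cyl_measure" by (rule borel_measurable_times[rotated])
  then show ?thesis by (subst measurable_cong[OF V_plus_cyl[OF f]])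
qed

lemma sqrt_power_eq_powr: "x > 0 \<Longrightarrow> sqrt x ^ k = x powr (real k / 2)"
  by (simp add: powr_half_sqrt[symmetric] powr_realpow[symmetric] powr_powr)

text \<open>Integrate the power a of the height over the half sphere in two ways. Horizontal slices
  give a finite Beta integral; slices perpendicular to \<theta> give the desired integral times a
  positive constant. So it is finite and the same for every \<theta>.\<close>

lemma half_slice_weight_integral:
  assumes n2: "CARD('n) \<ge> 2" and lam: "lam > real CARD('n) / 2 - 1"
  obtains J where "J \<ge> 0" "\<And>\<theta> :: real^'n. norm \<theta> = 1 \<Longrightarrow>
    (\<integral>\<^sup>+v. ennreal (indicator {0<..} (v \<bullet> \<theta>) * (v \<bullet> \<theta>) powr (2 * lam + 1 - real CARD('n))) \<partial>sphere_measure) = ennreal J"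
proof -
  let ?n = "CARD('n)"
  \<comment> \<open>The exponent of 1 / \<open>Wt\<close>; the bound on lam together with n >= 2
    makes it exceed -1.\<close>
  define a where "a = 2 * lam + 1 - real ?n"
  have a: "a > -1" and l0: "lam > 0" using lam n2 by (auto simp: a_def)
  let ?S = "sphere_measure :: (real^'n) measure"
  define g where "g = (\<lambda>x :: (real^'n) \<times> real. ennreal (indicator {0<..} (snd x) * snd x powr a))"
  have gm[measurable]: "g \<in> borel_measurable borel"
  proof -
    have "snd \<in> borel_measurable (borel :: ((real^'n) \<times> real) measure)" by (intro borel_measurable_continuous_onI continuous_intros)
    from measurable_compose[OF this, of "\<lambda>t. ennreal (indicator {0<..} t * t powr a)" borel]
    show ?thesis unfolding g_def by simp
  qed
  define A where "A = (\<integral>\<^sup>+x. g x \<partial>sphere_measure)"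
  define B where "B = (\<integral>\<^sup>+t. ennreal (indicator {-1<..<1} t * (1 - t\<^sup>2) powr (lam - 1/2)) \<partial>lborel)"
  have hB: "has_bochner_integral lborel (\<lambda>t. indicator {-1<..<1} t * (t ^ 0 * (1 - t\<^sup>2) powr (lam - 1/2))) (gegenbauer_moment lam 0 0)"
    by (rule power_moment_Gegenbauer_weight[OF l0])
  have B: "B = ennreal (gegenbauer_moment lam 0 0)"
    unfolding B_def using hB
    by (subst nn_integral_eq_integral) (auto simp: has_bochner_integral_iff)
  define b where "b = gegenbauer_moment lam 0 0"
  have b: "b > 0"
    using l0 by (simp add: b_def gegenbauer_moment_def rGamma_inverse_Gamma)
  have Afin: "A < \<infinity>"
  proof -
    have "A = (\<integral>\<^sup>+t. indicator {-1<..<1} t * ennreal (sqrt (1 - t\<^sup>2) ^ (?n - 2)) *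
        (\<integral>\<^sup>+u. g (sqrt (1 - t\<^sup>2) *\<^sub>R u, t) \<partial>?S) \<partial>lborel)"
      unfolding A_def using n2 by (subst nn_integral_sphere_prod_real[OF gm]) auto
    also have "\<dots> = (\<integral>\<^sup>+t. ennreal (indicator {0<..<1} t * (t powr (2 * ((a - 1)/2) + 1) * (1 - t\<^sup>2) powr (real (?n - 2) / 2))) *
        emeasure ?S (space ?S) \<partial>lborel)"
    proof (rule nn_integral_cong)
      fix t :: real
      show "indicator {-1<..<1} t * ennreal (sqrt (1 - t\<^sup>2) ^ (?n - 2)) * (\<integral>\<^sup>+u. g (sqrt (1 - t\<^sup>2) *\<^sub>R u, t) \<partial>?S) =
        ennreal (indicator {0<..<1} t * (t powr (2 * ((a - 1)/2) + 1) * (1 - t\<^sup>2) powr (real (?n - 2) / 2))) * emeasure ?S (space ?S)"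
      proof (cases "t \<in> {0<..<1}")
        case True
        then have "1 - t\<^sup>2 > 0" by (simp add: power_less_one_iff)
        then have "sqrt (1 - t\<^sup>2) ^ (?n - 2) = (1 - t\<^sup>2) powr (real (?n - 2) / 2)" by (rule sqrt_power_eq_powr)
        moreover have "2 * ((a - 1)/2) + 1 = a" by (simp add: field_simps)
        ultimately show ?thesis using True by (simp add: g_def ennreal_mult mult_ac del: of_nat_diff)
      next
        case False
        then show ?thesis by (auto simp: g_def indicator_def)
      qed
    qed
    also have "\<dots> = (\<integral>\<^sup>+t. ennreal (indicator {0<..<1} t * (t powr (2 * ((a - 1)/2) + 1) * (1 - t\<^sup>2) powr (real (?n - 2) / 2))) \<partial>lborel) *
        emeasure ?S (space ?S)"
      by (rule nn_integral_multc) measurable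
    also have "\<dots> < \<infinity>"
    proof -
      have "has_bochner_integral lborel (\<lambda>t. indicator {0<..<1} t * (t powr (2 * ((a - 1)/2) + 1) * (1 - t\<^sup>2) powr (real (?n - 2) / 2)))
          (Beta ((a - 1)/2 + 1) (real (?n - 2) / 2 + 1) / 2)"
        using a by (intro Beta_integral_squares) auto
      then have "(\<integral>\<^sup>+t. ennreal (indicator {0<..<1} t * (t powr (2 * ((a - 1)/2) + 1) * (1 - t\<^sup>2) powr (real (?n - 2) / 2))) \<partial>lborel) < \<infinity>"
        by (subst nn_integral_eq_integral) (auto simp: has_bochner_integral_iff)
      moreover have "emeasure ?S (space ?S) < \<infinity>"
        using finite_measure.emeasure_finite[OF finite_measure_sphere_measure] by (simp add: less_top)
      ultimately show ?thesis by (simp add: ennreal_mult_less_top)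
    qed
    finally show ?thesis .
  qed
  then obtain \<alpha> where \<alpha>: "A = ennreal \<alpha>" "\<alpha> \<ge> 0" by (cases A) auto
  have "(\<integral>\<^sup>+v. ennreal (indicator {0<..} (v \<bullet> \<theta>) * (v \<bullet> \<theta>) powr a) \<partial>?S) = ennreal (inverse b * \<alpha>)"
    if th: "norm \<theta> = 1" for \<theta>
  proof -
    let ?h = "\<lambda>v. ennreal (indicator {0<..} (v \<bullet> \<theta>) * (v \<bullet> \<theta>) powr a)"
    have hm: "?h \<in> borel_measurable ?S"
      by (rule measurable_sphere_measure_borel) measurable
    have "A = (\<integral>\<^sup>+t. indicator {-1<..<1} t * ennreal (sqrt (1 - t\<^sup>2) ^ (?n - 2)) *
        (\<integral>\<^sup>+v. g (slice_chart \<theta> t v) \<partial>?S) \<partial>lborel)"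
      unfolding A_def using n2 th by (subst nn_integral_sphere_slices[OF gm, of \<theta>]) auto
    \<comment> \<open>On the slice the height is r (v . \<theta>), so its power splits into a t part
      and a v part; (n - 2)/2 + a/2 = lam - 1/2 makes the t part the Gegenbauer weight.\<close>
    also have "\<dots> = (\<integral>\<^sup>+t. ennreal (indicator {-1<..<1} t * (1 - t\<^sup>2) powr (lam - 1/2)) * (\<integral>\<^sup>+v. ?h v \<partial>?S) \<partial>lborel)"
    proof (rule nn_integral_cong)
      fix t :: real
      show "indicator {-1<..<1} t * ennreal (sqrt (1 - t\<^sup>2) ^ (?n - 2)) * (\<integral>\<^sup>+v. g (slice_chart \<theta> t v) \<partial>?S) =
        ennreal (indicator {-1<..<1} t * (1 - t\<^sup>2) powr (lam - 1/2)) * (\<integral>\<^sup>+v. ?h v \<partial>?S)"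
      proof (cases "t \<in> {-1<..<1}")
        case True
        then have p: "1 - t\<^sup>2 > 0" by (simp add: abs_square_less_1 abs_less_iff)
        define r where "r = sqrt (1 - t\<^sup>2)"
        have r: "r > 0" using p by (simp add: r_def)
        have "g (slice_chart \<theta> t v) = ennreal (r powr a) * ?h v" for v
        proof (cases "v \<bullet> \<theta> > 0")
          case True
          then have "(r * (v \<bullet> \<theta>)) powr a = r powr a * (v \<bullet> \<theta>) powr a" using r by (simp add: powr_mult)
          then show ?thesis using True r by (simp add: g_def slice_chart_def r_def[symmetric] ennreal_mult)
        next
          case False
          then have "\<not> r * (v \<bullet> \<theta>) > 0" using r by (simp add: zero_less_mult_iff)
          then show ?thesis using False by (simp add: g_def slice_chart_def r_def[symmetric])
        qed
        then have "(\<integral>\<^sup>+v. g (slice_chart \<theta> t v) \<partial>?S) = ennreal (r powr a) * (\<integral>\<^sup>+v. ?h v \<partial>?S)"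
          by (simp only: nn_integral_cmult[OF hm])
        moreover have "ennreal (r ^ (?n - 2)) * ennreal (r powr a) = ennreal ((1 - t\<^sup>2) powr (lam - 1/2))"
        proof -
          have "r ^ (?n - 2) = (1 - t\<^sup>2) powr (real (?n - 2) / 2)" unfolding r_def by (rule sqrt_power_eq_powr[OF p])
          moreover have "r powr a = (1 - t\<^sup>2) powr (a / 2)" unfolding r_def using p by (simp add: powr_half_sqrt[symmetric] powr_powr)
          moreover have "real (?n - 2) / 2 + a / 2 = lam - 1/2" using n2 by (simp add: a_def of_nat_diff field_simps)
          ultimately have "r ^ (?n - 2) * r powr a = (1 - t\<^sup>2) powr (lam - 1/2)" by (simp only: powr_add[symmetric])
          then show ?thesis using r by (simp add: ennreal_mult[symmetric])
        qed
        ultimately show ?thesis using True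
          by (simp add: r_def[symmetric] mult.assoc[symmetric])
      qed simp
    qed
    also have "\<dots> = B * (\<integral>\<^sup>+v. ?h v \<partial>?S)"
      unfolding B_def by (rule nn_integral_multc) measurable
    finally have "ennreal (inverse b) * A = ennreal (inverse b) * (ennreal b * (\<integral>\<^sup>+v. ?h v \<partial>?S))"
      unfolding B b_def by simp
    also have "\<dots> = ennreal (inverse b * b) * (\<integral>\<^sup>+v. ?h v \<partial>?S)"
      using b by (subst ennreal_mult) (auto simp: mult.assoc)
    finally show ?thesis using b \<alpha> by (simp add: ennreal_mult)
  qed
  moreover have "inverse b * \<alpha> \<ge> 0" using b \<alpha> by simp
  ultimately show ?thesis by (intro that[of "inverse b * \<alpha>"]) (simp_all add: a_def)
qed

lemma Wt_measurable: "Wt k lam \<in> borel_measurable (borel :: ((real^'n) \<times> real) measure)"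
proof -
  have "snd \<in> borel_measurable (borel :: ((real^'n) \<times> real) measure)" by (intro borel_measurable_continuous_onI continuous_intros)
  from measurable_compose[OF this, of "\<lambda>s. s powr (real k - 2 * lam - 1)" borel]
  show ?thesis unfolding Wt_def[abs_def] by simp
qed

text \<open>The weighted square norm of f on one slice, in the coordinates of the unit sphere. It
  takes values in \<open>ennreal\<close> because it may be infinite on a null set of slices.\<close>

definition slice_energy :: "real \<Rightarrow> ((real^'n) \<times> real \<Rightarrow> real) \<Rightarrow> (real^'n) \<times> real \<Rightarrow> ennreal" where
  "slice_energy lam f p = (\<integral>\<^sup>+v. ennreal (indicator Splus (slice_chart (fst p) (snd p) v) *
     ((f (slice_chart (fst p) (snd p) v))\<^sup>2 * Wt CARD('n) lam (slice_chart (fst p) (snd p) v))) \<partial>sphere_measure)"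

lemma energy_density_measurable:
  fixes f :: "(real^'n) \<times> real \<Rightarrow> real"
  assumes f: "f \<in> borel_measurable Splus_measure"
  shows "(\<lambda>x. ennreal (indicator Splus x * ((f x)\<^sup>2 * Wt CARD('n) lam x))) \<in> borel_measurable borel"
proof -
  have "(\<lambda>x. indicator Splus x * f x) \<in> borel_measurable borel" using f by (simp add: Splus_measurable_iff)
  then have "(\<lambda>x. (indicator Splus x * f x)\<^sup>2 * Wt CARD('n) lam x) \<in> borel_measurable borel"
    by (rule borel_measurable_times[OF borel_measurable_power Wt_measurable])
  moreover have "(\<lambda>x. (indicator Splus x * f x)\<^sup>2 * Wt CARD('n) lam x) = (\<lambda>x. indicator Splus x * ((f x)\<^sup>2 * Wt CARD('n) lam x))"
    by (auto simp: fun_eq_iff indicator_def)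
  ultimately show ?thesis by simp
qed

lemma slice_energy_measurable:
  fixes f :: "(real^'n) \<times> real \<Rightarrow> real"
  assumes f: "f \<in> borel_measurable Splus_measure"
  shows "slice_energy lam f \<in> borel_measurable cyl_measure"
proof -
  interpret S: finite_measure "sphere_measure :: (real^'n) measure" by (rule finite_measure_sphere_measure)
  show ?thesis unfolding slice_energy_def[abs_def]
    using measurable_compose[OF cyl_sphere_chart_measurable energy_density_measurable[OF f]]
    by (intro S.borel_measurable_nn_integral) (simp add: case_prod_beta)
qed

text \<open>For each fixed direction the slices fill the half sphere, so the t-integral is the
  weighted energy of f; integrating over directions only multiplies by the area of the
  sphere.\<close>

lemma slice_energy_integral:
  fixes f :: "(real^'n) \<times> real \<Rightarrow> real"
  assumes n2: "CARD('n) \<ge> 2" and f: "f \<in> borel_measurable Splus_measure"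
  shows "(\<integral>\<^sup>+p. ennreal (sqrt (1 - (snd p)\<^sup>2) ^ (CARD('n) - 2)) * slice_energy lam f p \<partial>cyl_measure) =
    (\<integral>\<^sup>+x. ennreal ((f x)\<^sup>2 * Wt CARD('n) lam x) \<partial>Splus_measure) * emeasure (sphere_measure :: (real^'n) measure) (sphere 0 1)"
proof -
  let ?S = "sphere_measure :: (real^'n) measure"
  let ?E = "\<integral>\<^sup>+x. ennreal ((f x)\<^sup>2 * Wt CARD('n) lam x) \<partial>Splus_measure"
  interpret pair_sigma_finite ?S "restrict_space lborel {-1<..<1::real}" by (rule pair_sigma_finite_sphere) simp
  have dm: "(\<lambda>p. ennreal (sqrt (1 - (snd p)\<^sup>2) ^ (CARD('n) - 2))) \<in> borel_measurable (cyl_measure :: ((real^'n) \<times> real) measure)"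
    unfolding cyl_measure_def by (rule measurable_sphere_pair) (unfold borel_prod[symmetric], measurable)
  have m: "(\<lambda>p. ennreal (sqrt (1 - (snd p)\<^sup>2) ^ (CARD('n) - 2)) * slice_energy lam f p) \<in> borel_measurable cyl_measure"
    by (rule borel_measurable_times_ennreal[OF dm slice_energy_measurable[OF f]])
  have "(\<integral>\<^sup>+p. ennreal (sqrt (1 - (snd p)\<^sup>2) ^ (CARD('n) - 2)) * slice_energy lam f p \<partial>cyl_measure) =
    (\<integral>\<^sup>+\<theta>. (\<integral>\<^sup>+t. ennreal (sqrt (1 - t\<^sup>2) ^ (CARD('n) - 2)) * slice_energy lam f (\<theta>, t) \<partial>restrict_space lborel {-1<..<1}) \<partial>?S)"
    using M2.nn_integral_fst[OF m[unfolded cyl_measure_def]] by (simp add: cyl_measure_def)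
  also have "\<dots> = (\<integral>\<^sup>+\<theta>. ?E \<partial>?S)"
  proof (rule nn_integral_cong)
    fix \<theta> assume "\<theta> \<in> space ?S"
    then have th: "norm \<theta> = 1" by simp
    have "(\<integral>\<^sup>+t. ennreal (sqrt (1 - t\<^sup>2) ^ (CARD('n) - 2)) * slice_energy lam f (\<theta>, t) \<partial>restrict_space lborel {-1<..<1}) =
      (\<integral>\<^sup>+t. indicator {-1<..<1} t * ennreal (sqrt (1 - t\<^sup>2) ^ (CARD('n) - 2)) * slice_energy lam f (\<theta>, t) \<partial>lborel)"
      by (subst nn_integral_restrict_space) (auto simp: mult_ac)
    also have "\<dots> = (\<integral>\<^sup>+x. ennreal (indicator Splus x * ((f x)\<^sup>2 * Wt CARD('n) lam x)) \<partial>sphere_measure)"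
      unfolding slice_energy_def using n2 th
      by (subst nn_integral_sphere_slices[OF energy_density_measurable[OF f], of \<theta>]) auto
    also have "\<dots> = ?E" unfolding nn_integral_Splus_measure by (intro nn_integral_cong) (auto simp: indicator_def)
    finally show "(\<integral>\<^sup>+t. ennreal (sqrt (1 - t\<^sup>2) ^ (CARD('n) - 2)) * slice_energy lam f (\<theta>, t) \<partial>restrict_space lborel {-1<..<1}) = ?E" .
  qed
  also have "\<dots> = ?E * emeasure ?S (sphere 0 1)" by simp
  finally show ?thesis .
qed

text \<open>Cauchy--Schwarz on the slice with f split as f sqrt \<open>Wt\<close> times 1 / sqrt
  \<open>Wt\<close>. The square of the second factor integrates to a power of r times J; all powers
  of r then combine to the Jacobian of the slicing formula.\<close>

lemma V_plus_pointwise_bound: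
  fixes f :: "(real^'n) \<times> real \<Rightarrow> real"
  assumes n2: "CARD('n) \<ge> 2" and f: "f \<in> borel_measurable Splus_measure"
    and J0: "J \<ge> 0" and J: "\<And>\<theta> :: real^'n. norm \<theta> = 1 \<Longrightarrow>
      (\<integral>\<^sup>+v. ennreal (indicator {0<..} (v \<bullet> \<theta>) * (v \<bullet> \<theta>) powr (2 * lam + 1 - real CARD('n))) \<partial>sphere_measure) = ennreal J"
    and p: "p \<in> space cyl_measure" and fin: "slice_energy lam f p < \<infinity>"
  shows "integrable sphere_measure (\<lambda>v. indicator Splus (slice_chart (fst p) (snd p) v) * f (slice_chart (fst p) (snd p) v))"
    "(V_plus f (fst p) (snd p))\<^sup>2 * wt lam (snd p) \<le> J * (sqrt (1 - (snd p)\<^sup>2) ^ (CARD('n) - 2) * enn2real (slice_energy lam f p))"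
proof -
  let ?S = "sphere_measure :: (real^'n) measure"
  define \<theta> t where "\<theta> = fst p" and "t = snd p"
  have th: "norm \<theta> = 1" and t: "t \<in> {-1<..<1}" using p by (auto simp: space_cyl_measure \<theta>_def t_def)
  have x: "1 - t\<^sup>2 > 0" using t by (simp add: abs_square_less_1 abs_less_iff)
  have t1: "\<bar>t\<bar> < 1" using t by auto
  define r where "r = sqrt (1 - t\<^sup>2)"
  have r: "r > 0" using x by (simp add: r_def)
  define a where "a = 2 * lam + 1 - real CARD('n)"
  define ch where "ch = slice_chart \<theta> t"
  have chb: "ch \<in> borel \<rightarrow>\<^sub>M borel" unfolding ch_def slice_chart_def
    by (intro borel_measurable_continuous_onI continuous_intros)
  have f1: "(\<lambda>x. indicator Splus x * f x) \<in> borel_measurable borel" using f by (simp add: Splus_measurable_iff)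
  define F where "F = (\<lambda>v. indicator Splus (ch v) * f (ch v))"
  define \<phi> where "\<phi> = (\<lambda>v. F v * sqrt (Wt CARD('n) lam (ch v)))"
  \<comment> \<open>The reciprocal of the square root of \<open>Wt\<close>, supported where the
    height is positive.\<close>
  define \<psi> where "\<psi> = (\<lambda>v. indicator {0<..} (v \<bullet> \<theta>) * (r * (v \<bullet> \<theta>)) powr (a / 2))"
  have Fm: "F \<in> borel_measurable ?S" unfolding F_def
    by (rule measurable_sphere_measure_borel) (rule measurable_compose[OF chb f1])
  have \<phi>m: "\<phi> \<in> borel_measurable ?S" unfolding \<phi>_def
    by (intro borel_measurable_times Fm borel_measurable_sqrt[THEN measurable_compose[rotated]]
        measurable_sphere_measure_borel[OF measurable_compose[OF chb Wt_measurable]]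
        measurable_compose[OF measurable_sphere_measure_borel[OF measurable_compose[OF chb Wt_measurable]]]) auto
  have \<psi>m: "\<psi> \<in> borel_measurable ?S" unfolding \<psi>_def
    by (rule measurable_sphere_measure_borel) measurable
  have W0: "Wt CARD('n) lam x \<ge> 0" for x :: "(real^'n) \<times> real" by (simp add: Wt_def)
  have \<phi>2: "(\<phi> v)\<^sup>2 = indicator Splus (ch v) * ((f (ch v))\<^sup>2 * Wt CARD('n) lam (ch v))" for v
    using W0 by (simp add: \<phi>_def F_def power_mult_distrib indicator_def)
  have E: "slice_energy lam f p = (\<integral>\<^sup>+v. ennreal ((\<phi> v)\<^sup>2) \<partial>?S)"
    unfolding slice_energy_def \<phi>2 ch_def \<theta>_def t_def ..
  have \<phi>int: "integrable ?S (\<lambda>v. (\<phi> v)\<^sup>2)"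
    using fin \<phi>m unfolding E by (intro integrableI_nonneg) auto
  have \<phi>E: "(\<integral>v. (\<phi> v)\<^sup>2 \<partial>?S) = enn2real (slice_energy lam f p)"
    unfolding E using \<phi>m by (intro integral_eq_nn_integral) auto
  have \<psi>2: "(\<psi> v)\<^sup>2 = r powr a * (indicator {0<..} (v \<bullet> \<theta>) * (v \<bullet> \<theta>) powr a)" for v
  proof (cases "v \<bullet> \<theta> > 0")
    case True
    then have "((r * (v \<bullet> \<theta>)) powr (a/2))\<^sup>2 = (r * (v \<bullet> \<theta>)) powr a"
      using r by (simp add: power2_eq_square powr_add[symmetric])
    then show ?thesis using True r by (simp add: \<psi>_def powr_mult)
  qed (simp add: \<psi>_def)
  have hm: "(\<lambda>v. indicator {0<..} (v \<bullet> \<theta>) * (v \<bullet> \<theta>) powr a) \<in> borel_measurable ?S"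
    by (rule measurable_sphere_measure_borel) measurable
  have hJ: "has_bochner_integral ?S (\<lambda>v. indicator {0<..} (v \<bullet> \<theta>) * (v \<bullet> \<theta>) powr a) J"
    using J[OF th] J0 hm by (intro has_bochner_integral_nn_integral) (auto simp: a_def)
  have \<psi>J: "has_bochner_integral ?S (\<lambda>v. (\<psi> v)\<^sup>2) (r powr a * J)"
    unfolding \<psi>2 by (rule has_bochner_integral_mult_right[OF hJ])
  then have \<psi>int: "integrable ?S (\<lambda>v. (\<psi> v)\<^sup>2)" and \<psi>E: "(\<integral>v. (\<psi> v)\<^sup>2 \<partial>?S) = r powr a * J"
    by (auto simp: has_bochner_integral_iff)
  have "\<theta> \<noteq> 0" using th by auto
  \<comment> \<open>Only almost everywhere: at height 0 the weight is \<open>0 powr _ = 0\<close>,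
    so the factorisation of f breaks down there.\<close>
  have AEeq: "AE v in ?S. \<phi> v * \<psi> v = F v"
    using AE_sphere_inner_nonzero[OF \<open>\<theta> \<noteq> 0\<close>] AE_space[of ?S]
  proof eventually_elim
    case (elim v)
    then have v: "norm v = 1" by simp
    show ?case
    proof (cases "v \<bullet> \<theta> > 0")
      case True
      define y where "y = r * (v \<bullet> \<theta>)"
      have y: "y > 0" using True r by (simp add: y_def)
      have "Wt CARD('n) lam (ch v) = y powr (- a)"
        by (simp add: Wt_def ch_def slice_chart_def r_def[symmetric] y_def a_def algebra_simps)
      then have "sqrt (Wt CARD('n) lam (ch v)) = y powr (- a / 2)"
        using y by (simp add: powr_half_sqrt[symmetric] powr_powr)
      then have "sqrt (Wt CARD('n) lam (ch v)) * y powr (a / 2) = 1"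
        using y by (simp add: powr_add[symmetric])
      then show ?thesis using True by (simp add: \<phi>_def \<psi>_def y_def[symmetric] mult.assoc)
    next
      case False
      then have "\<not> 0 \<le> v \<bullet> \<theta>" using elim by simp
      then have "ch v \<notin> Splus" unfolding ch_def using slice_chart_in_Splus[OF th v t1] by simp
      then show ?thesis by (simp add: \<phi>_def F_def)
    qed
  qed
  note prod = integrable_mult_square[OF \<phi>m \<psi>m \<phi>int \<psi>int]
  have Fint: "integrable ?S F" using integrable_cong_AE[THEN iffD1, OF _ Fm AEeq prod] \<phi>m \<psi>m by simp
  then show "integrable sphere_measure (\<lambda>v. indicator Splus (slice_chart (fst p) (snd p) v) * f (slice_chart (fst p) (snd p) v))"
    unfolding F_def ch_def \<theta>_def t_def .
  have "(\<integral>v. F v \<partial>?S) = (\<integral>v. \<phi> v * \<psi> v \<partial>?S)"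
    by (rule integral_cong_AE[OF Fm]) (use \<phi>m \<psi>m AEeq in \<open>auto elim!: eventually_mono\<close>)
  then have CS: "(\<integral>v. F v \<partial>?S)\<^sup>2 \<le> enn2real (slice_energy lam f p) * (r powr a * J)"
    using integral_mult_square_bound[OF \<phi>m \<psi>m \<phi>int \<psi>int] by (simp add: \<phi>E \<psi>E)
  have V: "V_plus f (fst p) (snd p) = r ^ (CARD('n) - 1) * (\<integral>v. F v \<partial>?S)"
    unfolding V_plus_cyl[OF f p] F_def ch_def \<theta>_def t_def r_def ..
  have "(V_plus f (fst p) (snd p))\<^sup>2 * wt lam t = (r ^ (CARD('n) - 1))\<^sup>2 * wt lam t * (\<integral>v. F v \<partial>?S)\<^sup>2"
    unfolding V by (simp add: power_mult_distrib)
  also have "\<dots> \<le> (r ^ (CARD('n) - 1))\<^sup>2 * wt lam t * (enn2real (slice_energy lam f p) * (r powr a * J))"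
    using CS by (intro mult_left_mono) (auto simp: wt_def)
  also have "\<dots> = ((r ^ (CARD('n) - 1))\<^sup>2 * wt lam t * r powr a) * (J * enn2real (slice_energy lam f p))"
    by (simp add: mult_ac)
  \<comment> \<open>As powers of 1 - t^2: (n - 1) from the squared Jacobian, -1/2 - lam from
    \<open>wt\<close>, and a/2 add up to (n - 2)/2.\<close>
  also have "(r ^ (CARD('n) - 1))\<^sup>2 * wt lam t * r powr a = r ^ (CARD('n) - 2)"
  proof -
    have "(r ^ (CARD('n) - 1))\<^sup>2 = (1 - t\<^sup>2) powr real (CARD('n) - 1)"
      unfolding r_def sqrt_power_eq_powr[OF x] using x by (simp add: power2_eq_square powr_add[symmetric])
    moreover have "r powr a = (1 - t\<^sup>2) powr (a / 2)" unfolding r_def using x by (simp add: powr_half_sqrt[symmetric] powr_powr)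
    moreover have "r ^ (CARD('n) - 2) = (1 - t\<^sup>2) powr (real (CARD('n) - 2) / 2)" unfolding r_def by (rule sqrt_power_eq_powr[OF x])
    moreover have "real (CARD('n) - 1) + (- 1/2 - lam) + a / 2 = real (CARD('n) - 2) / 2"
      using n2 by (simp add: a_def of_nat_diff field_simps)
    ultimately show ?thesis unfolding wt_def by (simp only: powr_add[symmetric])
  qed
  finally show "(V_plus f (fst p) (snd p))\<^sup>2 * wt lam (snd p) \<le> J * (sqrt (1 - (snd p)\<^sup>2) ^ (CARD('n) - 2) * enn2real (slice_energy lam f p))"
    unfolding t_def[symmetric] r_def[symmetric] by (simp add: mult_ac)
qed

text \<open>Integrate the pointwise bound over the cylinder; the constant is J times the area of the
  sphere. Integrability on almost every slice is recorded too, since otherwise \<open>V_plus\<close>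
  would be a default 0 and linearity would fail.\<close>

lemma V_plus_bounded:
  fixes lam :: real
  assumes n2: "CARD('n) \<ge> 2" and lam: "lam > real CARD('n) / 2 - 1"
  obtains C where "C \<ge> 0"
    "\<And>f :: (real^'n) \<times> real \<Rightarrow> real. L2w Splus_measure (Wt CARD('n) lam) f \<Longrightarrow>
      L2w cyl_measure (\<lambda>p. wt lam (snd p)) (\<lambda>p. V_plus f (fst p) (snd p)) \<and>
      (\<integral>p. (V_plus f (fst p) (snd p))\<^sup>2 * wt lam (snd p) \<partial>cyl_measure) \<le> C * (\<integral>x. (f x)\<^sup>2 * Wt CARD('n) lam x \<partial>Splus_measure) \<and>
      (AE p in cyl_measure. integrable sphere_measure
        (\<lambda>v. indicator Splus (slice_chart (fst p) (snd p) v) * f (slice_chart (fst p) (snd p) v)))"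
proof -
  let ?S = "sphere_measure :: (real^'n) measure"
  obtain J where J0: "J \<ge> 0" and J: "\<And>\<theta> :: real^'n. norm \<theta> = 1 \<Longrightarrow>
      (\<integral>\<^sup>+v. ennreal (indicator {0<..} (v \<bullet> \<theta>) * (v \<bullet> \<theta>) powr (2 * lam + 1 - real CARD('n))) \<partial>sphere_measure) = ennreal J"
    using half_slice_weight_integral[OF n2 lam] by blast
  define \<sigma> where "\<sigma> = measure ?S (sphere 0 1)"
  have \<sigma>: "emeasure ?S (sphere 0 1) = ennreal \<sigma>" "\<sigma> \<ge> 0"
    using finite_measure.emeasure_eq_measure[OF finite_measure_sphere_measure, of "sphere 0 1 :: (real^'n) set"] by (auto simp: \<sigma>_def)
  show ?thesis
  proof (rule that[of "J * \<sigma>"])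
    fix f :: "(real^'n) \<times> real \<Rightarrow> real"
    assume L2: "L2w Splus_measure (Wt CARD('n) lam) f"
    then have f: "f \<in> borel_measurable Splus_measure" and fint: "integrable Splus_measure (\<lambda>x. (f x)\<^sup>2 * Wt CARD('n) lam x)"
      by (auto simp: L2w_def)
    define N where "N = (\<integral>x. (f x)\<^sup>2 * Wt CARD('n) lam x \<partial>Splus_measure)"
    have N0: "N \<ge> 0" unfolding N_def by (intro integral_nonneg_AE) (simp add: Wt_def)
    have N: "(\<integral>\<^sup>+x. ennreal ((f x)\<^sup>2 * Wt CARD('n) lam x) \<partial>Splus_measure) = ennreal N"
      unfolding N_def by (rule nn_integral_eq_integral[OF fint]) (simp add: Wt_def)
    let ?r = "\<lambda>p :: (real^'n) \<times> real. sqrt (1 - (snd p)\<^sup>2) ^ (CARD('n) - 2)"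
    have en: "(\<integral>\<^sup>+p. ennreal (?r p) * slice_energy lam f p \<partial>cyl_measure) = ennreal (N * \<sigma>)"
      unfolding slice_energy_integral[OF n2 f] N \<sigma>(1) using N0 \<sigma>(2) by (simp add: ennreal_mult)
    have dm: "(\<lambda>p. ennreal (?r p)) \<in> borel_measurable cyl_measure"
      unfolding cyl_measure_def by (rule measurable_sphere_pair) (unfold borel_prod[symmetric], measurable)
    have m: "(\<lambda>p. ennreal (?r p) * slice_energy lam f p) \<in> borel_measurable cyl_measure"
      by (rule borel_measurable_times_ennreal[OF dm slice_energy_measurable[OF f]])
    have rpos: "?r p > 0" if "p \<in> space cyl_measure" for p
    proof -
      have "\<bar>snd p\<bar> < 1" using that by (auto simp: space_cyl_measure)
      then show ?thesis by (simp add: abs_square_less_1)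
    qed
    have "AE p in cyl_measure. ennreal (?r p) * slice_energy lam f p \<noteq> \<infinity>"
      by (rule nn_integral_PInf_AE[OF m]) (simp add: en)
    then have fin: "AE p in cyl_measure. slice_energy lam f p < \<infinity>"
      using AE_space
    proof eventually_elim
      case (elim p)
      have "y < \<infinity>" if "ennreal x * y \<noteq> \<infinity>" "x > 0" for x y
        using that by (auto simp: ennreal_mult_eq_top_iff less_top)
      from this[OF elim(1) rpos[OF elim(2)]] show ?case .
    qed
    note pb = V_plus_pointwise_bound[OF n2 f J0 J]
    have aeint: "AE p in cyl_measure. integrable sphere_measure
        (\<lambda>v. indicator Splus (slice_chart (fst p) (snd p) v) * f (slice_chart (fst p) (snd p) v))"
      using fin AE_space by eventually_elim (rule pb(1))
    note Vm = V_plus_measurable[OF f]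
    have wm: "(\<lambda>p. wt lam (snd p)) \<in> borel_measurable (cyl_measure :: ((real^'n) \<times> real) measure)"
      unfolding cyl_measure_def wt_def by (rule measurable_sphere_pair) (unfold borel_prod[symmetric], measurable)
    have Vwm: "(\<lambda>p. (V_plus f (fst p) (snd p))\<^sup>2 * wt lam (snd p)) \<in> borel_measurable cyl_measure"
      by (intro borel_measurable_times borel_measurable_power Vm wm)
    have "(\<integral>\<^sup>+p. ennreal ((V_plus f (fst p) (snd p))\<^sup>2 * wt lam (snd p)) \<partial>cyl_measure) \<le>
      (\<integral>\<^sup>+p. ennreal J * (ennreal (?r p) * slice_energy lam f p) \<partial>cyl_measure)"
    proof (rule nn_integral_mono_AE)
      show "AE p in cyl_measure. ennreal ((V_plus f (fst p) (snd p))\<^sup>2 * wt lam (snd p)) \<le> ennreal J * (ennreal (?r p) * slice_energy lam f p)"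
        using fin AE_space
      proof eventually_elim
        case (elim p)
        have "ennreal ((V_plus f (fst p) (snd p))\<^sup>2 * wt lam (snd p)) \<le> ennreal (J * (?r p * enn2real (slice_energy lam f p)))"
          by (rule ennreal_leI[OF pb(2)[OF _ elim(2,1)]])
        also have "\<dots> = ennreal J * (ennreal (?r p) * slice_energy lam f p)"
          using elim(1) rpos[OF elim(2)] J0 by (simp add: ennreal_mult)
        finally show ?case .
      qed
    qed
    also have "\<dots> = ennreal (J * \<sigma> * N)"
      unfolding nn_integral_cmult[OF m] en using J0 N0 \<sigma>(2) by (simp add: ennreal_mult mult_ac)
    finally have nn: "(\<integral>\<^sup>+p. ennreal ((V_plus f (fst p) (snd p))\<^sup>2 * wt lam (snd p)) \<partial>cyl_measure) \<le> ennreal (J * \<sigma> * N)" .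
    have Vint: "integrable cyl_measure (\<lambda>p. (V_plus f (fst p) (snd p))\<^sup>2 * wt lam (snd p))"
      using nn by (intro integrableI_nonneg Vwm) (auto simp: wt_def intro: le_less_trans)
    have "ennreal (\<integral>p. (V_plus f (fst p) (snd p))\<^sup>2 * wt lam (snd p) \<partial>cyl_measure) \<le> ennreal (J * \<sigma> * N)"
      using nn by (subst nn_integral_eq_integral[OF Vint, symmetric]) (auto simp: wt_def)
    then have "(\<integral>p. (V_plus f (fst p) (snd p))\<^sup>2 * wt lam (snd p) \<partial>cyl_measure) \<le> J * \<sigma> * N"
      using J0 N0 \<sigma>(2) by (subst (asm) ennreal_le_iff) auto
    then show "L2w cyl_measure (\<lambda>p. wt lam (snd p)) (\<lambda>p. V_plus f (fst p) (snd p)) \<and>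
      (\<integral>p. (V_plus f (fst p) (snd p))\<^sup>2 * wt lam (snd p) \<partial>cyl_measure) \<le> J * \<sigma> * (\<integral>x. (f x)\<^sup>2 * Wt CARD('n) lam x \<partial>Splus_measure) \<and>
      (AE p in cyl_measure. integrable sphere_measure
        (\<lambda>v. indicator Splus (slice_chart (fst p) (snd p) v) * f (slice_chart (fst p) (snd p) v)))"
      using Vm Vint aeint by (simp add: L2w_def N_def)
  qed (use J0 \<sigma>(2) in simp)
qed

lemma V_plus_linear_combination:
  fixes f :: "(real^'n) \<times> real \<Rightarrow> real" and g :: "'i \<Rightarrow> (real^'n) \<times> real \<Rightarrow> real"
  assumes f: "f \<in> borel_measurable Splus_measure" and g: "\<And>i. i \<in> S \<Longrightarrow> g i \<in> borel_measurable Splus_measure"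
    and p: "p \<in> space cyl_measure"
    and If: "integrable sphere_measure (\<lambda>v. indicator Splus (slice_chart (fst p) (snd p) v) * f (slice_chart (fst p) (snd p) v))"
    and Ig: "\<And>i. i \<in> S \<Longrightarrow> integrable sphere_measure (\<lambda>v. indicator Splus (slice_chart (fst p) (snd p) v) * g i (slice_chart (fst p) (snd p) v))"
  shows "V_plus (\<lambda>x. (\<Sum>i\<in>S. c i * g i x) - f x) (fst p) (snd p) =
    (\<Sum>i\<in>S. c i * V_plus (g i) (fst p) (snd p)) - V_plus f (fst p) (snd p)"
proof -
  let ?ch = "slice_chart (fst p) (snd p)"
  have m: "(\<lambda>x. (\<Sum>i\<in>S. c i * g i x) - f x) \<in> borel_measurable Splus_measure"
    by (intro borel_measurable_diff borel_measurable_sum borel_measurable_times borel_measurable_const f g)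
  have "(\<integral>v. indicator Splus (?ch v) * ((\<Sum>i\<in>S. c i * g i (?ch v)) - f (?ch v)) \<partial>sphere_measure) =
    (\<integral>v. (\<Sum>i\<in>S. c i * (indicator Splus (?ch v) * g i (?ch v))) - indicator Splus (?ch v) * f (?ch v) \<partial>sphere_measure)"
    by (intro Bochner_Integration.integral_cong) (auto simp: right_diff_distrib sum_distrib_left mult_ac)
  also have "\<dots> = (\<integral>v. (\<Sum>i\<in>S. c i * (indicator Splus (?ch v) * g i (?ch v))) \<partial>sphere_measure) -
      (\<integral>v. indicator Splus (?ch v) * f (?ch v) \<partial>sphere_measure)"
    by (intro Bochner_Integration.integral_diff Bochner_Integration.integrable_sum integrable_mult_right Ig If)
  also have "(\<integral>v. (\<Sum>i\<in>S. c i * (indicator Splus (?ch v) * g i (?ch v))) \<partial>sphere_measure) =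
     (\<Sum>i\<in>S. \<integral>v. c i * (indicator Splus (?ch v) * g i (?ch v)) \<partial>sphere_measure)"
    by (intro Bochner_Integration.integral_sum integrable_mult_right Ig)
  also have "\<dots> = (\<Sum>i\<in>S. c i * (\<integral>v. indicator Splus (?ch v) * g i (?ch v) \<partial>sphere_measure))"
    by (intro sum.cong refl) simp
  finally have eq: "(\<integral>v. indicator Splus (?ch v) * ((\<Sum>i\<in>S. c i * g i (?ch v)) - f (?ch v)) \<partial>sphere_measure) =
    (\<Sum>i\<in>S. c i * (\<integral>v. indicator Splus (?ch v) * g i (?ch v) \<partial>sphere_measure)) -
      (\<integral>v. indicator Splus (?ch v) * f (?ch v) \<partial>sphere_measure)" .
  have "(\<Sum>i\<in>S. c i * V_plus (g i) (fst p) (snd p)) = (\<Sum>i\<in>S. c i * (sqrt (1 - (snd p)\<^sup>2) ^ (CARD('n) - 1) *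
    (\<integral>v. indicator Splus (?ch v) * g i (?ch v) \<partial>sphere_measure)))"
    by (intro sum.cong refl) (simp add: V_plus_cyl[OF g p])
  then show ?thesis unfolding V_plus_cyl[OF m p] V_plus_cyl[OF f p] eq
    by (simp add: right_diff_distrib sum_distrib_left mult_ac)
qed

section \<open>The orthonormal system on the half sphere\<close>

text \<open>Powers of 1 - t^2 span the even powers of t. Extending the function evenly to (-1, 1)
  kills the odd moments as well, and then all moments vanish.\<close>

lemma even_moments_zero_imp_AE_zero:
  fixes h :: "real \<Rightarrow> real"
  assumes h: "integrable lborel (\<lambda>t. indicator {0<..<1} t * h t)"
    and mom: "\<And>i::nat. (\<integral>t. indicator {0<..<1} t * h t * (1 - t\<^sup>2) ^ i \<partial>lborel) = 0"
  shows "AE t in lborel. t \<in> {0<..<1} \<longrightarrow> h t = 0"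
proof -
  define H where "H = (\<lambda>t. indicator {0<..<1} t * h t)"
  have Hint: "integrable lborel H" using h by (simp add: H_def)
  have bint: "integrable lborel (\<lambda>t. H t * q t)" if q: "continuous_on UNIV q" "\<And>t. t \<in> {0<..<1} \<Longrightarrow> \<bar>q t\<bar> \<le> 1" for q
  proof (rule Bochner_Integration.integrable_bound[OF Hint])
    show "(\<lambda>t. H t * q t) \<in> borel_measurable lborel"
      using Hint borel_measurable_continuous_onI[OF q(1)] by auto
    show "AE t in lborel. norm (H t * q t) \<le> norm (H t)"
    proof (rule AE_I2)
      fix t
      show "norm (H t * q t) \<le> norm (H t)"
      proof (cases "t \<in> {0<..<1}")
        case True
        have "\<bar>H t\<bar> * \<bar>q t\<bar> \<le> \<bar>H t\<bar> * 1" by (intro mult_left_mono q(2) True) simp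
        then show ?thesis by (simp add: abs_mult)
      qed (simp add: H_def)
    qed
  qed
  have even: "(\<integral>t. H t * t ^ (2 * q) \<partial>lborel) = 0" for q
  proof -
    have "t ^ (2 * q) = (\<Sum>j\<le>q. real (q choose j) * (-1)^j * (1 - t\<^sup>2)^j)" for t :: real
    proof -
      have "t ^ (2 * q) = (1 + - (1 - t\<^sup>2)) ^ q" by (simp add: power_mult)
      also have "\<dots> = (- (1 - t\<^sup>2) + 1) ^ q" by (simp add: add.commute)
      also have "\<dots> = (\<Sum>j\<le>q. real (q choose j) * (- (1 - t\<^sup>2))^j * 1^(q - j))" by (rule binomial_ring)
      also have "\<dots> = (\<Sum>j\<le>q. real (q choose j) * (-1)^j * (1 - t\<^sup>2)^j)"
      proof (intro sum.cong refl)
        fix j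
        have "(- (1 - t\<^sup>2))^j = (-1)^j * (1 - t\<^sup>2)^j" by (metis mult_minus1 power_mult_distrib)
        then show "real (q choose j) * (- (1 - t\<^sup>2))^j * 1^(q - j) = real (q choose j) * (-1)^j * (1 - t\<^sup>2)^j" by simp
      qed
      finally show ?thesis .
    qed
    then have "(\<integral>t. H t * t ^ (2 * q) \<partial>lborel) = (\<integral>t. (\<Sum>j\<le>q. (real (q choose j) * (-1)^j) * (H t * (1 - t\<^sup>2)^j)) \<partial>lborel)"
      by (simp add: sum_distrib_left mult_ac)
    also have "\<dots> = (\<Sum>j\<le>q. (real (q choose j) * (-1)^j) * (\<integral>t. H t * (1 - t\<^sup>2)^j \<partial>lborel))"
    proof -
      have "integrable lborel (\<lambda>t. H t * (1 - t\<^sup>2)^j)" for j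
      proof (rule bint)
        fix t :: real assume "t \<in> {0<..<1}"
        then have "0 \<le> 1 - t\<^sup>2" "1 - t\<^sup>2 \<le> 1" by (auto simp: power_le_one)
        then show "\<bar>(1 - t\<^sup>2)^j\<bar> \<le> 1" by (simp add: power_le_one abs_le_iff)
      qed (intro continuous_intros)
      then show ?thesis by (subst Bochner_Integration.integral_sum) auto
    qed
    also have "\<dots> = 0" using mom by (simp add: H_def)
    finally show ?thesis .
  qed
  have Pint: "integrable lborel (\<lambda>t. t ^ l * H t)" for l
  proof -
    have "integrable lborel (\<lambda>t. H t * t ^ l)"
      by (rule bint) (auto intro!: continuous_intros simp: power_abs power_le_one)
    then show ?thesis by (simp add: mult.commute)
  qed
  \<comment> \<open>The even extension: the two summands have disjoint supports, so \<open>K\<close>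
    equals h on (0, 1).\<close>
  define K where "K = (\<lambda>t. H t + H (- t))"
  have Hm: "integrable lborel (\<lambda>t. H (- t))"
    using lborel_integrable_real_affine_iff[of "-1" H 0] Hint by simp
  have refl: "integrable lborel (\<lambda>t. (- t) ^ l * H (- t)) \<and> (\<integral>t. (- t) ^ l * H (- t) \<partial>lborel) = (\<integral>t. t ^ l * H t \<partial>lborel)" for l
    using lborel_integrable_real_affine_iff[of "-1" "\<lambda>t. t ^ l * H t" 0] Pint[of l]
      lborel_integral_real_affine[of "-1" "\<lambda>t. t ^ l * H t" 0] by simp
  have "AE t in lborel. K t = 0"
  proof (rule moments_zero_imp_AE_zero[of K "-1" 1])
    show "integrable lborel K" unfolding K_def using Hint Hm by simp
    show "t \<notin> {- 1..1} \<Longrightarrow> K t = 0" for t by (auto simp: K_def H_def indicator_def)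
    fix l :: nat
    have sgn: "t ^ l = (-1)^l * (- t) ^ l" for t :: real by (simp add: power_mult_distrib[symmetric])
    have "(\<integral>t. t ^ l * K t \<partial>lborel) = (\<integral>t. t ^ l * H t + (-1)^l * ((- t) ^ l * H (- t)) \<partial>lborel)"
      unfolding K_def by (intro Bochner_Integration.integral_cong) (simp_all add: distrib_left mult.assoc[symmetric] sgn[symmetric])
    also have "\<dots> = (\<integral>t. t ^ l * H t \<partial>lborel) + (-1)^l * (\<integral>t. (- t) ^ l * H (- t) \<partial>lborel)"
      using Pint[of l] refl[of l] by (subst Bochner_Integration.integral_add) auto
    also have "\<dots> = (1 + (-1)^l) * (\<integral>t. t ^ l * H t \<partial>lborel)" using refl[of l] by (simp add: algebra_simps)
    also have "\<dots> = 0"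
    proof (cases "even l")
      case True
      then obtain q where "l = 2 * q" by (elim evenE)
      then show ?thesis using even[of q] by (simp add: mult.commute)
    qed simp
    finally show "(\<integral>t. t ^ l * K t \<partial>lborel) = 0" .
  qed
  then show ?thesis
  proof eventually_elim
    case (elim t)
    then show ?case by (auto simp: K_def H_def indicator_def split: if_splits)
  qed
qed

lemma jacobiP_continuous: "continuous_on UNIV (\<lambda>x. jacobiP k a b x)"
  unfolding jacobiP_def by (intro continuous_intros) auto

lemma gegenbauerC_continuous: "continuous_on UNIV (\<lambda>x. gegenbauerC l k x)"
  unfolding gegenbauerC_def by (intro continuous_intros) auto

section \<open>Products of spherical harmonics and Jacobi functions\<close>

locale sphere_transform =
  fixes lam :: real and Y :: "nat \<Rightarrow> nat \<Rightarrow> real^'n \<Rightarrow> real"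
  assumes n2: "CARD('n) \<ge> 2" and lam: "lam > real CARD('n) / 2 - 1"
    and Ybasis: "sph_harm_basis CARD('n) Y"
begin

abbreviation "S \<equiv> sphere_measure :: (real^'n) measure"
text \<open>The Jacobi parameters are \<open>a\<close> and \<open>b m\<close>; the hypothesis on lam
  is the classical condition a > -1.\<close>

definition "a = lam - real CARD('n) / 2"
definition "b m = real m + real CARD('n) / 2 - 1"

definition "index m \<mu> \<longleftrightarrow> 1 \<le> \<mu> \<and> \<mu> \<le> dn CARD('n) m"

lemma lam_pos: "lam > 0" and a_gt: "a > -1" and b_gt: "b m > -1" and ab_gt: "a + b m > -1"
  using lam n2 by (auto simp: a_def b_def)

lemma index_set_iff: "(m, \<mu>, k) \<in> index_set CARD('n) \<longleftrightarrow> index m \<mu>"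
  by (simp add: index_set_def index_def)

lemma Y_harmonic:
  assumes "index m \<mu>"
  obtains H where "harmonic_polynomial H" "homogeneous m H" "\<And>u. norm u = 1 \<Longrightarrow> Y m \<mu> u = H u"
proof -
  have "spherical_harmonic m (Y m \<mu>)" using Ybasis assms unfolding sph_harm_basis_def index_def by blast
  then show ?thesis using spherical_harmonic_polynomial that by blast
qed

lemma Y_measurable: "index m \<mu> \<Longrightarrow> Y m \<mu> \<in> borel_measurable S"
proof -
  assume "index m \<mu>"
  then obtain H where H: "harmonic_polynomial H" "\<And>u. norm u = 1 \<Longrightarrow> Y m \<mu> u = H u" using Y_harmonic by metis
  have "H \<in> borel_measurable S" using H(1)
    by (intro measurable_sphere_measure_borel borel_measurable_continuous_onI continuous_real_polynomial) (simp add: harmonic_polynomial_def)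
  then show ?thesis by (subst measurable_cong[of S _ H]) (auto simp: H(2))
qed

lemma Y_mult_integrable: "index m \<mu> \<Longrightarrow> index m' \<mu>' \<Longrightarrow> integrable S (\<lambda>u. Y m \<mu> u * Y m' \<mu>' u)"
proof -
  assume i: "index m \<mu>" "index m' \<mu>'"
  obtain H where H: "harmonic_polynomial H" "\<And>u. norm u = 1 \<Longrightarrow> Y m \<mu> u = H u" using Y_harmonic[OF i(1)] by metis
  obtain H' where H': "harmonic_polynomial H'" "\<And>u. norm u = 1 \<Longrightarrow> Y m' \<mu>' u = H' u" using Y_harmonic[OF i(2)] by metis
  have "integrable S (\<lambda>u. H u * H' u)"
    using H(1) H'(1) by (intro integrable_sphere_polynomial real_polynomial_function.intros(4)) (auto simp: harmonic_polynomial_def)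
  then show ?thesis by (subst Bochner_Integration.integrable_cong[OF refl, of S _ "\<lambda>u. H u * H' u"]) (auto simp: H(2) H'(2))
qed

lemma Y_orthonormal: "index m \<mu> \<Longrightarrow> index m' \<mu>' \<Longrightarrow>
    (\<integral>u. Y m \<mu> u * Y m' \<mu>' u \<partial>S) = (if (m, \<mu>) = (m', \<mu>') then 1 else 0)"
  using Ybasis unfolding sph_harm_basis_def index_def by blast

lemma Y_complete:
  assumes "g \<in> borel_measurable S" "integrable S (\<lambda>u. (g u)\<^sup>2)" "\<And>m \<mu>. index m \<mu> \<Longrightarrow> (\<integral>u. g u * Y m \<mu> u \<partial>S) = 0"
  shows "AE u in S. g u = 0"
proof -
  have "L2w S (\<lambda>_. 1) g" using assms by (simp add: L2w_def)
  then show ?thesis using Ybasis assms(3) unfolding sph_harm_basis_def index_def by blast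
qed

text \<open>Shared by both sides. For different (m, \<mu>) the spherical factor already integrates
  to zero, so the functions R need be orthonormal only in k.\<close>

lemma product_orthonormal_system:
  fixes A :: "real set" and R :: "nat \<times> nat \<times> nat \<Rightarrow> real \<Rightarrow> real"
  assumes A: "A \<in> sets borel"
    and Rm: "\<And>m \<mu> k. R (m, \<mu>, k) \<in> borel_measurable borel"
    and Ri: "\<And>m \<mu> k k'. has_bochner_integral lborel (\<lambda>t. indicator A t * (R (m, \<mu>, k) t * R (m, \<mu>, k') t)) (if k = k' then 1 else 0)"
  shows "orthonormal_system (S \<Otimes>\<^sub>M restrict_space lborel A)
    (\<lambda>(m, \<mu>, k) p. R (m, \<mu>, k) (snd p) * Y m \<mu> (fst p)) (index_set CARD('n))"
proof
  interpret P: pair_sigma_finite S "restrict_space lborel A" by (rule pair_sigma_finite_sphere[OF A])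
  have Rm': "R (m, \<mu>, k) \<in> borel_measurable (restrict_space lborel A)" for m \<mu> k
    by (rule measurable_restrict_space1) (use Rm in simp)
  have Ri': "integrable (restrict_space lborel A) (\<lambda>t. R (m, \<mu>, k) t * R (m, \<mu>, k') t)"
    "(\<integral>t. R (m, \<mu>, k) t * R (m, \<mu>, k') t \<partial>restrict_space lborel A) = (if k = k' then 1 else 0)" for m \<mu> k k'
    using Ri[of m \<mu> k k'] A by (auto simp: has_bochner_integral_iff integrable_restrict_space set_integrable_def integral_restrict_space)
  fix i :: "nat \<times> nat \<times> nat" assume i: "i \<in> index_set CARD('n)"
  obtain m \<mu> k where ieq: "i = (m, \<mu>, k)" by (cases i) auto
  have im: "index m \<mu>" using i by (simp add: ieq index_set_iff)
  show "(case i of (m, \<mu>, k) \<Rightarrow> \<lambda>p. R (m, \<mu>, k) (snd p) * Y m \<mu> (fst p)) \<in> borel_measurable (S \<Otimes>\<^sub>M restrict_space lborel A)"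
    unfolding ieq prod.case
    by (intro borel_measurable_times measurable_compose[OF measurable_snd Rm'] measurable_compose[OF measurable_fst Y_measurable[OF im]])
  have sq: "integrable (S \<Otimes>\<^sub>M restrict_space lborel A) (\<lambda>p. (Y m \<mu> (fst p) * Y m \<mu> (fst p)) * (R (m, \<mu>, k) (snd p) * R (m, \<mu>, k) (snd p)))"
    by (rule P.integrable_prod_mult(1)[OF Y_mult_integrable[OF im im] Ri'(1)])
  then show "integrable (S \<Otimes>\<^sub>M restrict_space lborel A) (\<lambda>p. ((case i of (m, \<mu>, k) \<Rightarrow> \<lambda>p. R (m, \<mu>, k) (snd p) * Y m \<mu> (fst p)) p)\<^sup>2)"
    unfolding ieq prod.case by (simp add: power2_eq_square mult_ac)
  fix j :: "nat \<times> nat \<times> nat" assume j: "j \<in> index_set CARD('n)"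
  obtain m' \<mu>' k' where jeq: "j = (m', \<mu>', k')" by (cases j) auto
  have jm: "index m' \<mu>'" using j by (simp add: jeq index_set_iff)
  have RR: "integrable (restrict_space lborel A) (\<lambda>t. R (m, \<mu>, k) t * R (m', \<mu>', k') t)"
    using Ri'(1)[of m \<mu> k k] Ri'(1)[of m' \<mu>' k' k'] by (intro integrable_mult_square Rm') (simp_all add: power2_eq_square)
  have "(\<integral>p. (R (m, \<mu>, k) (snd p) * Y m \<mu> (fst p)) * (R (m', \<mu>', k') (snd p) * Y m' \<mu>' (fst p)) \<partial>(S \<Otimes>\<^sub>M restrict_space lborel A)) =
    (\<integral>p. (Y m \<mu> (fst p) * Y m' \<mu>' (fst p)) * (R (m, \<mu>, k) (snd p) * R (m', \<mu>', k') (snd p)) \<partial>(S \<Otimes>\<^sub>M restrict_space lborel A))"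
    by (simp add: mult_ac)
  also have "\<dots> = (\<integral>u. Y m \<mu> u * Y m' \<mu>' u \<partial>S) * (\<integral>t. R (m, \<mu>, k) t * R (m', \<mu>', k') t \<partial>restrict_space lborel A)"
    by (rule P.integrable_prod_mult(2)[OF Y_mult_integrable[OF im jm] RR])
  also have "\<dots> = (if i = j then 1 else 0)"
    unfolding Y_orthonormal[OF im jm] ieq jeq using Ri'(2)[of m \<mu> k k'] by auto
  finally show "(\<integral>p. (case i of (m, \<mu>, k) \<Rightarrow> \<lambda>p. R (m, \<mu>, k) (snd p) * Y m \<mu> (fst p)) p *
      (case j of (m, \<mu>, k) \<Rightarrow> \<lambda>p. R (m, \<mu>, k) (snd p) * Y m \<mu> (fst p)) p \<partial>(S \<Otimes>\<^sub>M restrict_space lborel A)) = (if i = j then 1 else 0)"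
    unfolding ieq jeq prod.case .
qed

text \<open>The normalised Jacobi polynomial times the square root of its weight, the exponents
  being half of 2 a + 1 and of \<open>b m\<close>; hence orthonormal without a weight.\<close>

definition radial :: "nat \<times> nat \<times> nat \<Rightarrow> real \<Rightarrow> real" where
  "radial = (\<lambda>(m, \<mu>, k) t. c_const CARD('n) lam (m, \<mu>, k) * ((1 - t\<^sup>2) powr (b m / 2) * t powr (a + 1/2) * jacobiP k a (b m) (2 * (1 - t\<^sup>2) - 1)))"

definition half_basis :: "nat \<times> nat \<times> nat \<Rightarrow> (real^'n) \<times> real \<Rightarrow> real" where
  "half_basis = (\<lambda>(m, \<mu>, k) p. radial (m, \<mu>, k) (snd p) * Y m \<mu> (fst p))"

text \<open>In the Jacobi parameters the squared constant is the reciprocal of the squared norm in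
  \<open>jacobiP_orthogonal\<close>.\<close>

lemma c_const_square:
  "(c_const CARD('n) lam (m, \<mu>, k))\<^sup>2 = 2 * fact k * (a + b m + 2 * real k + 1) * Gamma (a + b m + real k + 1) /
    (Gamma (a + real k + 1) * Gamma (b m + real k + 1))"
  and c_const_pos: "c_const CARD('n) lam (m, \<mu>, k) > 0"
proof -
  have e: "2 * real k + lam + real m = a + b m + 2 * real k + 1" "real k + real m + lam = a + b m + real k + 1"
    "real k + lam - real CARD('n) / 2 + 1 = a + real k + 1" "real k + real m + real CARD('n) / 2 = b m + real k + 1"
    by (auto simp: a_def b_def)
  have "2 * fact k * (a + b m + 2 * real k + 1) * Gamma (a + b m + real k + 1) /
    (Gamma (a + real k + 1) * Gamma (b m + real k + 1)) > 0"
    using a_gt b_gt[of m] ab_gt[of m] by (intro divide_pos_pos mult_pos_pos Gamma_real_pos) auto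
  then show "(c_const CARD('n) lam (m, \<mu>, k))\<^sup>2 = 2 * fact k * (a + b m + 2 * real k + 1) * Gamma (a + b m + real k + 1) /
    (Gamma (a + real k + 1) * Gamma (b m + real k + 1))" "c_const CARD('n) lam (m, \<mu>, k) > 0"
    unfolding c_const_def prod.case e by simp_all
qed

lemma radial_measurable: "radial (m, \<mu>, k) \<in> borel_measurable borel"
proof -
  have [measurable]: "(\<lambda>t::real. jacobiP k a (b m) (2 * (1 - t\<^sup>2) - 1)) \<in> borel_measurable borel"
    by (intro borel_measurable_continuous_onI continuous_on_compose2[OF jacobiP_continuous]) (auto intro!: continuous_intros)
  show ?thesis unfolding radial_def prod.case by measurable
qed

lemma radial_orthonormal:
  "has_bochner_integral lborel (\<lambda>t. indicator {0<..<1} t * (radial (m, \<mu>, k) t * radial (m, \<mu>, k') t)) (if k = k' then 1 else 0)"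
proof -
  let ?c = "c_const CARD('n) lam (m, \<mu>, k) * c_const CARD('n) lam (m, \<mu>, k')"
  have "has_bochner_integral lborel (\<lambda>t. ?c * (indicator {0<..<1} t * (t powr (2*a + 1) * (1 - t\<^sup>2) powr (b m) *
       jacobiP k a (b m) (2 * (1 - t\<^sup>2) - 1) * jacobiP k' a (b m) (2 * (1 - t\<^sup>2) - 1))))
    (?c * (if k = k' then Gamma (a + real k + 1) * Gamma (b m + real k + 1) /
       (2 * fact k * Gamma (a + b m + real k + 1) * (a + b m + 2 * real k + 1)) else 0))"
    by (intro has_bochner_integral_mult_right jacobiP_orthogonal a_gt b_gt ab_gt)
  also have "(\<lambda>t. ?c * (indicator {0<..<1} t * (t powr (2*a + 1) * (1 - t\<^sup>2) powr (b m) *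
       jacobiP k a (b m) (2 * (1 - t\<^sup>2) - 1) * jacobiP k' a (b m) (2 * (1 - t\<^sup>2) - 1)))) =
    (\<lambda>t. indicator {0<..<1} t * (radial (m, \<mu>, k) t * radial (m, \<mu>, k') t))"
  proof
    fix t :: real
    have "t powr (2*a + 1) = t powr (a + 1/2) * t powr (a + 1/2)" by (simp add: powr_add[symmetric])
    moreover have "(1 - t\<^sup>2) powr (b m) = (1 - t\<^sup>2) powr (b m / 2) * (1 - t\<^sup>2) powr (b m / 2)" by (simp add: powr_add[symmetric])
    ultimately show "?c * (indicator {0<..<1} t * (t powr (2*a + 1) * (1 - t\<^sup>2) powr (b m) *
       jacobiP k a (b m) (2 * (1 - t\<^sup>2) - 1) * jacobiP k' a (b m) (2 * (1 - t\<^sup>2) - 1))) =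
       indicator {0<..<1} t * (radial (m, \<mu>, k) t * radial (m, \<mu>, k') t)"
      unfolding radial_def prod.case by (simp only: mult_ac)
  qed
  also have "?c * (if k = k' then Gamma (a + real k + 1) * Gamma (b m + real k + 1) /
       (2 * fact k * Gamma (a + b m + real k + 1) * (a + b m + 2 * real k + 1)) else 0) = (if k = k' then 1 else 0)"
  proof (cases "k = k'")
    case True
    have "Gamma (a + real k + 1) > 0" "Gamma (b m + real k + 1) > 0" "Gamma (a + b m + real k + 1) > 0" "a + b m + 2 * real k + 1 > 0"
      using a_gt b_gt[of m] ab_gt[of m] by (auto intro!: Gamma_real_pos)
    then have nz: "Gamma (a + real k + 1) \<noteq> 0" "Gamma (b m + real k + 1) \<noteq> 0" "Gamma (a + b m + real k + 1) \<noteq> 0" "a + b m + 2 * real k + 1 \<noteq> 0"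
      by linarith+
    have "?c = (c_const CARD('n) lam (m, \<mu>, k))\<^sup>2" using True by (simp add: power2_eq_square)
    then show ?thesis using nz True unfolding c_const_square by simp
  qed simp
  finally show ?thesis .
qed

lemma half_basis_orthonormal: "orthonormal_system half_cyl_measure half_basis (index_set CARD('n))"
  unfolding half_cyl_measure_def half_basis_def
  by (rule product_orthonormal_system) (simp_all add: radial_measurable radial_orthonormal)

text \<open>Take the Fourier coefficient of g against one harmonic as a function of t. Orthogonality
  for all k makes its weighted version orthogonal to all Jacobi polynomials, hence to all powers of
  1 - t^2, so it is zero for almost all t. Completeness of the harmonics then works fibre by
  fibre.\<close>

lemma half_basis_complete:
  assumes g: "g \<in> borel_measurable half_cyl_measure" and g2: "integrable half_cyl_measure (\<lambda>p. (g p)\<^sup>2)"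
    and orth: "\<And>\<nu>. \<nu> \<in> index_set CARD('n) \<Longrightarrow> (\<integral>p. g p * half_basis \<nu> p \<partial>half_cyl_measure) = 0"
  shows "AE p in half_cyl_measure. g p = 0"
proof -
  let ?L = "restrict_space lborel {0<..<1::real}"
  interpret P: pair_sigma_finite S ?L by (rule pair_sigma_finite_sphere) simp
  interpret O: orthonormal_system half_cyl_measure half_basis "index_set CARD('n)" by (rule half_basis_orthonormal)
  have gm[measurable]: "g \<in> borel_measurable (S \<Otimes>\<^sub>M ?L)" using g by (simp add: half_cyl_measure_def)
  have coeff: "AE t in ?L. (\<integral>u. g (u, t) * Y m \<mu> u \<partial>S) = 0" if i: "index m \<mu>" for m \<mu>
  proof -
    define G where "G = (\<lambda>t. \<integral>u. g (u, t) * Y m \<mu> u \<partial>S)"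
    have iI: "(m, \<mu>, k) \<in> index_set CARD('n)" for k using i by (simp add: index_set_iff)
    have int: "integrable (S \<Otimes>\<^sub>M ?L) (\<lambda>p. g p * half_basis (m, \<mu>, k) p)" for k
      using integrable_mult_square[OF g O.e_measurable[OF iI] g2 O.e_square[OF iI]] by (simp add: half_cyl_measure_def)
    have sec: "(\<integral>u. g (u, t) * half_basis (m, \<mu>, k) (u, t) \<partial>S) = radial (m, \<mu>, k) t * G t" for k t
      unfolding G_def half_basis_def prod.case by (simp add: mult_ac flip: integral_mult_right_zero)
    have int': "integrable (S \<Otimes>\<^sub>M ?L) (\<lambda>(u, t). g (u, t) * half_basis (m, \<mu>, k) (u, t))" for k
      using int[of k] by (simp only: split_def prod.collapse)
    have Rint: "integrable ?L (\<lambda>t. radial (m, \<mu>, k) t * G t)" for k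
      using P.integrable_snd[OF int'[of k]] by (simp only: sec)
    have R0: "(\<integral>t. radial (m, \<mu>, k) t * G t \<partial>?L) = 0" for k
      using P.integral_snd[OF int'[of k]] orth[OF iI[of k]]
      by (simp only: sec split_def prod.collapse half_cyl_measure_def)
    \<comment> \<open>The coefficient \<open>G\<close> times those factors of \<open>radial\<close>
      that do not depend on k, apart from the constant.\<close>
    define h where "h = (\<lambda>t. (1 - t\<^sup>2) powr (b m / 2) * t powr (a + 1/2) * G t)"
    have J0: "jacobiP 0 a (b m) x = 1" for x by (simp add: jacobiP_def)
    define c where "c = (\<lambda>k. c_const CARD('n) lam (m, \<mu>, k))"
    have c: "c k > 0" for k unfolding c_def by (rule c_const_pos)
    have rG: "radial (m, \<mu>, k) t * G t = c k * (h t * jacobiP k a (b m) (2 * (1 - t\<^sup>2) - 1))" for k t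
      unfolding radial_def h_def c_def prod.case by (simp add: mult_ac)
    have Hint: "integrable lborel (\<lambda>t. indicator {0<..<1} t * h t)"
      using Rint[of 0] c[of 0] unfolding rG J0 by (simp add: integrable_restrict_space set_integrable_def)
    have PJ: "(\<integral>t. indicator {0<..<1} t * h t * jacobiP k a (b m) (2 * (1 - t\<^sup>2) - 1) \<partial>lborel) = 0" for k
      using R0[of k] c[of k] unfolding rG by (simp add: integral_restrict_space mult.assoc)
    have hi: "integrable lborel (\<lambda>t. indicator {0<..<1} t * h t * (1 - t\<^sup>2) ^ i)" for i
    proof (rule Bochner_Integration.integrable_bound[OF Hint])
      have "(\<lambda>t. indicator {0<..<1} t * h t) \<in> borel_measurable borel" using Hint by simp
      then show "(\<lambda>t. indicator {0<..<1} t * h t * (1 - t\<^sup>2) ^ i) \<in> borel_measurable lborel" by simp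
      show "AE t in lborel. norm (indicator {0<..<1} t * h t * (1 - t\<^sup>2) ^ i) \<le> norm (indicator {0<..<1} t * h t)"
      proof (rule AE_I2)
        fix t :: real
        show "norm (indicator {0<..<1} t * h t * (1 - t\<^sup>2) ^ i) \<le> norm (indicator {0<..<1} t * h t)"
        proof (cases "t \<in> {0<..<1}")
          case True
          then have "0 \<le> 1 - t\<^sup>2" "1 - t\<^sup>2 \<le> 1" by (auto simp: power_le_one)
          then have "\<bar>(1 - t\<^sup>2)^i\<bar> \<le> 1" by (simp add: power_le_one abs_le_iff)
          then have "\<bar>h t\<bar> * \<bar>(1 - t\<^sup>2)^i\<bar> \<le> \<bar>h t\<bar> * 1" by (intro mult_left_mono) auto
          then show ?thesis using True by (simp add: abs_mult)
        qed simp
      qed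
    qed
    \<comment> \<open>The Jacobi polynomial of degree i has a positive leading coefficient, so its
      vanishing integral determines the i-th moment from the lower ones.\<close>
    have mom: "(\<integral>t. indicator {0<..<1} t * h t * (1 - t\<^sup>2) ^ i \<partial>lborel) = 0" for i
    proof (induction i rule: less_induct)
      case (less i)
      obtain e where e: "\<And>s. jacobiP i a (b m) (2 * s - 1) = (\<Sum>j\<le>i. e j * s ^ j)" and ei: "e i = (2 * real i + a + b m) gchoose i"
        using jacobiP_power_expansion[of i a "b m"] by blast
      have "e i > 0"
        unfolding ei using ab_gt[of m] by (subst gbinomial_Gamma_real) (auto intro!: divide_pos_pos mult_pos_pos Gamma_real_pos)
      have "0 = (\<integral>t. indicator {0<..<1} t * h t * (\<Sum>j\<le>i. e j * (1 - t\<^sup>2) ^ j) \<partial>lborel)"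
        using PJ[of i] unfolding e by simp
      also have "\<dots> = (\<integral>t. (\<Sum>j\<le>i. e j * (indicator {0<..<1} t * h t * (1 - t\<^sup>2) ^ j)) \<partial>lborel)"
        by (simp add: sum_distrib_left mult_ac)
      also have "\<dots> = (\<Sum>j\<le>i. e j * (\<integral>t. indicator {0<..<1} t * h t * (1 - t\<^sup>2) ^ j \<partial>lborel))"
        by (subst Bochner_Integration.integral_sum) (auto intro!: integrable_mult_right hi)
      also have "\<dots> = (\<Sum>j\<in>{i}. e j * (\<integral>t. indicator {0<..<1} t * h t * (1 - t\<^sup>2) ^ j \<partial>lborel))"
        by (intro sum.mono_neutral_right) (auto simp: less.IH)
      finally show ?case using \<open>e i > 0\<close> by simp
    qed
    have "AE t in lborel. t \<in> {0<..<1} \<longrightarrow> h t = 0" by (rule even_moments_zero_imp_AE_zero[OF Hint mom])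
    then have "AE t in lborel. t \<in> {0<..<1} \<longrightarrow> G t = 0"
    proof eventually_elim
      case (elim t)
      show ?case
      proof
        assume t: "t \<in> {0<..<1}"
        then have "1 - t\<^sup>2 > 0" "t > 0" by (auto simp: power_less_one_iff)
        then show "G t = 0" using elim t by (simp add: h_def)
      qed
    qed
    then show ?thesis unfolding G_def by (subst AE_restrict_space_iff) auto
  qed
  \<comment> \<open>There are countably many pairs (m, \<mu>), so one null set of heights serves
    them all.\<close>
  have "AE t in ?L. \<forall>m \<mu>. index m \<mu> \<longrightarrow> (\<integral>u. g (u, t) * Y m \<mu> u \<partial>S) = 0"
  proof -
    have "AE t in ?L. index m \<mu> \<longrightarrow> (\<integral>u. g (u, t) * Y m \<mu> u \<partial>S) = 0" for m \<mu>
      using coeff[of m \<mu>] by (cases "index m \<mu>") auto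
    then show ?thesis by (simp add: AE_all_countable)
  qed
  moreover have "AE t in ?L. integrable S (\<lambda>u. (g (u, t))\<^sup>2)"
  proof (rule P.AE_integrable_snd)
    show "integrable (S \<Otimes>\<^sub>M ?L) (\<lambda>(u, t). (g (u, t))\<^sup>2)"
      using g2 by (simp only: split_def prod.collapse half_cyl_measure_def)
  qed
  moreover have "AE t in ?L. t \<in> space ?L" by (rule AE_space)
  ultimately have "AE t in ?L. (\<integral>\<^sup>+u. ennreal ((g (u, t))\<^sup>2) \<partial>S) = 0"
  proof eventually_elim
    case (elim t)
    have sm: "(\<lambda>u. g (u, t)) \<in> borel_measurable S"
      by (rule measurable_compose[OF measurable_Pair2'[OF elim(3)] gm])
    have "AE u in S. g (u, t) = 0" by (rule Y_complete[OF sm elim(2)]) (use elim(1) in blast)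
    then have "(\<integral>\<^sup>+u. ennreal ((g (u, t))\<^sup>2) \<partial>S) = (\<integral>\<^sup>+u. 0 \<partial>S)"
      by (intro nn_integral_cong_AE) (auto elim!: eventually_mono)
    then show ?case by simp
  qed
  then have "(\<integral>\<^sup>+t. (\<integral>\<^sup>+u. ennreal ((g (u, t))\<^sup>2) \<partial>S) \<partial>?L) = (\<integral>\<^sup>+t. 0 \<partial>?L)"
    by (intro nn_integral_cong_AE) auto
  then have "(\<integral>\<^sup>+p. ennreal ((g p)\<^sup>2) \<partial>(S \<Otimes>\<^sub>M ?L)) = 0"
    by (subst P.nn_integral_snd[symmetric]) auto
  then have "AE p in S \<Otimes>\<^sub>M ?L. ennreal ((g p)\<^sup>2) = 0"
    by (subst (asm) nn_integral_0_iff_AE) auto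
  then show ?thesis unfolding half_cyl_measure_def by eventually_elim simp
qed

end

section \<open>The singular value decomposition\<close>

context sphere_transform
begin

text \<open>Pullback multiplied by the square root of Jacobian times weight: this makes it an
  isometry from the weighted space on the half sphere into the unweighted one on the half
  cylinder.\<close>

definition lift :: "((real^'n) \<times> real \<Rightarrow> real) \<Rightarrow> (real^'n) \<times> real \<Rightarrow> real" where
  "lift f p = (let x = (sqrt (1 - (snd p)\<^sup>2) *\<^sub>R fst p, snd p) in
     sqrt (sqrt (1 - (snd p)\<^sup>2) ^ (CARD('n) - 2) * Wt CARD('n) lam x) * f x)"

lemma space_half_cyl: "space (half_cyl_measure :: ((real^'n) \<times> real) measure) = sphere 0 1 \<times> {0<..<1}"
  by (simp add: half_cyl_measure_def space_pair_measure space_restrict_space)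

lemma lift_measurable:
  assumes f: "f \<in> borel_measurable Splus_measure"
  shows "lift f \<in> borel_measurable half_cyl_measure"
proof -
  have fR: "f \<in> borel_measurable (restrict_space borel Splus)" using f by (simp cong: measurable_cong_sets)
  have WR: "Wt CARD('n) lam \<in> borel_measurable (restrict_space (borel :: ((real^'n) \<times> real) measure) Splus)"
    by (rule measurable_restrict_space1[OF Wt_measurable])
  have d: "(\<lambda>p :: (real^'n) \<times> real. sqrt (1 - (snd p)\<^sup>2) ^ (CARD('n) - 2)) \<in> borel_measurable half_cyl_measure"
    unfolding half_cyl_measure_def by (rule measurable_sphere_pair) (unfold borel_prod[symmetric], measurable)
  show ?thesis unfolding lift_def[abs_def] Let_def
    by (intro borel_measurable_times measurable_compose[OF half_cyl_chart_measurable fR]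
        borel_measurable_sqrt[THEN measurable_compose[rotated]] measurable_compose[OF _ borel_measurable_sqrt]
        d measurable_compose[OF half_cyl_chart_measurable WR])
qed

lemma lift_integral:
  assumes f: "f \<in> borel_measurable Splus_measure" and g: "g \<in> borel_measurable Splus_measure"
  shows "integrable Splus_measure (\<lambda>x. f x * g x * Wt CARD('n) lam x) \<longleftrightarrow> integrable half_cyl_measure (\<lambda>p. lift f p * lift g p)"
    "(\<integral>x. f x * g x * Wt CARD('n) lam x \<partial>Splus_measure) = (\<integral>p. lift f p * lift g p \<partial>half_cyl_measure)"
proof -
  have WR: "Wt CARD('n) lam \<in> borel_measurable (Splus_measure :: ((real^'n) \<times> real) measure)"
  proof -
    have "Wt CARD('n) lam \<in> borel_measurable (restrict_space (borel :: ((real^'n) \<times> real) measure) Splus)"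
      by (rule measurable_restrict_space1[OF Wt_measurable])
    then show ?thesis by (simp cong: measurable_cong_sets)
  qed
  have m: "(\<lambda>x. f x * g x * Wt CARD('n) lam x) \<in> borel_measurable Splus_measure"
    by (intro borel_measurable_times f g WR)
  have eq: "sqrt (1 - (snd p)\<^sup>2) ^ (CARD('n) - 2) * (f (sqrt (1 - (snd p)\<^sup>2) *\<^sub>R fst p, snd p) * g (sqrt (1 - (snd p)\<^sup>2) *\<^sub>R fst p, snd p)
      * Wt CARD('n) lam (sqrt (1 - (snd p)\<^sup>2) *\<^sub>R fst p, snd p)) = lift f p * lift g p"
    if "p \<in> space half_cyl_measure" for p :: "(real^'n) \<times> real"
  proof -
    define x where "x = (sqrt (1 - (snd p)\<^sup>2) *\<^sub>R fst p, snd p)"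
    define q where "q = sqrt (1 - (snd p)\<^sup>2) ^ (CARD('n) - 2) * Wt CARD('n) lam x"
    have "\<bar>snd p\<bar> \<le> 1" using that by (auto simp: space_half_cyl)
    then have "q \<ge> 0" by (simp add: q_def Wt_def abs_square_le_1)
    then have "sqrt q * f x * (sqrt q * g x) = q * (f x * g x)" by simp
    then have "sqrt (1 - (snd p)\<^sup>2) ^ (CARD('n) - 2) * (f x * g x * Wt CARD('n) lam x) = (sqrt q * f x) * (sqrt q * g x)"
      by (simp only: q_def mult_ac)
    then show ?thesis unfolding lift_def Let_def x_def q_def .
  qed
  show "integrable Splus_measure (\<lambda>x. f x * g x * Wt CARD('n) lam x) \<longleftrightarrow> integrable half_cyl_measure (\<lambda>p. lift f p * lift g p)"
    unfolding Splus_integral_half_cyl(1)[OF n2 m] by (rule Bochner_Integration.integrable_cong[OF refl]) (rule eq)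
  show "(\<integral>x. f x * g x * Wt CARD('n) lam x \<partial>Splus_measure) = (\<integral>p. lift f p * lift g p \<partial>half_cyl_measure)"
    unfolding Splus_integral_half_cyl(2)[OF n2 m] by (rule Bochner_Integration.integral_cong[OF refl]) (rule eq)
qed

lemma eta_t_polar:
  assumes u: "norm u = 1" and t: "0 < t" "t < 1"
  shows "eta_t CARD('n) lam Y (m, \<mu>, k) (sqrt (1 - t\<^sup>2) *\<^sub>R u, t) =
    c_const CARD('n) lam (m, \<mu>, k) * ((1 - t\<^sup>2) powr (real m / 2) * t powr (2 * a + 1) * jacobiP k a (b m) (2 * (1 - t\<^sup>2) - 1)) * Y m \<mu> u"
proof -
  define r where "r = sqrt (1 - t\<^sup>2)"
  have x: "1 - t\<^sup>2 > 0" using t by (simp add: power_less_one_iff)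
  have r: "r > 0" "r\<^sup>2 = 1 - t\<^sup>2" using x by (auto simp: r_def)
  have nr: "norm (r *\<^sub>R u) = r" using r u by simp
  have ru: "(r *\<^sub>R u) /\<^sub>R r = u" using r by simp
  have W: "inverse (W CARD('n) lam (r *\<^sub>R u)) = t powr (2 * a)"
  proof -
    have "W CARD('n) lam (r *\<^sub>R u) = (t\<^sup>2) powr (- a)" unfolding W_def nr r(2) by (simp add: a_def)
    also have "t\<^sup>2 = t powr 2" using t by (simp add: powr_numeral)
    also have "(t powr 2) powr (- a) = t powr (- (2 * a))" by (simp add: powr_powr)
    finally show ?thesis by (simp add: powr_minus)
  qed
  have rm: "r ^ m = (1 - t\<^sup>2) powr (real m / 2)" unfolding r_def by (rule sqrt_power_eq_powr[OF x])
  have tt: "t * t powr (2 * a) = t powr (2 * a + 1)" using t by (simp add: powr_add)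
  have ab: "lam - real CARD('n) / 2 = a" "real m + real CARD('n) / 2 - 1 = b m" by (simp_all add: a_def b_def)
  show ?thesis unfolding r_def[symmetric] eta_t_def eta_def prod.case fst_conv snd_conv nr ru W rm r(2) ab tt[symmetric]
    by (simp only: mult_ac)
qed

text \<open>A match of exponents: (n - 2)/4 + m/2 = b m / 2 for 1 - t^2 and (-a - 1/2) + (2a + 1) =
  a + 1/2 for t.\<close>

lemma lift_eta:
  assumes p: "p \<in> space half_cyl_measure"
  shows "lift (eta_t CARD('n) lam Y \<nu>) p = half_basis \<nu> p"
proof -
  obtain m \<mu> k where \<nu>: "\<nu> = (m, \<mu>, k)" by (cases \<nu>) auto
  obtain u t where pe: "p = (u, t)" by (cases p) auto
  have u: "norm u = 1" and t: "0 < t" "t < 1" using p by (auto simp: space_half_cyl pe)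
  have x: "1 - t\<^sup>2 > 0" using t by (simp add: power_less_one_iff)
  define y where "y = 1 - t\<^sup>2"
  have y: "y > 0" using x by (simp add: y_def)
  have w: "sqrt (sqrt y ^ (CARD('n) - 2) * Wt CARD('n) lam (sqrt y *\<^sub>R u, t)) = y powr ((real CARD('n) - 2) / 4) * t powr (- a - 1/2)"
  proof -
    have "sqrt y ^ (CARD('n) - 2) = y powr ((real CARD('n) - 2) / 2)"
      using sqrt_power_eq_powr[OF y, of "CARD('n) - 2"] n2 by (simp add: of_nat_diff)
    moreover have "Wt CARD('n) lam (sqrt y *\<^sub>R u, t) = t powr (- 2 * a - 1)"
      by (simp add: Wt_def a_def)
    moreover have "sqrt (y powr ((real CARD('n) - 2) / 2)) = y powr ((real CARD('n) - 2) / 4)"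
      using y by (simp add: powr_half_sqrt[symmetric] powr_powr)
    moreover have "sqrt (t powr (- 2 * a - 1)) = t powr (- a - 1/2)"
    proof -
      have "(- 2 * a - 1) * (1/2) = - a - 1/2" by (simp add: field_simps)
      then show ?thesis using t by (simp only: powr_half_sqrt[OF powr_ge_zero, symmetric] powr_powr)
    qed
    ultimately show ?thesis by (simp only: real_sqrt_mult)
  qed
  have e1: "y powr ((real CARD('n) - 2) / 4) * y powr (real m / 2) = y powr (b m / 2)"
    unfolding powr_add[symmetric] by (simp add: b_def field_simps)
  have e2: "t powr (- a - 1/2) * t powr (2 * a + 1) = t powr (a + 1/2)"
    unfolding powr_add[symmetric] by (simp add: field_simps)
  have "lift (eta_t CARD('n) lam Y \<nu>) p = y powr ((real CARD('n) - 2) / 4) * t powr (- a - 1/2) *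
    (c_const CARD('n) lam (m, \<mu>, k) * (y powr (real m / 2) * t powr (2 * a + 1) * jacobiP k a (b m) (2 * y - 1)) * Y m \<mu> u)"
    unfolding lift_def Let_def pe fst_conv snd_conv \<nu> y_def[symmetric] w
    using eta_t_polar[OF u t, of m \<mu> k] by (simp only: y_def[symmetric])
  also have "\<dots> = half_basis \<nu> p"
    unfolding \<nu> pe half_basis_def radial_def prod.case fst_conv snd_conv y_def[symmetric] e1[symmetric] e2[symmetric]
    by (simp only: mult_ac)
  finally show ?thesis .
qed

lemma Y_direction_measurable:
  assumes i: "index m \<mu>"
  shows "(\<lambda>x. Y m \<mu> (x /\<^sub>R norm x)) \<in> borel_measurable borel"
proof -
  obtain H where H: "harmonic_polynomial H" "\<And>u. norm u = 1 \<Longrightarrow> Y m \<mu> u = H u" using Y_harmonic[OF i] by metis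
  have "H \<in> borel_measurable borel" using H(1)
    by (intro borel_measurable_continuous_onI continuous_real_polynomial) (simp add: harmonic_polynomial_def)
  then have [measurable]: "(\<lambda>x. H (x /\<^sub>R norm x)) \<in> borel_measurable borel"
    by (rule measurable_compose[rotated]) measurable
  \<comment> \<open>At x = 0 normalisation yields 0, where nothing is known about Y; that single
    value is split off.\<close>
  have "(\<lambda>x. Y m \<mu> (x /\<^sub>R norm x)) = (\<lambda>x. if x = 0 then Y m \<mu> 0 else H (x /\<^sub>R norm x))"
  proof
    fix x :: "real^'n"
    show "Y m \<mu> (x /\<^sub>R norm x) = (if x = 0 then Y m \<mu> 0 else H (x /\<^sub>R norm x))"
      using H(2)[of "x /\<^sub>R norm x"] by (cases "x = 0") auto
  qed
  then show ?thesis by simp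
qed

lemma eta_t_borel:
  assumes i: "index m \<mu>"
  shows "eta_t CARD('n) lam Y (m, \<mu>, k) \<in> borel_measurable borel"
proof -
  have f: "fst \<in> (borel :: ((real^'n) \<times> real) measure) \<rightarrow>\<^sub>M borel" "snd \<in> (borel :: ((real^'n) \<times> real) measure) \<rightarrow>\<^sub>M borel"
    by (intro borel_measurable_continuous_onI continuous_intros)+
  have [measurable]: "(\<lambda>x::real. jacobiP k (lam - real CARD('n) / 2) (real m + real CARD('n) / 2 - 1) x) \<in> borel_measurable borel"
    by (intro borel_measurable_continuous_onI jacobiP_continuous)
  note [measurable] = Y_direction_measurable[OF i]
  have "(\<lambda>x :: real^'n. eta CARD('n) lam Y (m, \<mu>, k) x) \<in> borel_measurable borel"
    unfolding eta_def prod.case W_def by measurable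
  from measurable_compose[OF f(1) this] f(2) show ?thesis
    unfolding eta_t_def[abs_def] by (rule borel_measurable_times[rotated])
qed

lemma eta_t_measurable:
  assumes i: "index m \<mu>"
  shows "eta_t CARD('n) lam Y (m, \<mu>, k) \<in> borel_measurable Splus_measure"
  unfolding Splus_measurable_iff using eta_t_borel[OF i] Splus_borel by (intro borel_measurable_times) auto

section \<open>The cylinder system and the normalising constants\<close>

text \<open>The power lam/2 - 1/4 is the square root of the Gegenbauer weight; it also equals the
  power lam in \<open>zeta_t\<close> combined with the square root of \<open>wt\<close>.\<close>

definition angular :: "nat \<times> nat \<times> nat \<Rightarrow> real \<Rightarrow> real" where
  "angular = (\<lambda>(m, \<mu>, k) t. d_const CARD('n) lam (m, \<mu>, k) * ((1 - t\<^sup>2) powr (lam / 2 - 1/4) * gegenbauerC lam (m + 2*k) t))"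

definition cyl_basis :: "nat \<times> nat \<times> nat \<Rightarrow> (real^'n) \<times> real \<Rightarrow> real" where
  "cyl_basis = (\<lambda>(m, \<mu>, k) p. angular (m, \<mu>, k) (snd p) * Y m \<mu> (fst p))"

lemma Gamma_pos_facts: "Gamma lam > 0" "Gamma (lam + 1/2) > 0" "Gamma (2 * lam) > 0" "Gamma (2 * lam + real j) > 0" "Gamma (lam + real j) > 0"
  using lam_pos by (auto intro!: Gamma_real_pos)

lemma d_const_square:
  "(d_const CARD('n) lam (m, \<mu>, k))\<^sup>2 = 2 powr (2 * lam - 1) * (Gamma lam)\<^sup>2 *
     (fact (m + 2*k) * (real (m + 2*k) + lam) / (pi * Gamma (2 * lam + real (m + 2*k))))"
proof -
  have "(2 powr (lam - 1/2))\<^sup>2 = 2 powr (2 * lam - 1)" by (simp add: power2_eq_square powr_add[symmetric])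
  moreover have "fact (m + 2*k) * (real (m + 2*k) + lam) / (pi * Gamma (2 * lam + real (m + 2*k))) \<ge> 0"
    using lam_pos Gamma_pos_facts(4)[of "m + 2*k"] by (intro divide_nonneg_nonneg mult_nonneg_nonneg) (auto intro: less_imp_le)
  ultimately show ?thesis unfolding d_const_def prod.case by (simp add: power_mult_distrib add.commute)
qed

lemma Gamma_duplication_lam: "2 powr (2 * lam - 1) * (Gamma lam * Gamma (lam + 1/2)) = sqrt pi * Gamma (2 * lam)"
proof -
  have "2 powr (2 * lam - 1) * 2 powr (1 - 2 * lam) = (1::real)" by (simp add: powr_add[symmetric])
  then show ?thesis unfolding Gamma_duplication_real[OF lam_pos] by (simp add: mult.assoc[symmetric])
qed

text \<open>N is the squared Gegenbauer norm. Legendre's duplication formula merges Gamma lam and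
  Gamma (lam + 1/2) into Gamma (2 lam), which cancels the denominator of the rising
  factorial.\<close>

lemma d_const_norm:
  fixes j defines "N \<equiv> sqrt pi * Gamma (lam + 1/2) * pochhammer (2*lam) j * pochhammer lam j * rGamma (lam + real j + 1) / fact j"
  assumes j: "j = m + 2 * k"
  shows "(d_const CARD('n) lam (m, \<mu>, k))\<^sup>2 * N = 1"
proof -
  define g1 g2 g3 g4 g5 J where "g1 = Gamma lam" and "g2 = Gamma (lam + 1/2)" and "g3 = Gamma (2 * lam)"
    and "g4 = Gamma (2 * lam + real j)" and "g5 = Gamma (lam + real j)" and "J = lam + real j"
  have pos: "g1 \<noteq> 0" "g2 \<noteq> 0" "g3 \<noteq> 0" "g4 \<noteq> 0" "g5 \<noteq> 0" "J \<noteq> 0"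
    using Gamma_pos_facts(1-3) Gamma_pos_facts(4,5)[of j] lam_pos unfolding g1_def g2_def g3_def g4_def g5_def J_def by linarith+
  have p1: "pochhammer (2*lam) j = g4 / g3" and p2: "pochhammer lam j = g5 / g1"
    unfolding g1_def g3_def g4_def g5_def using lam_pos by (simp_all add: pochhammer_Gamma pos_not_nonpos_Int)
  have p3: "rGamma (lam + real j + 1) = 1 / (J * g5)"
    using Gamma_plus1[OF pos_not_nonpos_Int, of "lam + real j"] lam_pos
    by (simp add: rGamma_inverse_Gamma J_def g5_def divide_inverse)
  define P where "P = (2::real) powr (2 * lam - 1)"
  have dup: "P * (g1 * g2) = sqrt pi * g3"
    using Gamma_duplication_lam by (simp add: P_def g1_def g2_def g3_def)
  have d: "(d_const CARD('n) lam (m, \<mu>, k))\<^sup>2 = P * g1\<^sup>2 * (fact j * J / (pi * g4))"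
    unfolding d_const_square j[symmetric] by (simp add: P_def g1_def g4_def J_def add.commute)
  have "(d_const CARD('n) lam (m, \<mu>, k))\<^sup>2 * N = (P * (g1 * g2)) * (sqrt pi / (pi * g3))"
    unfolding N_def d p1 p2 p3 g2_def[symmetric] using pos by (simp add: field_simps power2_eq_square)
  also have "\<dots> = (sqrt pi * sqrt pi) / pi" unfolding dup using pos by (simp add: field_simps)
  also have "\<dots> = 1" by simp
  finally show ?thesis .
qed

lemma angular_orthonormal:
  "has_bochner_integral lborel (\<lambda>t. indicator {-1<..<1} t * (angular (m, \<mu>, k) t * angular (m, \<mu>, k') t)) (if k = k' then 1 else 0)"
proof -
  let ?c = "d_const CARD('n) lam (m, \<mu>, k) * d_const CARD('n) lam (m, \<mu>, k')"
  let ?j = "m + 2 * k" and ?j' = "m + 2 * k'"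
  have "has_bochner_integral lborel (\<lambda>t. ?c * (indicator {-1<..<1} t * (gegenbauerC lam ?j t * gegenbauerC lam ?j' t * (1 - t\<^sup>2) powr (lam - 1/2))))
    (?c * (if ?j = ?j' then sqrt pi * Gamma (lam + 1/2) * pochhammer (2*lam) ?j * pochhammer lam ?j * rGamma (lam + real ?j + 1) / fact ?j else 0))"
    by (intro has_bochner_integral_mult_right gegenbauerC_orthogonal lam_pos)
  also have "(\<lambda>t. ?c * (indicator {-1<..<1} t * (gegenbauerC lam ?j t * gegenbauerC lam ?j' t * (1 - t\<^sup>2) powr (lam - 1/2)))) =
    (\<lambda>t. indicator {-1<..<1} t * (angular (m, \<mu>, k) t * angular (m, \<mu>, k') t))"
  proof
    fix t :: real
    have "(1 - t\<^sup>2) powr (lam - 1/2) = (1 - t\<^sup>2) powr (lam / 2 - 1/4) * (1 - t\<^sup>2) powr (lam / 2 - 1/4)"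
      by (simp add: powr_add[symmetric])
    then show "?c * (indicator {-1<..<1} t * (gegenbauerC lam ?j t * gegenbauerC lam ?j' t * (1 - t\<^sup>2) powr (lam - 1/2))) =
      indicator {-1<..<1} t * (angular (m, \<mu>, k) t * angular (m, \<mu>, k') t)"
      unfolding angular_def prod.case by (simp only: mult_ac)
  qed
  also have "?c * (if ?j = ?j' then sqrt pi * Gamma (lam + 1/2) * pochhammer (2*lam) ?j * pochhammer lam ?j * rGamma (lam + real ?j + 1) / fact ?j else 0) =
    (if k = k' then 1 else 0)"
    using d_const_norm[of ?j m k \<mu>] by (auto simp: power2_eq_square)
  finally show ?thesis .
qed

lemma cyl_basis_orthonormal: "orthonormal_system cyl_measure cyl_basis (index_set CARD('n))"
  unfolding cyl_measure_def cyl_basis_def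
proof (rule product_orthonormal_system)
  fix m \<mu> k
  have [measurable]: "gegenbauerC lam (m + 2 * k) \<in> borel_measurable borel"
    by (rule borel_measurable_continuous_onI[OF gegenbauerC_continuous])
  show "angular (m, \<mu>, k) \<in> borel_measurable borel" unfolding angular_def prod.case by measurable
qed (simp_all add: angular_orthonormal)

lemma zeta_t_cyl:
  assumes "p \<in> space cyl_measure"
  shows "zeta_t CARD('n) lam Y \<nu> p * sqrt (wt lam (snd p)) = cyl_basis \<nu> p"
    "zeta_t CARD('n) lam Y (m, \<mu>, k) p = d_const CARD('n) lam (m, \<mu>, k) * (1 - (snd p)\<^sup>2) powr lam * gegenbauerC lam (m + 2*k) (snd p) * Y m \<mu> (fst p)"
proof -
  obtain \<theta> t where p: "p = (\<theta>, t)" by (cases p) auto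
  have "\<bar>t\<bar> < 1" using assms by (auto simp: space_cyl_measure p)
  define y where "y = 1 - t\<^sup>2"
  have y: "y > 0" using \<open>\<bar>t\<bar> < 1\<close> by (simp add: y_def abs_square_less_1)
  have z: "zeta_t CARD('n) lam Y (m, \<mu>, k) p = d_const CARD('n) lam (m, \<mu>, k) * y powr lam * gegenbauerC lam (m + 2*k) t * Y m \<mu> \<theta>" for m \<mu> k
  proof -
    have e: "y powr (1/2) * inverse (y powr (1/2 - lam)) = y powr lam"
      using y by (simp add: powr_minus[symmetric] powr_add[symmetric])
    show ?thesis unfolding zeta_t_def zeta_def p prod.case fst_conv snd_conv w_def y_def[symmetric] e[symmetric]
      by (simp only: mult_ac)
  qed
  then show "zeta_t CARD('n) lam Y (m, \<mu>, k) p = d_const CARD('n) lam (m, \<mu>, k) * (1 - (snd p)\<^sup>2) powr lam * gegenbauerC lam (m + 2*k) (snd p) * Y m \<mu> (fst p)"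
    by (simp add: p y_def)
  obtain m \<mu> k where \<nu>: "\<nu> = (m, \<mu>, k)" by (cases \<nu>) auto
  have s: "sqrt (wt lam t) = y powr (- lam / 2 - 1/4)"
  proof -
    have "(- 1/2 - lam) * (1/2) = - lam / 2 - 1/4" by (simp add: field_simps)
    then show ?thesis unfolding wt_def y_def[symmetric]
      by (simp only: powr_half_sqrt[OF powr_ge_zero, symmetric] powr_powr)
  qed
  have e: "y powr lam * y powr (- lam / 2 - 1/4) = y powr (lam / 2 - 1/4)"
    unfolding powr_add[symmetric] by (simp add: field_simps)
  have "zeta_t CARD('n) lam Y \<nu> p * sqrt (wt lam t) = cyl_basis \<nu> p"
    unfolding \<nu> z s unfolding cyl_basis_def angular_def prod.case p fst_conv snd_conv y_def[symmetric] e[symmetric]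
    by (simp only: mult_ac)
  then show "zeta_t CARD('n) lam Y \<nu> p * sqrt (wt lam (snd p)) = cyl_basis \<nu> p" by (simp add: p)
qed

text \<open>The identity that fixes the singular value. The parenthesis on the left is the
  l-independent part of \<open>gegenbauer_moment\<close>; the right side is what Funk--Hecke
  coefficient and Jacobi moment leave once their l-dependent factors are removed.\<close>

lemma s_d_const:
  "s_const CARD('n) lam (m, \<mu>, k) * d_const CARD('n) lam (m, \<mu>, k) * (sqrt pi * Gamma (lam + 1/2) * pochhammer (2*lam) (m + 2*k) / fact (m + 2*k)) =
    pi powr (real CARD('n) / 2) * c_const CARD('n) lam (m, \<mu>, k) * Gamma (a + real k + 1) / fact k"
proof -
  define j where "j = m + 2 * k"
  define g1 g2 g3 g4 A B G J where "g1 = Gamma lam" and "g2 = Gamma (lam + 1/2)" and "g3 = Gamma (2 * lam)"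
    and "g4 = Gamma (2 * lam + real j)" and "A = Gamma (a + real k + 1)" and "B = Gamma (b m + real k + 1)"
    and "G = Gamma (a + b m + real k + 1)" and "J = real j + lam"
  have pos: "g1 > 0" "g2 > 0" "g3 > 0" "g4 > 0" "A > 0" "B > 0" "G > 0" "J > 0"
    using Gamma_pos_facts(1-3) Gamma_pos_facts(4)[of j] lam_pos a_gt b_gt[of m] ab_gt[of m]
    unfolding g1_def g2_def g3_def g4_def A_def B_def G_def J_def by (auto intro!: Gamma_real_pos)
  have p1: "pochhammer (2*lam) j = g4 / g3"
    unfolding g3_def g4_def using lam_pos by (simp add: pochhammer_Gamma pos_not_nonpos_Int)
  define c where "c = c_const CARD('n) lam (m, \<mu>, k)"
  have c: "c > 0" unfolding c_def by (rule c_const_pos)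
  have c2: "c\<^sup>2 = 2 * fact k * J * G / (A * B)"
    unfolding c_def c_const_square A_def B_def G_def J_def j_def by (simp add: a_def b_def algebra_simps)
  \<comment> \<open>Found by dividing the product of the radicands of s and d by c^2: the quotient
    is the perfect square of \<open>K\<close>, so no root survives apart from those of 2 and
    pi.\<close>
  define K where "K = fact j * A / (sqrt 2 * fact k * sqrt pi * g4)"
  have K: "K > 0" using pos by (simp add: K_def)
  have sqK: "sqrt (fact j * G * A / (fact k * g4 * B)) * sqrt (fact j * J / (pi * g4)) = c * K"
  proof -
    have "(fact j * G * A / (fact k * g4 * B)) * (fact j * J / (pi * g4)) = c\<^sup>2 * K\<^sup>2"
      unfolding c2 K_def using pos by (simp add: power_divide power_mult_distrib) (simp add: field_simps power2_eq_square)
    then have "sqrt (fact j * G * A / (fact k * g4 * B)) * sqrt (fact j * J / (pi * g4)) = sqrt ((c * K)\<^sup>2)"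
      by (simp only: real_sqrt_mult[symmetric] power_mult_distrib)
    then show ?thesis using c K by simp
  qed
  have e: "real k + real m + lam = a + b m + real k + 1" "real k + 1 + lam - real CARD('n) / 2 = a + real k + 1"
    "real k + real m + real CARD('n) / 2 = b m + real k + 1" "real j + 2 * lam = 2 * lam + real j"
    by (auto simp: a_def b_def)
  have s: "s_const CARD('n) lam (m, \<mu>, k) = 2 powr lam * pi powr ((real CARD('n) - 1) / 2) * sqrt (fact j * G * A / (fact k * g4 * B))"
    unfolding s_const_def prod.case j_def[symmetric] e A_def B_def G_def g4_def ..
  have d: "d_const CARD('n) lam (m, \<mu>, k) = 2 powr (lam - 1/2) * g1 * sqrt (fact j * J / (pi * g4))"
    unfolding d_const_def prod.case j_def[symmetric] e g1_def g4_def J_def ..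
  define P where "P = (2::real) powr (2 * lam - 1)"
  have dup: "P * (g1 * g2) = sqrt pi * g3"
    using Gamma_duplication_lam by (simp add: P_def g1_def g2_def g3_def)
  have P2: "2 powr lam * 2 powr (lam - 1/2) = P * sqrt 2"
  proof -
    have "2 powr lam * 2 powr (lam - 1/2) = (2::real) powr ((2 * lam - 1) + 1/2)" unfolding powr_add[symmetric] by simp
    also have "\<dots> = P * sqrt 2" unfolding powr_add P_def by (simp add: powr_half_sqrt)
    finally show ?thesis .
  qed
  have piP: "pi powr ((real CARD('n) - 1) / 2) * sqrt pi = pi powr (real CARD('n) / 2)"
  proof -
    have "pi powr ((real CARD('n) - 1) / 2) * sqrt pi = pi powr ((real CARD('n) - 1) / 2 + 1/2)"
      unfolding powr_add by (simp add: powr_half_sqrt)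
    then show ?thesis by (simp add: field_simps)
  qed
  have "s_const CARD('n) lam (m, \<mu>, k) * d_const CARD('n) lam (m, \<mu>, k) * (sqrt pi * g2 * (g4 / g3) / fact j) =
    (2 powr lam * 2 powr (lam - 1/2)) * pi powr ((real CARD('n) - 1) / 2) * g1 *
      (sqrt (fact j * G * A / (fact k * g4 * B)) * sqrt (fact j * J / (pi * g4))) * (sqrt pi * g2 * (g4 / g3) / fact j)"
    unfolding s d by (simp only: mult_ac)
  also have "\<dots> = (P * (g1 * g2)) * pi powr ((real CARD('n) - 1) / 2) * c * A / (fact k * g3)"
    unfolding P2 sqK unfolding K_def using pos by (simp add: field_simps)
  also have "\<dots> = (pi powr ((real CARD('n) - 1) / 2) * sqrt pi) * c * A / fact k"
    unfolding dup using pos by (simp add: field_simps)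
  finally show ?thesis unfolding piP p1[symmetric] g2_def j_def c_def A_def .
qed

lemma s_const_pos: "s_const CARD('n) lam (m, \<mu>, k) > 0"
proof -
  have "Gamma (real k + real m + lam) > 0" "Gamma (real k + 1 + lam - real CARD('n) / 2) > 0"
    "Gamma (real (m + 2 * k) + 2 * lam) > 0" "Gamma (real k + real m + real CARD('n) / 2) > 0"
    using lam lam_pos n2 by (auto intro!: Gamma_real_pos add_nonneg_pos)
  then show ?thesis unfolding s_const_def prod.case by simp
qed

end

section \<open>Moments of the transform\<close>

text \<open>On a slice x' . \<theta> is the constant t, so the moment over the half sphere becomes a
  moment in t. Slicing has the Jacobian r^(n-2) but \<open>V_plus\<close> contains r^(n-1), hence
  the division by sqrt (1 - t^2).\<close>

lemma V_plus_moments: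
  fixes E :: "(real^'n) \<times> real \<Rightarrow> real"
  assumes n2: "CARD('n) \<ge> 2" and E: "E \<in> borel_measurable Splus_measure" and th: "norm \<theta> = 1"
    and int: "integrable Splus_measure (\<lambda>x. (fst x \<bullet> \<theta>) ^ l * E x)"
  defines "h \<equiv> \<lambda>t. indicator {-1<..<1} t * (V_plus E \<theta> t / sqrt (1 - t\<^sup>2))"
  shows "integrable lborel (\<lambda>t. t ^ l * h t)"
    "(\<integral>t. t ^ l * h t \<partial>lborel) = (\<integral>x. (fst x \<bullet> \<theta>) ^ l * E x \<partial>Splus_measure)"
proof -
  let ?S = "sphere_measure :: (real^'n) measure"
  let ?I = "restrict_space lborel {-1<..<1::real}"
  interpret P: pair_sigma_finite ?S ?I by (rule pair_sigma_finite_sphere) simp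
  define g where "g = (\<lambda>x. (fst x \<bullet> \<theta>) ^ l * (indicator Splus x * E x))"
  have fm: "(\<lambda>x :: (real^'n) \<times> real. (fst x \<bullet> \<theta>) ^ l) \<in> borel_measurable borel"
    by (intro borel_measurable_continuous_onI continuous_intros)
  have g: "g \<in> borel_measurable borel"
    unfolding g_def using E by (intro borel_measurable_times[OF fm]) (simp add: Splus_measurable_iff)
  have S: "Splus \<inter> space sphere_measure \<in> sets (sphere_measure :: ((real^'n) \<times> real) measure)"
    unfolding sets_sphere_measure using Splus_borel
    by (subst sets_restrict_space_iff) (auto simp: Splus_def)
  have geq: "indicator Splus x *\<^sub>R ((fst x \<bullet> \<theta>) ^ l * E x) = g x" for x by (simp add: g_def)
  have gi: "integrable sphere_measure g"
    using int unfolding Splus_measure_def integrable_restrict_space[OF S] set_integrable_def geq .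
  have gI: "(\<integral>x. (fst x \<bullet> \<theta>) ^ l * E x \<partial>Splus_measure) = (\<integral>x. g x \<partial>sphere_measure)"
    unfolding Splus_measure_def integral_restrict_space[OF S] set_lebesgue_integral_def geq ..
  define G where "G = (\<lambda>(v, t). sqrt (1 - t\<^sup>2) ^ (CARD('n) - 2) * g (slice_chart \<theta> t v))"
  have G': "(\<lambda>p. sqrt (1 - (snd p)\<^sup>2) ^ (CARD('n) - 2) * g (slice_chart \<theta> (snd p) (fst p))) = G"
    by (auto simp: G_def)
  have Gi: "integrable (?S \<Otimes>\<^sub>M ?I) G"
    using gi cyl_integral_slices(1)[OF n2 g th] unfolding G' by (simp add: cyl_measure_def)
  have GI: "(\<integral>x. g x \<partial>sphere_measure) = (\<integral>p. G p \<partial>(?S \<Otimes>\<^sub>M ?I))"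
    using cyl_integral_slices(2)[OF n2 g th] unfolding G' by (simp add: cyl_measure_def)
  have int': "integrable (?S \<Otimes>\<^sub>M ?I) (\<lambda>(v, t). G (v, t))" using Gi by simp
  have inner: "(\<integral>v. G (v, t) \<partial>?S) = t ^ l * (V_plus E \<theta> t / sqrt (1 - t\<^sup>2))" if "t \<in> {-1<..<1}" for t
  proof -
    have t: "\<bar>t\<bar> < 1" using that by auto
    define r where "r = sqrt (1 - t\<^sup>2)"
    have r: "r > 0" using t by (simp add: r_def abs_square_less_1)
    have "(\<integral>v. G (v, t) \<partial>?S) = (\<integral>v. (r ^ (CARD('n) - 2) * t ^ l) * (indicator Splus (slice_chart \<theta> t v) * E (slice_chart \<theta> t v)) \<partial>?S)"
      unfolding G_def prod.case g_def fst_slice_chart_inner[OF th] r_def[symmetric] by (simp only: mult_ac)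
    also have "\<dots> = (r ^ (CARD('n) - 2) * t ^ l) * (\<integral>v. indicator Splus (slice_chart \<theta> t v) * E (slice_chart \<theta> t v) \<partial>?S)"
      by (rule integral_mult_right_zero)
    also have "\<dots> = t ^ l * (V_plus E \<theta> t / r)"
    proof -
      have N: "CARD('n) - Suc 0 = Suc (CARD('n) - 2)" using n2 by arith
      have "V_plus E \<theta> t = r ^ Suc (CARD('n) - 2) * (\<integral>v. indicator Splus (slice_chart \<theta> t v) * E (slice_chart \<theta> t v) \<partial>?S)"
        using V_plus_eq_slice_chart[of E \<theta> t] E th t by (simp add: Splus_measurable_iff r_def N del: power_Suc)
      then show ?thesis using r by simp
    qed
    finally show ?thesis unfolding r_def .
  qed
  have I: "{-1<..<1} \<inter> space lborel \<in> sets (lborel :: real measure)" by simp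
  have heq: "indicator {-1<..<1} t *\<^sub>R (\<integral>v. G (v, t) \<partial>?S) = t ^ l * h t" for t
    using inner[of t] by (simp add: h_def indicator_def)
  have "integrable ?I (\<lambda>t. \<integral>v. G (v, t) \<partial>?S)" by (rule P.integrable_snd[OF int'])
  then show "integrable lborel (\<lambda>t. t ^ l * h t)"
    unfolding integrable_restrict_space[OF I] set_integrable_def heq .
  have "(\<integral>t. (\<integral>v. G (v, t) \<partial>?S) \<partial>?I) = (\<integral>p. G p \<partial>(?S \<Otimes>\<^sub>M ?I))"
    using P.integral_snd[OF int'] by simp
  then show "(\<integral>t. t ^ l * h t \<partial>lborel) = (\<integral>x. (fst x \<bullet> \<theta>) ^ l * E x \<partial>Splus_measure)"
    unfolding integral_restrict_space[OF I] set_lebesgue_integral_def heq gI GI .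
qed

context sphere_transform
begin

text \<open>Needed for arbitrary exponents: the one of the l-th moment is b m + (l - m)/2, which is
  outside the scope of \<open>jacobiP_integral\<close> unless l - m is even and nonnegative.\<close>

lemma radial_moment_integrable:
  assumes "\<beta> > -1"
  shows "integrable lborel (\<lambda>t. indicator {0<..<1} t * (t powr (2 * a + 1) * (1 - t\<^sup>2) powr \<beta> * jacobiP k a (b m) (2 * (1 - t\<^sup>2) - 1)))"
proof -
  obtain e where e: "\<And>s. jacobiP k a (b m) (2 * s - 1) = (\<Sum>i\<le>k. e i * s ^ i)"
    using jacobiP_power_expansion by metis
  have "integrable lborel (\<lambda>t. \<Sum>i\<le>k. e i * (indicator {0<..<1} t * (t powr (2 * a + 1) * (1 - t\<^sup>2) powr (\<beta> + real i))))"
    using assms a_gt by (intro Bochner_Integration.integrable_sum integrable_mult_right integrable.intros[OF Beta_integral_squares]) auto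
  also have "(\<lambda>t. \<Sum>i\<le>k. e i * (indicator {0<..<1} t * (t powr (2 * a + 1) * (1 - t\<^sup>2) powr (\<beta> + real i)))) =
    (\<lambda>t. indicator {0<..<1} t * (t powr (2 * a + 1) * (1 - t\<^sup>2) powr \<beta> * jacobiP k a (b m) (2 * (1 - t\<^sup>2) - 1)))"
  proof
    fix t :: real
    show "(\<Sum>i\<le>k. e i * (indicator {0<..<1} t * (t powr (2 * a + 1) * (1 - t\<^sup>2) powr (\<beta> + real i)))) =
      indicator {0<..<1} t * (t powr (2 * a + 1) * (1 - t\<^sup>2) powr \<beta> * jacobiP k a (b m) (2 * (1 - t\<^sup>2) - 1))"
    proof (cases "t \<in> {0<..<1}")
      case True
      then have "1 - t\<^sup>2 > 0" by (simp add: power_less_one_iff)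
      then show ?thesis unfolding e by (simp add: powr_add powr_realpow sum_distrib_left mult_ac)
    qed simp
  qed
  finally show ?thesis .
qed

definition radial_moment :: "nat \<Rightarrow> nat \<Rightarrow> nat \<Rightarrow> real" where
  "radial_moment m k l = (\<integral>t. indicator {0<..<1} t *
     (t powr (2 * a + 1) * (1 - t\<^sup>2) powr ((real CARD('n) - 2 + real l + real m) / 2) * jacobiP k a (b m) (2 * (1 - t\<^sup>2) - 1)) \<partial>lborel)"

text \<open>In polar coordinates x' . \<theta> = sqrt (1 - t^2) (u . \<theta>), so the integrand
  separates: the u integral is Funk--Hecke, the t integral is a Jacobi moment.\<close>

lemma eta_moment:
  assumes i: "index m \<mu>" and th: "norm \<theta> = 1"
  shows "integrable Splus_measure (\<lambda>x. (fst x \<bullet> \<theta>) ^ l * eta_t CARD('n) lam Y (m, \<mu>, k) x)"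
    "(\<integral>x. (fst x \<bullet> \<theta>) ^ l * eta_t CARD('n) lam Y (m, \<mu>, k) x \<partial>Splus_measure) =
      funk_hecke_coeff CARD('n) l m * Y m \<mu> \<theta> * (c_const CARD('n) lam (m, \<mu>, k) * radial_moment m k l)"
proof -
  let ?E = "eta_t CARD('n) lam Y (m, \<mu>, k)" and ?c = "c_const CARD('n) lam (m, \<mu>, k)"
  let ?I = "restrict_space lborel {0<..<1::real}"
  interpret P: pair_sigma_finite S ?I by (rule pair_sigma_finite_sphere) simp
  obtain H where H: "harmonic_polynomial H" "homogeneous m H" "\<And>u. norm u = 1 \<Longrightarrow> Y m \<mu> u = H u"
    using Y_harmonic[OF i] by metis
  define R where "R = (\<lambda>t. t powr (2 * a + 1) * (1 - t\<^sup>2) powr ((real CARD('n) - 2 + real l + real m) / 2) * jacobiP k a (b m) (2 * (1 - t\<^sup>2) - 1))"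
  have "(real CARD('n) - 2 + real l + real m) / 2 > -1" using n2 by simp
  then have Rint: "integrable ?I (\<lambda>t. ?c * R t)" and RI: "(\<integral>t. ?c * R t \<partial>?I) = ?c * radial_moment m k l"
    using radial_moment_integrable[of "(real CARD('n) - 2 + real l + real m) / 2" k m]
    by (simp_all add: R_def radial_moment_def integrable_restrict_space integral_restrict_space set_integrable_def set_lebesgue_integral_def)
  have Uint: "integrable S (\<lambda>u. (u \<bullet> \<theta>) ^ l * H u)"
    using H(1) by (intro integrable_sphere_continuous continuous_intros continuous_real_polynomial) (simp add: harmonic_polynomial_def)
  have UI: "(\<integral>u. (u \<bullet> \<theta>) ^ l * H u \<partial>S) = funk_hecke_coeff CARD('n) l m * Y m \<mu> \<theta>"
    using funk_hecke_power[OF _ th H(1,2), of l] n2 th H(3)[of \<theta>] by simp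
  have m: "(\<lambda>x. (fst x \<bullet> \<theta>) ^ l * ?E x) \<in> borel_measurable Splus_measure"
  proof -
    have "(\<lambda>x :: (real^'n) \<times> real. (fst x \<bullet> \<theta>) ^ l) \<in> borel_measurable borel"
      by (intro borel_measurable_continuous_onI continuous_intros)
    then have "(\<lambda>x :: (real^'n) \<times> real. (fst x \<bullet> \<theta>) ^ l) \<in> borel_measurable (restrict_space borel Splus)"
      by (rule measurable_restrict_space1)
    then have "(\<lambda>x :: (real^'n) \<times> real. (fst x \<bullet> \<theta>) ^ l) \<in> borel_measurable Splus_measure"
      by (simp cong: measurable_cong_sets)
    then show ?thesis by (intro borel_measurable_times eta_t_measurable[OF i])
  qed
  have eq: "sqrt (1 - (snd p)\<^sup>2) ^ (CARD('n) - 2) * ((fst (sqrt (1 - (snd p)\<^sup>2) *\<^sub>R fst p, snd p) \<bullet> \<theta>) ^ l * ?E (sqrt (1 - (snd p)\<^sup>2) *\<^sub>R fst p, snd p)) =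
      ((fst p \<bullet> \<theta>) ^ l * H (fst p)) * (?c * R (snd p))"
    if "p \<in> space half_cyl_measure" for p
  proof -
    obtain u t where p: "p = (u, t)" by (cases p) auto
    have u: "norm u = 1" and t: "0 < t" "t < 1" using that by (auto simp: space_half_cyl p)
    define y where "y = 1 - t\<^sup>2"
    have y: "y > 0" using t by (simp add: y_def power_less_one_iff)
    have pw: "sqrt y ^ (CARD('n) - 2) * sqrt y ^ l * y powr (real m / 2) = y powr ((real CARD('n) - 2 + real l + real m) / 2)"
      using n2 unfolding sqrt_power_eq_powr[OF y] powr_add[symmetric] by (simp add: of_nat_diff add_divide_distrib diff_divide_distrib)
    have "sqrt y ^ (CARD('n) - 2) * ((sqrt y *\<^sub>R u \<bullet> \<theta>) ^ l * ?E (sqrt y *\<^sub>R u, t)) =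
      sqrt y ^ (CARD('n) - 2) * (sqrt y ^ l * (u \<bullet> \<theta>) ^ l *
        (?c * (y powr (real m / 2) * t powr (2 * a + 1) * jacobiP k a (b m) (2 * y - 1)) * Y m \<mu> u))"
      using eta_t_polar[OF u t, of m \<mu> k] by (simp only: y_def[symmetric] inner_scaleR_left power_mult_distrib)
    also have "\<dots> = ((u \<bullet> \<theta>) ^ l * H u) * (?c * R t)"
      unfolding R_def y_def[symmetric] pw[symmetric] H(3)[OF u] by (simp only: mult_ac)
    finally show ?thesis by (simp only: p fst_conv snd_conv y_def)
  qed
  have int: "integrable half_cyl_measure (\<lambda>p. ((fst p \<bullet> \<theta>) ^ l * H (fst p)) * (?c * R (snd p)))"
    unfolding half_cyl_measure_def by (rule P.integrable_prod_mult(1)[OF Uint Rint])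
  show "integrable Splus_measure (\<lambda>x. (fst x \<bullet> \<theta>) ^ l * ?E x)"
    unfolding Splus_integral_half_cyl(1)[OF n2 m]
    using int by (subst Bochner_Integration.integrable_cong[OF refl eq])
  have "(\<integral>x. (fst x \<bullet> \<theta>) ^ l * ?E x \<partial>Splus_measure) = (\<integral>p. ((fst p \<bullet> \<theta>) ^ l * H (fst p)) * (?c * R (snd p)) \<partial>half_cyl_measure)"
    unfolding Splus_integral_half_cyl(2)[OF n2 m] by (rule Bochner_Integration.integral_cong[OF refl eq])
  also have "\<dots> = funk_hecke_coeff CARD('n) l m * Y m \<mu> \<theta> * (?c * radial_moment m k l)"
    unfolding half_cyl_measure_def P.integrable_prod_mult(2)[OF Uint Rint] UI RI ..
  finally show "(\<integral>x. (fst x \<bullet> \<theta>) ^ l * ?E x \<partial>Splus_measure) =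
      funk_hecke_coeff CARD('n) l m * Y m \<mu> \<theta> * (?c * radial_moment m k l)" .
qed

text \<open>If l + m is odd or l < m, both sides are zero. For l = m + 2 i the Jacobi moment is
  explicit; its binomial vanishes for i < k exactly as the Gegenbauer moment does, and otherwise
  \<open>s_d_const\<close> finishes the comparison.\<close>

lemma moment_constants:
  "funk_hecke_coeff CARD('n) l m * (c_const CARD('n) lam (m, \<mu>, k) * radial_moment m k l) =
    s_const CARD('n) lam (m, \<mu>, k) * d_const CARD('n) lam (m, \<mu>, k) * gegenbauer_moment lam l (m + 2 * k)"
proof -
  consider "odd (l + m)" | "even (l + m)" "l < m" | i where "l = m + 2 * i"
  proof -
    have "\<exists>i. l = m + 2 * i" if "even (l + m)" "\<not> l < m"
    proof -
      have "even (l - m)" using that by simp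
      then obtain i where "l - m = 2 * i" by (elim evenE)
      then show ?thesis using that by (intro exI[of _ i]) simp
    qed
    then show ?thesis using that by blast
  qed
  then show ?thesis
  proof cases
    case 1
    then show ?thesis by (simp add: funk_hecke_coeff_def gegenbauer_moment_def)
  next
    case 2
    then obtain d where d: "m = l + 2 * Suc d"
    proof -
      have "even (m - l)" using 2 by simp
      then obtain i where i: "m - l = 2 * i" by (elim evenE)
      with 2 have "i \<noteq> 0" by auto
      then obtain d where "i = Suc d" by (cases i) auto
      with i 2 show ?thesis by (intro that[of d]) simp
    qed
    have "(real l - real m) / 2 + 1 = - real d" by (simp add: d field_simps)
    then have "funk_hecke_coeff CARD('n) l m = 0" unfolding funk_hecke_coeff_def by (simp add: rGamma_eq_zero_iff)
    moreover have "gegenbauer_moment lam l (m + 2 * k) = 0" using 2 by (intro gegenbauer_moment_eq_0) simp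
    ultimately show ?thesis by simp
  next
    case (3 i)
    \<comment> \<open>Only for l = m + 2 i is the exponent the Jacobi parameter plus a natural
      number, so that \<open>jacobiP_integral\<close> applies.\<close>
    have \<beta>: "(real CARD('n) - 2 + real l + real m) / 2 = b m + real i" by (simp add: b_def 3 field_simps)
    have R: "radial_moment m k l = real (i choose k) * Gamma (a + real k + 1) * Gamma (b m + real i + 1) / (2 * Gamma (a + b m + real k + real i + 2))"
      unfolding radial_moment_def \<beta> by (rule has_bochner_integral_integral_eq[OF jacobiP_integral[OF a_gt b_gt]])
    show ?thesis
    proof (cases "i < k")
      case True
      then have "gegenbauer_moment lam l (m + 2 * k) = 0" using 3 by (intro gegenbauer_moment_eq_0) simp
      with True show ?thesis by (simp add: R)
    next
      case False
      then have ik: "k \<le> i" by simp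
      define c A Gb Gz where "c = c_const CARD('n) lam (m, \<mu>, k)" and "A = Gamma (a + real k + 1)"
        and "Gb = Gamma (b m + real i + 1)" and "Gz = Gamma (a + b m + real k + real i + 2)"
      have pos: "Gb > 0" "Gz > 0" unfolding Gb_def Gz_def using b_gt[of m] ab_gt[of m] by (auto intro!: Gamma_real_pos)
      define p where "p = pi powr (real CARD('n) / 2)"
      define L where "L = (fact l / 2 ^ l :: real)"
      have rG: "rGamma (real q + 1) = (1 / fact q :: real)" for q
        using Gamma_fact[of q, where 'a = real] by (simp add: rGamma_inverse_Gamma add.commute divide_inverse)
      have ev: "even (l + m)" "even (l + (m + 2 * k))" by (simp_all add: 3)
      have e: "(real l - real m) / 2 + 1 = real i + 1" "(real l + real m + real CARD('n)) / 2 = b m + real i + 1"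
        by (auto simp: 3 b_def field_simps)
      have F: "funk_hecke_coeff CARD('n) l m = 2 * p * L / fact i / Gb"
        unfolding funk_hecke_coeff_def if_P[OF ev(1)] e rG unfolding p_def L_def Gb_def rGamma_inverse_Gamma by (simp only: divide_inverse mult_ac mult_1)
      have e': "(real l - real (m + 2 * k)) / 2 + 1 = real (i - k) + 1" "lam + (real l + real (m + 2 * k)) / 2 + 1 = a + b m + real k + real i + 2"
        using ik by (auto simp: 3 b_def a_def of_nat_diff field_simps)
      define Q where "Q = sqrt pi * Gamma (lam + 1/2) * pochhammer (2*lam) (m + 2*k) / fact (m + 2*k)"
      have M: "gegenbauer_moment lam l (m + 2 * k) = Q * L / fact (i - k) / Gz"
        unfolding gegenbauer_moment_def if_P[OF ev(2)] e' rG unfolding Q_def L_def Gz_def rGamma_inverse_Gamma by (simp only: divide_inverse mult_ac mult_1)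
      have ch: "real (i choose k) = fact i / (fact k * fact (i - k))" using ik by (rule binomial_fact)
      have sd: "s_const CARD('n) lam (m, \<mu>, k) * d_const CARD('n) lam (m, \<mu>, k) * Q = p * c * A / fact k"
        using s_d_const[of m \<mu> k] by (simp only: Q_def p_def c_def A_def)
      have "s_const CARD('n) lam (m, \<mu>, k) * d_const CARD('n) lam (m, \<mu>, k) * gegenbauer_moment lam l (m + 2 * k) =
        (s_const CARD('n) lam (m, \<mu>, k) * d_const CARD('n) lam (m, \<mu>, k) * Q) * (L / fact (i - k) / Gz)"
        unfolding M by simp
      also have "\<dots> = funk_hecke_coeff CARD('n) l m * (c * radial_moment m k l)"
      proof -
        have gen: "p * c * A / fk * (L / fd / Gz) = 2 * p * L / fi / Gb * (c * (fi / (fk * fd) * A * Gb / (2 * Gz)))"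
          if "fi > 0" "fk > 0" "fd > 0" for fi fk fd :: real
          using that pos by simp
        show ?thesis unfolding sd F R ch A_def[symmetric] Gb_def[symmetric] Gz_def[symmetric] by (rule gen) simp_all
      qed
      finally show ?thesis unfolding c_def ..
    qed
  qed
qed

text \<open>Both sides, divided by sqrt (1 - t^2), are integrable on (-1, 1) with equal moments. The
  weight of exponent lam - 1/2 in g is the power lam of \<open>zeta_t\<close> after this
  division.\<close>

lemma V_plus_eta_AE_slice:
  assumes i: "index m \<mu>" and th: "norm \<theta> = 1"
  shows "AE t in restrict_space lborel {-1<..<1}. V_plus (eta_t CARD('n) lam Y (m, \<mu>, k)) \<theta> t =
    s_const CARD('n) lam (m, \<mu>, k) * zeta_t CARD('n) lam Y (m, \<mu>, k) (\<theta>, t)"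
proof -
  let ?E = "eta_t CARD('n) lam Y (m, \<mu>, k)" and ?s = "s_const CARD('n) lam (m, \<mu>, k)" and ?d = "d_const CARD('n) lam (m, \<mu>, k)"
  define h where "h = (\<lambda>t. indicator {-1<..<1} t * (V_plus ?E \<theta> t / sqrt (1 - t\<^sup>2)))"
  define C where "C = ?s * ?d * Y m \<mu> \<theta>"
  define g where "g = (\<lambda>t. indicator {-1<..<1} t * (gegenbauerC lam (m + 2 * k) t * (1 - t\<^sup>2) powr (lam - 1/2)))"
  have hi: "integrable lborel (\<lambda>t. t ^ l * h t)"
    and hI: "(\<integral>t. t ^ l * h t \<partial>lborel) = funk_hecke_coeff CARD('n) l m * Y m \<mu> \<theta> * (c_const CARD('n) lam (m, \<mu>, k) * radial_moment m k l)" for l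
    using V_plus_moments[OF n2 eta_t_measurable[OF i] th eta_moment(1)[OF i th]]
    unfolding h_def eta_moment(2)[OF i th] by blast+
  have g: "has_bochner_integral lborel (\<lambda>t. t ^ l * g t) (gegenbauer_moment lam l (m + 2 * k))" for l
    using gegenbauerC_moment[OF lam_pos, of l "m + 2 * k"] unfolding g_def by (simp add: mult_ac)
  have gi: "integrable lborel (\<lambda>t. t ^ l * g t)" and gI: "(\<integral>t. t ^ l * g t \<partial>lborel) = gegenbauer_moment lam l (m + 2 * k)" for l
    using g[of l] by (auto simp: has_bochner_integral_iff)
  have "AE t in lborel. h t - C * g t = 0"
  proof (rule moments_zero_imp_AE_zero[where a = "-1" and b = 1])
    show "integrable lborel (\<lambda>t. h t - C * g t)" using hi[of 0] gi[of 0] by simp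
    show "h t - C * g t = 0" if "t \<notin> {- 1..1}" for t using that by (auto simp: h_def g_def indicator_def)
    fix l
    have "(\<integral>t. t ^ l * (h t - C * g t) \<partial>lborel) = (\<integral>t. t ^ l * h t - C * (t ^ l * g t) \<partial>lborel)"
      by (simp add: algebra_simps)
    also have "\<dots> = (\<integral>t. t ^ l * h t \<partial>lborel) - C * (\<integral>t. t ^ l * g t \<partial>lborel)"
      using hi[of l] gi[of l] by simp
    also have "\<dots> = 0"
      unfolding hI gI C_def using moment_constants[of l m \<mu> k] by (simp add: mult_ac)
    finally show "(\<integral>t. t ^ l * (h t - C * g t) \<partial>lborel) = 0" .
  qed
  then have "AE t in lborel. t \<in> {-1<..<1} \<longrightarrow> V_plus ?E \<theta> t = ?s * zeta_t CARD('n) lam Y (m, \<mu>, k) (\<theta>, t)"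
  proof eventually_elim
    case (elim t)
    show ?case
    proof
      assume t: "t \<in> {-1<..<1}"
      define y where "y = 1 - t\<^sup>2"
      have y: "y > 0" using t by (auto simp: y_def abs_square_less_1)
      have "V_plus ?E \<theta> t / sqrt y = C * (gegenbauerC lam (m + 2 * k) t * y powr (lam - 1/2))"
        using elim t by (simp add: h_def g_def y_def)
      then have "V_plus ?E \<theta> t = C * (gegenbauerC lam (m + 2 * k) t * (y powr (lam - 1/2) * sqrt y))"
        using y by (simp add: divide_eq_eq mult_ac)
      also have "y powr (lam - 1/2) * sqrt y = y powr lam"
        using y by (simp add: powr_half_sqrt[symmetric] powr_add[symmetric])
      finally show "V_plus ?E \<theta> t = ?s * zeta_t CARD('n) lam Y (m, \<mu>, k) (\<theta>, t)"
        using zeta_t_cyl(2)[of "(\<theta>, t)" m \<mu> k] th t by (simp add: space_cyl_measure C_def y_def)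
    qed
  qed
  then show ?thesis by (simp add: AE_restrict_space_iff)
qed

lemma zeta_t_measurable:
  assumes i: "index m \<mu>"
  shows "zeta_t CARD('n) lam Y (m, \<mu>, k) \<in> borel_measurable cyl_measure"
proof -
  let ?g = "\<lambda>p. d_const CARD('n) lam (m, \<mu>, k) * (1 - (snd p)\<^sup>2) powr lam * gegenbauerC lam (m + 2*k) (snd p) * Y m \<mu> (fst p)"
  have [measurable]: "gegenbauerC lam (m + 2 * k) \<in> borel_measurable borel"
    by (rule borel_measurable_continuous_onI[OF gegenbauerC_continuous])
  have "(\<lambda>t. d_const CARD('n) lam (m, \<mu>, k) * (1 - t\<^sup>2) powr lam * gegenbauerC lam (m + 2*k) t) \<in> borel_measurable (restrict_space lborel {-1<..<1})"
    by (rule measurable_restrict_space1) measurable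
  then have "?g \<in> borel_measurable cyl_measure" unfolding cyl_measure_def
    by (intro borel_measurable_times[OF measurable_compose[OF measurable_snd] measurable_compose[OF measurable_fst Y_measurable[OF i]]])
  then show ?thesis using zeta_t_cyl(2) by (subst measurable_cong[where g = ?g])
qed

text \<open>Joint measurability of both sides lets the slicewise statements combine to one on the
  product.\<close>

lemma V_plus_eta_AE:
  assumes i: "index m \<mu>"
  shows "AE p in cyl_measure. V_plus (eta_t CARD('n) lam Y (m, \<mu>, k)) (fst p) (snd p) =
    s_const CARD('n) lam (m, \<mu>, k) * zeta_t CARD('n) lam Y (m, \<mu>, k) p"
proof -
  let ?P = "\<lambda>p. V_plus (eta_t CARD('n) lam Y (m, \<mu>, k)) (fst p) (snd p) = s_const CARD('n) lam (m, \<mu>, k) * zeta_t CARD('n) lam Y (m, \<mu>, k) p"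
  interpret P: pair_sigma_finite S "restrict_space lborel {-1<..<1::real}" by (rule pair_sigma_finite_sphere) simp
  have "(\<lambda>p. V_plus (eta_t CARD('n) lam Y (m, \<mu>, k)) (fst p) (snd p)) \<in> borel_measurable cyl_measure"
    "(\<lambda>p. s_const CARD('n) lam (m, \<mu>, k) * zeta_t CARD('n) lam Y (m, \<mu>, k) p) \<in> borel_measurable cyl_measure"
    using V_plus_measurable[OF eta_t_measurable[OF i]] zeta_t_measurable[OF i] by auto
  then have "{p \<in> space cyl_measure. ?P p} \<in> sets cyl_measure" by (rule borel_measurable_eq)
  moreover have "AE \<theta> in S. AE t in restrict_space lborel {-1<..<1}. ?P (\<theta>, t)"
    unfolding fst_conv snd_conv by (rule AE_I2, rule V_plus_eta_AE_slice[OF i]) simp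
  ultimately show ?thesis unfolding cyl_measure_def by (intro P.AE_pair_measure)
qed

end

section \<open>Transport of the expansion through the transform\<close>

context sphere_transform
begin

lemma lift_sum_diff:
  "lift (\<lambda>x. (\<Sum>\<nu>\<in>A. c \<nu> * g \<nu> x) - f x) p = (\<Sum>\<nu>\<in>A. c \<nu> * lift (g \<nu>) p) - lift f p"
  unfolding lift_def Let_def by (simp add: right_diff_distrib sum_distrib_left) (simp only: mult_ac)

lemma lift_L2:
  assumes "f \<in> borel_measurable Splus_measure"
  shows "integrable Splus_measure (\<lambda>x. (f x)\<^sup>2 * Wt CARD('n) lam x) \<longleftrightarrow> integrable half_cyl_measure (\<lambda>p. (lift f p)\<^sup>2)"
    "(\<integral>x. (f x)\<^sup>2 * Wt CARD('n) lam x \<partial>Splus_measure) = (\<integral>p. (lift f p)\<^sup>2 \<partial>half_cyl_measure)"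
  using lift_integral[OF assms assms] by (simp_all add: power2_eq_square)

lemma eta_t_L2:
  assumes "\<nu> \<in> index_set CARD('n)"
  shows "L2w Splus_measure (Wt CARD('n) lam) (eta_t CARD('n) lam Y \<nu>)"
proof -
  obtain m \<mu> k where \<nu>: "\<nu> = (m, \<mu>, k)" by (cases \<nu>) auto
  have m: "eta_t CARD('n) lam Y \<nu> \<in> borel_measurable Splus_measure"
    using assms eta_t_measurable unfolding \<nu> index_set_iff by blast
  have "integrable half_cyl_measure (\<lambda>p. (half_basis \<nu> p)\<^sup>2)"
    by (rule orthonormal_system.e_square[OF half_basis_orthonormal assms])
  then have "integrable half_cyl_measure (\<lambda>p. (lift (eta_t CARD('n) lam Y \<nu>) p)\<^sup>2)"
    by (subst Bochner_Integration.integrable_cong[OF refl]) (simp_all add: lift_eta)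
  with m show ?thesis unfolding L2w_def lift_L2(1)[OF m] by blast
qed

lemma zeta_t_measurable': "\<nu> \<in> index_set CARD('n) \<Longrightarrow> zeta_t CARD('n) lam Y \<nu> \<in> borel_measurable cyl_measure"
  using zeta_t_measurable by (cases \<nu>) (auto simp: index_set_iff)

text \<open>The abstract expansion on the half cylinder, pulled back by \<open>lift\<close>. The
  second claim puts the errors into the weighted space, where boundedness of the transform can be
  applied to them.\<close>

lemma eta_series_converges:
  fixes f :: "(real^'n) \<times> real \<Rightarrow> real"
  assumes f: "L2w Splus_measure (Wt CARD('n) lam) f"
  defines "fc \<equiv> \<lambda>\<nu>. \<integral>x. f x * eta_t CARD('n) lam Y \<nu> x * Wt CARD('n) lam x \<partial>Splus_measure"
  shows "((\<lambda>A. \<integral>x. ((\<Sum>\<nu>\<in>A. fc \<nu> * eta_t CARD('n) lam Y \<nu> x) - f x)\<^sup>2 * Wt CARD('n) lam x \<partial>Splus_measure) \<longlongrightarrow> 0)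
      (finite_subsets_at_top (index_set CARD('n)))"
    "\<And>A. finite A \<Longrightarrow> A \<subseteq> index_set CARD('n) \<Longrightarrow>
      L2w Splus_measure (Wt CARD('n) lam) (\<lambda>x. (\<Sum>\<nu>\<in>A. fc \<nu> * eta_t CARD('n) lam Y \<nu> x) - f x)"
proof -
  let ?I = "index_set CARD('n)" and ?E = "eta_t CARD('n) lam Y"
  interpret H: orthonormal_system half_cyl_measure half_basis ?I by (rule half_basis_orthonormal)
  have fm: "f \<in> borel_measurable Splus_measure" and f2: "integrable half_cyl_measure (\<lambda>p. (lift f p)\<^sup>2)"
    using f lift_L2(1) unfolding L2w_def by blast+
  have Em: "?E \<nu> \<in> borel_measurable Splus_measure" if "\<nu> \<in> ?I" for \<nu>
    using eta_t_L2[OF that] by (simp add: L2w_def)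
  note Lm = lift_measurable[OF fm]
  define c where "c = (\<lambda>\<nu>. \<integral>p. lift f p * half_basis \<nu> p \<partial>half_cyl_measure)"
  have fc: "fc \<nu> = c \<nu>" if "\<nu> \<in> ?I" for \<nu>
    unfolding fc_def c_def lift_integral(2)[OF fm Em[OF that]]
    by (rule Bochner_Integration.integral_cong[OF refl]) (simp add: lift_eta)
  have m: "(\<lambda>x. (\<Sum>\<nu>\<in>A. fc \<nu> * ?E \<nu> x) - f x) \<in> borel_measurable Splus_measure" if "A \<subseteq> ?I" for A
    using that by (intro borel_measurable_diff borel_measurable_sum borel_measurable_times borel_measurable_const fm Em) auto
  have L: "lift (\<lambda>x. (\<Sum>\<nu>\<in>A. fc \<nu> * ?E \<nu> x) - f x) p = (\<Sum>\<nu>\<in>A. c \<nu> * half_basis \<nu> p) - lift f p"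
    if "A \<subseteq> ?I" "p \<in> space half_cyl_measure" for A p
  proof -
    have "(\<Sum>\<nu>\<in>A. fc \<nu> * lift (?E \<nu>) p) = (\<Sum>\<nu>\<in>A. c \<nu> * half_basis \<nu> p)"
      using that fc by (intro sum.cong) (auto simp: lift_eta)
    then show ?thesis unfolding lift_sum_diff by simp
  qed
  show "L2w Splus_measure (Wt CARD('n) lam) (\<lambda>x. (\<Sum>\<nu>\<in>A. fc \<nu> * ?E \<nu> x) - f x)" if A: "finite A" "A \<subseteq> ?I" for A
  proof -
    have "integrable half_cyl_measure (\<lambda>p. ((\<Sum>\<nu>\<in>A. c \<nu> * half_basis \<nu> p) - lift f p)\<^sup>2)"
      unfolding c_def by (rule H.bessel_identity(1)[OF A Lm f2])
    then have "integrable half_cyl_measure (\<lambda>p. (lift (\<lambda>x. (\<Sum>\<nu>\<in>A. fc \<nu> * ?E \<nu> x) - f x) p)\<^sup>2)"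
      by (subst Bochner_Integration.integrable_cong[OF refl]) (simp_all add: L[OF A(2)])
    with m[OF A(2)] show ?thesis unfolding L2w_def lift_L2(1)[OF m[OF A(2)]] by blast
  qed
  have eq: "(\<integral>p. ((\<Sum>\<nu>\<in>A. c \<nu> * half_basis \<nu> p) - lift f p)\<^sup>2 \<partial>half_cyl_measure) =
    (\<integral>x. ((\<Sum>\<nu>\<in>A. fc \<nu> * ?E \<nu> x) - f x)\<^sup>2 * Wt CARD('n) lam x \<partial>Splus_measure)" if "A \<subseteq> ?I" for A
    unfolding lift_L2(2)[OF m[OF that]] by (rule Bochner_Integration.integral_cong[OF refl]) (simp add: L[OF that])
  have lim: "((\<lambda>A. \<integral>p. ((\<Sum>\<nu>\<in>A. c \<nu> * half_basis \<nu> p) - lift f p)\<^sup>2 \<partial>half_cyl_measure) \<longlongrightarrow> 0) (finite_subsets_at_top ?I)"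
    unfolding c_def by (rule H.fourier_series_converges[OF half_basis_complete Lm f2])
  have "\<forall>\<^sub>F A in finite_subsets_at_top ?I. (\<integral>p. ((\<Sum>\<nu>\<in>A. c \<nu> * half_basis \<nu> p) - lift f p)\<^sup>2 \<partial>half_cyl_measure) =
    (\<integral>x. ((\<Sum>\<nu>\<in>A. fc \<nu> * ?E \<nu> x) - f x)\<^sup>2 * Wt CARD('n) lam x \<partial>Splus_measure)"
    by (rule eventually_finite_subsets_at_top_weakI) (rule eq)
  from Lim_transform_eventually[OF lim this]
  show "((\<lambda>A. \<integral>x. ((\<Sum>\<nu>\<in>A. fc \<nu> * ?E \<nu> x) - f x)\<^sup>2 * Wt CARD('n) lam x \<partial>Splus_measure) \<longlongrightarrow> 0) (finite_subsets_at_top ?I)" .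
qed

text \<open>Phrased for the error of a partial sum, the function to which the norm bound is applied.
  Linearity holds outside the finitely many null sets on which some slice integral fails to exist or
  some term misses its image.\<close>

lemma V_plus_partial_sum:
  fixes f :: "(real^'n) \<times> real \<Rightarrow> real"
  assumes f: "L2w Splus_measure (Wt CARD('n) lam) f" and A: "finite A" "A \<subseteq> index_set CARD('n)"
  shows "AE p in cyl_measure. V_plus (\<lambda>x. (\<Sum>\<nu>\<in>A. c \<nu> * eta_t CARD('n) lam Y \<nu> x) - f x) (fst p) (snd p) =
    (\<Sum>\<nu>\<in>A. s_const CARD('n) lam \<nu> * c \<nu> * zeta_t CARD('n) lam Y \<nu> p) - V_plus f (fst p) (snd p)"
proof -
  let ?E = "eta_t CARD('n) lam Y"
  let ?int = "\<lambda>g p. integrable sphere_measure (\<lambda>v. indicator Splus (slice_chart (fst p) (snd p) v) * g (slice_chart (fst p) (snd p) v))"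
  obtain C where "C \<ge> 0" and C: "\<And>f :: (real^'n) \<times> real \<Rightarrow> real. L2w Splus_measure (Wt CARD('n) lam) f \<Longrightarrow>
      L2w cyl_measure (\<lambda>p. wt lam (snd p)) (\<lambda>p. V_plus f (fst p) (snd p)) \<and>
      (\<integral>p. (V_plus f (fst p) (snd p))\<^sup>2 * wt lam (snd p) \<partial>cyl_measure) \<le> C * (\<integral>x. (f x)\<^sup>2 * Wt CARD('n) lam x \<partial>Splus_measure) \<and>
      (AE p in cyl_measure. ?int f p)"
    using V_plus_bounded[OF n2 lam] by blast
  have "AE p in cyl_measure. \<forall>\<nu>\<in>A. ?int (?E \<nu>) p"
    using A C[OF eta_t_L2] by (intro AE_finite_allI) auto
  moreover have "AE p in cyl_measure. \<forall>\<nu>\<in>A. V_plus (?E \<nu>) (fst p) (snd p) = s_const CARD('n) lam \<nu> * zeta_t CARD('n) lam Y \<nu> p"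
  proof (rule AE_finite_allI[OF A(1)])
    fix \<nu> assume \<nu>: "\<nu> \<in> A"
    obtain m \<mu> k where "\<nu> = (m, \<mu>, k)" by (cases \<nu>) auto
    with \<nu> A(2) show "AE p in cyl_measure. V_plus (?E \<nu>) (fst p) (snd p) = s_const CARD('n) lam \<nu> * zeta_t CARD('n) lam Y \<nu> p"
      using V_plus_eta_AE by (auto simp: index_set_iff)
  qed
  moreover have "AE p in cyl_measure. ?int f p" using C[OF f] by blast
  moreover note AE_space[of cyl_measure]
  ultimately show ?thesis
  proof eventually_elim
    case (elim p)
    have "V_plus (\<lambda>x. (\<Sum>\<nu>\<in>A. c \<nu> * ?E \<nu> x) - f x) (fst p) (snd p) = (\<Sum>\<nu>\<in>A. c \<nu> * V_plus (?E \<nu>) (fst p) (snd p)) - V_plus f (fst p) (snd p)"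
      using elim f eta_t_L2 A(2) by (intro V_plus_linear_combination) (auto simp: L2w_def)
    also have "(\<Sum>\<nu>\<in>A. c \<nu> * V_plus (?E \<nu>) (fst p) (snd p)) = (\<Sum>\<nu>\<in>A. s_const CARD('n) lam \<nu> * c \<nu> * zeta_t CARD('n) lam Y \<nu> p)"
      using elim by (intro sum.cong) auto
    finally show ?case .
  qed
qed

text \<open>Boundedness carries the convergent expansion of f to one of F with coefficients s_nu
  f_nu. Orthonormality on the cylinder identifies these with F_nu, and dividing by s_nu > 0 gives
  the inversion series.\<close>

lemma singular_value_expansion:
  fixes f :: "(real^'n) \<times> real \<Rightarrow> real"
  defines "F \<equiv> \<lambda>p :: (real^'n) \<times> real. V_plus f (fst p) (snd p)"
  defines "fc \<equiv> \<lambda>\<nu>. \<integral>x. f x * eta_t CARD('n) lam Y \<nu> x * Wt CARD('n) lam x \<partial>Splus_measure"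
  defines "Fc \<equiv> \<lambda>\<nu>. \<integral>p. F p * zeta_t CARD('n) lam Y \<nu> p * wt lam (snd p) \<partial>cyl_measure"
  assumes f: "L2w Splus_measure (Wt CARD('n) lam) f"
  shows "L2w cyl_measure (\<lambda>p. wt lam (snd p)) F"
    "L2_series_conv cyl_measure (\<lambda>p. wt lam (snd p))
      (\<lambda>\<nu> p. s_const CARD('n) lam \<nu> * fc \<nu> * zeta_t CARD('n) lam Y \<nu> p) (index_set CARD('n)) F"
    "L2_series_conv Splus_measure (Wt CARD('n) lam)
      (\<lambda>\<nu> x. inverse (s_const CARD('n) lam \<nu>) * Fc \<nu> * eta_t CARD('n) lam Y \<nu> x) (index_set CARD('n)) f"
proof -
  let ?I = "index_set CARD('n)" and ?E = "eta_t CARD('n) lam Y" and ?Z = "zeta_t CARD('n) lam Y"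
    and ?s = "s_const CARD('n) lam"
  interpret Z: orthonormal_system cyl_measure cyl_basis ?I by (rule cyl_basis_orthonormal)
  obtain C where C0: "C \<ge> 0" and C: "\<And>f :: (real^'n) \<times> real \<Rightarrow> real. L2w Splus_measure (Wt CARD('n) lam) f \<Longrightarrow>
      L2w cyl_measure (\<lambda>p. wt lam (snd p)) (\<lambda>p. V_plus f (fst p) (snd p)) \<and>
      (\<integral>p. (V_plus f (fst p) (snd p))\<^sup>2 * wt lam (snd p) \<partial>cyl_measure) \<le> C * (\<integral>x. (f x)\<^sup>2 * Wt CARD('n) lam x \<partial>Splus_measure) \<and>
      (AE p in cyl_measure. integrable sphere_measure
        (\<lambda>v. indicator Splus (slice_chart (fst p) (snd p) v) * f (slice_chart (fst p) (snd p) v)))"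
    using V_plus_bounded[OF n2 lam] by blast
  show F: "L2w cyl_measure (\<lambda>p. wt lam (snd p)) F" unfolding F_def using C[OF f] by blast
  define D where "D = (\<lambda>A. \<integral>x. ((\<Sum>\<nu>\<in>A. fc \<nu> * ?E \<nu> x) - f x)\<^sup>2 * Wt CARD('n) lam x \<partial>Splus_measure)"
  define D' where "D' = (\<lambda>A. \<integral>p. ((\<Sum>\<nu>\<in>A. ?s \<nu> * fc \<nu> * ?Z \<nu> p) - F p)\<^sup>2 * wt lam (snd p) \<partial>cyl_measure)"
  have D: "(D \<longlongrightarrow> 0) (finite_subsets_at_top ?I)"
    unfolding D_def fc_def by (rule eta_series_converges(1)[OF f])
  have wm: "(\<lambda>p. wt lam (snd p)) \<in> borel_measurable (cyl_measure :: ((real^'n) \<times> real) measure)"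
  proof -
    have "wt lam \<in> borel_measurable (restrict_space lborel {-1<..<1})"
      by (rule measurable_restrict_space1) (unfold wt_def[abs_def], measurable)
    then show ?thesis unfolding cyl_measure_def by (rule measurable_compose[OF measurable_snd])
  qed
  have w0: "wt lam t \<ge> 0" for t by (simp add: wt_def)
  have Fm: "F \<in> borel_measurable cyl_measure" using F by (simp add: L2w_def)
  \<comment> \<open>The transform of the error for f is almost everywhere the error for F, so the
    operator bound compares the two.\<close>
  have err: "integrable cyl_measure (\<lambda>p. ((\<Sum>\<nu>\<in>A. ?s \<nu> * fc \<nu> * ?Z \<nu> p) - F p)\<^sup>2 * wt lam (snd p))" "D' A \<le> C * D A"
    if A: "finite A" "A \<subseteq> ?I" for A
  proof -
    let ?g = "\<lambda>x. (\<Sum>\<nu>\<in>A. fc \<nu> * ?E \<nu> x) - f x"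
    have g: "L2w Splus_measure (Wt CARD('n) lam) ?g" unfolding fc_def by (rule eta_series_converges(2)[OF f A])
    note V = C[OF g]
    have m: "(\<lambda>p. (\<Sum>\<nu>\<in>A. ?s \<nu> * fc \<nu> * ?Z \<nu> p) - F p) \<in> borel_measurable cyl_measure"
      using A zeta_t_measurable' by (intro borel_measurable_diff borel_measurable_sum borel_measurable_times borel_measurable_const Fm) auto
    have m': "(\<lambda>p. ((\<Sum>\<nu>\<in>A. ?s \<nu> * fc \<nu> * ?Z \<nu> p) - F p)\<^sup>2 * wt lam (snd p)) \<in> borel_measurable cyl_measure"
      by (intro borel_measurable_times borel_measurable_power m wm)
    have Vi: "integrable cyl_measure (\<lambda>p. (V_plus ?g (fst p) (snd p))\<^sup>2 * wt lam (snd p))" using V by (simp add: L2w_def)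
    have ae: "AE p in cyl_measure. (V_plus ?g (fst p) (snd p))\<^sup>2 * wt lam (snd p) =
      ((\<Sum>\<nu>\<in>A. ?s \<nu> * fc \<nu> * ?Z \<nu> p) - F p)\<^sup>2 * wt lam (snd p)"
      using V_plus_partial_sum[OF f A, of fc] by eventually_elim (simp add: F_def)
    show "integrable cyl_measure (\<lambda>p. ((\<Sum>\<nu>\<in>A. ?s \<nu> * fc \<nu> * ?Z \<nu> p) - F p)\<^sup>2 * wt lam (snd p))"
      using integrable_cong_AE[OF borel_measurable_integrable[OF Vi] m' ae] Vi by simp
    have "D' A = (\<integral>p. (V_plus ?g (fst p) (snd p))\<^sup>2 * wt lam (snd p) \<partial>cyl_measure)"
      unfolding D'_def using integral_cong_AE[OF borel_measurable_integrable[OF Vi] m' ae] by simp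
    then show "D' A \<le> C * D A" using V unfolding D_def by simp
  qed
  have D'0: "D' A \<ge> 0" for A unfolding D'_def by (intro integral_nonneg_AE AE_I2 mult_nonneg_nonneg w0) simp
  have D': "(D' \<longlongrightarrow> 0) (finite_subsets_at_top ?I)"
  proof (rule tendsto_sandwich[where f = "\<lambda>_. 0" and h = "\<lambda>A. C * D A"])
    show "\<forall>\<^sub>F A in finite_subsets_at_top ?I. D' A \<le> C * D A"
      by (rule eventually_finite_subsets_at_top_weakI) (rule err(2))
    show "((\<lambda>A. C * D A) \<longlongrightarrow> 0) (finite_subsets_at_top ?I)" using tendsto_mult_right_zero[OF D] .
  qed (simp_all add: D'0)
  have coeff: "Fc \<nu> = ?s \<nu> * fc \<nu>" if \<nu>: "\<nu> \<in> ?I" for \<nu>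
  proof -
    \<comment> \<open>F with the square root of \<open>wt\<close> absorbed, to be tested against the
      unweighted system \<open>cyl_basis\<close>.\<close>
    define G where "G = (\<lambda>p. F p * sqrt (wt lam (snd p)))"
    have Gm: "G \<in> borel_measurable cyl_measure"
      unfolding G_def using Fm measurable_compose[OF wm borel_measurable_sqrt] by (intro borel_measurable_times) auto
    have G2: "integrable cyl_measure (\<lambda>p. (G p)\<^sup>2)"
      using F w0 by (simp add: L2w_def G_def power_mult_distrib)
    have bm: "cyl_basis \<nu> \<in> borel_measurable cyl_measure" and b2: "integrable cyl_measure (\<lambda>p. (cyl_basis \<nu> p)\<^sup>2)"
      using Z.e_measurable[OF \<nu>] Z.e_square[OF \<nu>] by auto
    have b1: "(\<integral>p. (cyl_basis \<nu> p)\<^sup>2 \<partial>cyl_measure) = 1" using Z.e_orth[OF \<nu> \<nu>] by (simp add: power2_eq_square)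
    have FcG: "Fc \<nu> = (\<integral>p. G p * cyl_basis \<nu> p \<partial>cyl_measure)"
      unfolding Fc_def
    proof (rule Bochner_Integration.integral_cong[OF refl])
      fix p :: "(real^'n) \<times> real" assume p: "p \<in> space cyl_measure"
      have "G p * cyl_basis \<nu> p = F p * ?Z \<nu> p * (sqrt (wt lam (snd p)) * sqrt (wt lam (snd p)))"
        unfolding G_def zeta_t_cyl(1)[OF p, symmetric] by (simp only: mult_ac)
      then show "F p * ?Z \<nu> p * wt lam (snd p) = G p * cyl_basis \<nu> p" using w0 by simp
    qed
    \<comment> \<open>Once A contains \<nu>, the difference is the coefficient of T - G along a unit
      vector, so its square is at most the squared norm \<open>D' A\<close>, which tends to
      0.\<close>
    have "(?s \<nu> * fc \<nu> - Fc \<nu>)\<^sup>2 \<le> D' A" if A: "finite A" "{\<nu>} \<subseteq> A" "A \<subseteq> ?I" for A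
    proof -
      define T where "T = (\<lambda>p. \<Sum>\<nu>\<in>A. (?s \<nu> * fc \<nu>) * cyl_basis \<nu> p)"
      have Tm: "T \<in> borel_measurable cyl_measure" and T2: "integrable cyl_measure (\<lambda>p. (T p)\<^sup>2)"
        unfolding T_def using Z.sum_square_integrable[OF A(3), of "\<lambda>\<nu>. ?s \<nu> * fc \<nu>"] by auto
      have sq: "(T p - G p)\<^sup>2 = ((\<Sum>\<nu>\<in>A. ?s \<nu> * fc \<nu> * ?Z \<nu> p) - F p)\<^sup>2 * wt lam (snd p)" if p: "p \<in> space cyl_measure" for p
      proof -
        have "T p - G p = ((\<Sum>\<nu>\<in>A. ?s \<nu> * fc \<nu> * ?Z \<nu> p) - F p) * sqrt (wt lam (snd p))"
          unfolding T_def G_def zeta_t_cyl(1)[OF p, symmetric] by (simp add: left_diff_distrib sum_distrib_right mult.assoc)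
        then show ?thesis using w0 by (simp add: power_mult_distrib)
      qed
      have i2: "integrable cyl_measure (\<lambda>p. (T p - G p)\<^sup>2)"
        using err(1)[OF A(1,3)] by (subst Bochner_Integration.integrable_cong[OF refl sq])
      have I2: "(\<integral>p. (T p - G p)\<^sup>2 \<partial>cyl_measure) = D' A"
        unfolding D'_def by (rule Bochner_Integration.integral_cong[OF refl sq])
      have "(\<integral>p. T p * cyl_basis \<nu> p \<partial>cyl_measure) = (\<Sum>\<mu>\<in>A. (?s \<mu> * fc \<mu>) * (\<integral>p. cyl_basis \<nu> p * cyl_basis \<mu> p \<partial>cyl_measure))"
        unfolding T_def by (rule Z.integral_sum_mult[OF A(3) bm b2])
      also have "\<dots> = (\<Sum>\<mu>\<in>A. if \<mu> = \<nu> then ?s \<nu> * fc \<nu> else 0)"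
        using A(3) Z.e_orth[OF \<nu>] by (intro sum.cong) auto
      also have "\<dots> = ?s \<nu> * fc \<nu>" using A(1,2) by simp
      finally have "?s \<nu> * fc \<nu> - Fc \<nu> = (\<integral>p. T p * cyl_basis \<nu> p \<partial>cyl_measure) - (\<integral>p. G p * cyl_basis \<nu> p \<partial>cyl_measure)"
        using FcG by simp
      also have "\<dots> = (\<integral>p. T p * cyl_basis \<nu> p - G p * cyl_basis \<nu> p \<partial>cyl_measure)"
        by (intro Bochner_Integration.integral_diff[symmetric] integrable_mult_square Tm T2 bm b2 Gm G2)
      also have "\<dots> = (\<integral>p. (T p - G p) * cyl_basis \<nu> p \<partial>cyl_measure)" by (simp only: left_diff_distrib)
      finally have "(?s \<nu> * fc \<nu> - Fc \<nu>)\<^sup>2 = (\<integral>p. (T p - G p) * cyl_basis \<nu> p \<partial>cyl_measure)\<^sup>2" by simp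
      also have "\<dots> \<le> (\<integral>p. (T p - G p)\<^sup>2 \<partial>cyl_measure) * (\<integral>p. (cyl_basis \<nu> p)\<^sup>2 \<partial>cyl_measure)"
        by (intro integral_mult_square_bound borel_measurable_diff Tm Gm bm i2 b2)
      finally show ?thesis unfolding I2 b1 by simp
    qed
    then have "\<forall>\<^sub>F A in finite_subsets_at_top ?I. (?s \<nu> * fc \<nu> - Fc \<nu>)\<^sup>2 \<le> D' A"
      unfolding eventually_finite_subsets_at_top using \<nu> by (intro exI[of _ "{\<nu>}"]) auto
    then have "(?s \<nu> * fc \<nu> - Fc \<nu>)\<^sup>2 \<le> 0"
      by (rule tendsto_lowerbound[OF D']) simp
    then show ?thesis by simp
  qed
  have sq: "((\<lambda>A. sqrt (X A)) \<longlongrightarrow> 0) (finite_subsets_at_top ?I)" if "(X \<longlongrightarrow> 0) (finite_subsets_at_top ?I)" for X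
    using tendsto_real_sqrt[OF that] by simp
  show "L2_series_conv cyl_measure (\<lambda>p. wt lam (snd p)) (\<lambda>\<nu> p. ?s \<nu> * fc \<nu> * ?Z \<nu> p) ?I F"
    unfolding L2_series_conv_def L2dist_def using sq[OF D'] unfolding D'_def .
  \<comment> \<open>The inversion series is the expansion of f itself with its coefficients
    rewritten through F.\<close>
  have "\<forall>\<^sub>F A in finite_subsets_at_top ?I. D A =
    (\<integral>x. ((\<Sum>\<nu>\<in>A. inverse (?s \<nu>) * Fc \<nu> * ?E \<nu> x) - f x)\<^sup>2 * Wt CARD('n) lam x \<partial>Splus_measure)"
  proof (rule eventually_finite_subsets_at_top_weakI)
    fix A assume A: "finite A" "A \<subseteq> ?I"
    have "inverse (?s \<nu>) * Fc \<nu> = fc \<nu>" if "\<nu> \<in> A" for \<nu>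
    proof -
      have "?s \<nu> > 0" using s_const_pos by (cases \<nu>) auto
      then show ?thesis using coeff[of \<nu>] that A(2) by auto
    qed
    then have "(\<Sum>\<nu>\<in>A. inverse (?s \<nu>) * Fc \<nu> * ?E \<nu> x) = (\<Sum>\<nu>\<in>A. fc \<nu> * ?E \<nu> x)" for x by (intro sum.cong) auto
    then show "D A = (\<integral>x. ((\<Sum>\<nu>\<in>A. inverse (?s \<nu>) * Fc \<nu> * ?E \<nu> x) - f x)\<^sup>2 * Wt CARD('n) lam x \<partial>Splus_measure)"
      unfolding D_def by simp
  qed
  from sq[OF Lim_transform_eventually[OF D this]]
  show "L2_series_conv Splus_measure (Wt CARD('n) lam) (\<lambda>\<nu> x. inverse (?s \<nu>) * Fc \<nu> * ?E \<nu> x) ?I f"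
    unfolding L2_series_conv_def L2dist_def .
qed

end

theorem theorem2p5:
  fixes lam :: real
    and Y :: "nat \<Rightarrow> nat \<Rightarrow> real^'n \<Rightarrow> real"
    and f :: "(real^'n) \<times> real \<Rightarrow> real"
  defines "n \<equiv> CARD('n)"
  defines "F \<equiv> (\<lambda>p :: (real^'n) \<times> real. V_plus f (fst p) (snd p))"
  defines "fc \<equiv> (\<lambda>\<nu>. \<integral>x. f x * eta_t n lam Y \<nu> x * Wt n lam x \<partial>Splus_measure)"
  defines "Fc \<equiv> (\<lambda>\<nu>. \<integral>p. F p * zeta_t n lam Y \<nu> p * wt lam (snd p) \<partial>cyl_measure)"
  assumes n2: "n \<ge> 2"
    and lam: "lam > real n / 2 - 1"
    and Ybasis: "sph_harm_basis n Y"
    and f_L2: "L2w Splus_measure (Wt n lam) f"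
  shows "L2w cyl_measure (\<lambda>p. wt lam (snd p)) F
         \<and> (\<forall>\<theta>\<in>sphere 0 1. \<forall>t\<in>{-1<..<1}. F (-\<theta>, -t) = F (\<theta>, t))
         \<and> L2_series_conv cyl_measure (\<lambda>p. wt lam (snd p))
             (\<lambda>\<nu> p. s_const n lam \<nu> * fc \<nu> * zeta_t n lam Y \<nu> p) (index_set n) F
         \<and> L2_series_conv Splus_measure (Wt n lam)
             (\<lambda>\<nu> x. inverse (s_const n lam \<nu>) * Fc \<nu> * eta_t n lam Y \<nu> x) (index_set n) f"
proof -
  interpret sphere_transform lam Y
    using n2 lam Ybasis unfolding n_def by unfold_locales
  note svd = singular_value_expansion[OF f_L2[unfolded n_def]]
  show ?thesis
    unfolding F_def fc_def Fc_def n_def using svd V_plus_even[of f] by auto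
qed

end
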